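(* Let $r>1$ be real and let $f:I\to I$ be a $\mathcal{C}^r$ map such that $h_{\rm top}(f)>\frac{R(f)}{r}$. For any $\varepsilon>0$ there exist $\delta>0$, $\eta>0$ and a $\mathcal{C}^r$-weak neighborhood $\mathcal{U}$ of $f$ such that for any $g\in\mathcal{U}$ and any $g$-ergodic measure $\nu$ with $h_g(\nu)\ge h_{\rm top}(g)-\delta$, $$\int_{\{x:\,|g'(x)|<\eta\}}-\log|g'|\,d\nu<\varepsilon.$$ Explicitly: for every $\varepsilon>0$ and every $K>0$ there exist $\delta>0$, $\eta>0$ and $\rho>0$ such that the displayed inequality holds for every $\mathcal{C}^r$ map $g:I\to I$ whose $\mathcal{C}^1$-distance to $f$ is less than $\rho$ and whose $\mathcal{C}^r$-norm is at most $K$, and for every $g$-ergodic measure $\nu$ with $h_g(\nu)\ge h_{\rm top}(g)-\delta$.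
   Context: $I$ denotes the interval $[0,1]$ or the circle $\mathbb{S}^1$. For real $r>1$, a map $g:I\to I$ is $\mathcal{C}^r$ if it is $\mathcal{C}^{\lfloor r\rfloor}$ and $g^{(\lfloor r\rfloor)}$ is $(r-\lfloor r\rfloor)$-Hölder. A sequence of $\mathcal{C}^r$ maps converges $\mathcal{C}^r$-weakly to $f$ if it converges to $f$ in the $\mathcal{C}^1$-topology and is bounded in the $\mathcal{C}^r$-norm; accordingly, $\mathcal{C}^r$-weak neighborhoods of $f$ are the sets $\{g:\ \mathcal{C}^1\text{-distance}(g,f)<\rho,\ \mathcal{C}^r\text{-norm of }g\le K\}$. A $g$-ergodic measure is a $g$-invariant ergodic Borel probability measure. $h_g(\nu)$ is metric entropy and $h_{\rm top}(g)$ topological entropy. $R(g):=\lim_{n\to\infty}\frac1n\log^+\|(g^n)'\|_\infty$, where $\log^+=\max\{0,\log\}$ and $\|\cdot\|_\infty$ is the supremum over $I$. *)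

theory Defs
  imports "HOL-Probability.Probability"
begin

section \<open>The interval and the circle\<close>

text \<open>
  Both spaces are given by an arclength parametrisation \<^term>\<open>param\<close> defined on a connected set
  \<^term>\<open>pdom\<close> of reals: the identity of the unit interval, respectively the universal covering of
  the unit circle by the line.  Differential notions for a self-map are those of its lift to
  \<^term>\<open>pdom\<close>; topological and measurable notions are those of the ambient type.
\<close>

record 'a one_dim =
  pdom :: "real set"
  param :: "real \<Rightarrow> 'a"

definition unit_interval :: "real one_dim" where
  "unit_interval = \<lparr>pdom = {0..1}, param = (\<lambda>t. t)\<rparr>"

definition unit_circle :: "complex one_dim" where
  "unit_circle = \<lparr>pdom = UNIV, param = cis\<rparr>"

definition points :: "'a one_dim \<Rightarrow> 'a set" where
  "points I = param I ` pdom I"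

lemma points_unit_interval: "points unit_interval = {0..1}"
  by (simp add: points_def unit_interval_def)

lemma points_unit_circle: "points unit_circle = sphere 0 1"
proof -
  have "z \<in> range cis" if "norm z = 1" for z
    using cis_Arg[of z] that by (metis norm_zero rangeI sgn_eq div_by_1 of_real_1 zero_neq_one)
  then show ?thesis
    by (auto simp: points_def unit_circle_def)
qed

section \<open>Maps of class $C^r$\<close>

text \<open>Derivatives are relative to \<open>J\<close>, hence one-sided at the endpoints of the interval.\<close>

primrec nth_deriv :: "real set \<Rightarrow> nat \<Rightarrow> (real \<Rightarrow> real) \<Rightarrow> real \<Rightarrow> real" where
  "nth_deriv J 0 u = u"
| "nth_deriv J (Suc k) u = (\<lambda>t. vector_derivative (nth_deriv J k u) (at t within J))"

definition Ck_on :: "nat \<Rightarrow> real set \<Rightarrow> (real \<Rightarrow> real) \<Rightarrow> bool" where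
  "Ck_on n J u \<longleftrightarrow>
     (\<forall>k<n. nth_deriv J k u differentiable_on J) \<and> continuous_on J (nth_deriv J n u)"

text \<open>For \<open>\<alpha> = 0\<close> (integer \<open>r\<close> below) this only says that the oscillation of \<open>u\<close> is bounded.\<close>

definition holder_on :: "real \<Rightarrow> real set \<Rightarrow> (real \<Rightarrow> real) \<Rightarrow> bool" where
  "holder_on \<alpha> J u \<longleftrightarrow> (\<exists>C. \<forall>s\<in>J. \<forall>t\<in>J. \<bar>u s - u t\<bar> \<le> C * \<bar>s - t\<bar> powr \<alpha>)"

definition holder_seminorm :: "real \<Rightarrow> real set \<Rightarrow> (real \<Rightarrow> real) \<Rightarrow> real" where
  "holder_seminorm \<alpha> J u =
     (SUP (s, t) \<in> {(s, t). s \<in> J \<and> t \<in> J \<and> s \<noteq> t}. \<bar>u s - u t\<bar> / \<bar>s - t\<bar> powr \<alpha>)"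

definition is_lift :: "'a one_dim \<Rightarrow> ('a \<Rightarrow> 'a) \<Rightarrow> (real \<Rightarrow> real) \<Rightarrow> bool" where
  "is_lift I g G \<longleftrightarrow>
     continuous_on (pdom I) G \<and> (\<forall>t\<in>pdom I. param I (G t) = g (param I t))"

text \<open>
  On the interval the lift is the map itself.  On the circle two lifts differ by a constant in
  $2\pi\mathbb{Z}$, so the derivatives of order at least 1 do not depend on the choice made here.
\<close>

definition some_lift :: "'a one_dim \<Rightarrow> ('a \<Rightarrow> 'a) \<Rightarrow> real \<Rightarrow> real" where
  "some_lift I g = (SOME G. is_lift I g G)"

definition cr_map :: "'a one_dim \<Rightarrow> real \<Rightarrow> ('a \<Rightarrow> 'a) \<Rightarrow> bool" where
  "cr_map I r g \<longleftrightarrow>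
     g \<in> points I \<rightarrow> points I \<and>
     (\<exists>G. is_lift I g G \<and> Ck_on (nat \<lfloor>r\<rfloor>) (pdom I) G \<and>
          holder_on (r - \<lfloor>r\<rfloor>) (pdom I) (nth_deriv (pdom I) (nat \<lfloor>r\<rfloor>) G))"

text \<open>The derivative $g'(x)$; it does not depend on the parameter chosen for \<open>x\<close>.\<close>

definition gderiv :: "'a one_dim \<Rightarrow> ('a \<Rightarrow> 'a) \<Rightarrow> 'a \<Rightarrow> real" where
  "gderiv I g x = nth_deriv (pdom I) 1 (some_lift I g) (SOME t. t \<in> pdom I \<and> param I t = x)"

lemma vector_derivative_within_cong:
  fixes u v :: "real \<Rightarrow> real"
  assumes "t \<in> J" "\<And>s. s \<in> J \<Longrightarrow> u s = v s"
  shows "vector_derivative u (at t within J) = vector_derivative v (at t within J)"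
proof -
  have "(u has_vector_derivative d) (at t within J) \<longleftrightarrow>
        (v has_vector_derivative d) (at t within J)" for d
    using has_vector_derivative_transform[of t J] assms by (metis (no_types, lifting))
  then show ?thesis by (simp add: vector_derivative_def)
qed

lemma gderiv_unit_interval:
  assumes "continuous_on {0..1} g" "x \<in> {0..1}"
  shows "gderiv unit_interval g x = vector_derivative g (at x within {0..1})"
proof -
  have "is_lift unit_interval g g" using assms by (simp add: is_lift_def unit_interval_def)
  then have L: "is_lift unit_interval g (some_lift unit_interval g)"
    unfolding some_lift_def by (metis someI)
  have e: "(SOME t. t \<in> pdom unit_interval \<and> param unit_interval t = x) = x"
    using assms by (auto simp: unit_interval_def intro!: some_equality)
  show ?thesis using L assms(2) unfolding gderiv_def e
    by (auto simp: is_lift_def unit_interval_def intro!: vector_derivative_within_cong)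
qed

lemma lift_unique:
  assumes "is_lift unit_circle g G" "is_lift unit_circle g H"
  obtains c where "\<And>t. G t = H t + c"
proof -
  have c: "continuous_on UNIV (\<lambda>t. G t - H t)"
    using assms by (auto simp: is_lift_def unit_circle_def intro!: continuous_intros)
  have i: "\<exists>n::int. G t - H t = 2 * pi * of_int n" for t
  proof -
    have "cis (G t - H t) = 1" using assms
      by (simp add: is_lift_def unit_circle_def flip: cis_divide) (metis cis_neq_zero)
    then have "cos (G t - H t) = 1" by (metis cis.sel(1) one_complex.sel(1))
    then show ?thesis by (auto simp: cos_one_2pi_int mult_ac)
  qed
  have "(\<lambda>t. G t - H t) constant_on UNIV"
  proof (rule continuous_discrete_range_constant[OF _ c])
    fix x :: real
    have "2 * pi \<le> norm ((G y - H y) - (G x - H x))" if "G y - H y \<noteq> G x - H x" for y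
    proof -
      obtain m n :: int
        where mn: "G y - H y = 2 * pi * of_int m" "G x - H x = 2 * pi * of_int n"
        using i by meson
      then have "m \<noteq> n" using that by auto
      then have "1 \<le> \<bar>real_of_int (m - n)\<bar>" by linarith
      then have "2 * pi * 1 \<le> 2 * pi * \<bar>real_of_int (m - n)\<bar>" by (intro mult_left_mono) auto
      also have "\<dots> = \<bar>2 * pi * real_of_int (m - n)\<bar>" by (simp only: abs_mult) simp
      also have "2 * pi * real_of_int (m - n) = 2 * pi * of_int m - 2 * pi * of_int n"
        by (simp only: of_int_diff right_diff_distrib)
      finally show ?thesis unfolding mn by simp
    qed
    then show "\<exists>e>0. \<forall>y. y \<in> UNIV \<and> G y - H y \<noteq> G x - H x \<longrightarrow>
                   e \<le> norm (G y - H y - (G x - H x))"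
      by (intro exI[of _ "2*pi"]) auto
  qed auto
  then obtain c where "\<And>t. G t - H t = c" by (auto simp: constant_on_def)
  then show ?thesis using that[of c] by (metis add.commute diff_add_cancel)
qed

lemma nth_deriv_shift:
  assumes k: "k \<ge> 1" and G: "\<And>t. G t = H (t + a) + c"
  shows "nth_deriv UNIV k G t = nth_deriv UNIV k H (t + a)"
proof -
  have v: "vector_derivative (\<lambda>t. u (t + a) + c) (at t) = vector_derivative u (at (t + a))"
    for u :: "real \<Rightarrow> real" and t c
  proof -
    have "((\<lambda>t. u (t + a) + c) has_field_derivative d) (at t) \<longleftrightarrow>
          ((\<lambda>t. u (t + a)) has_field_derivative d) (at t)" for d
      using DERIV_diff[OF _ DERIV_const[of c], of "\<lambda>t. u (t + a) + c"]
        DERIV_add[OF _ DERIV_const[of c], of "\<lambda>t. u (t + a)"] by fastforce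
    then have "((\<lambda>t. u (t + a) + c) has_vector_derivative d) (at t) \<longleftrightarrow>
               (u has_vector_derivative d) (at (t + a))" for d
      by (simp add: DERIV_shift flip: has_real_derivative_iff_has_vector_derivative)
    then show ?thesis by (simp add: vector_derivative_def)
  qed
  have G': "G = (\<lambda>t. H (t+a) + c)" using G by auto
  show ?thesis using k
  proof (induction k arbitrary: t rule: nat_induct_at_least)
    case base show ?case by (simp add: G' v)
  next
    case (Suc k)
    then have "nth_deriv UNIV k G = (\<lambda>t. nth_deriv UNIV k H (t+a) + 0)" by auto
    then show ?case using v[of "nth_deriv UNIV k H" 0 t] by simp
  qed
qed

lemma gderiv_unit_circle:
  assumes "is_lift unit_circle g G"
  shows "gderiv unit_circle g (cis t) = vector_derivative G (at t)"
proof -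
  let ?H = "some_lift unit_circle g"
  define s where "s = (SOME s. s \<in> pdom unit_circle \<and> param unit_circle s = cis t)"
  have "s \<in> pdom unit_circle \<and> param unit_circle s = cis t"
    unfolding s_def by (rule someI[of _ t]) (simp add: unit_circle_def)
  then have s: "cis s = cis t" by (simp add: unit_circle_def)
  have H: "is_lift unit_circle g ?H" unfolding some_lift_def using assms by (metis someI)
  then have "is_lift unit_circle g (\<lambda>u. ?H (u + (s - t)))"
    using s continuous_on_compose2[of UNIV ?H UNIV "\<lambda>u. u + (s - t)"]
    by (auto simp: is_lift_def unit_circle_def cis_mult[symmetric] cis_divide[symmetric] continuous_intros)
  from lift_unique[OF assms this] obtain c where c: "\<And>u. G u = ?H (u + (s - t)) + c" by blast
  show ?thesis using nth_deriv_shift[of 1 G ?H "s - t" c t] c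
    by (simp add: gderiv_def flip: s_def) (simp add: unit_circle_def)
qed

definition c1_dist :: "('a::metric_space) one_dim \<Rightarrow> ('a \<Rightarrow> 'a) \<Rightarrow> ('a \<Rightarrow> 'a) \<Rightarrow> real" where
  "c1_dist I f g =
     (SUP x\<in>points I. dist (f x) (g x)) + (SUP x\<in>points I. \<bar>gderiv I f x - gderiv I g x\<bar>)"

definition cr_norm :: "('a::real_normed_vector) one_dim \<Rightarrow> real \<Rightarrow> ('a \<Rightarrow> 'a) \<Rightarrow> real" where
  "cr_norm I r g =
     (SUP x\<in>points I. norm (g x))
     + (\<Sum>k=1..nat \<lfloor>r\<rfloor>. SUP t\<in>pdom I. \<bar>nth_deriv (pdom I) k (some_lift I g) t\<bar>)
     + (if r \<in> \<int> then 0
        else holder_seminorm (r - \<lfloor>r\<rfloor>) (pdom I)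
               (nth_deriv (pdom I) (nat \<lfloor>r\<rfloor>) (some_lift I g)))"

text \<open>The limit exists for maps of class $C^1$, by submultiplicativity.\<close>

definition growth_rate :: "'a one_dim \<Rightarrow> ('a \<Rightarrow> 'a) \<Rightarrow> real" where
  "growth_rate I g =
     lim (\<lambda>n. max 0 (ln (SUP x\<in>points I. \<bar>gderiv I (g ^^ n) x\<bar>)) / real n)"

section \<open>Entropy\<close>

text \<open>Topological entropy of a map of a compact set \<open>X\<close>, by Bowen's separated sets.\<close>

definition separated :: "'a::metric_space set \<Rightarrow> ('a \<Rightarrow> 'a) \<Rightarrow> nat \<Rightarrow> real \<Rightarrow> 'a set \<Rightarrow> bool" where
  "separated X g n \<epsilon> E \<longleftrightarrow>
     E \<subseteq> X \<and>
     (\<forall>x\<in>E. \<forall>y\<in>E. x \<noteq> y \<longrightarrow> (\<exists>i<n. dist ((g ^^ i) x) ((g ^^ i) y) > \<epsilon>))"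

definition top_entropy :: "'a::metric_space set \<Rightarrow> ('a \<Rightarrow> 'a) \<Rightarrow> ereal" where
  "top_entropy X g =
     (SUP \<epsilon>\<in>{0<..}. limsup (\<lambda>n.
        SUP E\<in>{E. finite E \<and> E \<noteq> {} \<and> separated X g n \<epsilon> E}. ereal (ln (real (card E)) / real n)))"

text \<open>
  Kolmogorov--Sinai entropy.  A finite measurable partition is given as the level sets of a simple
  function \<open>\<xi>\<close>; the atoms of its join with its first \<open>n - 1\<close> preimages are the level sets of the
  itinerary of length \<open>n\<close>, whose Shannon entropy is taken in base \<open>e\<close>.
  For an invariant measure the upper limit is a limit.
\<close>

definition itinerary :: "('a \<Rightarrow> 'a) \<Rightarrow> ('a \<Rightarrow> nat) \<Rightarrow> nat \<Rightarrow> 'a \<Rightarrow> nat list" where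
  "itinerary g \<xi> n x = map (\<lambda>i. \<xi> ((g ^^ i) x)) [0..<n]"

definition metric_entropy :: "'a measure \<Rightarrow> ('a \<Rightarrow> 'a) \<Rightarrow> ereal" where
  "metric_entropy M g =
     (SUP \<xi>\<in>{\<xi>. simple_function M \<xi>}. limsup (\<lambda>n.
        ereal (prob_space.entropy M (exp 1) (count_space (itinerary g \<xi> n ` space M))
                 (itinerary g \<xi> n) / real n)))"

definition ergodic_measure :: "'a::topological_space set \<Rightarrow> ('a \<Rightarrow> 'a) \<Rightarrow> 'a measure \<Rightarrow> bool" where
  "ergodic_measure X g M \<longleftrightarrow>
     sets M = sets (restrict_space borel X) \<and> prob_space M \<and>
     g \<in> measurable M M \<and> distr M M g = M \<and>
     (\<forall>A\<in>sets M. g -` A \<inter> space M = A \<longrightarrow> measure M A = 0 \<or> measure M A = 1)"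

section \<open>Integrating the logarithm of the derivative\<close>

text \<open>Since \<^term>\<open>ln 0 = (0::real)\<close>, the value $-\log 0 = +\infty$ has to be given explicitly.\<close>

definition neg_log :: "real \<Rightarrow> ereal" where
  "neg_log y = (if y = 0 then \<infinity> else ereal (- ln y))"

definition ext_integral :: "'a measure \<Rightarrow> ('a \<Rightarrow> ereal) \<Rightarrow> ereal" where
  "ext_integral M u =
     enn2ereal (\<integral>\<^sup>+x. e2ennreal (u x) \<partial>M) - enn2ereal (\<integral>\<^sup>+x. e2ennreal (- u x) \<partial>M)"

text \<open>For \<open>\<eta> > 1\<close> the integrand changes sign; its negative part is bounded for a $C^1$ map.\<close>

definition small_deriv_integral :: "'a one_dim \<Rightarrow> ('a \<Rightarrow> 'a) \<Rightarrow> 'a measure \<Rightarrow> real \<Rightarrow> ereal" where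
  "small_deriv_integral I g M \<eta> =
     ext_integral (restrict_space M {x. \<bar>gderiv I g x\<bar> < \<eta>}) (\<lambda>x. neg_log \<bar>gderiv I g x\<bar>)"

end

(*
  Write G for a lift of g and u for its derivative. Where |u| is about e^-m, a C^r bound
  leaves about e^(m/(r-1)) branches on which |u| is at most of this order, each of length at most
  e^(-m/(r-1)). Naming one of them costs m/(r-1), and its image has length about e^(-m r/(r-1)).
  Since distances grow by at most e^R per step, R slightly above R(f), nothing has to be coded
  during the next m r/((r-1) R) steps. Visits near the critical set thus generate entropy at rate
  about R/r per unit of recovery time; the remaining time costs about h_top(f), by coding whole
  blocks of N steps with a fixed spanning set of f.

  If the integral of -log|g'| over {|g'| < eta} is not small for an ergodic measure nu, a definite
  proportion of almost every orbit is recovery time, so h_g(nu) falls below h_top(f) by a definite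
  amount, since R/r < h_top(f). Lower semicontinuity of the topological entropy (Misiurewicz's
  horseshoes) turns this into h_g(nu) < h_top(g) - delta.

  Derivatives of medium size, between e^-M' and e^-M, cost more than they contract, because M' has
  to be large in terms of N. They are controlled by choosing among many disjoint ranges one in
  which the integral of -log|g'| is small; this is possible unless that integral exceeds 2R already
  over {|g'| <= e^-M}, and then nearly all the time is recovery time and h_g(nu) is about R/r.
*)

theory Submission
  imports Defs "HOL-Real_Asymp.Real_Asymp"
begin

section \<open>Colouring by the derivative\<close>

text \<open>Entropy is bounded by a mean code length, not by counting: the levels of the derivative
  are unbounded, so a uniform code for them is impossible, but level m can be given the weight
  \<open>exp (- gam * real m)\<close>. Branches are found without reparametrisation. Points are
  coloured by the longest chains of alternations between small and large values of the derivative,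
  and smoothness bounds the length of such chains on short pieces.

  A deep visit interrupts the current block of N steps, although its whole price
  \<open>real N * H\<close> has been paid. The gain of the visit has to cover this loss, and
  therefore M' depends on N. In turn N depends on the scale \<open>\<epsilon>\<close> below which a
  point with derivative above \<open>exp (- real M)\<close> sees no critical point, hence on M. So
  M' = M cannot be arranged in general; instead the passage from M to M' is iterated, and the
  pigeonhole principle selects one of finitely many ranges. Their number depends on
  \<open>gam\<close>, \<open>R\<close> and the constants of the splitting only, so finitely many
  neighbourhoods are intersected.\<close>

text \<open>The colour of \<open>t\<close> is the length of the longest chain ending at
  \<open>t\<close>, as in the proof of Mirsky's theorem: if \<open>Rel a b\<close>, a longest chain
  ending at \<open>a\<close> extends to \<open>b\<close>, so \<open>b\<close> gets a larger colour.
  Chains may repeat points, so cycles of \<open>Rel\<close> are excluded as well.\<close>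

lemma chain_colouring:
  fixes Rel :: "'a \<Rightarrow> 'a \<Rightarrow> bool"
  assumes no: "\<And>s. (\<forall>i\<le>m. s i \<in> A) \<Longrightarrow> (\<forall>i<m. Rel (s i) (s (Suc i))) \<Longrightarrow> False"
  obtains col :: "'a \<Rightarrow> nat" where "\<And>t. t \<in> A \<Longrightarrow> col t < m"
    "\<And>a b. a \<in> A \<Longrightarrow> b \<in> A \<Longrightarrow> col a = col b \<Longrightarrow> \<not> Rel a b"
proof -
  define ch where "ch = (\<lambda>t l. \<exists>s. (\<forall>i\<le>l. s i \<in> A) \<and> (\<forall>i<l. Rel (s i) (s (Suc i))) \<and> s l = t)"
  define col where "col = (\<lambda>t. GREATEST l. ch t l)"
  have bd: "l < m" if "ch t l" for t l
  proof (rule ccontr)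
    assume "\<not> l < m"
    from that obtain s where s: "\<forall>i\<le>l. s i \<in> A" "\<forall>i<l. Rel (s i) (s (Suc i))"
      unfolding ch_def by auto
    with \<open>\<not> l < m\<close> show False using no[of s] by auto
  qed
  have c0: "ch t 0" if "t \<in> A" for t
    unfolding ch_def using that by (intro exI[of _ "\<lambda>_. t"]) auto
  have cc: "ch t (col t)" if "t \<in> A" for t
    unfolding col_def by (rule GreatestI_nat[of "ch t" 0 m]) (use c0[OF that] bd in \<open>auto intro:
        less_imp_le\<close>)
  have up: "l \<le> col t" if "ch t l" for t l
    unfolding col_def by (rule Greatest_le_nat[of "ch t" l m]) (use that bd in \<open>auto intro:
        less_imp_le\<close>)
  show ?thesis
  proof
    show "col t < m" if "t \<in> A" for t using bd cc that by blast
    show "\<not> Rel a b" if ab: "a \<in> A" "b \<in> A" "col a = col b" for a b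
    proof
      assume R: "Rel a b"
      from cc[OF ab(1)] obtain s
          where s: "\<forall>i\<le>col a. s i \<in> A" "\<forall>i<col a. Rel (s i) (s (Suc i))" "s (col a) = a"
        unfolding ch_def by auto
      have "ch b (Suc (col a))" unfolding ch_def
        by (rule exI[of _ "\<lambda>i. if i \<le> col a then s i else b"]) (use s R ab in \<open>auto simp:
          le_Suc_eq less_Suc_eq\<close>)
      from up[OF this] ab show False by simp
    qed
  qed
qed

text \<open>Between consecutive small values of \<open>\<bar>v 0\<bar>\<close> separated by a large one, \<open>v 1\<close> is first large and
  then zero (at an interior maximum of \<open>\<bar>v 0\<bar>\<close>), so alternations of \<open>v 1\<close> interlace.\<close>

lemma alternation_bound:
  fixes v :: "nat \<Rightarrow> real \<Rightarrow> real"
  assumes J: "convex J" and len: "\<And>s t. s \<in> J \<Longrightarrow> t \<in> J \<Longrightarrow> \<bar>s - t\<bar> \<le> \<tau>" and \<tau>: "\<tau> > 0"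
    and der: "\<And>i t. i < k \<Longrightarrow> t \<in> J \<Longrightarrow> (v i has_real_derivative v (Suc i) t) (at t within J)"
    and osc: "\<And>s t. s \<in> J \<Longrightarrow> t \<in> J \<Longrightarrow> \<bar>v k s - v k t\<bar> \<le> B"
    and a: "a > 0" "B * \<tau> ^ k \<le> a"
    and ch: "\<And>i. i \<le> k \<Longrightarrow> s i \<in> J \<and> c i \<in> J \<and> s i < c i \<and> \<bar>v 0 (s i)\<bar> \<le> a \<and>
        \<bar>v 0 (c i)\<bar> > (real k + 2) * a"
    and ch2: "\<And>i. i < k \<Longrightarrow> c i < s (Suc i)"
  shows False
  using der osc a ch ch2
proof (induction k arbitrary: v a s c)
  case 0
  from "0.prems"(2)[of "s 0" "c 0"] "0.prems"(5)[of 0] "0.prems"(3,4) show False by auto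
next
  case (Suc k)
  note der = Suc.prems(1) and osc = Suc.prems(2) and a = Suc.prems(3,4) and ch = Suc.prems(5)
      and ch2 = Suc.prems(6)
  have sub: "{x..y} \<subseteq> J" if "x \<in> J" "y \<in> J" for x y
    using closed_segment_subset[OF that J]
      by (cases "x \<le> y") (simp_all add: closed_segment_eq_real_ivl)
  have d0: "(v 0 has_real_derivative v 1 t) (at t)" if "x \<in> J" "y \<in> J" "x < t" "t < y" for t x y
  proof -
    have "t \<in> interior J" using sub[OF that(1,2)] that
      by (meson greaterThanLessThan_iff greaterThanLessThan_subseteq_atLeastAtMost_iff
        interior_maximal open_greaterThanLessThan order.refl subset_eq)
    then have "at t within J = at t" by (rule at_within_interior)
    moreover have "t \<in> J" using sub[OF that(1,2)] that by auto
    ultimately show ?thesis using der[of 0 t] by simp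
  qed
  have cont: "continuous_on {x..y} (v 0)" if "x \<in> J" "y \<in> J" for x y
  proof -
    have "continuous_on J (v 0)" using der[of 0] by (intro DERIV_continuous_on) auto
    then show ?thesis using sub[OF that] continuous_on_subset by blast
  qed
  \<comment> \<open>The values differ by more than (k + 3) a - a = (k + 2) a over a length of at
    most \<tau>. The factor drops by one with each derivative, which is why the threshold carries
    the number of derivatives left.\<close>
  have big: "\<exists>p. x < p \<and> p < y \<and> \<bar>v 1 p\<bar> > (real k + 2) * (a / \<tau>)"
    if xy: "x \<in> J" "y \<in> J" "x < y" "\<bar>v 0 x\<bar> \<le> a" "\<bar>v 0 y\<bar> > (real (Suc k) + 2) * a" for x y
  proof -
    obtain l p where lp: "x < p" "p < y" "DERIV (v 0) p :> l" "v 0 y - v 0 x = (y - x) * l"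
      using MVT[OF xy(3) cont[OF xy(1,2)]] d0[OF xy(1,2)] real_differentiable_def by metis
    then have p: "x < p" "p < y" "v 0 y - v 0 x = (y - x) * v 1 p"
      using DERIV_unique[OF lp(3) d0[OF xy(1,2) lp(1,2)]] by auto
    have "(real k + 2) * a < \<bar>v 0 y - v 0 x\<bar>" using xy by (auto simp: algebra_simps)
    also have "\<dots> = (y - x) * \<bar>v 1 p\<bar>" using p xy by (simp add: abs_mult)
    also have "\<dots> \<le> \<tau> * \<bar>v 1 p\<bar>" using len[of y x] xy by (intro mult_right_mono) auto
    finally show ?thesis using p \<tau> by (intro exI[of _ p]) (auto simp: field_simps)
  qed
  have zero: "\<exists>z. x < z \<and> z < y \<and> v 1 z = 0 \<and> \<bar>v 0 z\<bar> \<ge> \<bar>v 0 c\<bar>"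
    if xy: "x \<in> J" "y \<in> J" "x < c" "c < y" "\<bar>v 0 x\<bar> \<le> a" "\<bar>v 0 y\<bar> \<le> a"
        "\<bar>v 0 c\<bar> > (real (Suc k) + 2) * a" for x y c
  proof -
    have "\<exists>z\<in>{x..y}. \<forall>w\<in>{x..y}. \<bar>v 0 w\<bar> \<le> \<bar>v 0 z\<bar>"
      using xy by (intro continuous_attains_sup continuous_on_rabs cont) auto
    then obtain z where z: "z \<in> {x..y}" "\<And>w. w \<in> {x..y} \<Longrightarrow> \<bar>v 0 w\<bar> \<le> \<bar>v 0 z\<bar>" by auto
    have zc: "\<bar>v 0 z\<bar> \<ge> \<bar>v 0 c\<bar>" using z(2)[of c] xy by auto
    have ca: "\<bar>v 0 c\<bar> > a" using xy(7) a(1)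
      by (smt (verit) mult_right_mono of_nat_0_le_iff mult_cancel_right1)
    have zi: "x < z" "z < y" using z(1) zc xy ca by (auto simp: less_le)
    have "v 1 z = 0"
    proof (cases "v 0 z > 0")
      case True
      show ?thesis
      proof (rule DERIV_local_max[OF d0[OF xy(1,2) zi], of "min (z-x) (y-z)"])
        show "\<forall>y'. \<bar>z - y'\<bar> < min (z-x) (y-z) \<longrightarrow> v 0 y' \<le> v 0 z"
          using z(2) True by (auto simp: abs_less_iff) (smt (verit))
      qed (use zi in auto)
    next
      case False
      show ?thesis
      proof (rule DERIV_local_min[OF d0[OF xy(1,2) zi], of "min (z-x) (y-z)"])
        show "\<forall>y'. \<bar>z - y'\<bar> < min (z-x) (y-z) \<longrightarrow> v 0 z \<le> v 0 y'"
          using z(2) False by (auto simp: abs_less_iff) (smt (verit))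
      qed (use zi in auto)
    qed
    then show ?thesis using zi zc by blast
  qed
  have "\<exists>z. \<forall>i\<le>k. s i < z i \<and> z i < s (Suc i) \<and> v 1 (z i) = 0 \<and> \<bar>v 0 (z i)\<bar> \<ge> \<bar>v 0 (c i)\<bar>"
  proof (rule choice[of "\<lambda>i z. i \<le> k \<longrightarrow> s i < z \<and> z < s (Suc i) \<and> v 1 z = 0 \<and>
      \<bar>v 0 z\<bar> \<ge> \<bar>v 0 (c i)\<bar>"], rule allI)
    fix i show "\<exists>z. i \<le> k \<longrightarrow> s i < z \<and> z < s (Suc i) \<and> v 1 z = 0 \<and> \<bar>v 0 (c i)\<bar> \<le> \<bar>v 0 z\<bar>"
      using zero[of "s i" "s (Suc i)" "c i"] ch[of i] ch[of "Suc i"] ch2[of i] by auto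
  qed
  then obtain z where z: "\<And>i. i \<le> k \<Longrightarrow> s i < z i \<and> z i < s (Suc i) \<and> v 1 (z i) = 0 \<and>
      \<bar>v 0 (z i)\<bar> \<ge> \<bar>v 0 (c i)\<bar>" by auto
  have zJ: "z i \<in> J" if "i \<le> k" for i
    using sub[of "s i" "s (Suc i)"] ch[of i] ch[of "Suc i"] z[OF that] that by auto
  \<comment> \<open>Behind the last large point there is no further zero, so \<open>c\<close> itself
    closes the interval on which the last steep point is found. One alternation is lost per
    derivative.\<close>
  define e where "e = (\<lambda>i. if i \<le> k then z i else c i)"
  have "\<exists>p. \<forall>i\<le>Suc k. s i < p i \<and> p i < e i \<and> \<bar>v 1 (p i)\<bar> > (real k + 2) * (a / \<tau>)"
  proof (rule choice[of "\<lambda>i p. i \<le> Suc k \<longrightarrow> s i < p \<and> p < e i \<and>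
      \<bar>v 1 p\<bar> > (real k + 2) * (a / \<tau>)"], rule allI)
    fix i
    have "e i \<in> J" "s i < e i" "\<bar>v 0 (e i)\<bar> > (real (Suc k) + 2) * a" if i: "i \<le> Suc k"
      using z[of i] zJ[of i] ch[of i] i unfolding e_def by (auto simp: algebra_simps)
    then show "\<exists>p. i \<le> Suc k \<longrightarrow> s i < p \<and> p < e i \<and> (real k + 2) * (a / \<tau>) < \<bar>v 1 p\<bar>"
      using big[of "s i" "e i"] ch[of i] by auto
  qed
  then obtain p where p: "\<And>i. i \<le> Suc k \<Longrightarrow> s i < p i \<and> p i < e i \<and>
      \<bar>v 1 (p i)\<bar> > (real k + 2) * (a / \<tau>)" by auto
  have pJ: "p i \<in> J" if "i \<le> Suc k" for i
    using sub[of "s i" "e i"] ch[of i] p[OF that] that zJ[of i] unfolding e_def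
      by (auto split: if_splits)
  show False
  proof (rule Suc.IH[of "\<lambda>i. v (Suc i)" "a / \<tau>" z "\<lambda>i. p (Suc i)"])
    show "(v (Suc i) has_real_derivative v (Suc (Suc i)) t) (at t within J)" if "i < k" "t \<in> J"
        for i t
      using der[of "Suc i" t] that by auto
    show "\<bar>v (Suc k) s - v (Suc k) t\<bar> \<le> B" if "s \<in> J" "t \<in> J" for s t using osc that by auto
    show "0 < a / \<tau>" "B * \<tau> ^ k \<le> a / \<tau>" using a \<tau> by (auto simp: field_simps)
    show "z i \<in> J \<and> p (Suc i) \<in> J \<and> z i < p (Suc i) \<and> \<bar>v (Suc 0) (z i)\<bar> \<le> a / \<tau> \<and>
        (real k + 2) * (a / \<tau>) < \<bar>v (Suc 0) (p (Suc i))\<bar>"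
      if "i \<le> k" for i
      using zJ[OF that] pJ[of "Suc i"] p[of "Suc i"] z[OF that] that a \<tau> by auto
    show "p (Suc i) < z (Suc i)" if "i < k" for i
      using p[of "Suc i"] that unfolding e_def by auto
  qed
qed

text \<open>Two uses of \<open>alternation_bound\<close> with exchanged roles: a chain of small
  points separated by large values, and a chain of large points separated by zeros, have at most
  \<open>k + 1\<close> points each. The colour combines the two chain lengths.\<close>

lemma split_piece:
  fixes v :: "nat \<Rightarrow> real \<Rightarrow> real"
  assumes J: "convex J" and len: "\<And>s t. s \<in> J \<Longrightarrow> t \<in> J \<Longrightarrow> \<bar>s - t\<bar> \<le> \<tau>" and \<tau>: "\<tau> > 0"
    and der: "\<And>i t. i < k \<Longrightarrow> t \<in> J \<Longrightarrow> (v i has_real_derivative v (Suc i) t) (at t within J)"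
    and osc: "\<And>s t. s \<in> J \<Longrightarrow> t \<in> J \<Longrightarrow> \<bar>v k s - v k t\<bar> \<le> B"
    and a: "a' > 0" "a' \<le> a" "B * \<tau> ^ k \<le> a' / (real k + 2)"
  obtains col :: "real \<Rightarrow> nat" where "\<And>t. col t < (k + 1)\<^sup>2"
    "\<And>s t c. s \<in> J \<Longrightarrow> t \<in> J \<Longrightarrow> s < t \<Longrightarrow> col s = col t \<Longrightarrow> \<bar>v 0 s\<bar> \<le> a \<Longrightarrow> \<bar>v 0 t\<bar> \<le> a \<Longrightarrow> c \<in> {s..t} \<Longrightarrow>
       \<bar>v 0 c\<bar> \<le> (real k + 2) * a"
    "\<And>s t c. s \<in> J \<Longrightarrow> t \<in> J \<Longrightarrow> s < t \<Longrightarrow> col s = col t \<Longrightarrow> \<bar>v 0 s\<bar> > a' \<Longrightarrow> \<bar>v 0 t\<bar> > a' \<Longrightarrow> c \<in> {s..t} \<Longrightarrow>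
       v 0 c \<noteq> 0"
proof -
  have sub: "{x..y} \<subseteq> J" if "x \<in> J" "y \<in> J" for x y
    using closed_segment_subset[OF that J]
      by (cases "x \<le> y") (simp_all add: closed_segment_eq_real_ivl)
  define R1 where "R1 = (\<lambda>s t. \<exists>c. s < c \<and> c < t \<and> \<bar>v 0 c\<bar> > (real k + 2) * a)"
  define R2 where "R2 = (\<lambda>s t. \<exists>c. s < c \<and> c < t \<and> v 0 c = 0)"
  have a2: "B * \<tau> ^ k \<le> a"
  proof -
    have "a' / (real k + 2) \<le> a' / 1" using a by (intro divide_left_mono) auto
    then show ?thesis using a by linarith
  qed
  obtain c1 where c1: "\<And>t. t \<in> {t\<in>J. \<bar>v 0 t\<bar> \<le> a} \<Longrightarrow> c1 t < Suc k"
    "\<And>s t. s \<in> {t\<in>J. \<bar>v 0 t\<bar> \<le> a} \<Longrightarrow> t \<in> {t\<in>J. \<bar>v 0 t\<bar> \<le> a} \<Longrightarrow> c1 s = c1 t \<Longrightarrow> \<not> R1 s t"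
  proof (rule chain_colouring[of "Suc k" "{t\<in>J. \<bar>v 0 t\<bar> \<le> a}" R1])
    fix s assume s: "\<forall>i\<le>Suc k. s i \<in> {t \<in> J. \<bar>v 0 t\<bar> \<le> a}" "\<forall>i<Suc k. R1 (s i) (s (Suc i))"
    then obtain c where c: "\<And>i. i < Suc k \<Longrightarrow> s i < c i \<and> c i < s (Suc i) \<and>
        \<bar>v 0 (c i)\<bar> > (real k + 2) * a"
      unfolding R1_def by metis
    have cJ: "c i \<in> J" if "i \<le> k" for i
      using sub[of "s i" "s (Suc i)"] s(1) c[of i] that by (auto simp: less_Suc_eq_le)
    show False
      by (rule alternation_bound[OF J len \<tau> der osc _ a2, of s c]) (use s c cJ a in auto)
  qed auto
  obtain c2 where c2: "\<And>t. t \<in> {t\<in>J. \<bar>v 0 t\<bar> > a'} \<Longrightarrow> c2 t < Suc k"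
    "\<And>s t. s \<in> {t\<in>J. \<bar>v 0 t\<bar> > a'} \<Longrightarrow> t \<in> {t\<in>J. \<bar>v 0 t\<bar> > a'} \<Longrightarrow> c2 s = c2 t \<Longrightarrow> \<not> R2 s t"
  proof (rule chain_colouring[of "Suc k" "{t\<in>J. \<bar>v 0 t\<bar> > a'}" R2])
    fix s assume s: "\<forall>i\<le>Suc k. s i \<in> {t \<in> J. \<bar>v 0 t\<bar> > a'}" "\<forall>i<Suc k. R2 (s i) (s (Suc i))"
    then obtain c where c: "\<And>i. i < Suc k \<Longrightarrow> s i < c i \<and> c i < s (Suc i) \<and> v 0 (c i) = 0"
      unfolding R2_def by metis
    have cJ: "c i \<in> J" if "i \<le> k" for i
      using sub[of "s i" "s (Suc i)"] s(1) c[of i] that by (auto simp: less_Suc_eq_le)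
    \<comment> \<open>Here the zeros are the small points and the next points of the chain the large
      ones, at the threshold \<open>a' / (real k + 2)\<close>.\<close>
    show False
      by (rule alternation_bound[OF J len \<tau> der osc _ a(3), of c "\<lambda>i. s (Suc i)"]) (use s c cJ a
        in auto)
  qed auto
  \<comment> \<open>\<open>c1\<close> and \<open>c2\<close> are controlled only on their own sets;
    the cap at \<open>k\<close> makes the combined colour bounded everywhere.\<close>
  define d1 where "d1 = (\<lambda>t. min k (c1 t))"
  define d2 where "d2 = (\<lambda>t. min k (c2 t))"
  define col where "col = (\<lambda>t. d1 t + (k+1) * d2 t)"
  have eq: "d1 s = d1 t \<and> d2 s = d2 t" if "col s = col t" for s t
  proof -
    define Q where "Q = k + 1"
    have "d1 x < Q" "col x = d1 x + Q * d2 x" for x unfolding d1_def Q_def col_def by auto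
    then have "col x mod Q = d1 x" "col x div Q = d2 x" for x
      using gr_implies_not0[OF \<open>\<And>x. d1 x < Q\<close>] by (simp_all add: \<open>\<And>x. d1 x < Q\<close>)
    then show ?thesis using that by metis
  qed
  show ?thesis
  proof
    show "col t < (k+1)\<^sup>2" for t
    proof -
      have "d1 t \<le> k" "d2 t \<le> k" unfolding d1_def d2_def by auto
      then have "col t \<le> k + (k+1) * k" unfolding col_def by (intro add_mono mult_left_mono) auto
      also have "\<dots> < (k+1)\<^sup>2" by (simp add: power2_eq_square)
      finally show ?thesis .
    qed
    fix s t c assume st: "s \<in> J" "t \<in> J" "s < t" "col s = col t" "c \<in> {s..t}"
    { assume b: "\<bar>v 0 s\<bar> \<le> a" "\<bar>v 0 t\<bar> \<le> a"
      then have "c1 s = c1 t" using eq[OF st(4)] c1(1)[of s] c1(1)[of t] st unfolding d1_def by auto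
      then have n: "\<not> R1 s t" using c1(2) st b by auto
      have "a \<le> (real k + 2) * a" using a by (simp add: algebra_simps)
      moreover have "s < c \<and> c < t \<Longrightarrow> \<bar>v 0 c\<bar> \<le> (real k + 2) * a" using n unfolding R1_def
          by (meson not_less)
      ultimately show "\<bar>v 0 c\<bar> \<le> (real k + 2) * a" using b st
        by (cases "c = s \<or> c = t") (auto simp: less_le) }
    { assume b: "\<bar>v 0 s\<bar> > a'" "\<bar>v 0 t\<bar> > a'"
      then have "c2 s = c2 t" using eq[OF st(4)] c2(1)[of s] c2(1)[of t] st unfolding d2_def by auto
      then have n: "\<not> R2 s t" using c2(2) st b by auto
      then show "v 0 c \<noteq> 0" using b st a unfolding R2_def
        by (cases "c = s \<or> c = t") (auto simp: less_le) }
  qed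
qed

text \<open>On a piece of length \<tau> =
  \<open>split_scale k \<rho> B * exp (- real m / \<rho>)\<close> the product
  \<open>B * \<tau> powr \<rho>\<close> is at most \<open>exp (- real m - 1) / (real k + 2)\<close>,
  the smallness that \<open>split_piece\<close> asks for at level \<open>m\<close>.\<close>

definition split_scale :: "nat \<Rightarrow> real \<Rightarrow> real \<Rightarrow> real" where
  "split_scale k \<rho> B = min 1 ((1 / (exp 1 * (real k + 2) * B)) powr (1 / \<rho>))"

text \<open>One constant for two purposes: the factor by which values inside a branch may exceed the
  level, and the factor in front of the number of branches.\<close>

definition split_const :: "nat \<Rightarrow> real \<Rightarrow> real \<Rightarrow> real" where
  "split_const k \<rho> B = max (real k + 2) (2 * real ((k + 1)\<^sup>2) / split_scale k \<rho> B)"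

text \<open>The window is cut into pieces of length \<open>w * \<tau>\<close> with \<tau>
  proportional to \<open>exp (- real m / \<rho>)\<close>, and each piece is coloured separately. For
  the intended \<open>v 0\<close>, the derivative of a lift, \<rho> is r - 1, and on such a piece
  smoothness of order r controls the derivative up to an error comparable to e^-m.\<close>

lemma branch_splitting:
  fixes v :: "nat \<Rightarrow> real \<Rightarrow> real"
  assumes S: "convex S" and \<rho>: "\<rho> > 0" "real k + \<alpha> = \<rho>" and B: "B > 0"
    and der: "\<And>i t. i < k \<Longrightarrow> t \<in> S \<Longrightarrow> (v i has_real_derivative v (Suc i) t) (at t within S)"
    and osc: "\<And>s t h. s \<in> S \<Longrightarrow> t \<in> S \<Longrightarrow> 0 < h \<Longrightarrow> h \<le> 1 \<Longrightarrow> \<bar>s - t\<bar> \<le> h \<Longrightarrow> \<bar>v k s - v k t\<bar> \<le> B * h powr \<alpha>"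
    and w: "0 < w" "w \<le> 1"
  defines "C \<equiv> split_const k \<rho> B"
  obtains col :: "real \<Rightarrow> nat" where "\<And>t. t \<in> {x0..x0+w} \<Longrightarrow> real (col t) + 1 \<le> C * exp (real m / \<rho>)"
    "\<And>s t. s \<in> S \<inter> {x0..x0+w} \<Longrightarrow> t \<in> S \<inter> {x0..x0+w} \<Longrightarrow> s < t \<Longrightarrow> col s = col t \<Longrightarrow>
        t - s \<le> w * exp (- real m / \<rho>)"
    "\<And>s t c. s \<in> S \<inter> {x0..x0+w} \<Longrightarrow> t \<in> S \<inter> {x0..x0+w} \<Longrightarrow> s < t \<Longrightarrow> col s = col t \<Longrightarrow>
       \<bar>v 0 s\<bar> \<le> exp (- real m) \<Longrightarrow> \<bar>v 0 t\<bar> \<le> exp (- real m) \<Longrightarrow> c \<in> {s..t} \<Longrightarrow>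
       \<bar>v 0 c\<bar> \<le> C * exp (- real m)"
    "\<And>s t c. s \<in> S \<inter> {x0..x0+w} \<Longrightarrow> t \<in> S \<inter> {x0..x0+w} \<Longrightarrow> s < t \<Longrightarrow> col s = col t \<Longrightarrow>
       \<bar>v 0 s\<bar> > exp (- real m - 1) \<Longrightarrow> \<bar>v 0 t\<bar> > exp (- real m - 1) \<Longrightarrow> c \<in> {s..t} \<Longrightarrow> v 0 c \<noteq> 0"
proof -
  define \<kappa> where "\<kappa> = split_scale k \<rho> B"
  have \<kappa>: "0 < \<kappa>" "\<kappa> \<le> 1" using B unfolding \<kappa>_def split_scale_def by auto
  define \<tau> where "\<tau> = \<kappa> * exp (- real m / \<rho>)"
  have \<tau>: "0 < \<tau>" "\<tau> \<le> exp (- real m / \<rho>)" using \<kappa> unfolding \<tau>_def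
      by (auto simp: mult_le_cancel_right1)
  have e1: "exp (- real m / \<rho>) \<le> 1" using \<rho> by simp
  then have \<tau>1: "\<tau> \<le> 1" using \<tau> by linarith
  have kp: "B * \<tau> powr \<rho> \<le> exp (- real m - 1) / (real k + 2)"
  proof -
    have "\<kappa> powr \<rho> \<le> ((1 / (exp 1 * (real k + 2) * B)) powr (1 / \<rho>)) powr \<rho>"
      using \<kappa> \<rho> B by (intro powr_mono2) (auto simp: \<kappa>_def split_scale_def)
    also have "\<dots> = 1 / (exp 1 * (real k + 2) * B)" using \<rho> B by (simp add: powr_powr)
    finally have "B * \<kappa> powr \<rho> \<le> B * (1 / (exp 1 * (real k + 2) * B))" using B
        by (intro mult_left_mono) auto
    also have "\<dots> = 1 / (exp 1 * (real k + 2))" using B by simp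
    finally have "B * \<kappa> powr \<rho> \<le> 1 / (exp 1 * (real k + 2))" .
    then have "B * \<kappa> powr \<rho> * exp (- real m) \<le> 1 / (exp 1 * (real k + 2)) * exp (- real m)"
        by (intro mult_right_mono) auto
    moreover have "\<tau> powr \<rho> = \<kappa> powr \<rho> * exp (- real m)"
      using \<kappa> \<rho> unfolding \<tau>_def by (simp add: powr_mult exp_powr_real)
    moreover have "exp (- real m - 1) = exp (- real m) / exp 1" by (simp add: exp_diff)
    moreover have "1 / (exp 1 * (real k + 2)) * exp (- real m) = exp (- real m) / exp 1 / (real k
        + 2)" by simp
    ultimately show ?thesis by (simp only: mult.assoc)
  qed
  define idx where "idx = (\<lambda>t. nat \<lfloor>(t - x0) / (w * \<tau>)\<rfloor>)"
  have wt: "w * \<tau> > 0" "w * \<tau> \<le> \<tau>" using w \<tau> by (auto simp: mult_le_cancel_right1)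
  define J where "J = (\<lambda>i. S \<inter> {x0 + real i * (w * \<tau>) .. x0 + real (Suc i) * (w * \<tau>)})"
  have inJ: "t \<in> J (idx t)" if "t \<in> S" "x0 \<le> t" for t
  proof -
    have p: "0 \<le> (t - x0) / (w * \<tau>)" using that wt by auto
    then have "real (idx t) = of_int \<lfloor>(t - x0) / (w * \<tau>)\<rfloor>" unfolding idx_def by simp
    then have "real (idx t) \<le> (t - x0) / (w * \<tau>)" "(t - x0) / (w * \<tau>) \<le> real (Suc (idx t))"
      using floor_correct[of "(t - x0) / (w * \<tau>)"] by linarith+
    then show ?thesis using wt that unfolding J_def by (auto simp: field_simps)
  qed
  have idxle: "real (idx t) \<le> 1 / \<tau>" if "t \<in> {x0..x0+w}" for t
  proof -
    have p: "0 \<le> (t - x0) / (w * \<tau>)" using that wt by auto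
    then have "real (idx t) \<le> (t - x0) / (w * \<tau>)" unfolding idx_def by simp
    also have "\<dots> \<le> w / (w * \<tau>)" using that wt by (intro divide_right_mono) auto
    finally show ?thesis using w by simp
  qed
  have Jlen: "\<bar>s - t\<bar> \<le> w * \<tau>" if "s \<in> J i" "t \<in> J i" for s t i
    using that unfolding J_def by (auto simp: abs_le_iff algebra_simps)
  have JS: "J i \<subseteq> S" for i unfolding J_def by auto
  have ex: "\<forall>i. \<exists>col::real \<Rightarrow> nat. (\<forall>t. col t < (k + 1)\<^sup>2) \<and>
    (\<forall>s t c. s \<in> J i \<longrightarrow> t \<in> J i \<longrightarrow> s < t \<longrightarrow> col s = col t \<longrightarrow> \<bar>v 0 s\<bar> \<le> exp (- real m) \<longrightarrow> \<bar>v 0 t\<bar> \<le> exp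
        (- real m) \<longrightarrow> c \<in> {s..t} \<longrightarrow>
       \<bar>v 0 c\<bar> \<le> (real k + 2) * exp (- real m)) \<and>
    (\<forall>s t c. s \<in> J i \<longrightarrow> t \<in> J i \<longrightarrow> s < t \<longrightarrow> col s = col t \<longrightarrow> \<bar>v 0 s\<bar> > exp (- real m - 1) \<longrightarrow> \<bar>v 0 t\<bar> >
        exp (- real m - 1) \<longrightarrow> c \<in> {s..t} \<longrightarrow>
       v 0 c \<noteq> 0)" (is "\<forall>i. \<exists>col. ?P i col")
  proof
    fix i
    have cJ: "convex (J i)" unfolding J_def using S by (intro convex_Int) auto
    have le: "B * \<tau> powr \<alpha> * \<tau> ^ k \<le> exp (- real m - 1) / (real k + 2)"
      using kp \<tau> \<rho>(2)[symmetric] by (simp add: powr_add powr_realpow algebra_simps)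
    have d: "(v j has_real_derivative v (Suc j) t) (at t within J i)" if "j < k" "t \<in> J i" for j t
      using der[of j t] that JS[of i] by (meson DERIV_subset subsetD)
    have o: "\<bar>v k s - v k t\<bar> \<le> B * \<tau> powr \<alpha>" if "s \<in> J i" "t \<in> J i" for s t
      using osc[of s t \<tau>] that JS[of i] Jlen[OF that] wt \<tau> \<tau>1 by auto
    have l: "\<bar>s - t\<bar> \<le> \<tau>" if "s \<in> J i" "t \<in> J i" for s t using Jlen[OF that] wt by linarith
    obtain col where "\<And>t. col t < (k + 1)\<^sup>2"
      "\<And>s t c. s \<in> J i \<Longrightarrow> t \<in> J i \<Longrightarrow> s < t \<Longrightarrow> col s = col t \<Longrightarrow> \<bar>v 0 s\<bar> \<le> exp (- real m) \<Longrightarrow>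
          \<bar>v 0 t\<bar> \<le> exp (- real m) \<Longrightarrow> c \<in> {s..t} \<Longrightarrow>
         \<bar>v 0 c\<bar> \<le> (real k + 2) * exp (- real m)"
      "\<And>s t c. s \<in> J i \<Longrightarrow> t \<in> J i \<Longrightarrow> s < t \<Longrightarrow> col s = col t \<Longrightarrow> \<bar>v 0 s\<bar> > exp (- real m - 1) \<Longrightarrow>
          \<bar>v 0 t\<bar> > exp (- real m - 1) \<Longrightarrow> c \<in> {s..t} \<Longrightarrow>
         v 0 c \<noteq> 0"
      using split_piece[OF cJ l \<tau>(1) d o _ _ le, of "exp (- real m)"] by auto
    then show "\<exists>col. ?P i col" by blast
  qed
  obtain cl where ccl: "\<forall>i. ?P i (cl i)" using choice[OF ex] by (rule exE)
  have cl: "\<And>i t. cl i t < (k + 1)\<^sup>2"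
    "\<And>i s t c. s \<in> J i \<Longrightarrow> t \<in> J i \<Longrightarrow> s < t \<Longrightarrow> cl i s = cl i t \<Longrightarrow> \<bar>v 0 s\<bar> \<le> exp (- real m) \<Longrightarrow>
        \<bar>v 0 t\<bar> \<le> exp (- real m) \<Longrightarrow> c \<in> {s..t} \<Longrightarrow>
       \<bar>v 0 c\<bar> \<le> (real k + 2) * exp (- real m)"
    "\<And>i s t c. s \<in> J i \<Longrightarrow> t \<in> J i \<Longrightarrow> s < t \<Longrightarrow> cl i s = cl i t \<Longrightarrow> \<bar>v 0 s\<bar> > exp (- real m - 1) \<Longrightarrow>
        \<bar>v 0 t\<bar> > exp (- real m - 1) \<Longrightarrow> c \<in> {s..t} \<Longrightarrow>
       v 0 c \<noteq> 0"
    using ccl by blast+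
  define Q where "Q = (k + 1)\<^sup>2"
  define col where "col = (\<lambda>t. idx t * Q + cl (idx t) t)"
  have eq: "idx s = idx t \<and> cl (idx t) s = cl (idx t) t" if "col s = col t" for s t
  proof -
    have "idx x = col x div Q" "cl (idx x) x = col x mod Q" for x
      using cl(1)[of "idx x" x] unfolding col_def Q_def[symmetric] by auto
    then show ?thesis using that by metis
  qed
  have Ck: "(real k + 2) \<le> C" unfolding C_def split_const_def by auto
  show ?thesis
  proof
    fix t assume t: "t \<in> {x0..x0+w}"
    have "real (col t) + 1 \<le> real (idx t) * real Q + real Q"
      using cl(1)[of "idx t" t] unfolding col_def Q_def[symmetric] by simp
    also have "\<dots> = (real (idx t) + 1) * real Q" by (simp add: algebra_simps)
    \<comment> \<open>Piece numbers start at 0, which gives one piece more than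
      \<open>1 / \<tau>\<close>; it is absorbed by doubling because \<tau> is at most 1.\<close>
    also have "\<dots> \<le> (1 / \<tau> + 1 / \<tau>) * real Q"
      using idxle[OF t] \<tau> \<tau>1 by (intro mult_right_mono add_mono) (auto simp: field_simps)
    also have "\<dots> = (2 * real Q / \<kappa>) * exp (real m / \<rho>)"
      unfolding \<tau>_def by (simp add: exp_minus field_simps)
    also have "\<dots> \<le> C * exp (real m / \<rho>)"
      unfolding C_def split_const_def \<kappa>_def Q_def by (intro mult_right_mono) auto
    finally show "real (col t) + 1 \<le> C * exp (real m / \<rho>)" .
  next
    fix s t assume st: "s \<in> S \<inter> {x0..x0+w}" "t \<in> S \<inter> {x0..x0+w}" "s < t" "col s = col t"
    have "s \<in> J (idx t)" "t \<in> J (idx t)" using inJ[of s] inJ[of t] st eq[OF st(4)] by auto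
    note J = this
    have "t - s \<le> w * \<tau>" using Jlen[OF J] by auto
    also have "\<dots> \<le> w * exp (- real m / \<rho>)" using \<tau> w by (intro mult_left_mono) auto
    finally show "t - s \<le> w * exp (- real m / \<rho>)" .
    fix c assume c: "c \<in> {s..t}"
    show "\<bar>v 0 c\<bar> \<le> C * exp (- real m)" if "\<bar>v 0 s\<bar> \<le> exp (- real m)" "\<bar>v 0 t\<bar> \<le> exp (- real m)"
    proof -
      have "\<bar>v 0 c\<bar> \<le> (real k + 2) * exp (- real m)" using cl(2)[OF J st(3) _ that c] eq[OF st(4)]
          by simp
      also have "\<dots> \<le> C * exp (- real m)" using Ck by (intro mult_right_mono) auto
      finally show ?thesis .
    qed
    show "v 0 c \<noteq> 0" if "\<bar>v 0 s\<bar> > exp (- real m - 1)" "\<bar>v 0 t\<bar> > exp (- real m - 1)"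
      using cl(3)[OF J st(3) _ that c] eq[OF st(4)] by simp
  qed
qed

section \<open>Kraft covers\<close>

text \<open>By Kraft's inequality \<open>L t\<close> plays the role of the length, in natural units, of a code word for
  a set with property \<open>P\<close> that contains \<open>t\<close>.\<close>

definition kraft_cover :: "('a set \<Rightarrow> bool) \<Rightarrow> 'a set \<Rightarrow> ('a \<Rightarrow> real) \<Rightarrow> bool" where
  "kraft_cover P A L \<longleftrightarrow> (\<exists>\<B> w. finite \<B> \<and> (\<forall>B\<in>\<B>. P B \<and> 0 \<le> w B) \<and> (\<Sum>B\<in>\<B>. w B) \<le> (1::real) \<and>
     (\<forall>t\<in>A. \<exists>B\<in>\<B>. t \<in> B \<and> exp (- L t) \<le> w B))"

lemma kraft_coverI:
  assumes "finite \<B>" "\<And>B. B \<in> \<B> \<Longrightarrow> P B" "\<And>B. B \<in> \<B> \<Longrightarrow> 0 \<le> w B" "(\<Sum>B\<in>\<B>. w B) \<le> 1"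
    "\<And>t. t \<in> A \<Longrightarrow> \<exists>B\<in>\<B>. t \<in> B \<and> exp (- L t) \<le> w B"
  shows "kraft_cover P A L"
  unfolding kraft_cover_def using assms by (intro exI[of _ \<B>] exI[of _ w]) blast

lemma kraft_coverE:
  assumes "kraft_cover P A L"
  obtains \<B> w where "finite \<B>" "\<And>B. B \<in> \<B> \<Longrightarrow> P B" "\<And>B. B \<in> \<B> \<Longrightarrow> 0 \<le> w B" "(\<Sum>B\<in>\<B>. w B) \<le> 1"
    "\<And>t. t \<in> A \<Longrightarrow> \<exists>B\<in>\<B>. t \<in> B \<and> exp (- L t) \<le> w B"
  using assms unfolding kraft_cover_def by blast

lemma kraft_cover_mono:
  assumes "kraft_cover P A L" "\<And>t. t \<in> A' \<Longrightarrow> t \<in> A \<and> L t \<le> L' t" "\<And>B. P B \<Longrightarrow> P' B"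
  shows "kraft_cover P' A' L'"
proof -
  from assms(1) obtain \<B> w where b: "finite \<B>" "\<And>B. B \<in> \<B> \<Longrightarrow> P B" "\<And>B. B \<in> \<B> \<Longrightarrow>
      0 \<le> w B" "(\<Sum>B\<in>\<B>. w B) \<le> 1"
    "\<And>t. t \<in> A \<Longrightarrow> \<exists>B\<in>\<B>. t \<in> B \<and> exp (- L t) \<le> w B" by (rule kraft_coverE) blast
  show ?thesis
  proof (rule kraft_coverI[of \<B> _ w])
    fix t assume t: "t \<in> A'"
    then obtain B where "B \<in> \<B>" "t \<in> B" "exp (- L t) \<le> w B" using b(5) assms(2) by blast
    moreover have "exp (- L' t) \<le> exp (- L t)" using assms(2)[OF t] by simp
    ultimately show "\<exists>B\<in>\<B>. t \<in> B \<and> exp (- L' t) \<le> w B" by (meson order_trans)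
  qed (use b assms(3) in auto)
qed

lemma kraft_cover_single:
  assumes "P A" "\<And>t. t \<in> A \<Longrightarrow> L t \<ge> 0"
  shows "kraft_cover P A L"
  by (rule kraft_coverI[of "{A}" _ "\<lambda>_. 1"]) (use assms in simp_all)

text \<open>Concatenation of codes: first a letter of length \<open>- ln (p c)\<close>, then a word
  from the cover that belongs to this letter.\<close>

lemma kraft_cover_split:
  assumes C: "finite C" "\<And>t. t \<in> A \<Longrightarrow> f t \<in> C" and p: "\<And>c. c \<in> C \<Longrightarrow> 0 \<le> p c" "(\<Sum>c\<in>C. p c) \<le> (1::real)"
    and K: "\<And>c. c \<in> C \<Longrightarrow> kraft_cover P {t\<in>A. f t = c} (M c)"
    and L: "\<And>t. t \<in> A \<Longrightarrow> exp (- L t) \<le> p (f t) * exp (- M (f t) t)"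
  shows "kraft_cover P A L"
proof -
  have "\<forall>c\<in>C. \<exists>\<B> w. finite \<B> \<and> (\<forall>B\<in>\<B>. P B \<and> 0 \<le> w B) \<and> (\<Sum>B\<in>\<B>. w B) \<le> (1::real) \<and>
     (\<forall>t\<in>{t\<in>A. f t = c}. \<exists>B\<in>\<B>. t \<in> B \<and> exp (- M c t) \<le> w B)"
    by (intro ballI K[unfolded kraft_cover_def])
  from bchoice[OF this] obtain \<B>
      where "\<forall>c\<in>C. \<exists>w. finite (\<B> c) \<and> (\<forall>B\<in>\<B> c. P B \<and> 0 \<le> w B) \<and> (\<Sum>B\<in>\<B> c. w B) \<le> (1::real) \<and>
     (\<forall>t\<in>{t\<in>A. f t = c}. \<exists>B\<in>\<B> c. t \<in> B \<and> exp (- M c t) \<le> w B)" by auto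
  from bchoice[OF this] obtain w
      where b: "\<And>c. c \<in> C \<Longrightarrow> finite (\<B> c) \<and> (\<forall>B\<in>\<B> c. P B \<and> 0 \<le> w c B) \<and> (\<Sum>B\<in>\<B> c. w c B) \<le> (1::real) \<and>
     (\<forall>t\<in>{t\<in>A. f t = c}. \<exists>B\<in>\<B> c. t \<in> B \<and> exp (- M c t) \<le> w c B)" by auto
  \<comment> \<open>The same set may occur in the families of several letters; its weights add
    up.\<close>
  define W where "W = (\<lambda>B. \<Sum>c\<in>C. if B \<in> \<B> c then p c * w c B else 0)"
  have nn: "0 \<le> (if B \<in> \<B> c then p c * w c B else 0)" if "c \<in> C" for c B
    using b[OF that] p(1)[OF that] by auto
  have "(\<Sum>B\<in>(\<Union>c\<in>C. \<B> c). W B) = (\<Sum>c\<in>C. \<Sum>B\<in>(\<Union>c\<in>C. \<B> c). if B \<in> \<B> c then p c * w c B else 0)"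
    unfolding W_def by (rule sum.swap)
  also have "\<dots> = (\<Sum>c\<in>C. \<Sum>B\<in>\<B> c. p c * w c B)"
  proof (rule sum.cong[OF refl])
    fix c assume c: "c \<in> C"
    have "(\<Union>c\<in>C. \<B> c) \<inter> \<B> c = \<B> c" using c by auto
    then show "(\<Sum>B\<in>(\<Union>c\<in>C. \<B> c). if B \<in> \<B> c then p c * w c B else 0) = (\<Sum>B\<in>\<B> c. p c * w c B)"
      using b C(1) by (subst sum.inter_restrict[symmetric]) auto
  qed
  also have "\<dots> \<le> (\<Sum>c\<in>C. p c)"
  proof (rule sum_mono)
    fix c assume c: "c \<in> C"
    have "(\<Sum>B\<in>\<B> c. p c * w c B) = p c * (\<Sum>B\<in>\<B> c. w c B)" by (simp add: sum_distrib_left)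
    also have "\<dots> \<le> p c * 1" using b[OF c] p(1)[OF c] by (intro mult_left_mono) auto
    finally show "(\<Sum>B\<in>\<B> c. p c * w c B) \<le> p c" by simp
  qed
  finally have s1: "(\<Sum>B\<in>(\<Union>c\<in>C. \<B> c). W B) \<le> 1" using p(2) by linarith
  show ?thesis
  proof (rule kraft_coverI[of "\<Union>c\<in>C. \<B> c" _ W])
    show "0 \<le> W B" for B unfolding W_def by (intro sum_nonneg nn)
    fix t assume t: "t \<in> A"
    then have c: "f t \<in> C" using C by auto
    then obtain B where B: "B \<in> \<B> (f t)" "t \<in> B" "exp (- M (f t) t) \<le> w (f t) B" using b[OF c] t
        by auto
    have "exp (- L t) \<le> p (f t) * w (f t) B"
      using L[OF t] B(3) p(1)[OF c] by (meson mult_left_mono order_trans)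
    also have "\<dots> = (if B \<in> \<B> (f t) then p (f t) * w (f t) B else 0)" using B by simp
    also have "\<dots> \<le> W B" unfolding W_def by (rule member_le_sum[OF c]) (use nn C in auto)
    finally show "\<exists>B\<in>(\<Union>c\<in>C. \<B> c). t \<in> B \<and> exp (- L t) \<le> W B" using B c by blast
  qed (use b C s1 in auto)
qed

text \<open>The special case of a uniform code for \<open>K\<close> letters, with price
  \<kappa>.\<close>

lemma kraft_cover_colour:
  assumes "\<And>t. t \<in> A \<Longrightarrow> f t < K" "real K \<le> exp \<kappa>"
    and "\<And>c. c < (K::nat) \<Longrightarrow> kraft_cover P {t\<in>A. f t = c} M"
    and "\<And>t. t \<in> A \<Longrightarrow> \<kappa> + M t \<le> L t"
  shows "kraft_cover P A L"
proof (rule kraft_cover_split[of "{..<K}" A f "\<lambda>_. exp (- \<kappa>)" P "\<lambda>_. M"])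
  show "(\<Sum>c<K. exp (- \<kappa>)) \<le> 1" using assms(2) by (simp add: exp_minus field_simps)
  show "exp (- L t) \<le> exp (- \<kappa>) * exp (- M t)" if "t \<in> A" for t
    using assms(4)[OF that] by (simp flip: exp_add)
qed (use assms in auto)

lemma kraft_cover_restrict:
  assumes "kraft_cover P A L" "\<And>B. P B \<Longrightarrow> Q (B \<inter> D)"
  shows "kraft_cover Q (A \<inter> D) L"
proof -
  from assms(1) obtain \<B> w where b: "finite \<B>" "\<And>B. B \<in> \<B> \<Longrightarrow> P B" "\<And>B. B \<in> \<B> \<Longrightarrow>
      0 \<le> w B" "(\<Sum>B\<in>\<B>. w B) \<le> 1"
    "\<And>t. t \<in> A \<Longrightarrow> \<exists>B\<in>\<B>. t \<in> B \<and> exp (- L t) \<le> w B" by (rule kraft_coverE) blast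
  \<comment> \<open>Different sets may have the same trace on \<open>D\<close>; the trace inherits
    the sum of their weights.\<close>
  define W where "W = (\<lambda>B'. \<Sum>B\<in>{B\<in>\<B>. B \<inter> D = B'}. w B)"
  show ?thesis
  proof (rule kraft_coverI[of "(\<lambda>B. B \<inter> D) ` \<B>" _ W])
    have "(\<Sum>B'\<in>(\<lambda>B. B \<inter> D) ` \<B>. W B') = (\<Sum>B\<in>\<B>. w B)"
      unfolding W_def by (rule sum.image_gen[symmetric]) (use b in auto)
    then show "(\<Sum>B'\<in>(\<lambda>B. B \<inter> D) ` \<B>. W B') \<le> 1" using b by simp
    fix t assume t: "t \<in> A \<inter> D"
    then obtain B where B: "B \<in> \<B>" "t \<in> B" "exp (- L t) \<le> w B" using b(5) by blast
    have "w B \<le> W (B \<inter> D)" unfolding W_def by (rule member_le_sum) (use B b in auto)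
    then show "\<exists>B\<in>(\<lambda>B. B \<inter> D) ` \<B>. t \<in> B \<and> exp (- L t) \<le> W B" using B t
      by (intro bexI[of _ "B \<inter> D"]) auto
  qed (use b assms(2) in \<open>auto simp: W_def intro!: sum_nonneg\<close>)
qed

text \<open>Appends the symbol \<open>f t\<close> to each word. It serves to add the name of a
  partition element at one time of the orbit.\<close>

lemma kraft_cover_refine:
  assumes "kraft_cover P A L" "\<And>B B'. P B \<Longrightarrow> B' \<subseteq> B \<Longrightarrow> P B'"
    and C: "finite C" "\<And>t. t \<in> A \<Longrightarrow> f t \<in> C" and p: "\<And>c. c \<in> C \<Longrightarrow> 0 < p c" "(\<Sum>c\<in>C. p c) \<le> (1::real)"
  shows "kraft_cover (\<lambda>B. P B \<and> (\<forall>s\<in>B. \<forall>t\<in>B. f s = f t)) A (\<lambda>t. L t - ln (p (f t)))"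
proof (rule kraft_cover_split[of C A f p _ "\<lambda>_. L"])
  fix c assume "c \<in> C"
  have "{t \<in> A. f t = c} = A \<inter> {t. f t = c}" by auto
  then show "kraft_cover (\<lambda>B. P B \<and> (\<forall>s\<in>B. \<forall>t\<in>B. f s = f t)) {t \<in> A. f t = c} L"
    using kraft_cover_restrict[OF assms(1), of "\<lambda>B. P B \<and> (\<forall>s\<in>B. \<forall>t\<in>B. f s = f t)" "{t. f t
      = c}"] assms(2) by auto
next
  show "exp (- (L t - ln (p (f t)))) \<le> p (f t) * exp (- L t)" if "t \<in> A" for t
    using p(1)[OF C(2)[OF that]] by (simp add: exp_diff exp_minus field_simps)
qed (use C p in \<open>auto simp: less_imp_le\<close>)

definition mono_between :: "(real \<Rightarrow> real) \<Rightarrow> real \<Rightarrow> real \<Rightarrow> bool" where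
  "mono_between F a b \<longleftrightarrow> (\<forall>x y. a \<le> x \<and> x \<le> y \<and> y \<le> b \<longrightarrow> F x \<le> F y) \<or> (\<forall>x y. a \<le> x \<and> x \<le> y \<and> y \<le> b \<longrightarrow>
      F y \<le> F x)"

text \<open>Smallness in Bowen's metric, measured on the line rather than on the space.\<close>

definition dyn_small :: "(real \<Rightarrow> real) \<Rightarrow> nat \<Rightarrow> real \<Rightarrow> real set \<Rightarrow> bool" where
  "dyn_small G n \<sigma> B \<longleftrightarrow> (\<forall>a\<in>B. \<forall>b\<in>B. \<forall>i<n. \<bar>(G ^^ i) a - (G ^^ i) b\<bar> \<le> \<sigma>)"

text \<open>More than the number of jumps of size \<sigma> that are possible for at most
  \<open>n + 1\<close> monotone iterates whose images have length at most 1.\<close>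

definition lap_count :: "nat \<Rightarrow> real \<Rightarrow> nat" where
  "lap_count n \<sigma> = nat \<lceil>(real n + 1) / \<sigma>\<rceil> + 1"

lemma mono_between_chain:
  assumes "mono_between F (s 0) (s m)" "\<And>i. i < m \<Longrightarrow> s i < s (Suc i)"
  shows "(\<Sum>i<m. \<bar>F (s (Suc i)) - F (s i)\<bar>) = \<bar>F (s m) - F (s 0)\<bar>"
proof -
  have le: "s i \<le> s j" if "i \<le> j" "j \<le> m" for i j
    using that(1,2) by (induction j rule: dec_induct) (use assms(2) in \<open>auto intro: order_trans[OF
      _ less_imp_le]\<close>)
  have st: "s 0 \<le> s i" "s i \<le> s (Suc i)" "s (Suc i) \<le> s m" if "i < m" for i
    using le[of 0 i] le[of i "Suc i"] le[of "Suc i" m] that by auto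
  from assms(1)[unfolded mono_between_def] show ?thesis
  proof
    assume m: "\<forall>x y. s 0 \<le> x \<and> x \<le> y \<and> y \<le> s m \<longrightarrow> F x \<le> F y"
    have "(\<Sum>i<m. \<bar>F (s (Suc i)) - F (s i)\<bar>) = (\<Sum>i<m. F (s (Suc i)) - F (s i))"
      using m st by (intro sum.cong) auto
    also have "\<dots> = F (s m) - F (s 0)" by (rule sum_lessThan_telescope)
    finally show ?thesis using m le[of 0 m] by auto
  next
    assume m: "\<forall>x y. s 0 \<le> x \<and> x \<le> y \<and> y \<le> s m \<longrightarrow> F y \<le> F x"
    have "(\<Sum>i<m. \<bar>F (s (Suc i)) - F (s i)\<bar>) = (\<Sum>i<m. F (s i) - F (s (Suc i)))"
      using m st by (intro sum.cong) auto
    also have "\<dots> = F (s 0) - F (s m)" by (rule sum_lessThan_telescope')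
    finally show ?thesis using m le[of 0 m] by auto
  qed
qed

section \<open>Branching of a lift\<close>

lemma mono_between_comp:
  assumes "mono_between F a b" "mono_between G lo hi" "\<And>x. a \<le> x \<Longrightarrow> x \<le> b \<Longrightarrow> lo \<le> F x \<and> F x \<le> hi"
  shows "mono_between (\<lambda>x. G (F x)) a b"
proof -
  have b: "lo \<le> F x" "F x \<le> hi" "lo \<le> F y" "F y \<le> hi" if "a \<le> x \<and> x \<le> y \<and> y \<le> b" for x y
    using assms(3)[of x] assms(3)[of y] that by auto
  from assms(1,2) show ?thesis unfolding mono_between_def
  proof (elim disjE, goal_cases)
    case 1
    have "G (F x) \<le> G (F y)" if "a \<le> x \<and> x \<le> y \<and> y \<le> b" for x y using 1 b[OF that] that by simp
    then show ?case by (intro disjI1) blast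
  next
    case 2
    have "G (F y) \<le> G (F x)" if "a \<le> x \<and> x \<le> y \<and> y \<le> b" for x y using 2 b[OF that] that by simp
    then show ?case by (intro disjI2) blast
  next
    case 3
    have "G (F y) \<le> G (F x)" if "a \<le> x \<and> x \<le> y \<and> y \<le> b" for x y using 3 b[OF that] that by simp
    then show ?case by (intro disjI2) blast
  next
    case 4
    have "G (F x) \<le> G (F y)" if "a \<le> x \<and> x \<le> y \<and> y \<le> b" for x y using 4 b[OF that] that by simp
    then show ?case by (intro disjI1) blast
  qed
qed

text \<open>
  Points with \<open>exp (- M) < \<bar>u t\<bar>\<close> are shallow: \<open>G\<close> is monotone at scale \<open>\<epsilon>\<close> around them.  Points
  with \<open>\<bar>u t\<bar> \<le> exp (- M')\<close> are deep and start a recovery.  The \<open>NY\<close> colours of \<open>ycol\<close> come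
  from a spanning set of \<open>f\<close> for \<open>N\<close> steps, \<open>H\<close> being slightly above the entropy of \<open>f\<close>.
\<close>

locale branching =
  fixes S :: "real set" and G u :: "real \<Rightarrow> real" and r L R C0 CA \<epsilon> H gam \<kappa> :: real
      and M M' N NY :: nat and ycol :: "real \<Rightarrow> nat"
  assumes convS: "convex S" and GS: "\<And>t. t \<in> S \<Longrightarrow> G t \<in> S"
    and derG: "\<And>t. t \<in> S \<Longrightarrow> (G has_real_derivative u t) (at t within S)"
    and contu: "continuous_on S u"
    and r: "r > 1" and R: "R > 0" and C0: "C0 \<ge> 1" and CA: "CA \<ge> 1" and \<kappa>: "\<kappa> > 0"
    and growth: "\<And>a b n. a \<in> S \<Longrightarrow> b \<in> S \<Longrightarrow> \<bar>(G ^^ n) a - (G ^^ n) b\<bar> \<le> C0 * exp (R * real n) * \<bar>a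
        - b\<bar>"
    and lip: "\<And>a b. a \<in> S \<Longrightarrow> b \<in> S \<Longrightarrow> \<bar>G a - G b\<bar> \<le> L * \<bar>a - b\<bar>"
    and \<epsilon>: "0 < \<epsilon>" "\<epsilon> \<le> 1" "L * \<epsilon> \<le> 1" "\<epsilon> * exp R \<le> 1"
    and split: "\<And>(m::nat) x0 w. 0 < w \<Longrightarrow> w \<le> 1 \<Longrightarrow> \<exists>col :: real \<Rightarrow> nat.
      (\<forall>t\<in>{x0..x0+w}. real (col t) + 1 \<le> CA * exp (real m / (r - 1))) \<and>
      (\<forall>s\<in>S \<inter> {x0..x0+w}. \<forall>t\<in>S \<inter> {x0..x0+w}. s < t \<longrightarrow> col s = col t \<longrightarrow>
         t - s \<le> w * exp (- real m / (r - 1)) \<and>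
         (\<bar>u s\<bar> \<le> exp (- real m) \<longrightarrow> \<bar>u t\<bar> \<le> exp (- real m) \<longrightarrow> (\<forall>c\<in>{s..t}. \<bar>u c\<bar> \<le> CA * exp (- real
             m))) \<and>
         (\<bar>u s\<bar> > exp (- real m - 1) \<longrightarrow> \<bar>u t\<bar> > exp (- real m - 1) \<longrightarrow> (\<forall>c\<in>{s..t}. u c \<noteq> 0)))"
    and shallow: "\<And>a b c. a \<in> S \<Longrightarrow> b \<in> S \<Longrightarrow> c \<in> S \<Longrightarrow> \<bar>a - b\<bar> \<le> \<epsilon> \<Longrightarrow> \<bar>u a\<bar> > exp (- real M) \<Longrightarrow>
        min a b \<le> c \<Longrightarrow> c \<le> max a b \<Longrightarrow> u c \<noteq> 0"
    and N: "N \<ge> 1" "H \<ge> 0" "real NY \<le> exp (real N * H)"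
    and span1: "\<And>t. t \<in> S \<Longrightarrow> ycol t < NY"
    and span2: "\<And>a b i. a \<in> S \<Longrightarrow> b \<in> S \<Longrightarrow> ycol a = ycol b \<Longrightarrow> i < N \<Longrightarrow> \<bar>(G ^^ i) a - (G ^^ i) b\<bar> \<le> 1 \<Longrightarrow>
        \<bar>(G ^^ i) a - (G ^^ i) b\<bar> \<le> \<epsilon>"
    and gam: "gam > 0" and M: "1 \<le> M" "M \<le> M'"
    and gainR: "\<And>m. M' \<le> m \<Longrightarrow> R < real m * (r / (r - 1)) - ln (CA * C0)"
    and kraft: "exp (- gam) + exp (- gam * real M) / (1 - exp (- gam)) \<le> 1"
begin

text \<open>
  In \<open>cost \<sigma> V k x q t\<close> there are \<open>k\<close> steps left, \<open>x\<close> is the recovery potential (distances are at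
  most \<open>\<epsilon> * exp (- x)\<close>) and \<open>q\<close> is what remains of the current block of \<open>N\<close> steps, for \<open>x = 0\<close>.
  Levels are cut off at \<open>cap\<close>, where the image stays below \<open>\<sigma>\<close> until the end.  The last summand \<open>V\<close>
  pays for cutting monotone pieces to size \<open>\<sigma>\<close>.
\<close>

definition lev :: "real \<Rightarrow> nat" where "lev t = nat \<lfloor>- ln \<bar>u t\<bar>\<rfloor>"
definition dcon :: real where "dcon = ln (CA * C0)"
text \<open>The exponent of contraction of a visit at level \<open>m\<close>:
  \<open>m / (r - 1)\<close> from shrinking to a branch and \<open>m\<close> from the derivative on
  it, less a constant for the loss inside the branch and for the factor \<open>C0\<close> in the
  later growth.\<close>

definition gain :: "nat \<Rightarrow> real" where "gain m = real m * (r / (r - 1)) - dcon"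
text \<open>The first summand names the level, the other two name a branch at this level.\<close>

definition vcost :: "nat \<Rightarrow> real" where "vcost m = gam * real m + ln CA + real m / (r - 1)"
text \<open>From this potential on, growth at rate \<open>R\<close> keeps distances below \<sigma>
  for the \<open>k\<close> remaining steps: \<open>\<epsilon> * exp (- x + R * real k)\<close> is
  then at most \<sigma>.\<close>

definition lim_pot :: "real \<Rightarrow> nat \<Rightarrow> real" where "lim_pot \<sigma> k = R * real k + ln (\<epsilon> / \<sigma>)"
definition cap :: "real \<Rightarrow> nat \<Rightarrow> real \<Rightarrow> nat" where
  "cap \<sigma> k x = max M' (nat \<lceil>(lim_pot \<sigma> k - x + dcon) * ((r - 1) / r)\<rceil>)"

primrec cost :: "real \<Rightarrow> real \<Rightarrow> nat \<Rightarrow> real \<Rightarrow> nat \<Rightarrow> real \<Rightarrow> real" where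
  "cost \<sigma> V 0 x q t = V"
| "cost \<sigma> V (Suc k) x q t = (if x = 0 \<and> q = 0 then real N * H else 0) +
    (let q' = (if x = 0 then (if q = 0 then N else q) - 1 else 0) in
     if \<bar>u t\<bar> > exp (- real M) then gam + cost \<sigma> V k (max 0 (x - R)) q' (G t)
     else if \<bar>u t\<bar> > exp (- real M') then vcost (lev t) + cost \<sigma> V k (max 0 (x - R)) q' (G t)
     else if \<bar>u t\<bar> \<le> exp (- real (cap \<sigma> (Suc k) x)) then vcost (cap \<sigma> (Suc k) x) + V
     else vcost (lev t) + cost \<sigma> V k (x + gain (lev t) - R) 0 (G t))"

text \<open>The invariant of the coding after \<open>j\<close> steps. A positive potential controls
  all later times at once. For \<open>x = 0\<close> closeness during the rest of the block is
  conditional, because the spanning set controls distances in the space, which determine distances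
  of lifted points only if the latter are at most 1. That premise is restored at each step by
  \<open>L * \<epsilon> \<le> 1\<close>.\<close>

definition state :: "nat \<Rightarrow> real \<Rightarrow> nat \<Rightarrow> real set \<Rightarrow> bool" where
  "state j x q A \<longleftrightarrow> A \<subseteq> S \<and>
     (\<forall>a\<in>A. \<forall>b\<in>A. a < b \<longrightarrow> (\<forall>i\<le>j. mono_between (G ^^ i) a b)) \<and>
     (\<forall>a\<in>A. \<forall>b\<in>A. \<forall>i\<le>j. \<bar>(G ^^ i) a - (G ^^ i) b\<bar> \<le> 1) \<and>
     (x > 0 \<longrightarrow> (\<forall>a\<in>A. \<forall>b\<in>A. \<forall>i. \<bar>(G ^^ (j + i)) a - (G ^^ (j + i)) b\<bar> \<le> \<epsilon> * exp (- x + R * real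
         i))) \<and>
     (x = 0 \<longrightarrow> (\<forall>a\<in>A. \<forall>b\<in>A. \<forall>i<q. \<bar>(G ^^ (j + i)) a - (G ^^ (j + i)) b\<bar> \<le> 1 \<longrightarrow> \<bar>(G ^^ (j + i)) a -
         (G ^^ (j + i)) b\<bar> \<le> \<epsilon>))"

section \<open>Geometry of a single step of the lift\<close>

lemma between_S: "c \<in> S" if "a \<in> S" "b \<in> S" "min a b \<le> c" "c \<le> max a b"
proof -
  have "min a b \<in> S" "max a b \<in> S" using that by (auto simp: min_def max_def)
  from closed_segment_subset[OF this convS] show ?thesis using that
      by (auto simp: closed_segment_eq_real_ivl)
qed

lemma GnS: "t \<in> S \<Longrightarrow> (G ^^ n) t \<in> S"
  by (induction n) (auto simp: GS)

lemma lev_bounds: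
  assumes "0 < \<bar>u t\<bar>" "\<bar>u t\<bar> \<le> 1"
  shows "exp (- real (lev t) - 1) < \<bar>u t\<bar>" "\<bar>u t\<bar> \<le> exp (- real (lev t))"
proof -
  have p: "0 \<le> - ln \<bar>u t\<bar>" using assms by simp
  then have e: "real (lev t) = of_int \<lfloor>- ln \<bar>u t\<bar>\<rfloor>" unfolding lev_def by simp
  then have "real (lev t) \<le> - ln \<bar>u t\<bar>" "- ln \<bar>u t\<bar> < real (lev t) + 1"
    using floor_correct[of "- ln \<bar>u t\<bar>"] by linarith+
  then have "- real (lev t) - 1 < ln \<bar>u t\<bar>" "ln \<bar>u t\<bar> \<le> - real (lev t)" by linarith+
  then show "exp (- real (lev t) - 1) < \<bar>u t\<bar>" "\<bar>u t\<bar> \<le> exp (- real (lev t))"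
    using assms(1) by (metis exp_less_cancel_iff exp_ln, metis exp_le_cancel_iff exp_ln)
qed

lemma lev_iff:
  assumes "0 < \<bar>u t\<bar>" "\<bar>u t\<bar> \<le> 1"
  shows "\<bar>u t\<bar> \<le> exp (- real m) \<longleftrightarrow> m \<le> lev t"
proof
  assume "\<bar>u t\<bar> \<le> exp (- real m)"
  with lev_bounds(1)[OF assms] have "exp (- real (lev t) - 1) < exp (- real m)" by linarith
  then show "m \<le> lev t" by simp
next
  assume "m \<le> lev t"
  then have "exp (- real (lev t)) \<le> exp (- real m)" by simp
  with lev_bounds(2)[OF assms] show "\<bar>u t\<bar> \<le> exp (- real m)" by linarith
qed

lemma G_mono:
  assumes "a \<in> S" "b \<in> S" "a \<le> b" "\<And>c. c \<in> {a..b} \<Longrightarrow> u c \<noteq> 0"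
  shows "mono_between G a b"
proof -
  have sub: "{a..b} \<subseteq> S" using between_S[OF assms(1,2)] assms(3) by auto
  have cu: "continuous_on {a..b} u" using contu sub continuous_on_subset by blast
  have d: "\<exists>y\<in>{x<..<z}. G z - G x = (z - x) * u y" if "a \<le> x" "x < z" "z \<le> b" for x z
  proof -
    have "\<exists>y\<in>{x<..<z}. G z - G x = (\<lambda>h. h * u y) (z - x)"
    proof (rule mvt_simple)
      fix y assume y: "x \<le> y" "y \<le> z"
      then have "(G has_real_derivative u y) (at y within {x..z})"
        by (intro DERIV_subset[OF derG]) (use y sub that in auto)
      then show "(G has_derivative (\<lambda>h. h * u y)) (at y within {x..z})"
        unfolding has_field_derivative_def by (simp add: mult_commute_abs)
    qed (use that in auto)
    then show ?thesis by simp
  qed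
  have "(\<forall>c\<in>{a..b}. u c > 0) \<or> (\<forall>c\<in>{a..b}. u c < 0)"
  proof (rule ccontr)
    assume "\<not> ?thesis"
    then obtain c1 c2 where c: "c1 \<in> {a..b}" "c2 \<in> {a..b}" "u c1 < 0" "u c2 > 0"
      using assms(4) by (meson linorder_neqE_linordered_idom)
    have "connected (u ` {a..b})" using cu by (intro connected_continuous_image) auto
    then have "0 \<in> u ` {a..b}" using c by (meson connectedD_interval imageI less_imp_le)
    then show False using assms(4) by fastforce
  qed
  then show ?thesis
  proof
    assume p: "\<forall>c\<in>{a..b}. u c > 0"
    have "G x \<le> G y" if xy: "a \<le> x" "x \<le> y" "y \<le> b" for x y
    proof (cases "x < y")
      case True
      obtain c where c: "c\<in>{x<..<y}" "G y - G x = (y - x) * u c" using d[OF xy(1) True xy(3)]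
          by blast
      then have "0 \<le> (y - x) * u c" using p that True
          by (intro mult_nonneg_nonneg) (auto intro!: less_imp_le)
      then show ?thesis using c by linarith
    qed (use that in auto)
    then show ?thesis unfolding mono_between_def by blast
  next
    assume p: "\<forall>c\<in>{a..b}. u c < 0"
    have "G y \<le> G x" if xy: "a \<le> x" "x \<le> y" "y \<le> b" for x y
    proof (cases "x < y")
      case True
      obtain c where c: "c\<in>{x<..<y}" "G y - G x = (y - x) * u c" using d[OF xy(1) True xy(3)]
          by blast
      then have "(y - x) * u c \<le> 0" using p that True
          by (intro mult_nonneg_nonpos) (auto intro!: less_imp_le)
      then show ?thesis using c by linarith
    qed (use that in auto)
    then show ?thesis unfolding mono_between_def by blast
  qed
qed

lemma G_bound:
  assumes "a \<in> S" "b \<in> S" "\<And>c. min a b \<le> c \<Longrightarrow> c \<le> max a b \<Longrightarrow> \<bar>u c\<bar> \<le> D"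
  shows "\<bar>G a - G b\<bar> \<le> D * \<bar>a - b\<bar>"
proof -
  define T where "T = {min a b..max a b}"
  have sub: "T \<subseteq> S" using between_S[OF assms(1,2)] unfolding T_def by auto
  have "norm (G a - G b) \<le> D * norm (a - b)"
  proof (rule field_differentiable_bound[of T G u])
    show "(G has_field_derivative u z) (at z within T)" if "z \<in> T" for z
      by (rule DERIV_subset[OF derG]) (use sub that in auto)
  qed (use assms(3) in \<open>auto simp: T_def\<close>)
  then show ?thesis by simp
qed

lemma mono_step:
  assumes ab: "a \<in> S" "b \<in> S" "a < b" and m: "mono_between (G ^^ j) a b"
    and nz: "\<And>c. min ((G ^^ j) a) ((G ^^ j) b) \<le> c \<Longrightarrow> c \<le> max ((G ^^ j) a) ((G ^^ j) b) \<Longrightarrow> u c \<noteq> 0"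
  shows "mono_between (G ^^ Suc j) a b"
proof -
  let ?a = "(G ^^ j) a" and ?b = "(G ^^ j) b"
  have "?a \<in> S" "?b \<in> S" using ab GnS by auto
  then have "min ?a ?b \<in> S" "max ?a ?b \<in> S" by (auto simp: min_def max_def)
  then have g: "mono_between G (min ?a ?b) (max ?a ?b)" by (rule G_mono) (use nz in auto)
  have "mono_between (\<lambda>x. G ((G ^^ j) x)) a b"
  proof (rule mono_between_comp[OF m g])
    fix x assume "a \<le> x" "x \<le> b"
    with m show "min ?a ?b \<le> (G ^^ j) x \<and> (G ^^ j) x \<le> max ?a ?b"
      unfolding mono_between_def by (auto simp: min_le_iff_disj le_max_iff_disj)
  qed
  then show ?thesis by (simp add: comp_def)
qed

text \<open>The iterates up to time \<open>j\<close> are monotone on \<open>A\<close> with images of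
  length at most 1, so along a chain of points their total variation is at most
  \<open>j + 1\<close>. Each link of a chain for \<open>Rel\<close> consumes more than \<sigma> of
  it. Hence chains are short, and colouring by chain length cuts \<open>A\<close> into the required
  sets.\<close>

lemma final_cover:
  assumes A: "A \<subseteq> S" and mono: "\<And>a b i. a \<in> A \<Longrightarrow> b \<in> A \<Longrightarrow> a < b \<Longrightarrow> i \<le> j \<Longrightarrow> mono_between (G ^^ i) a b"
    and le1: "\<And>a b i. a \<in> A \<Longrightarrow> b \<in> A \<Longrightarrow> i \<le> j \<Longrightarrow> \<bar>(G ^^ i) a - (G ^^ i) b\<bar> \<le> 1"
    and tail: "\<And>a b i. a \<in> A \<Longrightarrow> b \<in> A \<Longrightarrow> j < i \<Longrightarrow> i < n \<Longrightarrow> \<bar>(G ^^ i) a - (G ^^ i) b\<bar> \<le> \<sigma>"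
    and jn: "j \<le> n" and \<sigma>: "\<sigma> > 0"
  shows "kraft_cover (dyn_small G n \<sigma>) A (\<lambda>_. ln (real (lap_count n \<sigma>)))"
proof -
  define m where "m = lap_count n \<sigma>"
  have m: "m > 0" "(real n + 1) / \<sigma> < real m" unfolding m_def lap_count_def
      by (auto simp: of_nat_nat) linarith
  define Rel where "Rel = (\<lambda>a b. a < b \<and> (\<exists>i<n. \<bar>(G ^^ i) a - (G ^^ i) b\<bar> > \<sigma>))"
  obtain col where col: "\<And>t. t \<in> A \<Longrightarrow> col t < m" "\<And>a b. a \<in> A \<Longrightarrow> b \<in> A \<Longrightarrow> col a = col b \<Longrightarrow> \<not> Rel a b"
  proof (rule chain_colouring[of m A Rel])
    fix s assume s: "\<forall>i\<le>m. s i \<in> A" "\<forall>i<m. Rel (s i) (s (Suc i))"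
    have inc: "s i < s (Suc i)" if "i < m" for i using s(2) that unfolding Rel_def by auto
    have "s 0 < s k" if "0 < k" "k \<le> m" for k
      using that(1,2) by (induction k rule: nat_induct_non_zero) (use inc in \<open>force intro:
        less_trans\<close>)+
    then have s0m: "s 0 < s m" using m by auto
    have "real m * \<sigma> = (\<Sum>i<m. \<sigma>)" by simp
    also have "\<dots> \<le> (\<Sum>i<m. \<Sum>l\<le>j. \<bar>(G ^^ l) (s (Suc i)) - (G ^^ l) (s i)\<bar>)"
    proof (rule sum_mono)
      fix i assume i: "i \<in> {..<m}"
      then obtain l where l: "l < n" "\<bar>(G ^^ l) (s i) - (G ^^ l) (s (Suc i))\<bar> > \<sigma>" using s(2)
          unfolding Rel_def by auto
      have "l \<le> j" using tail[of "s i" "s (Suc i)" l] s(1) i l by force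
      then have "\<bar>(G ^^ l) (s (Suc i)) - (G ^^ l) (s i)\<bar> \<le> (\<Sum>l\<le>j. \<bar>(G ^^ l) (s (Suc i))
          - (G ^^ l) (s i)\<bar>)"
        by (intro member_le_sum) auto
      then show "\<sigma> \<le> (\<Sum>l\<le>j. \<bar>(G ^^ l) (s (Suc i)) - (G ^^ l) (s i)\<bar>)" using l by linarith
    qed
    also have "\<dots> = (\<Sum>l\<le>j. \<Sum>i<m. \<bar>(G ^^ l) (s (Suc i)) - (G ^^ l) (s i)\<bar>)" by (rule sum.swap)
    also have "\<dots> = (\<Sum>l\<le>j. \<bar>(G ^^ l) (s m) - (G ^^ l) (s 0)\<bar>)"
      using s(1) s0m mono inc by (intro sum.cong mono_between_chain) auto
    also have "\<dots> \<le> (\<Sum>l\<le>j. 1)" using s(1) le1 by (intro sum_mono) auto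
    also have "\<dots> \<le> real n + 1" using jn by simp
    finally have "real m * \<sigma> \<le> real n + 1" .
    then show False using m \<sigma> by (simp add: field_simps)
  qed auto
  show ?thesis
  proof (rule kraft_cover_colour[of A col m "ln (real m)" _ "\<lambda>_. 0"])
    fix c assume "c < m"
    show "kraft_cover (dyn_small G n \<sigma>) {t \<in> A. col t = c} (\<lambda>_. 0)"
    proof (rule kraft_cover_single)
      have "\<bar>(G ^^ i) a - (G ^^ i) b\<bar> \<le> \<sigma>" if ab: "a \<in> A" "b \<in> A" "col a = col b" "i < n" for a b i
      proof (cases a b rule: linorder_cases)
        case less
        then show ?thesis using col(2)[OF ab(1,2,3)] ab(4) unfolding Rel_def by (meson not_less)
      next
        case greater
        then show ?thesis using col(2)[OF ab(2,1)] ab(3,4) unfolding Rel_def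
          by (metis abs_minus_commute not_less)
      qed (use \<sigma> in auto)
      then show "dyn_small G n \<sigma> {t \<in> A. col t = c}" unfolding dyn_small_def by blast
    qed simp
  qed (use col m in \<open>auto simp: m_def\<close>)
qed

text \<open>The letter 0 stands for a shallow point and has length \<open>gam\<close>; a level
  \<open>m\<close> has length \<open>gam * real m\<close>. Since \<open>M \<ge> 1\<close>, no level
  is confused with the letter 0.\<close>

lemma kraft_sum: "(\<Sum>m\<in>insert 0 {M..K}. exp (- gam * real m) * (if m = 0 then exp (- gam) else 1))
    \<le> 1"
proof -
  define x where "x = exp (- gam)"
  have x: "0 < x" "x < 1" using gam unfolding x_def by auto
  have e: "exp (- gam * real m) = x ^ m" for m unfolding x_def
      by (simp flip: exp_of_nat_mult add: mult.commute)
  have "(\<Sum>m\<in>{M..K}. x ^ m) \<le> x ^ M / (1 - x)"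
  proof (cases "M \<le> K")
    case True
    have "(\<Sum>m\<in>{M..K}. x ^ m) = (x ^ M - x ^ Suc K) / (1 - x)"
      using x True by (subst sum_gp) auto
    also have "\<dots> \<le> x ^ M / (1 - x)" using x by (intro divide_right_mono) auto
    finally show ?thesis .
  qed (use x in auto)
  moreover have "(\<Sum>m\<in>{M..K}. exp (- gam * real m) * (if m = 0 then exp (- gam) else 1))
      = (\<Sum>m\<in>{M..K}. x ^ m)"
    using M by (intro sum.cong) (auto simp: e[symmetric])
  moreover have "0 \<notin> {M..K}" using M by auto
  ultimately show ?thesis using kraft e[of M] unfolding x_def[symmetric] by (simp add: e)
qed

text \<open>Shortness of the branch, the small derivative on it and the general growth bound
  multiply to the exponent \<open>gain m\<close>, for all later times simultaneously.\<close>

lemma visit_shrink: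
  assumes "a \<in> S" "b \<in> S" "x \<ge> 0" "\<bar>a - b\<bar> \<le> \<epsilon> * exp (- x) * exp (- real m / (r - 1))"
    and "\<And>c. min a b \<le> c \<Longrightarrow> c \<le> max a b \<Longrightarrow> \<bar>u c\<bar> \<le> CA * exp (- real m)"
  shows "\<bar>(G ^^ Suc i) a - (G ^^ Suc i) b\<bar> \<le> \<epsilon> * exp (- (x + gain m) + R * real i)"
proof -
  have g: "\<bar>G a - G b\<bar> \<le> (CA * exp (- real m)) * \<bar>a - b\<bar>" using G_bound[OF assms(1,2)] assms(5)
      by blast
  have "\<bar>(G ^^ Suc i) a - (G ^^ Suc i) b\<bar> = \<bar>(G ^^ i) (G a) - (G ^^ i) (G b)\<bar>"
      by (simp add: funpow_swap1)
  also have "\<dots> \<le> C0 * exp (R * real i) * \<bar>G a - G b\<bar>" using growth GS assms by auto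
  also have "\<dots> \<le> C0 * exp (R * real i) * ((CA * exp (- real m)) * \<bar>a - b\<bar>)"
    using g C0 by (intro mult_left_mono) auto
  also have "\<dots> \<le> C0 * exp (R * real i) * ((CA * exp (- real m))
      * (\<epsilon> * exp (- x) * exp (- real m / (r - 1))))"
    using assms(4) C0 CA by (intro mult_left_mono) auto
  also have "\<dots> = \<epsilon> * ((CA * C0) * (exp (R * real i) * exp (- real m) * exp (- x)
      * exp (- real m / (r - 1))))" by simp
  also have "CA * C0 = exp dcon" using CA C0 unfolding dcon_def by (subst exp_ln) auto
  also have "exp dcon * (exp (R * real i) * exp (- real m) * exp (- x) * exp (- real m / (r - 1)))
      = exp (dcon + (R * real i - real m - x - real m / (r - 1)))" by
          (simp add: exp_add exp_diff exp_minus field_simps)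
  also have "dcon + (R * real i - real m - x - real m / (r - 1)) = - (x + gain m) + R * real i"
    using r unfolding gain_def by (simp add: field_simps)
  finally show ?thesis .
qed

lemma pow_Suc_split: "(G ^^ (Suc j + i)) a = (G ^^ Suc i) ((G ^^ j) a)"
  by (metis add_Suc_shift add.commute comp_apply funpow_add)

text \<open>A step that is not deep uses up \<open>R\<close> of the potential or, without potential,
  one step of the block.\<close>

lemma state_next:
  assumes st: "state j x q A" and A': "A' \<subseteq> A" and x: "x \<ge> 0" and q: "x = 0 \<Longrightarrow> q \<ge> 1"
    and close: "\<And>a b. a \<in> A \<Longrightarrow> b \<in> A \<Longrightarrow> \<bar>(G ^^ j) a - (G ^^ j) b\<bar> \<le> \<epsilon> * exp (- x)"
    and nz: "\<And>a b c. a \<in> A' \<Longrightarrow> b \<in> A' \<Longrightarrow> min ((G ^^ j) a) ((G ^^ j) b) \<le> c \<Longrightarrow>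
        c \<le> max ((G ^^ j) a) ((G ^^ j) b) \<Longrightarrow> u c \<noteq> 0"
  shows "state (Suc j) (max 0 (x - R)) (if x = 0 then q - 1 else 0) A'"
proof -
  have AS: "A \<subseteq> S" using st unfolding state_def by auto
  have one: "\<bar>(G ^^ Suc j) a - (G ^^ Suc j) b\<bar> \<le> 1" if ab: "a \<in> A" "b \<in> A" for a b
  proof (cases "x = 0")
    case True
    have "\<bar>(G ^^ Suc j) a - (G ^^ Suc j) b\<bar> \<le> L * \<bar>(G ^^ j) a - (G ^^ j) b\<bar>"
      using lip[of "(G ^^ j) a" "(G ^^ j) b"] GnS AS ab by auto
    also have "\<dots> \<le> 1"
    proof (cases "L \<ge> 0")
      case True
      then have "L * \<bar>(G ^^ j) a - (G ^^ j) b\<bar> \<le> L * \<epsilon>"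
        using close[OF ab] \<open>x = 0\<close> by (intro mult_left_mono) auto
      then show ?thesis using \<epsilon> by linarith
    next
      case False
      then have "L * \<bar>(G ^^ j) a - (G ^^ j) b\<bar> \<le> 0" by (intro mult_nonpos_nonneg) auto
      then show ?thesis by linarith
    qed
    finally show ?thesis .
  next
    case False
    then have "\<bar>(G ^^ (j + 1)) a - (G ^^ (j + 1)) b\<bar> \<le> \<epsilon> * exp (- x + R * real 1)"
      using st x ab unfolding state_def by (metis less_le)
    also have "\<dots> \<le> \<epsilon> * exp R" using x \<epsilon> by (intro mult_left_mono) auto
    finally show ?thesis using \<epsilon> by simp
  qed
  show ?thesis unfolding state_def
  proof (intro conjI ballI allI impI)
    show "A' \<subseteq> S" using A' AS by auto
    fix a b assume ab: "a \<in> A'" "b \<in> A'"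
    then have abA: "a \<in> A" "b \<in> A" using A' by auto
    { fix i assume "a < b" "i \<le> Suc j"
      then show "mono_between (G ^^ i) a b"
      proof (cases "i = Suc j")
        case True
        have "mono_between (G ^^ j) a b" using st abA \<open>a < b\<close> unfolding state_def by blast
        then show ?thesis unfolding True using nz[OF ab] abA AS \<open>a < b\<close> by (intro mono_step) auto
      next
        case False
        then show ?thesis using st abA \<open>a < b\<close> \<open>i \<le> Suc j\<close> unfolding state_def
            by (simp add: le_Suc_eq)
      qed }
    { fix i assume "i \<le> Suc j"
      then show "\<bar>(G ^^ i) a - (G ^^ i) b\<bar> \<le> 1"
        using one[OF abA] st abA unfolding state_def
          by (cases "i = Suc j") (simp_all add: le_Suc_eq del: funpow.simps) }
    { fix i assume "0 < max 0 (x - R)"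
      then have x': "x > 0" "max 0 (x - R) = x - R" using R by auto
      then have "\<bar>(G ^^ (j + Suc i)) a - (G ^^ (j + Suc i)) b\<bar> \<le> \<epsilon> * exp (- x + R * real (Suc i))"
        using st abA unfolding state_def by blast
      then show "\<bar>(G ^^ (Suc j + i)) a - (G ^^ (Suc j + i)) b\<bar>
          \<le> \<epsilon> * exp (- max 0 (x - R) + R * real i)"
        using x' by (simp add: algebra_simps del: funpow.simps) }
    { fix i assume i: "i < (if x = 0 then q - 1 else 0)"
        "\<bar>(G ^^ (Suc j + i)) a - (G ^^ (Suc j + i)) b\<bar> \<le> 1"
      then have "x = 0" "Suc i < q" by (auto split: if_splits)
      then have "\<bar>(G ^^ (j + Suc i)) a - (G ^^ (j + Suc i)) b\<bar> \<le> 1 \<longrightarrow>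
          \<bar>(G ^^ (j + Suc i)) a - (G ^^ (j + Suc i)) b\<bar> \<le> \<epsilon>"
        using st abA unfolding state_def by blast
      then show "\<bar>(G ^^ (Suc j + i)) a - (G ^^ (Suc j + i)) b\<bar> \<le> \<epsilon>" using i
          by (simp del: funpow.simps) }
  qed
qed

text \<open>Because of \<open>g > R\<close> the new potential is positive, so the clause of
  \<open>state\<close> on blocks is void and the block can be given up
  (\<open>q = 0\<close>).\<close>

lemma state_deep:
  assumes st: "state j x q A" and A': "A' \<subseteq> A" and x: "x \<ge> 0" and g: "g > R"
    and shr: "\<And>a b i. a \<in> A' \<Longrightarrow> b \<in> A' \<Longrightarrow> \<bar>(G ^^ Suc i) ((G ^^ j) a) - (G ^^ Suc i) ((G ^^ j) b)\<bar>
        \<le> \<epsilon> * exp (- (x + g) + R * real i)"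
    and nz: "\<And>a b c. a \<in> A' \<Longrightarrow> b \<in> A' \<Longrightarrow> min ((G ^^ j) a) ((G ^^ j) b) \<le> c \<Longrightarrow>
        c \<le> max ((G ^^ j) a) ((G ^^ j) b) \<Longrightarrow> u c \<noteq> 0"
  shows "state (Suc j) (x + g - R) 0 A'"
proof -
  have AS: "A \<subseteq> S" using st unfolding state_def by auto
  have shr': "\<bar>(G ^^ (Suc j + i)) a - (G ^^ (Suc j + i)) b\<bar> \<le> \<epsilon> * exp (- (x + g) + R * real i)"
      if "a \<in> A'" "b \<in> A'" for a b i
    using shr[OF that, of i] by (simp only: pow_Suc_split)
  show ?thesis unfolding state_def
  proof (intro conjI ballI allI impI)
    show "A' \<subseteq> S" using A' AS by auto
    fix a b assume ab: "a \<in> A'" "b \<in> A'"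
    then have abA: "a \<in> A" "b \<in> A" using A' by auto
    { fix i assume "a < b" "i \<le> Suc j"
      then show "mono_between (G ^^ i) a b"
      proof (cases "i = Suc j")
        case True
        have "mono_between (G ^^ j) a b" using st abA \<open>a < b\<close> unfolding state_def by blast
        then show ?thesis unfolding True using nz[OF ab] abA AS \<open>a < b\<close> by (intro mono_step) auto
      next
        case False
        then show ?thesis using st abA \<open>a < b\<close> \<open>i \<le> Suc j\<close> unfolding state_def
            by (simp add: le_Suc_eq)
      qed }
    { fix i assume i: "i \<le> Suc j"
      show "\<bar>(G ^^ i) a - (G ^^ i) b\<bar> \<le> 1"
      proof (cases "i = Suc j")
        case True
        have "\<epsilon> * exp (- (x + g)) \<le> 1 * 1" using \<epsilon> x g R by (intro mult_mono) auto
        then show ?thesis using shr'[OF ab, of 0] True by (simp del: funpow.simps)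
      next
        case False
        then show ?thesis using st abA i unfolding state_def by (simp add: le_Suc_eq)
      qed }
    { fix i assume "0 < x + g - R"
      have "\<epsilon> * exp (- (x + g) + R * real i) \<le> \<epsilon> * exp (- (x + g - R) + R * real i)" using \<epsilon> R
          by simp
      then show "\<bar>(G ^^ (Suc j + i)) a - (G ^^ (Suc j + i)) b\<bar>
          \<le> \<epsilon> * exp (- (x + g - R) + R * real i)"
        using shr'[OF ab, of i] by linarith }
    { fix i assume "i < (0::nat)" then show "\<bar>(G ^^ (Suc j + i)) a - (G ^^ (Suc j + i)) b\<bar> \<le> \<epsilon>"
        by simp }
  qed
qed

text \<open>\<open>cap\<close> is the least level from \<open>M'\<close> on whose gain reaches
  \<open>lim_pot \<sigma> k - x\<close>; neighbouring levels differ in gain by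
  \<open>r / (r - 1)\<close>.\<close>

lemma cap_gain:
  shows "lim_pot \<sigma> k - x \<le> gain (cap \<sigma> k x)"
    and "M' \<le> m \<Longrightarrow> m < cap \<sigma> k x \<Longrightarrow> gain m < lim_pot \<sigma> k - x"
    and "cap \<sigma> k x = M' \<or> gain (cap \<sigma> k x) \<le> lim_pot \<sigma> k - x + r / (r - 1)"
proof -
  define y where "y = (lim_pot \<sigma> k - x + dcon) * ((r - 1) / r)"
  have rr: "r / (r - 1) > 0" "(r - 1) / r * (r / (r - 1)) = 1" using r by auto
  have yr: "y * (r / (r - 1)) = lim_pot \<sigma> k - x + dcon"
    unfolding y_def mult.assoc using rr(2) by simp
  have "y \<le> real (cap \<sigma> k x)" unfolding cap_def y_def[symmetric]
    using real_nat_ceiling_ge[of y] by (auto simp: max_def not_le)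
  then have "y * (r / (r - 1)) \<le> real (cap \<sigma> k x) * (r / (r - 1))" using rr
      by (intro mult_right_mono) auto
  then show "lim_pot \<sigma> k - x \<le> gain (cap \<sigma> k x)" using yr unfolding gain_def by linarith
  show "gain m < lim_pot \<sigma> k - x" if "M' \<le> m" "m < cap \<sigma> k x"
  proof -
    have "m < nat \<lceil>y\<rceil>" using that unfolding cap_def y_def[symmetric] by auto
    then have "real m < y" by linarith
    then have "real m * (r / (r - 1)) < y * (r / (r - 1))" using rr
        by (intro mult_strict_right_mono) auto
    then show ?thesis using yr unfolding gain_def by linarith
  qed
  show "cap \<sigma> k x = M' \<or> gain (cap \<sigma> k x) \<le> lim_pot \<sigma> k - x + r / (r - 1)"
  proof (cases "cap \<sigma> k x = M'")
    case False
    then have c: "cap \<sigma> k x = nat \<lceil>y\<rceil>" "nat \<lceil>y\<rceil> > M'"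
      unfolding cap_def y_def[symmetric] by (auto simp: max_def split: if_splits)
    then have "nat \<lceil>y\<rceil> > 0" by linarith
    note c(1) this
    then have "real (cap \<sigma> k x) \<le> y + 1" using c(1) by linarith
    then have "real (cap \<sigma> k x) * (r / (r - 1)) \<le> (y + 1) * (r / (r - 1))" using rr
        by (intro mult_right_mono) auto
    also have "\<dots> = y * (r / (r - 1)) + r / (r - 1)" by (simp only: distrib_right mult_1_left)
    finally show ?thesis using yr unfolding gain_def by linarith
  qed simp
qed

lemma letter_colouring:
  assumes w: "0 < w" "w \<le> 1" and D: "D \<subseteq> S" "\<And>s t. s \<in> D \<Longrightarrow> t \<in> D \<Longrightarrow> \<bar>s - t\<bar> \<le> w"
    and lu: "\<And>s. s \<in> D \<Longrightarrow> \<bar>u s\<bar> \<le> exp (- real m)"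
  obtains col :: "real \<Rightarrow> nat" and K :: nat where "real K \<le> exp (ln CA + real m / (r - 1))"
    "\<And>t. t \<in> D \<Longrightarrow> col t < K"
    "\<And>s t. s \<in> D \<Longrightarrow> t \<in> D \<Longrightarrow> col s = col t \<Longrightarrow> \<bar>s - t\<bar> \<le> w * exp (- real m / (r - 1))"
    "\<And>s t c. s \<in> D \<Longrightarrow> t \<in> D \<Longrightarrow> col s = col t \<Longrightarrow> min s t \<le> c \<Longrightarrow> c \<le> max s t \<Longrightarrow>
        \<bar>u c\<bar> \<le> CA * exp (- real m)"
    "\<And>s t c. s \<in> D \<Longrightarrow> t \<in> D \<Longrightarrow> col s = col t \<Longrightarrow> \<bar>u s\<bar> > exp (- real m - 1) \<Longrightarrow>
        \<bar>u t\<bar> > exp (- real m - 1) \<Longrightarrow>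
       min s t \<le> c \<Longrightarrow> c \<le> max s t \<Longrightarrow> u c \<noteq> 0"
proof (cases "D = {}")
  case True
  show ?thesis by (rule that[of 0 "\<lambda>_. 0"]) (use True in auto)
next
  case False
  \<comment> \<open>The window of length \<open>w\<close> that starts at the infimum of
    \<open>D\<close> contains all of \<open>D\<close>.\<close>
  define x0 where "x0 = Inf D"
  have bb: "bdd_below D"
  proof -
    obtain d where "d \<in> D" using False by auto
    then have "\<And>s. s \<in> D \<Longrightarrow> d - w \<le> s" using D(2) by (smt (verit))
    then show ?thesis by (rule bdd_belowI)
  qed
  have win: "t \<in> S \<inter> {x0..x0+w}" if "t \<in> D" for t
  proof -
    have "x0 \<le> t" unfolding x0_def by (rule cInf_lower[OF that bb])
    moreover have "t - w \<le> x0" unfolding x0_def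
      by (rule cInf_greatest[OF False]) (use D(2)[OF that] in \<open>smt (verit)\<close>)
    ultimately show ?thesis using D(1) that by auto
  qed
  obtain col where c1: "\<forall>t\<in>{x0..x0+w}. real (col t) + 1 \<le> CA * exp (real m / (r - 1))"
    and c2: "\<forall>s\<in>S \<inter> {x0..x0+w}. \<forall>t\<in>S \<inter> {x0..x0+w}. s < t \<longrightarrow> col s = col t \<longrightarrow>
         t - s \<le> w * exp (- real m / (r - 1)) \<and>
         (\<bar>u s\<bar> \<le> exp (- real m) \<longrightarrow> \<bar>u t\<bar> \<le> exp (- real m) \<longrightarrow> (\<forall>c\<in>{s..t}. \<bar>u c\<bar> \<le> CA * exp (- real
             m))) \<and>
         (\<bar>u s\<bar> > exp (- real m - 1) \<longrightarrow> \<bar>u t\<bar> > exp (- real m - 1) \<longrightarrow> (\<forall>c\<in>{s..t}. u c \<noteq> 0))"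
    using split[OF w, of x0 m] by blast
  define K where "K = nat \<lfloor>CA * exp (real m / (r - 1))\<rfloor>"
  have eK: "exp (ln CA + real m / (r - 1)) = CA * exp (real m / (r - 1))" using CA
      by (simp add: exp_add)
  show ?thesis
  proof (rule that[of K col])
    show "real K \<le> exp (ln CA + real m / (r - 1))" unfolding eK K_def using CA by simp
    show "col t < K" if "t \<in> D" for t
    proof -
      have "real (col t) + 1 \<le> CA * exp (real m / (r - 1))" using c1 win[OF that] by auto
      then show ?thesis unfolding K_def by (simp add: le_nat_floor less_eq_Suc_le)
    qed
    fix s t assume st: "s \<in> D" "t \<in> D" "col s = col t"
    have lt: "t' - s' \<le> w * exp (- real m / (r - 1)) \<and> (\<forall>c\<in>{s'..t'}. \<bar>u c\<bar> \<le> CA * exp (- real m)) \<and>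
       (\<bar>u s'\<bar> > exp (- real m - 1) \<longrightarrow> \<bar>u t'\<bar> > exp (- real m - 1) \<longrightarrow> (\<forall>c\<in>{s'..t'}. u c \<noteq> 0))"
      if "s' \<in> D" "t' \<in> D" "s' < t'" "col s' = col t'" for s' t'
      using c2 win[OF that(1)] win[OF that(2)] that(3,4) lu[OF that(1)] lu[OF that(2)] by blast
    have w0: "0 \<le> w * exp (- real m / (r - 1))" using w by simp
    show "\<bar>s - t\<bar> \<le> w * exp (- real m / (r - 1))"
      using lt[of s t] lt[of t s] st w0 by (cases s t rule: linorder_cases) auto
    fix c assume c: "min s t \<le> c" "c \<le> max s t"
    have "exp (- real m) \<le> CA * exp (- real m)" using CA by simp
    then have "\<bar>u s\<bar> \<le> CA * exp (- real m)" using lu[OF st(1)] by linarith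
    then show "\<bar>u c\<bar> \<le> CA * exp (- real m)"
      using lt[of s t] lt[of t s] st c
        by (cases s t rule: linorder_cases) (auto simp del: mult_le_cancel_right1)
    show "u c \<noteq> 0" if "\<bar>u s\<bar> > exp (- real m - 1)" "\<bar>u t\<bar> > exp (- real m - 1)"
    proof (cases s t rule: linorder_cases)
      case equal
      then have "c = s" using c by auto
      moreover have "0 < exp (- real m - 1)" by simp
      ultimately show ?thesis using that(1) by auto
    qed (use lt[of s t] lt[of t s] st c that in auto)
  qed
qed

text \<open>What remains of \<open>cost\<close> once a block, if due, has been paid for.\<close>

definition step_cost :: "real \<Rightarrow> real \<Rightarrow> nat \<Rightarrow> real \<Rightarrow> nat \<Rightarrow> real \<Rightarrow> real" where
  "step_cost \<sigma> V k x q t =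
    (if \<bar>u t\<bar> > exp (- real M) then gam + cost \<sigma> V k (max 0 (x - R)) (if x = 0 then q - 1 else 0)
        (G t)
     else if \<bar>u t\<bar> > exp (- real M') then vcost (lev t) + cost \<sigma> V k (max 0 (x - R)) (if x = 0
         then q - 1 else 0) (G t)
     else if \<bar>u t\<bar> \<le> exp (- real (cap \<sigma> (Suc k) x)) then vcost (cap \<sigma> (Suc k) x) + V
     else vcost (lev t) + cost \<sigma> V k (x + gain (lev t) - R) 0 (G t))"

lemma cost_step:
  "cost \<sigma> V (Suc k) x q t = (if x = 0 \<and> q = 0 then real N * H else 0)
      + step_cost \<sigma> V k x (if q = 0 then N else q) t"
  unfolding step_cost_def cost.simps Let_def by simp

section \<open>The code for orbit segments\<close>

text \<open>Code words are built along the orbit, by induction on the number of steps left: a name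
  from the spanning set when a block begins, a letter for the size of the derivative, and for a
  small derivative the colour of a branch. Sets with the same word so far satisfy
  \<open>state\<close>. A visit at the cap ends the coding, and so does the end of time; in both
  cases \<open>final_cover\<close> provides the rest at the price \<open>V\<close>.\<close>

theorem main_cover:
  assumes \<sigma>: "0 < \<sigma>" "\<sigma> < \<epsilon>" and V: "V = ln (real (lap_count n \<sigma>))"
  shows "state j x q A \<Longrightarrow> j + k = n \<Longrightarrow> 0 \<le> x \<Longrightarrow> x < lim_pot \<sigma> k \<Longrightarrow> q \<le> N \<Longrightarrow>
    kraft_cover (dyn_small G n \<sigma>) A (\<lambda>t. cost \<sigma> V k x q ((G ^^ j) t))"
proof (induction k arbitrary: j x q A)
  case 0
  have "kraft_cover (dyn_small G n \<sigma>) A (\<lambda>_. ln (real (lap_count n \<sigma>)))"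
    by (rule final_cover[of A j]) (use 0 \<sigma> in \<open>auto simp: state_def\<close>)
  then show ?case using V by simp
next
  case (Suc k)
  have lp0: "lim_pot \<sigma> k > 0"
    using \<sigma> R \<epsilon> unfolding lim_pot_def by (intro add_nonneg_pos) auto
  have lpS: "lim_pot \<sigma> (Suc k) = lim_pot \<sigma> k + R" unfolding lim_pot_def by (simp add: algebra_simps)
  \<comment> \<open>One step after a due block has been paid for, so for \<open>x = 0\<close> at
    least one step of the block is left.\<close>
  have main: "kraft_cover (dyn_small G n \<sigma>) A (\<lambda>t. step_cost \<sigma> V k x q ((G ^^ j) t))"
    if st: "state j x q A" and q1: "x = 0 \<Longrightarrow> q \<ge> 1" "q \<le> N" for q A
  proof -
    have AS: "A \<subseteq> S" using st unfolding state_def by auto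
    have close: "\<bar>(G ^^ j) a - (G ^^ j) b\<bar> \<le> \<epsilon> * exp (- x)" if "a \<in> A" "b \<in> A" for a b
    proof (cases "x = 0")
      case True
      then have "\<bar>(G ^^ (j + 0)) a - (G ^^ (j + 0)) b\<bar> \<le> 1 \<longrightarrow>
          \<bar>(G ^^ (j + 0)) a - (G ^^ (j + 0)) b\<bar> \<le> \<epsilon>"
        using st that q1 unfolding state_def by (metis less_eq_Suc_le One_nat_def)
      moreover have "\<bar>(G ^^ j) a - (G ^^ j) b\<bar> \<le> 1" using st that unfolding state_def by blast
      ultimately show ?thesis using True by simp
    next
      case False
      then have "\<bar>(G ^^ (j + 0)) a - (G ^^ (j + 0)) b\<bar> \<le> \<epsilon> * exp (- x + R * real 0)"
        using st that Suc.prems(3) unfolding state_def by (metis less_le)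
      then show ?thesis by simp
    qed
    define w where "w = \<epsilon> * exp (- x)"
    have "w \<le> 1 * 1" unfolding w_def using \<epsilon> Suc.prems(3) by (intro mult_mono) auto
    then have w: "0 < w" "w \<le> 1" using \<epsilon> unfolding w_def by auto
    define cp where "cp = cap \<sigma> (Suc k) x"
    have cpM: "M' \<le> cp" unfolding cp_def cap_def by auto
    \<comment> \<open>The letter: 0 for a shallow point, otherwise the level, where all levels from
      the cap on share the letter \<open>cp\<close>. This leaves finitely many letters, and it also
      covers zeros of \<open>u\<close>, which have no level.\<close>
    define f where "f = (\<lambda>t. let s = (G ^^ j) t in if \<bar>u s\<bar> > exp (- real M) then 0 else if \<bar>u s\<bar>
        \<le> exp (- real cp) then cp else lev s)"
    define p where "p = (\<lambda>m. exp (- gam * real m) * (if m = 0 then exp (- gam) else 1))"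
    define Mf where "Mf = (\<lambda>m t. step_cost \<sigma> V k x q ((G ^^ j) t)
        - (if m = 0 then gam else gam * real m))"
    have eM: "exp (- real m) \<le> 1" for m by simp
    have f0: "f t = 0 \<longleftrightarrow> \<bar>u ((G ^^ j) t)\<bar> > exp (- real M)"
     and fcp: "f t = cp \<longleftrightarrow> \<bar>u ((G ^^ j) t)\<bar> \<le> exp (- real cp)"
     and fmid: "f t = m \<and> m \<noteq> 0 \<and> m \<noteq> cp \<Longrightarrow> lev ((G ^^ j) t) = m \<and> M \<le> m \<and> m < cp \<and>
         exp (- real m - 1) < \<bar>u ((G ^^ j) t)\<bar> \<and> \<bar>u ((G ^^ j) t)\<bar> \<le> exp (- real m)"
     and fC: "f t \<in> insert 0 {M..cp}" for t m
    proof -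
      let ?s = "(G ^^ j) t"
      have cpb: "exp (- real cp) \<le> exp (- real M)" using cpM M by simp
      consider "\<bar>u ?s\<bar> > exp (- real M)" | "\<bar>u ?s\<bar> \<le> exp (- real cp)" | "\<bar>u ?s\<bar> \<le> exp (- real M)"
          "\<bar>u ?s\<bar> > exp (- real cp)"
        by linarith
      note cs = this
      have mid: "M \<le> lev ?s \<and> lev ?s < cp \<and> exp (- real (lev ?s) - 1) < \<bar>u ?s\<bar> \<and>
          \<bar>u ?s\<bar> \<le> exp (- real (lev ?s))"
        if "\<bar>u ?s\<bar> \<le> exp (- real M)" "\<bar>u ?s\<bar> > exp (- real cp)"
      proof -
        have b: "0 < \<bar>u ?s\<bar>" using that(2) by (meson exp_gt_zero less_trans)
        have b1: "\<bar>u ?s\<bar> \<le> 1" using that(1) eM[of M] by linarith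
        show ?thesis using lev_iff[OF b b1] lev_bounds[OF b b1] that by (meson not_less)
      qed
      have cp0: "cp \<noteq> 0" using cpM M by auto
      have fd: "f t = (if \<bar>u ?s\<bar> > exp (- real M) then 0 else if \<bar>u ?s\<bar>
          \<le> exp (- real cp) then cp else lev ?s)"
        unfolding f_def Let_def by simp
      show "f t = 0 \<longleftrightarrow> \<bar>u ?s\<bar> > exp (- real M)"
      proof (cases rule: cs)
        case 3
        then have "f t = lev ?s" "M \<le> lev ?s" using mid unfolding fd by simp_all
        then show ?thesis using 3 M by simp
      next
        case 2
        then have "\<not> \<bar>u ?s\<bar> > exp (- real M)" using cpb by linarith
        moreover from this 2 have "f t = cp" unfolding fd by simp
        ultimately have "f t = cp" "\<not> \<bar>u ?s\<bar> > exp (- real M)" by simp_all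
        then show ?thesis using cp0 by simp
      qed (simp add: fd)
      show "f t = cp \<longleftrightarrow> \<bar>u ?s\<bar> \<le> exp (- real cp)"
      proof (cases rule: cs)
        case 1
        then have "\<not> \<bar>u ?s\<bar> \<le> exp (- real cp)" using cpb by linarith
        moreover have "f t = 0" using 1 unfolding fd by simp
        ultimately have "f t = 0" "\<not> \<bar>u ?s\<bar> \<le> exp (- real cp)" by simp_all
        then show ?thesis using cp0 by simp
      next
        case 2
        then have "\<not> \<bar>u ?s\<bar> > exp (- real M)" using cpb by linarith
        with 2 have "f t = cp" unfolding fd by simp
        then show ?thesis using 2 by simp
      next
        case 3
        then have "f t = lev ?s" "lev ?s < cp" using mid unfolding fd by simp_all
        then show ?thesis using 3 by simp
      qed
      show "f t \<in> insert 0 {M..cp}"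
      proof (cases rule: cs)
        case 1
        then show ?thesis unfolding fd by simp
      next
        case 2
        then have "\<not> \<bar>u ?s\<bar> > exp (- real M)" using cpb by linarith
        with 2 have "f t = cp" unfolding fd by simp
        then show ?thesis using cpM M by simp
      next
        case 3
        then have "f t = lev ?s" "lev ?s < cp" "M \<le> lev ?s" using mid unfolding fd by simp_all
        then show ?thesis by simp
      qed
      show "f t = m \<and> m \<noteq> 0 \<and> m \<noteq> cp \<Longrightarrow> lev ?s = m \<and> M \<le> m \<and> m < cp \<and> exp (- real m - 1) < \<bar>u ?s\<bar> \<and>
          \<bar>u ?s\<bar> \<le> exp (- real m)"
        using mid unfolding fd by (auto split: if_splits)
    qed
    show ?thesis
    proof (rule kraft_cover_split[of "insert 0 {M..cp}" A f p _ Mf])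
      show "0 \<le> p c" for c by (simp add: p_def)
      show "(\<Sum>c\<in>insert 0 {M..cp}. p c) \<le> 1" unfolding p_def by (rule kraft_sum)
      show "exp (- step_cost \<sigma> V k x q ((G ^^ j) t)) \<le> p (f t) * exp (- Mf (f t) t)" for t
        unfolding p_def Mf_def by (simp flip: exp_add)
      fix c assume c: "c \<in> insert 0 {M..cp}"
      define D where "D = {t \<in> A. f t = c}"
      have DA: "D \<subseteq> A" unfolding D_def by auto
      show "kraft_cover (dyn_small G n \<sigma>) {t \<in> A. f t = c} (Mf c)" unfolding D_def[symmetric]
      proof (cases "c = 0")
        case True
        have st': "state (Suc j) (max 0 (x - R)) (if x = 0 then q - 1 else 0) D"
        proof (rule state_next[OF st DA Suc.prems(3) q1(1) close])
          fix a b c' assume ab: "a \<in> D" "b \<in> D" "min ((G ^^ j) a) ((G ^^ j) b) \<le> c'"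
              "c' \<le> max ((G ^^ j) a) ((G ^^ j) b)"
          have S2: "(G ^^ j) a \<in> S" "(G ^^ j) b \<in> S" using ab DA AS GnS by auto
          have "\<bar>(G ^^ j) a - (G ^^ j) b\<bar> \<le> w" using close ab DA unfolding w_def by auto
          also have "w \<le> \<epsilon> * 1" unfolding w_def using \<epsilon> Suc.prems(3) by (intro mult_left_mono) auto
          finally have "\<bar>(G ^^ j) a - (G ^^ j) b\<bar> \<le> \<epsilon>" by simp
          moreover have "\<bar>u ((G ^^ j) a)\<bar> > exp (- real M)" using ab(1) f0[of a] True
              unfolding D_def by auto
          ultimately show "u c' \<noteq> 0" using shallow[OF S2 between_S[OF S2 ab(3,4)]] ab by blast
        qed
        have "kraft_cover (dyn_small G n \<sigma>) D (\<lambda>t. cost \<sigma> V k (max 0 (x - R)) (if x = 0 then q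
            - 1 else 0) ((G ^^ Suc j) t))"
          by (rule Suc.IH[OF st']) (use Suc.prems lp0 lpS q1 in auto)
        then show "kraft_cover (dyn_small G n \<sigma>) D (Mf c)"
        proof (rule kraft_cover_mono)
          fix t assume "t \<in> D"
          then have "\<bar>u ((G ^^ j) t)\<bar> > exp (- real M)" using f0[of t] True unfolding D_def by auto
          then show "t \<in> D \<and> cost \<sigma> V k (max 0 (x - R)) (if x = 0 then q
              - 1 else 0) ((G ^^ Suc j) t) \<le> Mf c t"
            using True \<open>t \<in> D\<close> unfolding Mf_def step_cost_def by simp
        qed
      next
        case c0: False
        have cM: "M \<le> c" "c \<le> cp" using c c0 by auto
        have uc: "\<bar>u ((G ^^ j) t)\<bar> \<le> exp (- real c)" if "t \<in> D" for t
          using fcp[of t] fmid[of t c] that c0 unfolding D_def by (cases "c = cp") auto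
        define E where "E = (G ^^ j) ` D"
        have ES: "E \<subseteq> S" using DA AS GnS unfolding E_def by auto
        have Ew: "\<bar>s - t\<bar> \<le> w" if "s \<in> E" "t \<in> E" for s t
          using close DA that unfolding E_def w_def by auto
        have Eu: "\<bar>u s\<bar> \<le> exp (- real c)" if "s \<in> E" for s using uc that unfolding E_def by auto
        obtain col :: "real \<Rightarrow> nat" and K :: nat where K: "real K \<le> exp (ln CA + real c / (r - 1))"
          "\<And>t. t \<in> E \<Longrightarrow> col t < K"
          "\<And>s t. s \<in> E \<Longrightarrow> t \<in> E \<Longrightarrow> col s = col t \<Longrightarrow> \<bar>s - t\<bar> \<le> w * exp (- real c / (r - 1))"
          "\<And>s t c'. s \<in> E \<Longrightarrow> t \<in> E \<Longrightarrow> col s = col t \<Longrightarrow> min s t \<le> c' \<Longrightarrow> c' \<le> max s t \<Longrightarrow>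
              \<bar>u c'\<bar> \<le> CA * exp (- real c)"
          "\<And>s t c'. s \<in> E \<Longrightarrow> t \<in> E \<Longrightarrow> col s = col t \<Longrightarrow> \<bar>u s\<bar> > exp (- real c - 1) \<Longrightarrow>
              \<bar>u t\<bar> > exp (- real c - 1) \<Longrightarrow>
             min s t \<le> c' \<Longrightarrow> c' \<le> max s t \<Longrightarrow> u c' \<noteq> 0"
          by (rule letter_colouring[OF w ES Ew Eu]) (assumption | rule that)+
        \<comment> \<open>The price after letter and branch: the closing price for a terminal visit,
          a reduced potential for a medium one, an increased potential and no block for a deep
          one.\<close>
        define N0 where "N0 = (\<lambda>t. if c = cp then V else cost \<sigma> V k (if c
            < M' then max 0 (x - R) else x + gain c - R) (if c < M' \<and> x = 0 then q - 1 else 0) ((G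
            ^^ Suc j) t))"
        show "kraft_cover (dyn_small G n \<sigma>) D (Mf c)"
        proof (rule kraft_cover_colour[of D "\<lambda>t. col ((G ^^ j) t)" K "ln CA + real c / (r - 1)" _
            N0])
          show "col ((G ^^ j) t) < K" if "t \<in> D" for t using K(2) that unfolding E_def by auto
          show "real K \<le> exp (ln CA + real c / (r - 1))" by (rule K(1))
          show "ln CA + real c / (r - 1) + N0 t \<le> Mf c t" if t: "t \<in> D" for t
          proof (cases "c = cp")
            case True
            then have "\<bar>u ((G ^^ j) t)\<bar> \<le> exp (- real cp)" using uc[OF t] by simp
            moreover have "exp (- real cp) \<le> exp (- real M')" "exp (- real M') \<le> exp (- real M)"
                using cpM M by auto
            ultimately have "\<not> exp (- real M) < \<bar>u ((G ^^ j) t)\<bar>"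
                "\<not> exp (- real M') < \<bar>u ((G ^^ j) t)\<bar>" "\<bar>u ((G ^^ j) t)\<bar> \<le> exp (- real cp)"
              by linarith+
            then have "step_cost \<sigma> V k x q ((G ^^ j) t) = vcost cp + V"
              unfolding step_cost_def cp_def[symmetric] by auto
            then show ?thesis using True c0 unfolding N0_def Mf_def vcost_def by simp
          next
            case False
            then have b: "lev ((G ^^ j) t) = c" "exp (- real c - 1) < \<bar>u ((G ^^ j) t)\<bar>"
                "\<bar>u ((G ^^ j) t)\<bar> \<le> exp (- real c)" "c < cp"
              using fmid[of t c] t c0 unfolding D_def by auto
            have p0: "0 < \<bar>u ((G ^^ j) t)\<bar>" using b(2) by (meson exp_gt_zero less_trans)
            have p1: "\<bar>u ((G ^^ j) t)\<bar> \<le> 1" using b(3) eM[of c] by linarith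
            have n1: "\<not> \<bar>u ((G ^^ j) t)\<bar> > exp (- real M)" using lev_iff[OF p0 p1, of M] b(1) cM
                by simp
            have n2: "\<bar>u ((G ^^ j) t)\<bar> > exp (- real M') \<longleftrightarrow> c < M'"
                using lev_iff[OF p0 p1, of M'] b(1) by (simp only: not_le[symmetric])
            have n3: "\<not> \<bar>u ((G ^^ j) t)\<bar> \<le> exp (- real cp)" using lev_iff[OF p0 p1, of cp] b(1,4)
                by simp
            have "step_cost \<sigma> V k x q ((G ^^ j) t) = vcost c + N0 t"
            proof (cases "c < M'")
              case True
              then show ?thesis using n1 n2 False unfolding step_cost_def N0_def b(1) by simp
            next
              case c2: False
              then have "\<not> \<bar>u ((G ^^ j) t)\<bar> > exp (- real M')" using n2 by blast
              then show ?thesis using n1 n3 c2 False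
                  unfolding step_cost_def N0_def b(1) cp_def[symmetric] by simp
            qed
            then show ?thesis using c0 unfolding Mf_def vcost_def by simp
          qed
          fix l assume "l < K"
          define A' where "A' = {t \<in> D. col ((G ^^ j) t) = l}"
          have A'D: "A' \<subseteq> D" and A'A: "A' \<subseteq> A" using DA unfolding A'_def by auto
          have shr: "\<bar>(G ^^ Suc i) ((G ^^ j) a) - (G ^^ Suc i) ((G ^^ j) b)\<bar>
              \<le> \<epsilon> * exp (- (x + gain c) + R * real i)"
            if "a \<in> A'" "b \<in> A'" for a b i
          proof (rule visit_shrink)
            have E: "(G ^^ j) a \<in> E" "(G ^^ j) b \<in> E" "col ((G ^^ j) a) = col ((G ^^ j) b)"
                using that A'D unfolding A'_def E_def by auto
            show "(G ^^ j) a \<in> S" "(G ^^ j) b \<in> S" using E ES by auto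
            show "\<bar>(G ^^ j) a - (G ^^ j) b\<bar> \<le> \<epsilon> * exp (- x) * exp (- real c / (r - 1))"
              using K(3)[OF E] unfolding w_def .
            show "\<bar>u c'\<bar> \<le> CA * exp (- real c)"
                if "min ((G ^^ j) a) ((G ^^ j) b) \<le> c'" "c' \<le> max ((G ^^ j) a) ((G ^^ j) b)" for c'
              using K(4)[OF E] that by blast
          qed (use Suc.prems in auto)
          \<comment> \<open>For the letter \<open>cp\<close> the derivative has no positive lower
            bound, so the next iterate may fail to be monotone. In that case the argument uses
            instead that all later distances are at most \<sigma>.\<close>
          have nz: "u c' \<noteq> 0" if "a \<in> A'" "b \<in> A'" "min ((G ^^ j) a) ((G ^^ j) b) \<le> c'"
              "c' \<le> max ((G ^^ j) a) ((G ^^ j) b)" "c \<noteq> cp" for a b c'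
          proof (rule K(5)[OF _ _ _ _ _ that(3,4)])
            show "(G ^^ j) a \<in> E" "(G ^^ j) b \<in> E" "col ((G ^^ j) a) = col ((G ^^ j) b)"
                using that A'D unfolding A'_def E_def by auto
            show "exp (- real c - 1) < \<bar>u ((G ^^ j) a)\<bar>" "exp (- real c - 1) < \<bar>u ((G ^^ j) b)\<bar>"
              using fmid[of a c] fmid[of b c] that c0 unfolding A'_def D_def by auto
          qed
          have "kraft_cover (dyn_small G n \<sigma>) A' N0"
          proof (cases "c = cp")
            case True
            have "kraft_cover (dyn_small G n \<sigma>) A' (\<lambda>_. ln (real (lap_count n \<sigma>)))"
            proof (rule final_cover[of A' j])
              fix a b i assume ab: "a \<in> A'" "b \<in> A'"
              then have abA: "a \<in> A" "b \<in> A" using A'A by auto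
              { assume "a < b" "i \<le> j" then show "mono_between (G ^^ i) a b" using st abA
                  unfolding state_def by blast }
              { assume "i \<le> j" then show "\<bar>(G ^^ i) a - (G ^^ i) b\<bar> \<le> 1" using st abA
                  unfolding state_def by blast }
              assume i: "j < i" "i < n"
              define i' where "i' = i - j - 1"
              have i': "i = Suc j + i'" "i' \<le> k" using i Suc.prems(2) unfolding i'_def by auto
              have "\<bar>(G ^^ i) a - (G ^^ i) b\<bar> \<le> \<epsilon> * exp (- (x + gain c) + R * real i')"
                using shr[OF ab, of i'] unfolding i'(1) by (simp only: pow_Suc_split)
              also have "\<dots> \<le> \<epsilon> * exp (- ln (\<epsilon> / \<sigma>))"
              proof -
                have "R * real i' \<le> R * real k" using i' R by simp
                moreover have "lim_pot \<sigma> (Suc k) - x \<le> gain c"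
                    using cap_gain(1)[of \<sigma> "Suc k" x] True unfolding cp_def by simp
                moreover have "lim_pot \<sigma> (Suc k) \<ge> R * real k + ln (\<epsilon> / \<sigma>)" using R
                    unfolding lim_pot_def by (simp add: algebra_simps)
                ultimately have "- (x + gain c) + R * real i' \<le> - ln (\<epsilon> / \<sigma>)" by linarith
                then show ?thesis using \<epsilon> by simp
              qed
              also have "\<dots> = \<sigma>" using \<epsilon> \<sigma> by (simp add: exp_minus)
              finally show "\<bar>(G ^^ i) a - (G ^^ i) b\<bar> \<le> \<sigma>" .
            qed (use A'A AS Suc.prems(2) \<sigma> in auto)
            then show ?thesis using True V unfolding N0_def by simp
          next
            case False
            have ccp: "c < cp" using False cM by auto
            show ?thesis
            proof (cases "c < M'")
              case True
              have st': "state (Suc j) (max 0 (x - R)) (if x = 0 then q - 1 else 0) A'"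
                by (rule state_next[OF st A'A Suc.prems(3) q1(1) close]) (use nz False in blast)+
              have "kraft_cover (dyn_small G n \<sigma>) A' (\<lambda>t. cost \<sigma> V k (max 0 (x - R)) (if x
                  = 0 then q - 1 else 0) ((G ^^ Suc j) t))"
                by (rule Suc.IH[OF st']) (use Suc.prems lp0 lpS q1 in auto)
              then show ?thesis using True False unfolding N0_def by simp
            next
              case c2: False
              have g: "gain c < lim_pot \<sigma> (Suc k) - x" using cap_gain(2)[of c \<sigma> "Suc k" x] c2 ccp
                  unfolding cp_def by simp
              have gR: "gain c > R" using gainR[of c] c2 unfolding gain_def dcon_def by simp
              have st': "state (Suc j) (x + gain c - R) 0 A'"
                by (rule state_deep[OF st A'A Suc.prems(3) gR shr]) (use nz False in blast)+
              have "kraft_cover (dyn_small G n \<sigma>) A' (\<lambda>t. cost \<sigma> V k (x + gain c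
                  - R) 0 ((G ^^ Suc j) t))"
                by (rule Suc.IH[OF st']) (use Suc.prems lpS g gR in auto)
              then show ?thesis using c2 False unfolding N0_def by simp
            qed
          qed
          then show "kraft_cover (dyn_small G n \<sigma>) {t \<in> D. col ((G ^^ j) t) = l} N0"
              unfolding A'_def .
        qed
      qed
    qed (use fC in auto)
  qed
  show ?case
  proof (cases "x = 0 \<and> q = 0")
    case False
    have "kraft_cover (dyn_small G n \<sigma>) A (\<lambda>t. step_cost \<sigma> V k x q ((G ^^ j) t))"
      by (rule main) (use Suc.prems False in auto)
    moreover have "step_cost \<sigma> V k x (if q = 0 then N else q) t = step_cost \<sigma> V k x q t" for t
      using False unfolding step_cost_def by auto
    moreover have "cost \<sigma> V (Suc k) x q t = step_cost \<sigma> V k x (if q = 0 then N else q) t" for t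
      by (simp only: cost_step False if_False add_0)
    ultimately show ?thesis by simp
  next
    case True
    \<comment> \<open>A new block begins: the colour names a point of the spanning set, which keeps
      equally coloured points close for the next \<open>N\<close> steps.\<close>
    show ?thesis
    proof (rule kraft_cover_colour[of A "\<lambda>t. ycol ((G ^^ j) t)" NY "real N * H" _
        "\<lambda>t. step_cost \<sigma> V k x N ((G ^^ j) t)"])
      have AS: "A \<subseteq> S" using Suc.prems(1) unfolding state_def by auto
      then show "ycol ((G ^^ j) t) < NY" if "t \<in> A" for t using span1 GnS that by auto
      show "real N * H + step_cost \<sigma> V k x N ((G ^^ j) t) \<le> cost \<sigma> V (Suc k) x q ((G ^^ j) t)" for t
        unfolding cost_step using True by simp
      fix c assume "c < NY"
      have "state j x N {t \<in> A. ycol ((G ^^ j) t) = c}"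
      proof -
        have "\<bar>(G ^^ (j + i)) a - (G ^^ (j + i)) b\<bar> \<le> \<epsilon>"
          if "a \<in> A" "b \<in> A" "ycol ((G ^^ j) a) = ycol ((G ^^ j) b)" "i < N"
              "\<bar>(G ^^ (j + i)) a - (G ^^ (j + i)) b\<bar> \<le> 1" for a b i
        proof -
          have e: "(G ^^ (j + i)) y = (G ^^ i) ((G ^^ j) y)" for y
              by (metis add.commute comp_apply funpow_add)
          show ?thesis using span2[of "(G ^^ j) a" "(G ^^ j) b" i] that AS GnS unfolding e by auto
        qed
        then show ?thesis using Suc.prems(1) True unfolding state_def by simp (use AS in auto)
      qed
      then show "kraft_cover (dyn_small G n \<sigma>) {t \<in> A. ycol ((G ^^ j) t)
          = c} (\<lambda>t. step_cost \<sigma> V k x N ((G ^^ j) t))"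
        by (rule main) (use N in auto)
    qed (use N in auto)
  qed
qed

section \<open>Bounds for the length of a code word\<close>

lemma M'_gain_pos: "0 < gain M'"
  using gainR[of M'] R unfolding gain_def dcon_def by simp

text \<open>By \<open>deep\<close> a terminal visit costs at most \<kappa> times its gain. At the
  cap the gain exceeds the potential that is still missing by at most one level, unless the cap is
  \<open>M'\<close>; in either case the excess is a constant. \<open>D\<close> is room for the price
  of an interrupted block.\<close>

lemma terminal_bound:
  assumes \<sigma>: "0 < \<sigma>" "\<sigma> < \<epsilon>" and deep: "\<And>m. M' \<le> m \<Longrightarrow> vcost m + D \<le> \<kappa> * gain m"
    and x: "x < lim_pot \<sigma> k"
  shows "vcost (cap \<sigma> k x) + D \<le> \<kappa> * (R * real k - x) + \<kappa> * (ln (\<epsilon> / \<sigma>) + r / (r - 1) + gain M')"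
proof -
  have c: "M' \<le> cap \<sigma> k x" unfolding cap_def by auto
  have "r / (r - 1) > 0" using r by auto
  moreover have "lim_pot \<sigma> k - x = R * real k - x + ln (\<epsilon> / \<sigma>)" unfolding lim_pot_def by simp
  ultimately have "gain (cap \<sigma> k x) \<le> (R * real k - x) + (ln (\<epsilon> / \<sigma>) + r / (r - 1) + gain M')"
    using cap_gain(3)[of \<sigma> k x] M'_gain_pos x by auto
  then have "\<kappa> * gain (cap \<sigma> k x) \<le> \<kappa> * ((R * real k - x) + (ln (\<epsilon> / \<sigma>) + r / (r - 1) + gain M'))"
    using \<kappa> by (intro mult_left_mono) auto
  then show ?thesis using deep[OF c] by (simp add: distrib_left)
qed

text \<open>\<open>T\<close> is the time spent in recovery, where all steps from a terminal visit at
  time \<open>i\<close> on are counted as recovery. Visits pay \<kappa> per unit of potential and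
  recovery burns \<open>R\<close> per step, so recovery costs \<open>\<kappa> * R\<close> per step
  and the other time \<open>H\<close> per step. Potential is burnt or left over, and at most
  \<open>ln (\<epsilon> / \<sigma>)\<close> can be left at the end; this bounds \<open>T\<close>
  from below. The term with \<open>real q * H\<close> is the paid rest of a block, and the summand
  \<open>real N * H\<close> in \<open>deep\<close> lets a visit pay for the block that it
  interrupts.\<close>

lemma cost_bound_recovery:
  assumes \<sigma>: "0 < \<sigma>" "\<sigma> < \<epsilon>" and V: "V \<ge> 0"
    and deep: "\<And>m. M' \<le> m \<Longrightarrow> vcost m + real N * H \<le> \<kappa> * gain m"
    and med: "\<And>t. 0 \<le> med t" "\<And>t. exp (- real M') < \<bar>u t\<bar> \<Longrightarrow> \<bar>u t\<bar> \<le> exp (- real M) \<Longrightarrow>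
        vcost (lev t) \<le> med t"
    and \<phi>: "\<And>t. exp (- real M') < \<bar>u t\<bar> \<Longrightarrow> \<phi> t \<le> 0" "\<And>t. 0 < \<bar>u t\<bar> \<Longrightarrow> \<bar>u t\<bar> \<le> exp (- real M') \<Longrightarrow>
        \<phi> t \<le> gain (lev t)"
  defines "c1 \<equiv> ln (\<epsilon> / \<sigma>)"
  defines "c2 \<equiv> V + \<kappa> * (c1 + r / (r - 1) + gain M')"
  shows "0 \<le> x \<Longrightarrow> x < lim_pot \<sigma> k \<Longrightarrow> q \<le> N \<Longrightarrow> \<exists>i T. i \<le> k \<and> real (k - i) \<le> T \<and> T \<le> real k \<and>
     x + (\<Sum>l<i. \<phi> ((G ^^ l) t)) - c1 \<le> R * T \<and>
     cost \<sigma> V k x q t \<le> H * (real k - T) + \<kappa> * (R * T) - \<kappa> * x + gam * real k + (\<Sum>l<k. med ((G ^^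
         l) t)) + real N * H
        - (if x = 0 then real q * H else 0) + c2"
proof (induction k arbitrary: x q t)
  case 0
  have "x < c1" using 0 unfolding lim_pot_def c1_def by simp
  then have "\<kappa> * x \<le> \<kappa> * c1" using \<kappa> by simp
  moreover have "0 \<le> \<kappa> * (r / (r - 1) + gain M')" using r \<kappa> M'_gain_pos
      by (intro mult_nonneg_nonneg add_nonneg_nonneg) auto
  moreover have "real q * H \<le> real N * H" using 0 N by (intro mult_right_mono) auto
  moreover have "0 \<le> real N * H" using N by simp
  ultimately have "V \<le> - \<kappa> * x + real N * H - (if x = 0 then real q * H else 0) + c2"
    unfolding c2_def by (auto simp: distrib_left)
  then show ?case using \<open>x < c1\<close> by (intro exI[of _ 0]) auto
next
  case (Suc k)
  have lp0: "lim_pot \<sigma> k > 0"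
    using \<sigma> R \<epsilon> unfolding lim_pot_def by (intro add_nonneg_pos) auto
  have lpS: "lim_pot \<sigma> (Suc k) = lim_pot \<sigma> k + R" unfolding lim_pot_def by (simp add: algebra_simps)
  define Q where "Q = (if q = 0 then N else q)"
  have Q: "1 \<le> Q" "Q \<le> N" using Suc.prems N unfolding Q_def by auto
  have sumS: "(\<Sum>l<Suc i. f ((G ^^ l) t)) = f t + (\<Sum>l<i. f ((G ^^ l) (G t)))"
      for f :: "real \<Rightarrow> real" and i
    by (simp add: sum.lessThan_Suc_shift funpow_swap1 del: sum.lessThan_Suc)
  have NH: "0 \<le> real N * H" "real Q * H \<le> real N * H" using N Q by (auto intro: mult_right_mono)
  have main: "\<exists>i T. i \<le> Suc k \<and> real (Suc k - i) \<le> T \<and> T \<le> real (Suc k) \<and>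
     x + (\<Sum>l<i. \<phi> ((G ^^ l) t)) - c1 \<le> R * T \<and>
     step_cost \<sigma> V k x Q t \<le> H * (real (Suc k) - T) + \<kappa> * (R * T) - \<kappa> * x + gam * real (Suc k) +
         (\<Sum>l<Suc k. med ((G ^^ l) t)) + real N * H
        - (if x = 0 then real Q * H else 0) + c2"
  proof (cases "\<bar>u t\<bar> > exp (- real M')")
    case nd: True
    define x' where "x' = max 0 (x - R)"
    define q' where "q' = (if x = 0 then Q - 1 else 0)"
    have x': "0 \<le> x'" "x' < lim_pot \<sigma> k" "q' \<le> N" using Suc.prems lp0 lpS Q
        unfolding x'_def q'_def by auto
    from Suc.IH[OF x', of "G t"] obtain i T where iT: "i \<le> k" "real (k - i) \<le> T" "T \<le> real k"
      "x' + (\<Sum>l<i. \<phi> ((G ^^ l) (G t))) - c1 \<le> R * T"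
      "cost \<sigma> V k x' q' (G t) \<le> H * (real k - T) + \<kappa> * (R * T) - \<kappa> * x' + gam * real k
          + (\<Sum>l<k. med ((G ^^ l) (G t))) + real N * H
        - (if x' = 0 then real q' * H else 0) + c2" by blast
    have sc: "step_cost \<sigma> V k x Q t \<le> gam + med t + cost \<sigma> V k x' q' (G t)"
      using nd med(1)[of t] med(2)[of t] gam
        unfolding step_cost_def x'_def[symmetric] q'_def[symmetric] by auto
    have \<phi>0: "\<phi> t \<le> 0" by (rule \<phi>(1)[OF nd])
    \<comment> \<open>Without potential the step belongs to a block and \<open>T\<close> stays the
      same; with potential it is a step of recovery and \<open>T\<close> grows by one.\<close>
    show ?thesis
    proof (cases "x = 0")
      case True
      then have e: "x' = 0" "real q' = real Q - 1" using R Q unfolding x'_def q'_def by auto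
      show ?thesis
        by (rule exI[of _ "Suc i"], rule exI[of _ T])
           (use iT sc \<phi>0 True in \<open>auto simp: sumS e algebra_simps simp del: sum.lessThan_Suc\<close>)
    next
      case False
      have e: "q' = 0" using False unfolding q'_def by auto
      have e5: "cost \<sigma> V k x' 0 (G t) \<le> H * (real k - T) + \<kappa> * (R * T) - \<kappa> * x' + gam * real k
          + (\<Sum>l<k. med ((G ^^ l) (G t))) + real N * H + c2"
        using iT(5) unfolding e by (auto split: if_splits)
      have "\<kappa> * (x - R) \<le> \<kappa> * x'" using \<kappa> unfolding x'_def by simp
      then have k': "\<kappa> * x \<le> \<kappa> * x' + \<kappa> * R" by (simp add: algebra_simps)
      have "x \<le> x' + R" unfolding x'_def by auto
      then show ?thesis
        by (intro exI[of _ "Suc i"] exI[of _ "T + 1"])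
           (use iT(1-4) e5 sc \<phi>0 False k' in \<open>auto simp: sumS e algebra_simps simp del:
               sum.lessThan_Suc\<close>)
    qed
  next
    case dp: False
    then have nM: "\<not> \<bar>u t\<bar> > exp (- real M)" using M
        by (meson exp_le_cancel_iff neg_le_iff_le not_less of_nat_le_iff order_trans)
    have med0: "0 \<le> (\<Sum>l<i. med ((G ^^ l) t))" for i by (intro sum_nonneg med)
    have gk: "0 \<le> gam * real (Suc k)" using gam by simp
    show ?thesis
    proof (cases "\<bar>u t\<bar> \<le> exp (- real (cap \<sigma> (Suc k) x))")
      case True
      have sc: "step_cost \<sigma> V k x Q t = vcost (cap \<sigma> (Suc k) x) + V"
        unfolding step_cost_def using True dp nM by simp
      have "vcost (cap \<sigma> (Suc k) x) + real N * H \<le> \<kappa> * (R * real (Suc k) - x) + (c2 - V)"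
        using terminal_bound[OF \<sigma> deep Suc.prems(2)] unfolding c2_def c1_def by simp
      then have "step_cost \<sigma> V k x Q t \<le> \<kappa> * (R * real (Suc k)) - \<kappa> * x + gam * real (Suc k)
          + (\<Sum>l<Suc k. med ((G ^^ l) t)) + real N * H
        - (if x = 0 then real Q * H else 0) + c2"
        using sc med0[of "Suc k"] gk NH by (auto simp: right_diff_distrib)
      moreover have "x - c1 \<le> R * real (Suc k)" using Suc.prems(2) unfolding lim_pot_def c1_def
          by linarith
      \<comment> \<open>After a terminal visit nothing more is coded: \<open>i\<close> is 0 and the
        whole remaining time counts as recovery.\<close>
      ultimately show ?thesis
        by (intro exI[of _ 0] exI[of _ "real (Suc k)"]) (simp del: of_nat_Suc)
    next
      case nt: False
      define g where "g = gain (lev t)"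
      have u0: "0 < \<bar>u t\<bar>" using nt by (meson exp_gt_zero less_trans not_less order_less_le_trans)
      have u1: "\<bar>u t\<bar> \<le> 1" using dp
          by (meson exp_le_one_iff neg_le_0_iff_le not_less of_nat_0_le_iff order_trans)
      have lv: "M' \<le> lev t" "lev t < cap \<sigma> (Suc k) x" using lev_iff[OF u0 u1] dp nt
          by (auto simp: not_less not_le)
      have g: "R < g" "g < lim_pot \<sigma> (Suc k) - x" using gainR[OF lv(1)] cap_gain(2)[OF lv]
          unfolding g_def gain_def dcon_def by auto
      define x' where "x' = x + g - R"
      have x': "0 \<le> x'" "x' < lim_pot \<sigma> k" "0 \<le> N" and x'0: "x' \<noteq> 0" using Suc.prems lpS g
          unfolding x'_def by auto
      from Suc.IH[OF x', of "G t"] obtain i T where iT: "i \<le> k" "real (k - i) \<le> T" "T \<le> real k"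
        "x' + (\<Sum>l<i. \<phi> ((G ^^ l) (G t))) - c1 \<le> R * T"
        "cost \<sigma> V k x' 0 (G t) \<le> H * (real k - T) + \<kappa> * (R * T) - \<kappa> * x' + gam * real k
            + (\<Sum>l<k. med ((G ^^ l) (G t))) + real N * H + c2"
        using x'0 by auto
      have sc: "step_cost \<sigma> V k x Q t = vcost (lev t) + cost \<sigma> V k x' 0 (G t)"
        unfolding step_cost_def x'_def g_def using nt dp nM by simp
      have "vcost (lev t) + real N * H \<le> \<kappa> * g" unfolding g_def by (rule deep[OF lv(1)])
      moreover have "\<phi> t \<le> g" unfolding g_def using \<phi>(2)[OF u0] dp by simp
      moreover have "\<kappa> * x' = \<kappa> * x + \<kappa> * g - \<kappa> * R" unfolding x'_def by (simp add: algebra_simps)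
      moreover have "0 \<le> gam" "0 \<le> med t" using gam med by auto
      ultimately show ?thesis
        by (intro exI[of _ "Suc i"] exI[of _ "T + 1"])
           (use iT sc NH in \<open>auto simp: sumS x'_def algebra_simps simp del: sum.lessThan_Suc\<close>)
    qed
  qed
  have "(if x = 0 \<and> q = 0 then real N * H else 0) - (if x = 0 then real Q * H else 0)
      = - (if x = 0 then real q * H else 0)"
    unfolding Q_def by simp
  then show ?case using main unfolding cost_step Q_def[symmetric]
      by (elim exE) (intro exI conjI, auto)
qed

text \<open>A block is bought only when the potential is 0. The potential dominates the excess of
  \<open>\<phi>\<close> over \<open>R\<close> per step on every stretch ending at the present, so at
  such a time no stretch has an excess and \<open>\<psi>\<close> is at least 1. Thus all blocks are
  charged to \<open>\<psi>\<close>, while visits and recovery together cost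
  \<open>\<kappa> * R\<close> per step.\<close>

lemma cost_bound_free:
  assumes \<sigma>: "0 < \<sigma>" "\<sigma> < \<epsilon>" and V: "V \<ge> 0" and MM: "M' = M"
    and deep: "\<And>m. M' \<le> m \<Longrightarrow> vcost m \<le> \<kappa> * gain m"
    and \<phi>: "\<And>t. exp (- real M') < \<bar>u t\<bar> \<Longrightarrow> \<phi> t \<le> 0" "\<And>t. 0 < \<bar>u t\<bar> \<Longrightarrow> \<bar>u t\<bar> \<le> exp (- real M') \<Longrightarrow>
        \<phi> t \<le> gain (lev t)"
    and \<psi>: "\<And>l. 0 \<le> \<psi> l" "\<And>l. (\<And>i. i \<le> l \<Longrightarrow> (\<Sum>m\<in>{i..<l}. \<phi> ((G ^^ m) t)) \<le> R * real (l - i)) \<Longrightarrow>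
        1 \<le> \<psi> l"
  defines "c2 \<equiv> V + \<kappa> * (ln (\<epsilon> / \<sigma>) + r / (r - 1) + gain M')"
  shows "0 \<le> x \<Longrightarrow> x < lim_pot \<sigma> k \<Longrightarrow> q \<le> N \<Longrightarrow>
     (\<And>i. i \<le> j \<Longrightarrow> (\<Sum>m\<in>{i..<j}. \<phi> ((G ^^ m) t)) - R * real (j - i) \<le> x) \<Longrightarrow>
     cost \<sigma> V k x q ((G ^^ j) t) \<le> real N * H * (\<Sum>l\<in>{j..<j+k}. \<psi> l) + \<kappa> * (R * real k - x) + gam *
         real k + c2"
proof (induction k arbitrary: x q j)
  case 0
  have "\<kappa> * x \<le> \<kappa> * ln (\<epsilon> / \<sigma>)" using 0 \<kappa> unfolding lim_pot_def by simp
  moreover have "0 \<le> \<kappa> * (r / (r - 1) + gain M')" using r \<kappa> M'_gain_pos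
      by (intro mult_nonneg_nonneg add_nonneg_nonneg) auto
  ultimately show ?case unfolding c2_def by (simp add: distrib_left)
next
  case (Suc k)
  have lp0: "lim_pot \<sigma> k > 0"
    using \<sigma> R \<epsilon> unfolding lim_pot_def by (intro add_nonneg_pos) auto
  have lpS: "lim_pot \<sigma> (Suc k) = lim_pot \<sigma> k + R" unfolding lim_pot_def by (simp add: algebra_simps)
  define s where "s = (G ^^ j) t"
  have Gs: "G s = (G ^^ Suc j) t" unfolding s_def by simp
  define Q where "Q = (if q = 0 then N else q)"
  have Q: "1 \<le> Q" "Q \<le> N" using Suc.prems N unfolding Q_def by auto
  have NH: "0 \<le> real N * H" using N by simp
  have blk: "(if x = 0 \<and> q = 0 then real N * H else 0) \<le> real N * H * \<psi> j"
  proof (cases "x = 0")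
    case True
    have "1 \<le> \<psi> j" using Suc.prems(4) True by (intro \<psi>(2)) force
    from mult_left_mono[OF this NH] show ?thesis using NH by simp
  next
    case False
    then show ?thesis using mult_nonneg_nonneg[OF NH \<psi>(1)[of j]] by simp
  qed
  have split: "(\<Sum>l\<in>{j..<j + Suc k}. \<psi> l) = \<psi> j + (\<Sum>l\<in>{Suc j..<Suc j + k}. \<psi> l)"
    by (subst sum.atLeast_Suc_lessThan) auto
  \<comment> \<open>Every stretch is prolonged by the current step; for the empty stretch the claim
    is that the new potential is nonnegative.\<close>
  have hist: "(\<Sum>m\<in>{i..<Suc j}. \<phi> ((G ^^ m) t)) - R * real (Suc j - i) \<le> x'"
    if "i \<le> Suc j" "0 \<le> x'" "x + \<phi> s - R \<le> x'" for i x'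
  proof (cases "i = Suc j")
    case False
    then have "i \<le> j" using that by auto
    then have "(\<Sum>m\<in>{i..<Suc j}. \<phi> ((G ^^ m) t)) = (\<Sum>m\<in>{i..<j}. \<phi> ((G ^^ m) t)) + \<phi> s"
        "real (Suc j - i) = real (j - i) + 1"
      unfolding s_def by (auto simp: Suc_diff_le)
    then show ?thesis using Suc.prems(4)[OF \<open>i \<le> j\<close>] that(3) by (simp add: algebra_simps)
  qed (use that in auto)
  have main: "step_cost \<sigma> V k x Q s \<le> real N * H * (\<Sum>l\<in>{Suc j..<Suc j + k}. \<psi> l)
      + \<kappa> * (R * real (Suc k) - x) + gam * real (Suc k) + c2"
  proof (cases "\<bar>u s\<bar> > exp (- real M')")
    case nd: True
    define x' where "x' = max 0 (x - R)"
    define q' where "q' = (if x = 0 then Q - 1 else 0)"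
    have x': "0 \<le> x'" "x' < lim_pot \<sigma> k" "q' \<le> N" using Suc.prems lp0 lpS Q
        unfolding x'_def q'_def by auto
    have "cost \<sigma> V k x' q' ((G ^^ Suc j) t) \<le> real N * H * (\<Sum>l\<in>{Suc j..<Suc j + k}. \<psi> l)
        + \<kappa> * (R * real k - x') + gam * real k + c2"
      by (rule Suc.IH[OF x']) (rule hist, use \<phi>(1)[OF nd] x' in \<open>auto simp: x'_def\<close>)
    moreover have "step_cost \<sigma> V k x Q s = gam + cost \<sigma> V k x' q' (G s)"
      using nd MM unfolding step_cost_def x'_def[symmetric] q'_def[symmetric] by auto
    moreover have "\<kappa> * (R * real k - x') \<le> \<kappa> * (R * real (Suc k) - x)"
      using \<kappa> unfolding x'_def by (intro mult_left_mono) (auto simp: algebra_simps)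
    ultimately show ?thesis unfolding Gs by (simp add: algebra_simps del: funpow.simps)
  next
    case dp: False
    have s0: "0 \<le> real N * H * (\<Sum>l\<in>{Suc j..<Suc j + k}. \<psi> l)"
        by (rule mult_nonneg_nonneg[OF NH]) (intro sum_nonneg \<psi>)
    have gk: "0 \<le> gam * real (Suc k)" "0 \<le> gam" using gam by auto
    show ?thesis
    proof (cases "\<bar>u s\<bar> \<le> exp (- real (cap \<sigma> (Suc k) x))")
      case True
      have sc: "step_cost \<sigma> V k x Q s = vcost (cap \<sigma> (Suc k) x) + V"
        unfolding step_cost_def using True dp MM by simp
      have "vcost (cap \<sigma> (Suc k) x) + 0 \<le> \<kappa> * (R * real (Suc k) - x) + (c2 - V)"
        using terminal_bound[OF \<sigma> _ Suc.prems(2), of 0] deep unfolding c2_def by simp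
      then show ?thesis using sc s0 gk by linarith
    next
      case nt: False
      define g where "g = gain (lev s)"
      have u0: "0 < \<bar>u s\<bar>" using nt by (meson exp_gt_zero less_trans not_less order_less_le_trans)
      have u1: "\<bar>u s\<bar> \<le> 1" using dp
          by (meson exp_le_one_iff neg_le_0_iff_le not_less of_nat_0_le_iff order_trans)
      have lv: "M' \<le> lev s" "lev s < cap \<sigma> (Suc k) x" using lev_iff[OF u0 u1] dp nt
          by (auto simp: not_less not_le)
      have g: "R < g" "g < lim_pot \<sigma> (Suc k) - x" using gainR[OF lv(1)] cap_gain(2)[OF lv]
          unfolding g_def gain_def dcon_def by auto
      have \<phi>g: "\<phi> s \<le> g" unfolding g_def using \<phi>(2)[OF u0] dp by simp
      define x' where "x' = x + g - R"
      have x': "0 \<le> x'" "x' < lim_pot \<sigma> k" "0 \<le> N" using Suc.prems lpS g unfolding x'_def by auto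
      have "cost \<sigma> V k x' 0 ((G ^^ Suc j) t) \<le> real N * H * (\<Sum>l\<in>{Suc j..<Suc j + k}. \<psi> l)
          + \<kappa> * (R * real k - x') + gam * real k + c2"
        by (rule Suc.IH[OF x']) (rule hist, use \<phi>g x' in \<open>auto simp: x'_def\<close>)
      moreover have "step_cost \<sigma> V k x Q s = vcost (lev s) + cost \<sigma> V k x' 0 (G s)"
        unfolding step_cost_def x'_def g_def using nt dp MM by simp
      moreover have "vcost (lev s) \<le> \<kappa> * g" unfolding g_def by (rule deep[OF lv(1)])
      moreover have "\<kappa> * (R * real k - x') + \<kappa> * g = \<kappa> * (R * real (Suc k) - x)"
        unfolding x'_def by (simp add: algebra_simps)
      ultimately show ?thesis unfolding Gs using gk by (simp add: algebra_simps del: funpow.simps)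
    qed
  qed
  have "cost \<sigma> V (Suc k) x q s \<le> real N * H * \<psi> j + step_cost \<sigma> V k x Q s"
    using blk unfolding cost_step Q_def by linarith
  then show ?case using main unfolding s_def[symmetric] split distrib_left by linarith
qed

end

section \<open>Entropy and recurrence of ergodic measures\<close>

text \<open>Gibbs' inequality: by \<open>ln z \<le> z - 1\<close> the entropy is at most the mean of
  \<open>- ln (q (X x))\<close> as soon as the weights \<open>q\<close> have sum at most 1.\<close>

lemma entropy_le_code_length:
  assumes M: "prob_space M" and X: "simple_function M X"
    and q: "\<And>w. w \<in> X ` space M \<Longrightarrow> 0 \<le> q w" "(\<Sum>w\<in>X ` space M. q w) \<le> 1"
    and L: "integrable M L" "\<And>x. x \<in> space M \<Longrightarrow> exp (- L x) \<le> q (X x)"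
  shows "prob_space.entropy M (exp 1) (count_space (X ` space M)) X \<le> (\<integral>x. L x \<partial>M)"
proof -
  interpret prob_space M by (rule M)
  interpret information_space M "exp 1" by unfold_locales simp
  define p where "p = (\<lambda>w. measure M (X -` {w} \<inter> space M))"
  have fin: "finite (X ` space M)" using X by (rule simple_functionD)
  have sd: "simple_distributed M X p"
    by (rule simple_distributedI[OF X]) (auto simp: p_def)
  have H: "entropy (exp 1) (count_space (X ` space M)) X = - (\<Sum>w\<in>X ` space M. p w * ln (p w))"
    unfolding entropy_simple_distributed[OF sd] by (simp add: log_def)
  have qpos: "0 < q w" if "w \<in> X ` space M" for w
    using that L(2) by (auto intro: less_le_trans[OF exp_gt_zero])
  have sp: "(\<Sum>w\<in>X ` space M. p w) = 1"
  proof -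
    have "(\<Sum>w\<in>X ` space M. p w) = measure M (\<Union>w\<in>X ` space M. X -` {w} \<inter> space M)"
      unfolding p_def by (rule finite_measure_finite_Union[symmetric]) (use fin X in \<open>auto simp:
          disjoint_family_on_def simple_functionD\<close>)
    also have "(\<Union>w\<in>X ` space M. X -` {w} \<inter> space M) = space M" by auto
    finally show ?thesis by (simp add: prob_space)
  qed
  have trm: "p w * ln (q w) - p w * ln (p w) \<le> q w - p w" if "w \<in> X ` space M" for w
  proof (cases "p w = 0")
    case True then show ?thesis using q(1)[OF that] by simp
  next
    case False
    then have pw: "0 < p w" unfolding p_def by (simp add: zero_less_measure_iff)
    have "ln (q w / p w) \<le> q w / p w - 1" using pw qpos[OF that] by (intro ln_le_minus_one) auto
    then have "p w * ln (q w / p w) \<le> p w * (q w / p w - 1)" using pw by (intro mult_left_mono) auto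
    then show ?thesis using pw qpos[OF that] by (simp add: ln_div right_diff_distrib)
  qed
  have "(\<Sum>w\<in>X ` space M. p w * ln (q w) - p w * ln (p w)) \<le> (\<Sum>w\<in>X ` space M. q w - p w)"
    by (rule sum_mono[OF trm])
  then have 1: "- (\<Sum>w\<in>X ` space M. p w * ln (p w)) \<le> (\<Sum>w\<in>X ` space M. p w * (- ln (q w)))"
    using q(2) sp by (simp add: sum_subtractf sum_negf)
  have sf: "simple_function M (\<lambda>x. - ln (q (X x)))"
    using simple_function_compose[OF X, of "\<lambda>w. - ln (q w)"] by (simp add: comp_def)
  have ind: "- ln (q (X x)) = (\<Sum>w\<in>X ` space M. (- ln (q w)) * indicator (X -` {w} \<inter> space M) x)"
      if "x \<in> space M" for x
  proof -
    have "(\<Sum>w\<in>X ` space M. (- ln (q w)) * indicator (X -` {w} \<inter> space M) x)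
        = (\<Sum>w\<in>X ` space M. if w = X x then - ln (q w) else 0)"
      by (rule sum.cong) (use that in \<open>auto simp: indicator_def\<close>)
    then show ?thesis using that fin by (simp add: sum.delta)
  qed
  have ms: "X -` {w} \<inter> space M \<in> sets M" for w using X by (rule simple_functionD)
  have "(\<integral>x. - ln (q (X x)) \<partial>M) = (\<integral>x. (\<Sum>w\<in>X ` space M. (- ln (q w)) * indicator
      (X -` {w} \<inter> space M) x) \<partial>M)"
    by (rule Bochner_Integration.integral_cong[OF refl ind])
  also have "\<dots> = (\<Sum>w\<in>X ` space M. (- ln (q w)) * measure M (X -` {w} \<inter> space M))"
    by (subst Bochner_Integration.integral_sum)
       (use ms in \<open>auto intro!: sum.cong integrable_mult_right integrable_real_indicator simp:
           emeasure_eq_measure simp del: integrable_mult_left_iff integrable_mult_right_iff\<close>)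
  also have "\<dots> = (\<Sum>w\<in>X ` space M. p w * (- ln (q w)))" unfolding p_def by (simp add: mult.commute)
  finally have 2: "(\<Sum>w\<in>X ` space M. p w * (- ln (q w))) = (\<integral>x. - ln (q (X x)) \<partial>M)" by simp
  have int: "integrable M (\<lambda>x. - ln (q (X x)))"
    by (subst Bochner_Integration.integrable_cong[OF refl ind], assumption)
       (intro Bochner_Integration.integrable_sum integrable_mult_right integrable_real_indicator,
           use ms in \<open>auto simp: emeasure_eq_measure\<close>)
  have "(\<integral>x. - ln (q (X x)) \<partial>M) \<le> (\<integral>x. L x \<partial>M)"
  proof (rule integral_mono[OF int L(1)])
    fix x assume x: "x \<in> space M"
    then have "ln (exp (- L x)) \<le> ln (q (X x))" using L(2)[OF x] qpos[of "X x"]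
        by (intro ln_mono) auto
    then show "- ln (q (X x)) \<le> L x" by simp
  qed
  then show ?thesis unfolding H using 1 2 by linarith
qed

locale ergodic_system = prob_space M for M :: "'a measure" +
  fixes g :: "'a \<Rightarrow> 'a"
  assumes g: "g \<in> measurable M M" and inv: "distr M M g = M"
    and erg: "\<And>A. A \<in> sets M \<Longrightarrow> g -` A \<inter> space M = A \<Longrightarrow> measure M A = 0 \<or> measure M A = 1"
begin

lemma gpow [measurable]: "(g ^^ n) \<in> measurable M M"
proof (induction n)
  case (Suc n) then show ?case using measurable_comp[OF Suc g] by (simp add: comp_def)
qed (simp add: id_def)

lemma gpow_space: "x \<in> space M \<Longrightarrow> (g ^^ n) x \<in> space M"
  using gpow measurable_space by metis

lemma distr_gpow: "distr M M (g ^^ n) = M"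
proof (induction n)
  case (Suc n)
  have "distr M M (g ^^ Suc n) = distr (distr M M (g ^^ n)) M g"
    by (subst distr_distr) (use g gpow in auto)
  then show ?case using Suc inv by (simp add: comp_def)
qed (simp add: id_def distr_id2)

lemma integral_gpow:
  fixes f :: "'a \<Rightarrow> real"
  assumes "f \<in> borel_measurable M"
  shows "(\<integral>x. f ((g ^^ n) x) \<partial>M) = (\<integral>x. f x \<partial>M)"
  using integral_distr[OF gpow assms, of n] unfolding distr_gpow by simp

lemma integrable_gpow:
  fixes f :: "'a \<Rightarrow> real"
  assumes "integrable M f"
  shows "integrable M (\<lambda>x. f ((g ^^ n) x))"
  using integrable_distr[of "g ^^ n" M M f] assms gpow unfolding distr_gpow by simp

definition bsum :: "('a \<Rightarrow> real) \<Rightarrow> nat \<Rightarrow> 'a \<Rightarrow> real" where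
  "bsum f n x = (\<Sum>i<n. f ((g ^^ i) x))"

lemma integral_bsum:
  assumes "integrable M f"
  shows "(\<integral>x. bsum f n x \<partial>M) = real n * (\<integral>x. f x \<partial>M)" "integrable M (bsum f n)"
  using assms integrable_gpow[OF assms] integral_gpow[of f] unfolding bsum_def
    by (auto simp: Bochner_Integration.integral_sum)

lemma bsum_g: "bsum f n (g x) = bsum f (Suc n) x - f x"
  unfolding bsum_def by (simp add: sum.lessThan_Suc_shift funpow_swap1 del: sum.lessThan_Suc)

lemma bsum_add: "bsum h (k + l) x = bsum h k x + bsum h l ((g ^^ k) x)"
proof (induction l)
  case (Suc l)
  have "(g ^^ (k + l)) x = (g ^^ l) ((g ^^ k) x)" by (metis add.commute comp_apply funpow_add)
  then show ?case using Suc by (simp add: bsum_def)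
qed (simp add: bsum_def)

text \<open>The set where the upper limit of the averages exceeds \<open>c\<close> is invariant,
  hence null or of full measure. If it were null, the averages cut off from below at a number d <
  \<integral>f would tend to d almost everywhere, while their integrals stay at least
  \<integral>f.\<close>

lemma average_recurrence:
  assumes f[measurable]: "f \<in> borel_measurable M" and fb: "\<And>x. x \<in> space M \<Longrightarrow> 0 \<le> f x \<and> f x \<le> W"
    and c: "c < (\<integral>x. f x \<partial>M)"
  shows "measure M {x\<in>space M. \<exists>k\<ge>1. c * real k \<le> bsum f k x} = 1"
proof -
  have bm[measurable]: "bsum f n \<in> borel_measurable M" for n unfolding bsum_def by measurable
  have intf: "integrable M f"
      by (rule integrable_const_bound[of _ "\<bar>W\<bar>"]) (use fb in \<open>auto intro!: AE_I2\<close>, force)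
  \<comment> \<open>The slack makes the inequality for the upper limit strict. It is halved in the
    proof of invariance, in order to absorb the single term by which the sums for \<open>x\<close>
    and \<open>g x\<close> differ.\<close>
  define V where "V = {x\<in>space M. \<exists>m::nat. \<forall>k0::nat. \<exists>k\<ge>k0. (c + 1 / (real m + 1)) * real k
      \<le> bsum f k x}"
  have Vm[measurable]: "V \<in> sets M" unfolding V_def by measurable
  have half: "\<exists>m'. d / 2 = 1 / (real m' + 1)" if "d = 1 / (real m + 1)" for d and m :: nat
    by (rule exI[of _ "2 * m + 1"]) (simp add: that field_simps)
  have large: "\<exists>k0::nat. \<forall>k\<ge>k0. e * real k \<ge> C" if "e > 0" for e C :: real
  proof -
    obtain k0 :: nat where k0: "C / e \<le> real k0" using real_arch_simple by blast
    show ?thesis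
    proof (intro exI[of _ k0] allI impI)
      fix k assume "k0 \<le> k"
      then have "C / e \<le> real k" using k0 by linarith
      then show "C \<le> e * real k" using that by (simp add: field_simps)
    qed
  qed
  have V1: "g x \<in> V" if "x \<in> V" for x
  proof -
    from that obtain m where x: "x \<in> space M"
        and m: "\<And>k0. \<exists>k\<ge>k0. (c + 1 / (real m + 1)) * real k \<le> bsum f k x" unfolding V_def by auto
    define d where "d = 1 / (real m + 1)"
    obtain m' where m': "d / 2 = 1 / (real m' + 1)" using half d_def by blast
    obtain k1 :: nat where k1: "\<And>k. k \<ge> k1 \<Longrightarrow> d / 2 * real k \<ge> W - c - d"
        using large[of "d/2" "W - c - d"] unfolding d_def by auto
    have "\<exists>k\<ge>k0. (c + 1 / (real m' + 1)) * real k \<le> bsum f k (g x)" for k0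
    proof -
      obtain k where k: "k \<ge> k0 + k1 + 1" "(c + d) * real k \<le> bsum f k x"
          using m[of "k0 + k1 + 1"] unfolding d_def by auto
      then obtain l where l: "k = Suc l" "l \<ge> k0" "l \<ge> k1" by (cases k) auto
      have "(c + d / 2) * real l = (c + d) * real k - (c + d) - d / 2 * real l" using l
          by (simp add: algebra_simps)
      also have "\<dots> \<le> bsum f k x - W" using k1[OF l(3)] k(2) by linarith
      also have "\<dots> \<le> bsum f l (g x)" unfolding bsum_g l(1) using fb[OF x] by simp
      finally show ?thesis using l m' by auto
    qed
    then show ?thesis using x measurable_space[OF g] unfolding V_def by blast
  qed
  have V2: "x \<in> V" if "g x \<in> V" "x \<in> space M" for x
  proof -
    from that obtain m where m: "\<And>k0. \<exists>k\<ge>k0. (c + 1 / (real m + 1)) * real k \<le> bsum f k (g x)"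
        unfolding V_def by auto
    define d where "d = 1 / (real m + 1)"
    obtain m' where m': "d / 2 = 1 / (real m' + 1)" using half d_def by blast
    obtain k1 :: nat where k1: "\<And>k. k \<ge> k1 \<Longrightarrow> d / 2 * real k \<ge> c + d / 2"
        using large[of "d/2" "c + d/2"] unfolding d_def by auto
    have "\<exists>k\<ge>k0. (c + 1 / (real m' + 1)) * real k \<le> bsum f k x" for k0
    proof -
      obtain k where k: "k \<ge> k0 + k1" "(c + d) * real k \<le> bsum f k (g x)" using m[of "k0 + k1"]
          unfolding d_def by auto
      have "(c + d / 2) * real (Suc k) = (c + d) * real k + (c + d / 2) - d / 2 * real k"
          by (simp add: algebra_simps)
      also have "\<dots> \<le> bsum f k (g x)" using k1[of k] k by simp
      also have "\<dots> \<le> bsum f (Suc k) x" unfolding bsum_g using fb[OF that(2)] by simp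
      finally have "(c + d / 2) * real (Suc k) \<le> bsum f (Suc k) x" .
      then show ?thesis using k m' by (intro exI[of _ "Suc k"]) auto
    qed
    then show ?thesis using that(2) unfolding V_def by blast
  qed
  have "g -` V \<inter> space M = V" using V1 V2 unfolding V_def by blast
  then have V01: "measure M V = 0 \<or> measure M V = 1" by (rule erg[OF Vm])
  have "measure M V \<noteq> 0"
  proof
    assume "measure M V = 0"
    then have AEV: "AE x in M. x \<notin> V"
        using AE_iff_measurable[OF Vm, of "\<lambda>x. x \<notin> V"] sets.sets_into_space[OF Vm]
      by (auto simp: emeasure_eq_measure)
    obtain m :: nat where m: "1 / (real m + 1) < (\<integral>x. f x \<partial>M) - c"
        using c nat_approx_posE[of "(\<integral>x. f x \<partial>M) - c"]
      by (metis diff_gt_0_iff_gt of_nat_Suc add.commute)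
    define d where "d = c + 1 / (real m + 1)"
    \<comment> \<open>Outside \<open>V\<close> the averages are eventually below \<open>d\<close>,
      so the truncated sequence is eventually constant. The index \<open>Suc k\<close> avoids
      division by 0.\<close>
    define F where "F = (\<lambda>k x. max (bsum f (Suc k) x / real (Suc k)) d)"
    have bb: "0 \<le> bsum f k x \<and> bsum f k x \<le> real k * W" if "x \<in> space M" for k x
    proof -
      have "bsum f k x \<le> (\<Sum>i<k. W)" unfolding bsum_def using fb gpow_space[OF that]
          by (intro sum_mono) auto
      moreover have "0 \<le> bsum f k x" unfolding bsum_def using fb gpow_space[OF that]
          by (intro sum_nonneg) auto
      ultimately show ?thesis by simp
    qed
    have "(\<lambda>k. \<integral>x. F k x \<partial>M) \<longlonglongrightarrow> (\<integral>x. d \<partial>M)"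
    proof (rule integral_dominated_convergence[where w="\<lambda>_. \<bar>W\<bar> + \<bar>d\<bar>"])
      show "AE x in M. (\<lambda>k. F k x) \<longlonglongrightarrow> d"
        using AEV AE_space
      proof eventually_elim
        case (elim x)
        then have "\<forall>m::nat. \<exists>k0. \<forall>k\<ge>k0. bsum f k x < (c + 1 / (real m + 1)) * real k"
            unfolding V_def by (auto simp: not_le) (meson not_le)
        then obtain k0 where k0: "\<And>k. k \<ge> k0 \<Longrightarrow> bsum f k x < d * real k" unfolding d_def by meson
        show ?case
        proof (rule tendsto_eventually, unfold eventually_sequentially, intro exI[of _ k0] allI
            impI)
          fix k assume "k0 \<le> k"
          then have "bsum f (Suc k) x < d * real (Suc k)" by (intro k0) simp
          then have "bsum f (Suc k) x / real (Suc k) \<le> d"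
              by (simp add: pos_divide_le_eq del: of_nat_Suc)
          then show "F k x = d" unfolding F_def by simp
        qed
      qed
      show "AE x in M. norm (F k x) \<le> \<bar>W\<bar> + \<bar>d\<bar>" for k
      proof (rule AE_I2)
        fix x assume x: "x \<in> space M"
        have "0 \<le> bsum f (Suc k) x / real (Suc k)" "bsum f (Suc k) x / real (Suc k) \<le> W"
          using bb[OF x, of "Suc k"] by (auto simp: field_simps)
        then show "norm (F k x) \<le> \<bar>W\<bar> + \<bar>d\<bar>" unfolding F_def by (auto simp: max_def)
      qed
    qed (auto simp: F_def)
    then have lim: "(\<lambda>k. \<integral>x. F k x \<partial>M) \<longlonglongrightarrow> d" by (simp add: prob_space)
    have "(\<integral>x. f x \<partial>M) \<le> (\<integral>x. F k x \<partial>M)" for k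
    proof -
      have i: "integrable M (bsum f (Suc k))" by (rule integral_bsum[OF intf])
      have "(\<integral>x. f x \<partial>M) = (\<integral>x. bsum f (Suc k) x / real (Suc k) \<partial>M)"
        using integral_bsum(1)[OF intf, of "Suc k"] by simp
      also have "\<dots> \<le> (\<integral>x. F k x \<partial>M)"
        unfolding F_def using i by (intro integral_mono integrable_max) auto
      finally show ?thesis .
    qed
    then have "(\<integral>x. f x \<partial>M) \<le> d" by (intro LIMSEQ_le_const[OF lim]) auto
    then show False using m unfolding d_def by linarith
  qed
  then have V1': "measure M V = 1" using V01 by auto
  define E where "E = {x\<in>space M. \<exists>k\<ge>1. c * real k \<le> bsum f k x}"
  have "V \<subseteq> E"
  proof
    fix x assume "x \<in> V"
    then obtain m k where "x \<in> space M" "k \<ge> 1" "(c + 1 / (real m + 1)) * real k \<le> bsum f k x"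
        unfolding V_def by blast
    moreover have "c * real k \<le> (c + 1 / (real m + 1)) * real k" by (intro mult_right_mono) auto
    ultimately show "x \<in> E" unfolding E_def using order_trans by blast
  qed
  moreover have "E \<in> sets M" unfolding E_def by measurable
  ultimately have "measure M V \<le> measure M E" by (intro finite_measure_mono)
  then show ?thesis using V1' prob_le_1[of E] unfolding E_def by linarith
qed

text \<open>Follow the orbit, jumping over the stretches provided by \<open>average_recurrence\<close> as long as they are
  shorter than a bound that fails only on a small set (Katznelson and Weiss).\<close>

lemma birkhoff_lower:
  assumes f[measurable]: "f \<in> borel_measurable M" and fb: "\<And>x. x \<in> space M \<Longrightarrow> 0 \<le> f x \<and> f x \<le> W"
    and b: "b \<le> (\<integral>x. f x \<partial>M)" and \<gamma>: "\<gamma> > 0"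
  shows "\<exists>n0. \<forall>n\<ge>n0. \<exists>\<Omega>\<in>sets M. measure M \<Omega> \<ge> 1 - \<gamma> \<and>
      (\<forall>x\<in>\<Omega>. \<forall>j\<le>n. b * real j - \<gamma> * real n \<le> bsum f j x)"
proof -
  have bm[measurable]: "bsum f n \<in> borel_measurable M" for n unfolding bsum_def by measurable
  have nn: "0 \<le> bsum f k x" if "x \<in> space M" for k x
    unfolding bsum_def using fb gpow_space[OF that] by (intro sum_nonneg) auto
  define c where "c = b - \<gamma> / 4"
  show ?thesis
  proof (cases "c \<le> 0")
    case True
    have "b * real j - \<gamma> * real n \<le> bsum f j x" if "x \<in> space M" "j \<le> n" for j n x
    proof -
      have "b * real j \<le> \<gamma> * real j" using True \<gamma> unfolding c_def by (intro mult_right_mono) auto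
      also have "\<dots> \<le> \<gamma> * real n" using that \<gamma> by (intro mult_left_mono) auto
      finally show ?thesis using nn[OF that(1), of j] by linarith
    qed
    then show ?thesis using \<gamma>
        by (intro exI[of _ 0] allI impI bexI[of _ "space M"]) (auto simp: prob_space)
  next
    case False
    then have c0: "c > 0" by simp
    have c1: "c < (\<integral>x. f x \<partial>M)" using b \<gamma> unfolding c_def by simp
    define E where "E = (\<lambda>K. {x\<in>space M. \<exists>k\<in>{1..K}. c * real k \<le> bsum f k x})"
    have Em[measurable]: "E K \<in> sets M" for K unfolding E_def by measurable
    have "(\<lambda>K. measure M (E K)) \<longlonglongrightarrow> measure M (\<Union>K. E K)"
      by (rule finite_Lim_measure_incseq) (auto simp: incseq_def E_def)
    moreover have "(\<Union>K. E K) = {x\<in>space M. \<exists>k\<ge>1. c * real k \<le> bsum f k x}"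
      unfolding E_def by auto (metis One_nat_def atLeastAtMost_iff order_refl)
    ultimately have lim: "(\<lambda>K. measure M (E K)) \<longlonglongrightarrow> 1" using average_recurrence[OF f fb c1] by simp
    \<comment> \<open>With this bound on the measure of the exceptional set \<open>B\<close>,
      Markov's inequality shows that \<open>c\<close> times the time spent in \<open>B\<close>
      exceeds \<open>\<gamma> / 4 * real n\<close> with probability at most \<gamma>.\<close>
    define \<theta> where "\<theta> = min 1 (\<gamma> / (4 * c)) * \<gamma>"
    have \<theta>: "\<theta> > 0" unfolding \<theta>_def using \<gamma> c0 by auto
    have "\<forall>\<^sub>F K in sequentially. measure M (E K) > 1 - \<theta>"
        by (rule order_tendstoD(1)[OF lim]) (use \<theta> in auto)
    then obtain K where K: "measure M (E K) > 1 - \<theta>" by (metis eventually_sequentially order_refl)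
    define B where "B = space M - E K"
    have Bm[measurable]: "B \<in> sets M" unfolding B_def by measurable
    have PB: "measure M B \<le> \<theta>" unfolding B_def using K prob_compl[OF Em[of K]] by simp
    \<comment> \<open>Outside \<open>B\<close> the orbit jumps over a good stretch of length at most
      \<open>K\<close>; in \<open>B\<close> it moves one step and books the loss \<open>c\<close>.
      At the end up to \<open>K\<close> steps remain uncovered.\<close>
    have key: "c * (real j - real K) \<le> bsum f j x + c * bsum (indicator B) j x" if "x \<in> space M"
        for j x
      using that
    proof (induction j arbitrary: x rule: less_induct)
      case (less j)
      have ip: "0 \<le> bsum (indicator B) i y" for i y unfolding bsum_def by (intro sum_nonneg) auto
      show ?case
      proof (cases "j \<le> K")
        case True
        then have "c * (real j - real K) \<le> 0" using c0 by (intro mult_nonneg_nonpos) auto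
        moreover have "0 \<le> c * bsum (indicator B) j x" using c0 ip by simp
        ultimately show ?thesis using nn[OF less.prems, of j] by linarith
      next
        case jK: False
        show ?thesis
        proof (cases "x \<in> B")
          case True
          obtain l where l: "j = 1 + l" using jK by (cases j) auto
          have b1: "bsum h 1 x = h x" for h unfolding bsum_def by simp
          have funpow_1: "(g ^^ 1) x = g x" by simp
          have "c * (real l - real K) \<le> bsum f l (g x) + c * bsum (indicator B) l (g x)"
            using less.IH[of l "g x"] l less.prems measurable_space[OF g] by auto
          then show ?thesis unfolding l bsum_add b1 funpow_1 using True fb[OF less.prems]
              by (simp add: algebra_simps)
        next
          case False
          then obtain k where k: "1 \<le> k" "k \<le> K" "c * real k \<le> bsum f k x" using less.prems
              unfolding B_def E_def by auto
          obtain l where l: "j = k + l" using jK k by (metis le_Suc_ex le_trans nat_le_linear)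
          have "c * (real l - real K) \<le> bsum f l ((g ^^ k) x)
              + c * bsum (indicator B) l ((g ^^ k) x)"
            using less.IH[of l "(g ^^ k) x"] l k less.prems gpow_space by auto
          moreover have "0 \<le> c * bsum (indicator B) k x" using c0 ip by simp
          ultimately show ?thesis unfolding l bsum_add using k by (simp add: algebra_simps)
        qed
      qed
    qed
    obtain n0 :: nat where n0: "4 * c * real K / \<gamma> \<le> real n0" using real_arch_simple by blast
    show ?thesis
    proof (intro exI[of _ "n0 + 1"] allI impI)
      fix n assume n: "n0 + 1 \<le> n"
      define \<Omega> where "\<Omega> = {x\<in>space M. c * bsum (indicator B) n x \<le> \<gamma> / 4 * real n}"
      have bmB[measurable]: "bsum (indicator B) n \<in> borel_measurable M" unfolding bsum_def
          by measurable
      have \<Omega>m: "\<Omega> \<in> sets M" unfolding \<Omega>_def by measurable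
      have iB: "integrable M (indicator B :: 'a \<Rightarrow> real)" using Bm by (simp add: emeasure_eq_measure)
      have nnB: "0 \<le> bsum (indicator B) n x" for x unfolding bsum_def by (intro sum_nonneg) auto
      have "measure M {x\<in>space M. bsum (indicator B) n x \<ge> \<gamma> / (4 * c) * real n}
          \<le> (\<integral>x. bsum (indicator B) n x \<partial>M) / (\<gamma> / (4 * c) * real n)"
        by (rule integral_Markov_inequality_measure[where A="{}"])
           (use integral_bsum(2)[OF iB] \<gamma> c0 n nnB in \<open>auto intro!: AE_I2\<close>)
      also have "(\<integral>x. bsum (indicator B) n x \<partial>M) = real n * measure M B"
          using integral_bsum(1)[OF iB, of n] Bm by simp
      also have "real n * measure M B / (\<gamma> / (4 * c) * real n) = measure M B * (4 * c / \<gamma>)"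
          using n \<gamma> c0 by (simp add: field_simps)
      also have "\<dots> \<le> \<theta> * (4 * c / \<gamma>)" using PB \<gamma> c0 by (intro mult_right_mono) auto
      also have "\<dots> \<le> (\<gamma> / (4 * c) * \<gamma>) * (4 * c / \<gamma>)" using \<gamma> c0 unfolding \<theta>_def
          by (intro mult_right_mono) auto
      also have "\<dots> = \<gamma>" using \<gamma> c0 by simp
      finally have m1: "measure M {x\<in>space M. bsum (indicator B) n x \<ge> \<gamma> / (4 * c) * real n} \<le> \<gamma>" .
      have "space M - \<Omega> \<subseteq> {x\<in>space M. bsum (indicator B) n x \<ge> \<gamma> / (4 * c) * real n}"
        unfolding \<Omega>_def using c0 by (auto simp: field_simps)
      then have "measure M (space M - \<Omega>) \<le> \<gamma>"
        by (rule order_trans[OF finite_measure_mono m1]) measurable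
      then have "measure M \<Omega> \<ge> 1 - \<gamma>" using prob_compl[OF \<Omega>m] by simp
      moreover have "b * real j - \<gamma> * real n \<le> bsum f j x" if x: "x \<in> \<Omega>" and j: "j \<le> n" for x j
      proof -
        have xs: "x \<in> space M" using x unfolding \<Omega>_def by auto
        have "bsum (indicator B) j x \<le> bsum (indicator B) n x" unfolding bsum_def using j
            by (intro sum_mono2) auto
        then have "c * bsum (indicator B) j x \<le> c * bsum (indicator B) n x" using c0 by simp
        also have "\<dots> \<le> \<gamma> / 4 * real n" using x unfolding \<Omega>_def by auto
        finally have 1: "c * (real j - real K) \<le> bsum f j x + \<gamma> / 4 * real n"
            using key[OF xs, of j] by linarith
        have "c * real K \<le> \<gamma> / 4 * real n0" using n0 \<gamma> by (simp add: field_simps)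
        also have "\<dots> \<le> \<gamma> / 4 * real n" using n \<gamma> by (intro mult_left_mono) auto
        finally have 2: "c * real K \<le> \<gamma> / 4 * real n" .
        have 3: "\<gamma> / 4 * real j \<le> \<gamma> / 4 * real n" using j \<gamma> by (intro mult_left_mono) auto
        have "c * (real j - real K) = b * real j - \<gamma> / 4 * real j - c * real K"
          by (simp add: right_diff_distrib) (simp add: c_def left_diff_distrib)
        moreover have "0 \<le> \<gamma> * real n" using \<gamma> by simp
        ultimately show ?thesis using 1 2 3 by linarith
      qed
      ultimately show "\<exists>\<Omega>\<in>sets M. 1 - \<gamma> \<le> measure M \<Omega> \<and>
          (\<forall>x\<in>\<Omega>. \<forall>j\<le>n. b * real j - \<gamma> * real n \<le> bsum f j x)"
        using \<Omega>m by blast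
    qed
  qed
qed

end

lemma ergodic_measure_system:
  assumes "ergodic_measure X g M"
  shows "ergodic_system M g"
proof (intro ergodic_system.intro ergodic_system_axioms.intro)
  note d = assms[unfolded ergodic_measure_def]
  show "prob_space M" "g \<in> measurable M M" "distr M M g = M" using d by blast+
  show "measure M A = 0 \<or> measure M A = 1" if "A \<in> sets M" "g -` A \<inter> space M = A" for A
      using d that by blast
qed

section \<open>Metric entropy from covers by dynamically small sets\<close>

lemma compact_inner_approx:
  fixes X :: "'a::euclidean_space set"
  assumes M: "prob_space M" and s: "sets M = sets (restrict_space borel X)" and X: "X \<in> sets borel"
    and A: "A \<in> sets M" and e: "(e::real) > 0"
  obtains K where "compact K" "K \<subseteq> A" "K \<in> sets M" "measure M (A - K) \<le> e"
proof -
  interpret prob_space M by (rule M)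
  have sp: "space M = X" using sets_eq_imp_space_eq[OF s] by (simp add: space_restrict_space)
  have sub: "sets M \<subseteq> sets borel" using s X by (auto simp: sets_restrict_space)
  \<comment> \<open>Inner regularity concerns Borel measures on the whole space, so the measure on
    \<open>X\<close> is pushed forward to it.\<close>
  define N where "N = distr M borel (\<lambda>x. x)"
  have mid: "(\<lambda>x. x) \<in> measurable M borel"

    using measurable_restrict_space1[of "\<lambda>x. x" borel borel X]
      by (simp add: measurable_cong_sets[OF s refl])
  have N: "emeasure N B = emeasure M (B \<inter> X)" if "B \<in> sets borel" for B
    unfolding N_def using that mid by (simp add: emeasure_distr sp)
  have sN: "sets N = sets borel" unfolding N_def by simp
  have fN: "emeasure N (space N) \<noteq> \<infinity>" using N[of UNIV] emeasure_space_1 sp unfolding N_def by simp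
  have AX: "A \<subseteq> X" using sets.sets_into_space[OF A] sp by simp
  have Ab: "A \<in> sets borel" using A sub by auto
  have "\<exists>K. compact K \<and> K \<subseteq> A \<and> emeasure N A < emeasure N K + ennreal e"
  proof (rule ccontr)
    assume "\<not> ?thesis"
    then have le: "emeasure N K + ennreal e \<le> emeasure N A" if "K \<subseteq> A" "compact K" for K
        using that by (auto simp: not_less)
    have "emeasure N A = (SUP K \<in> {K. K \<subseteq> A \<and> compact K}. emeasure N K)"
      by (rule inner_regular[OF sN fN Ab])
    also have "\<dots> \<le> emeasure N A - ennreal e"
      by (rule SUP_least) (use le in \<open>auto simp: ennreal_le_minus_iff add.commute\<close>)
    finally have "emeasure N A + ennreal e \<le> emeasure N A - ennreal e + ennreal e"
        by (rule add_right_mono)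
    also have "\<dots> = emeasure N A" using le[of "{}"] by (intro diff_add_cancel_ennreal) auto
    finally have "emeasure M A + ennreal e \<le> emeasure M A" using N[OF Ab] AX
        by (simp add: Int_absorb2)
    then have "ennreal (measure M A + e) \<le> ennreal (measure M A)" using e
        by (simp add: emeasure_eq_measure)
    then show False using e by (subst (asm) ennreal_le_iff) auto
  qed
  then obtain K where K: "compact K" "K \<subseteq> A" "emeasure N A < emeasure N K + ennreal e" by auto
  have Kb: "K \<in> sets borel" using K by (simp add: borel_compact)
  have KM: "K \<in> sets M" unfolding s sets_restrict_space using Kb K(2) AX
      by (auto simp: image_iff intro!: bexI[of _ K])
  have "ennreal (measure M A) < ennreal (measure M K + e)"
    using K(3) e N[OF Ab] N[OF Kb] AX K(2)
      by (simp add: Int_absorb2 emeasure_eq_measure order_trans[OF K(2) AX])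
  then have "measure M A < measure M K + e" by (subst (asm) ennreal_less_iff) auto
  moreover have "measure M (A - K) = measure M A - measure M K"
      by (rule finite_measure_Diff[OF A KM K(2)])
  ultimately show ?thesis using that[OF K(1,2) KM] by simp
qed

lemma disjoint_compacts_gap:
  fixes K :: "'i \<Rightarrow> 'a::heine_borel set"
  assumes "finite I" "\<And>i. i \<in> I \<Longrightarrow> compact (K i)" "\<And>i j. i \<in> I \<Longrightarrow> j \<in> I \<Longrightarrow> i \<noteq> j \<Longrightarrow> K i \<inter> K j = {}"
  obtains d where "d > 0" "\<And>i j x y. i \<in> I \<Longrightarrow> j \<in> I \<Longrightarrow> x \<in> K i \<Longrightarrow> y \<in> K j \<Longrightarrow> dist x y < d \<Longrightarrow> i = j"
proof -
  have "\<forall>p\<in>I\<times>I. \<exists>d>0. fst p \<noteq> snd p \<longrightarrow> (\<forall>x\<in>K (fst p). \<forall>y\<in>K (snd p). d \<le> dist x y)"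
  proof
    fix p assume p: "p \<in> I \<times> I"
    show "\<exists>d>0. fst p \<noteq> snd p \<longrightarrow> (\<forall>x\<in>K (fst p). \<forall>y\<in>K (snd p). d \<le> dist x y)"
    proof (cases "fst p = snd p")
      case False
      then show ?thesis using separate_compact_closed[of "K (fst p)" "K (snd p)"] assms(2)[of
          "fst p"] assms(2)[of "snd p"] assms(3)[of "fst p" "snd p"] p
        by (auto simp: compact_imp_closed)
    qed (auto intro: exI[of _ 1])
  qed
  from bchoice[OF this] obtain d
      where d': "\<forall>p\<in>I \<times> I. d p > 0 \<and> (fst p \<noteq> snd p \<longrightarrow>
      (\<forall>x\<in>K (fst p). \<forall>y\<in>K (snd p). d p \<le> dist x y))" by (rule exE)
  note d = bspec[OF d']
  define D where "D = Min (insert 1 (d ` (I \<times> I)))"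
  have fin: "finite (insert 1 (d ` (I \<times> I)))" using assms(1) by auto
  show ?thesis
  proof
    show "D > 0" unfolding D_def using fin d by (subst Min_gr_iff) auto
    fix i j x y assume a: "i \<in> I" "j \<in> I" "x \<in> K i" "y \<in> K j" "dist x y < D"
    show "i = j"
    proof (rule ccontr)
      assume "i \<noteq> j"
      then have "d (i, j) \<le> dist x y" using d[of "(i, j)"] a by auto
      moreover have "D \<le> d (i, j)" unfolding D_def using fin a by (intro Min_le) auto
      ultimately show False using a by linarith
    qed
  qed
qed

text \<open>The atoms of a partition are exhausted by disjoint compact sets up to small measure.
  Points that are close and both in the compact sets have the same label, so a cover by small sets
  determines the itinerary except at visits to the rest; there the label is spelled out, which costs
  little on average.\<close>

lemma metric_entropy_le_kraft:
  fixes X :: "'a::euclidean_space set" and g :: "'a \<Rightarrow> 'a" and \<pi> :: "real \<Rightarrow> 'a"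
      and G :: "real \<Rightarrow> real"
  assumes erg: "ergodic_measure X g M" and X: "X \<in> sets borel"
    and onto: "\<And>x. x \<in> X \<Longrightarrow> \<exists>t\<in>A. \<pi> t = x" and into: "\<And>t. t \<in> A \<Longrightarrow> \<pi> t \<in> X"
    and close: "\<And>s t i. s \<in> A \<Longrightarrow> t \<in> A \<Longrightarrow> dist ((g ^^ i) (\<pi> s)) ((g ^^ i) (\<pi> t)) \<le> \<bar>(G ^^ i) s
        - (G ^^ i) t\<bar>"
    and \<sigma>0: "\<sigma>0 > 0"
    and main: "\<And>\<sigma> e. 0 < \<sigma> \<Longrightarrow> \<sigma> < \<sigma>0 \<Longrightarrow> e > 0 \<Longrightarrow> \<exists>n0. \<forall>n\<ge>n0. \<exists>L. integrable M L \<and>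
       kraft_cover (dyn_small G n \<sigma>) A (\<lambda>t. L (\<pi> t)) \<and> (\<integral>x. L x \<partial>M) \<le> real n * (B + e)"
  shows "metric_entropy M g \<le> ereal B"
proof -
  from erg have M: "prob_space M" and s: "sets M = sets (restrict_space borel X)"
      and g: "g \<in> measurable M M"
    and inv: "distr M M g = M" unfolding ergodic_measure_def by auto
  interpret ergodic_system M g by (rule ergodic_measure_system[OF erg])
  have sp: "space M = X" using sets_eq_imp_space_eq[OF s] by (simp add: space_restrict_space)
  have "limsup (\<lambda>n. ereal (entropy (exp 1) (count_space (itinerary g \<xi> n ` space M))
      (itinerary g \<xi> n) / real n)) \<le> ereal B"
    if \<xi>: "simple_function M \<xi>" for \<xi> :: "'a \<Rightarrow> nat"
  proof (rule ereal_le_epsilon2)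
    fix e :: real assume e: "0 < e"
    define I where "I = \<xi> ` space M"
    have fI: "finite I" unfolding I_def using \<xi> by (rule simple_functionD)
    have I0: "I \<noteq> {}" unfolding I_def using not_empty by auto
    define e1 where "e1 = e / 3"
    \<comment> \<open>The labels share the mass that the letter for the compact sets, of weight
      \<open>exp (- e1)\<close>, leaves. A spelled label costs at most \<open>cz\<close> more, and
      \<open>e2\<close> makes the bad set so small that these extra costs are at most
      \<open>e1\<close> in the mean.\<close>
    define pr where "pr = (1 - exp (- e1)) / real (card I)"
    have cI: "real (card I) > 0" using fI I0 by (simp add: card_gt_0_iff)
    have e1: "e1 > 0" "pr > 0" using e cI unfolding e1_def pr_def by auto
    define cz where "cz = max 0 (- ln pr)"
    define e2 where "e2 = e1 / (cz + 1) / real (card I)"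
    have cz: "cz \<ge> 0" unfolding cz_def by simp
    have e2: "e2 > 0" unfolding e2_def using e1 cz cI by simp
    have "\<forall>v\<in>I. \<exists>K. compact K \<and> K \<subseteq> \<xi> -` {v} \<inter> space M \<and> K \<in> sets M \<and>
        measure M (\<xi> -` {v} \<inter> space M - K) \<le> e2"
    proof
      fix v
      obtain K where "compact K" "K \<subseteq> \<xi> -` {v} \<inter> space M" "K \<in> sets M"
          "measure M (\<xi> -` {v} \<inter> space M - K) \<le> e2"
        by (rule compact_inner_approx[OF M s X simple_functionD(2)[OF \<xi>] e2])
      then show "\<exists>K. compact K \<and> K \<subseteq> \<xi> -` {v} \<inter> space M \<and> K \<in> sets M \<and>
          measure M (\<xi> -` {v} \<inter> space M - K) \<le> e2" by blast
    qed
    from bchoice[OF this] obtain K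
        where K': "\<forall>v\<in>I. compact (K v) \<and> K v \<subseteq> \<xi> -` {v} \<inter> space M \<and> K v \<in> sets M \<and>
        measure M (\<xi> -` {v} \<inter> space M - K v) \<le> e2" by (rule exE)
    note K = bspec[OF K']
    obtain d where d: "d > 0" "\<And>i j x y. i \<in> I \<Longrightarrow> j \<in> I \<Longrightarrow> x \<in> K i \<Longrightarrow> y \<in> K j \<Longrightarrow> dist x y < d \<Longrightarrow> i = j"
      by (rule disjoint_compacts_gap[OF fI, of K]) (use K in blast)+
    define \<sigma> where "\<sigma> = min \<sigma>0 d / 2"
    have \<sigma>: "0 < \<sigma>" "\<sigma> < \<sigma>0" "\<sigma> < d" using \<sigma>0 d unfolding \<sigma>_def by auto
    define good where "good = (\<Union>v\<in>I. K v)"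
    have gM[measurable]: "good \<in> sets M" unfolding good_def using fI K by auto
    define bad where "bad = space M - good"
    have bM[measurable]: "bad \<in> sets M" unfolding bad_def by measurable
    have Pbad: "measure M bad \<le> e1 / (cz + 1)"
    proof -
      have "bad \<subseteq> (\<Union>v\<in>I. \<xi> -` {v} \<inter> space M - K v)" unfolding bad_def good_def I_def by auto
      then have "measure M bad \<le> measure M (\<Union>v\<in>I. \<xi> -` {v} \<inter> space M - K v)"
        using fI K simple_functionD(2)[OF \<xi>] by (intro finite_measure_mono sets.finite_UN) auto
      also have "\<dots> \<le> (\<Sum>v\<in>I. measure M (\<xi> -` {v} \<inter> space M - K v))"
        using fI K simple_functionD(2)[OF \<xi>] by (intro finite_measure_subadditive_finite) auto
      also have "\<dots> \<le> (\<Sum>v\<in>I. e2)" using K by (intro sum_mono) auto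
      also have "\<dots> = e1 / (cz + 1)" unfolding e2_def using cI by simp
      finally show ?thesis .
    qed
    \<comment> \<open>The symbol 0 says only that the point lies in one of the compact sets; the
      shift by \<open>Suc\<close> keeps real labels apart from it.\<close>
    define \<zeta> where "\<zeta> = (\<lambda>x. if x \<in> good then 0 else Suc (\<xi> x))"
    define C where "C = insert 0 (Suc ` I)"
    define p where "p = (\<lambda>c::nat. if c = 0 then exp (- e1) else pr)"
    define cost where "cost = (\<lambda>x. e1 + cz * indicator bad x)"
    have pC: "0 < p c" for c unfolding p_def using e1 by auto
    have psum: "(\<Sum>c\<in>C. p c) \<le> 1"
    proof -
      have "(\<Sum>c\<in>C. p c) = exp (- e1) + (\<Sum>c\<in>Suc ` I. p c)" unfolding C_def using fI
          by (subst sum.insert) (auto simp: p_def)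
      also have "(\<Sum>c\<in>Suc ` I. p c) = (\<Sum>c\<in>Suc ` I. pr)" by (intro sum.cong) (auto simp: p_def)
      also have "(\<Sum>c\<in>Suc ` I. pr) = real (card I) * pr" by (simp add: card_image)
      also have "\<dots> = 1 - exp (- e1)" unfolding pr_def using cI by simp
      finally show ?thesis by simp
    qed
    have pcost: "- ln (p (\<zeta> x)) \<le> cost x" if "x \<in> space M" for x
      using that e1 unfolding p_def \<zeta>_def cost_def bad_def cz_def by (auto simp: indicator_def)
    have icost: "integrable M cost" unfolding cost_def
      by (intro Bochner_Integration.integrable_add integrable_const integrable_mult_right
        integrable_real_indicator) (auto simp: emeasure_eq_measure)
    have Icost: "(\<integral>x. cost x \<partial>M) \<le> 2 * e1"
    proof -
      have "(\<integral>x. cost x \<partial>M) = e1 + cz * measure M bad"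
        unfolding cost_def by (subst Bochner_Integration.integral_add) (auto simp: prob_space
            emeasure_eq_measure)
      also have "\<dots> \<le> e1 + cz * (e1 / (cz + 1))" using Pbad cz
          by (intro add_mono mult_left_mono) auto
      also have "cz * (e1 / (cz + 1)) \<le> e1" using cz e1 by (simp add: field_simps)
      finally show ?thesis by simp
    qed
    obtain n0 where n0: "\<And>n. n \<ge> n0 \<Longrightarrow> \<exists>L. integrable M L \<and>
       kraft_cover (dyn_small G n \<sigma>) A (\<lambda>t. L (\<pi> t)) \<and> (\<integral>x. L x \<partial>M) \<le> real n * (B + e1)"
      using main[OF \<sigma>(1,2) e1(1)] by auto
    have bound: "entropy (exp 1) (count_space (itinerary g \<xi> n ` space M)) (itinerary g \<xi> n)
        / real n \<le> B + e" if n: "n \<ge> n0 + 1" for n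
    proof -
      obtain L where L: "integrable M L" "kraft_cover (dyn_small G n \<sigma>) A (\<lambda>t. L (\<pi> t))"
          "(\<integral>x. L x \<partial>M) \<le> real n * (B + e1)"
        using n0[of n] n by auto
      \<comment> \<open>The symbols of the times below \<open>m\<close> are constant on such sets;
        they are added one at a time by induction on \<open>m\<close>.\<close>
      define P where "P = (\<lambda>m B. B \<subseteq> A \<and> dyn_small G n \<sigma> B \<and>
          (\<forall>i<m. \<forall>s\<in>B. \<forall>t\<in>B. \<zeta> ((g ^^ i) (\<pi> s)) = \<zeta> ((g ^^ i) (\<pi> t))))"
      have gX: "(g ^^ i) (\<pi> t) \<in> space M" if "t \<in> A" for t i using gpow_space into[OF that] sp
          by simp
      have "kraft_cover (P m) A (\<lambda>t. L (\<pi> t) + bsum cost m (\<pi> t))" if "m \<le> n" for m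
        using that
      proof (induction m)
        case 0
        have "kraft_cover (P 0) (A \<inter> A) (\<lambda>t. L (\<pi> t))"
          by (rule kraft_cover_restrict[OF L(2)]) (auto simp: P_def dyn_small_def)
        then show ?case by (simp add: bsum_def)
      next
        case (Suc m)
        have "kraft_cover (\<lambda>B. P m B \<and> (\<forall>s\<in>B. \<forall>t\<in>B. \<zeta> ((g ^^ m) (\<pi> s)) = \<zeta> ((g ^^ m) (\<pi> t)))) A
           (\<lambda>t. L (\<pi> t) + bsum cost m (\<pi> t) - ln (p (\<zeta> ((g ^^ m) (\<pi> t)))))"
        proof (rule kraft_cover_refine[of _ _ _ C])
          show "kraft_cover (P m) A (\<lambda>t. L (\<pi> t) + bsum cost m (\<pi> t))" using Suc by simp
          show "P m B'" if "P m B" "B' \<subseteq> B" for B B' using that unfolding P_def dyn_small_def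
              by blast
          show "\<zeta> ((g ^^ m) (\<pi> t)) \<in> C" if "t \<in> A" for t using gX[OF that, of m]
              unfolding \<zeta>_def C_def I_def by auto
          show "finite C" unfolding C_def using fI by simp
        qed (rule pC, rule psum)
        then show ?case
        proof (rule kraft_cover_mono)
          fix t assume t: "t \<in> A"
          show "t \<in> A \<and> L (\<pi> t) + bsum cost m (\<pi> t) - ln (p (\<zeta> ((g ^^ m) (\<pi> t)))) \<le> L (\<pi> t)
              + bsum cost (Suc m) (\<pi> t)"
            using pcost[OF gX[OF t, of m]] t by (simp add: bsum_def)
        next
          show "P (Suc m) B" if "P m B \<and> (\<forall>s\<in>B. \<forall>t\<in>B. \<zeta> ((g ^^ m) (\<pi> s)) = \<zeta> ((g ^^ m) (\<pi> t)))"
              for B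
            using that unfolding P_def less_Suc_eq by blast
        qed
      qed
      from this[OF order_refl] obtain \<B> w where b: "finite \<B>" "\<And>B. B \<in> \<B> \<Longrightarrow> P n B" "\<And>B. B \<in> \<B> \<Longrightarrow>
          0 \<le> w B" "(\<Sum>B\<in>\<B>. w B) \<le> 1"
        "\<And>t. t \<in> A \<Longrightarrow> \<exists>B\<in>\<B>. t \<in> B \<and> exp (- (L (\<pi> t) + bsum cost n (\<pi> t))) \<le> w B"
        by (rule kraft_coverE) blast
      have same: "itinerary g \<xi> n (\<pi> s) = itinerary g \<xi> n (\<pi> t)" if "B \<in> \<B>" "s \<in> B" "t \<in> B"
          for B s t
      proof -
        have PB: "P n B" using b(2) that by auto
        then have sA: "s \<in> A" "t \<in> A" using that unfolding P_def by auto
        have "\<xi> ((g ^^ i) (\<pi> s)) = \<xi> ((g ^^ i) (\<pi> t))" if i: "i < n" for i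
        proof -
          have z: "\<zeta> ((g ^^ i) (\<pi> s)) = \<zeta> ((g ^^ i) (\<pi> t))" using PB i \<open>s \<in> B\<close> \<open>t \<in> B\<close>
              unfolding P_def by blast
          show ?thesis
          proof (cases "(g ^^ i) (\<pi> s) \<in> good")
            case True
            then have "(g ^^ i) (\<pi> t) \<in> good" using z unfolding \<zeta>_def by (auto split: if_splits)
            with True obtain v v'
                where v: "v \<in> I" "v' \<in> I" "(g ^^ i) (\<pi> s) \<in> K v" "(g ^^ i) (\<pi> t) \<in> K v'"
                unfolding good_def by auto
            have "\<bar>(G ^^ i) s - (G ^^ i) t\<bar> \<le> \<sigma>" using PB i \<open>s \<in> B\<close> \<open>t \<in> B\<close>
                unfolding P_def dyn_small_def by blast
            then have "dist ((g ^^ i) (\<pi> s)) ((g ^^ i) (\<pi> t)) < d" using close[OF sA, of i] \<sigma>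
                by linarith
            then have "v = v'" using d(2) v by blast
            then show ?thesis using K[OF v(1)] v(3,4) by blast
          next
            case False
            then show ?thesis using z unfolding \<zeta>_def by (auto split: if_splits)
          qed
        qed
        then show ?thesis unfolding itinerary_def by simp
      qed
      \<comment> \<open>The weight of an itinerary is the total weight of the sets that carry it. By
        \<open>same\<close> every nonempty set carries exactly one, so the weights still have sum at
        most 1.\<close>
      define q where "q = (\<lambda>v. \<Sum>B\<in>{B\<in>\<B>. \<exists>t\<in>B. itinerary g \<xi> n (\<pi> t) = v}. w B)"
      have si: "simple_function M (itinerary g \<xi> n)"
      proof -
        have sg: "simple_function M (\<lambda>x. \<xi> ((g ^^ i) x))" for i
          unfolding simple_function_def
        proof
          have "(\<lambda>x. \<xi> ((g ^^ i) x)) ` space M \<subseteq> I" unfolding I_def using gpow_space by auto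
          then show "finite ((\<lambda>x. \<xi> ((g ^^ i) x)) ` space M)" using fI finite_subset by auto
          have "(\<lambda>x. \<xi> ((g ^^ i) x)) -` {y} \<inter> space M
              = (g ^^ i) -` (\<xi> -` {y} \<inter> space M) \<inter> space M" for y
            using gpow_space by auto
          then show "\<forall>y\<in>(\<lambda>x. \<xi> ((g ^^ i) x)) ` space M. (\<lambda>x. \<xi> ((g ^^ i) x)) -` {y} \<inter> space M \<in>
              sets M"
            using measurable_sets[OF gpow simple_functionD(2)[OF \<xi>]] by simp
        qed
        have "simple_function M (\<lambda>x. itinerary g \<xi> m x)" for m
        proof (induction m)
          case (Suc m)
          have "simple_function M (\<lambda>x. itinerary g \<xi> m x @ [\<xi> ((g ^^ m) x)])"
            by (rule simple_function_compose2[OF Suc sg])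
          then show ?case by (simp add: itinerary_def)
        qed (simp add: itinerary_def)
        then show ?thesis .
      qed
      have "entropy (exp 1) (count_space (itinerary g \<xi> n ` space M)) (itinerary g \<xi> n)
          \<le> (\<integral>x. L x + bsum cost n x \<partial>M)"
      proof (rule entropy_le_code_length[OF M si, of q])
        show "0 \<le> q v" for v unfolding q_def using b(3) by (intro sum_nonneg) auto
        have fin: "finite (itinerary g \<xi> n ` space M)" using si by (rule simple_functionD)
        have "(\<Sum>v\<in>itinerary g \<xi> n ` space M. q v)
            = (\<Sum>v\<in>itinerary g \<xi> n ` space M. \<Sum>B\<in>\<B>. if \<exists>t\<in>B. itinerary g \<xi> n (\<pi> t) = v then w B
            else 0)"
          unfolding q_def using b(1) by (intro sum.cong refl sum.inter_filter)
        also have "\<dots> = (\<Sum>B\<in>\<B>. \<Sum>v\<in>itinerary g \<xi> n ` space M. if \<exists>t\<in>B. itinerary g \<xi> n (\<pi> t)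
            = v then w B else 0)"
          by (rule sum.swap)
        also have "\<dots> \<le> (\<Sum>B\<in>\<B>. w B)"
        proof (rule sum_mono)
          fix B assume B: "B \<in> \<B>"
          show "(\<Sum>v\<in>itinerary g \<xi> n ` space M. if \<exists>t\<in>B. itinerary g \<xi> n (\<pi> t) = v then w B else 0)
              \<le> w B"
          proof (cases "B = {}")
            case True
            then show ?thesis using b(3)[OF B] by simp
          next
            case False
            then obtain s where sB: "s \<in> B" by auto
            have "(\<Sum>v\<in>itinerary g \<xi> n ` space M. if \<exists>t\<in>B. itinerary g \<xi> n (\<pi> t) = v then w B else 0)
               = (\<Sum>v\<in>itinerary g \<xi> n ` space M. if v = itinerary g \<xi> n (\<pi> s) then w B else 0)"
              using same[OF B sB] sB by (intro sum.cong refl if_cong) metis+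
            also have "\<dots> \<le> w B" using fin b(3)[OF B] by (simp add: sum.delta)
            finally show ?thesis .
          qed
        qed
        finally show "(\<Sum>v\<in>itinerary g \<xi> n ` space M. q v) \<le> 1" using b(4) by linarith
        show "integrable M (\<lambda>x. L x + bsum cost n x)" using L(1) integral_bsum(2)[OF icost] by auto
        fix x assume "x \<in> space M"
        then obtain t where t: "t \<in> A" "\<pi> t = x" using onto sp by auto
        then obtain B where B: "B \<in> \<B>" "t \<in> B" "exp (- (L x + bsum cost n x)) \<le> w B" using b(5)
            by blast
        have "w B \<le> q (itinerary g \<xi> n x)" unfolding q_def using B t b by (intro member_le_sum) auto
        then show "exp (- (L x + bsum cost n x)) \<le> q (itinerary g \<xi> n x)" using B(3) by linarith
      qed
      also have "\<dots> = (\<integral>x. L x \<partial>M) + real n * (\<integral>x. cost x \<partial>M)"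
        using L(1) integral_bsum[OF icost] by simp
      also have "\<dots> \<le> real n * (B + e1) + real n * (2 * e1)" using L(3) Icost
          by (intro add_mono mult_left_mono) auto
      also have "\<dots> = real n * (B + e)" unfolding e1_def by (simp add: algebra_simps)
      finally show ?thesis using n by (simp add: field_simps)
    qed
    have "limsup (\<lambda>n. ereal (entropy (exp 1) (count_space (itinerary g \<xi> n ` space M))
        (itinerary g \<xi> n) / real n)) \<le> ereal (B + e)"
      by (rule Limsup_bounded) (auto simp: eventually_sequentially intro!: exI[of _ "n0 + 1"] bound)
    then show "limsup (\<lambda>n. ereal (entropy (exp 1) (count_space (itinerary g \<xi> n ` space M))
        (itinerary g \<xi> n) / real n)) \<le> ereal B + ereal e" by simp
  qed
  then show ?thesis unfolding metric_entropy_def by (intro SUP_least) auto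
qed

section \<open>Lifts of interval and circle maps\<close>

text \<open>What interval (\<open>lam = 1\<close>) and circle (\<open>lam = 2 * pi\<close>) have in
  common, so that both are treated at once. \<open>{0..lam}\<close> is a fundamental interval,
  \<open>shift\<close> encodes deck transformations, which are trivial for the interval, and the
  factors 2 compare arc with chord.\<close>

locale arc =
  fixes I :: "'a::euclidean_space one_dim" and lam :: real
  assumes convS: "convex (pdom I)" and closedS: "closed (pdom I)"
      and lam: "1 \<le> lam" "{0..lam} \<subseteq> pdom I"
    and onto: "\<And>t. t \<in> pdom I \<Longrightarrow> \<exists>s\<in>{0..lam}. param I s = param I t"
    and dist_le: "\<And>s t. s \<in> pdom I \<Longrightarrow> t \<in> pdom I \<Longrightarrow> dist (param I s) (param I t) \<le> \<bar>s - t\<bar>"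
    and near: "\<And>s t. s \<in> pdom I \<Longrightarrow> t \<in> pdom I \<Longrightarrow> \<bar>s - t\<bar> \<le> 1 \<Longrightarrow>
        \<bar>s - t\<bar> \<le> 2 * dist (param I s) (param I t)"
    and local_lift: "\<And>s t. s \<in> pdom I \<Longrightarrow> t \<in> pdom I \<Longrightarrow>
      \<exists>t'\<in>pdom I. param I t' = param I t \<and> \<bar>s - t'\<bar> \<le> 2 * dist (param I s) (param I t)"
    and shift: "\<And>s t a. s \<in> pdom I \<Longrightarrow> t \<in> pdom I \<Longrightarrow> t + a \<in> pdom I \<Longrightarrow> param I s = param I t \<Longrightarrow>
      s + a \<in> pdom I \<and> param I (s + a) = param I (t + a)"
    and cyclic_dist: "\<And>s t. s \<in> {0..lam} \<Longrightarrow> t \<in> {0..lam} \<Longrightarrow>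
        min \<bar>s - t\<bar> (lam - \<bar>s - t\<bar>) \<le> 2 * dist (param I s) (param I t)"
    and lift_diff: "\<And>g G H. is_lift I g G \<Longrightarrow> is_lift I g H \<Longrightarrow> \<exists>c. \<forall>t\<in>pdom I. G t = H t + c"
    and nth_deriv_eq: "\<And>g G s t k. is_lift I g G \<Longrightarrow> s \<in> pdom I \<Longrightarrow> t \<in> pdom I \<Longrightarrow>
        param I s = param I t \<Longrightarrow> 1 \<le> k \<Longrightarrow>
      nth_deriv (pdom I) k G s = nth_deriv (pdom I) k G t"
    and lift_into: "\<And>g G t. is_lift I g G \<Longrightarrow> g \<in> points I \<rightarrow> points I \<Longrightarrow> t \<in> pdom I \<Longrightarrow> G t \<in> pdom I"

context arc
begin

abbreviation "S \<equiv> pdom I"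
abbreviation "\<pi> \<equiv> param I"

lemma points_eq: "points I = \<pi> ` {0..lam}"
proof
  show "points I \<subseteq> \<pi> ` {0..lam}"
  proof
    fix x assume "x \<in> points I"
    then obtain t where "t \<in> S" "\<pi> t = x" unfolding points_def by auto
    then show "x \<in> \<pi> ` {0..lam}" using onto[of t] by (metis image_eqI)
  qed
qed (use lam(2) in \<open>auto simp: points_def\<close>)

lemma points_compact: "compact (points I)"
proof -
  have "continuous_on {0..lam} \<pi>"
    unfolding continuous_on_iff
  proof (intro ballI allI impI)
    fix s e :: real assume s: "s \<in> {0..lam}" and e: "0 < e"
    have "dist (\<pi> t) (\<pi> s) < e" if "t \<in> {0..lam}" "dist t s < e" for t
      using dist_le[OF subsetD[OF lam(2) that(1)] subsetD[OF lam(2) s]] that(2)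
        by (simp add: dist_real_def)
    then show "\<exists>d>0. \<forall>t\<in>{0..lam}. dist t s < d \<longrightarrow> dist (\<pi> t) (\<pi> s) < e" using e by blast
  qed
  then show ?thesis unfolding points_eq by (intro compact_continuous_image) auto
qed

lemma nth_deriv_diff:
  assumes "\<And>t. t \<in> S \<Longrightarrow> G t = H t + c" "1 \<le> k" "t \<in> S"
  shows "nth_deriv S k G t = nth_deriv S k H t"
  using assms(2,3)
proof (induction k arbitrary: t rule: nat_induct_at_least)
  case base
  have "vector_derivative G (at t within S) = vector_derivative (\<lambda>t. H t + c) (at t within S)"
    by (rule vector_derivative_within_cong[OF base assms(1)])
  also have "\<dots> = vector_derivative H (at t within S)"
    unfolding vector_derivative_def by (simp add: has_vector_derivative_add_const)
  finally show ?case by simp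
next
  case (Suc k)
  show ?case unfolding nth_deriv.simps by (rule vector_derivative_within_cong[OF Suc.prems Suc.IH])
qed

lemma some_lift: "is_lift I g G \<Longrightarrow> is_lift I g (some_lift I g)"
  unfolding some_lift_def by (rule someI[of "is_lift I g" G])

lemma some_lift_nth_deriv:
  assumes "is_lift I g G" "1 \<le> k" "t \<in> S"
  shows "nth_deriv S k (some_lift I g) t = nth_deriv S k G t"
  using lift_diff[OF some_lift[OF assms(1)] assms(1)] nth_deriv_diff assms(2,3) by blast

lemma gderiv_lift:
  assumes "is_lift I g G" "t \<in> S"
  shows "gderiv I g (\<pi> t) = nth_deriv S 1 G t"
proof -
  define s where "s = (SOME s. s \<in> S \<and> \<pi> s = \<pi> t)"
  have "s \<in> S \<and> \<pi> s = \<pi> t" unfolding s_def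
      by (rule someI[where P="\<lambda>s. s \<in> S \<and> \<pi> s = \<pi> t" and x=t]) (use assms(2) in simp)
  then have s: "s \<in> S" "\<pi> s = \<pi> t" by auto
  have "gderiv I g (\<pi> t) = nth_deriv S 1 (some_lift I g) s" unfolding gderiv_def s_def ..
  also have "\<dots> = nth_deriv S 1 G s" by (rule some_lift_nth_deriv[OF assms(1) _ s(1)]) simp
  also have "\<dots> = nth_deriv S 1 G t" by (rule nth_deriv_eq[OF assms(1) s(1) assms(2) s(2)]) simp
  finally show ?thesis .
qed

lemma lift_eq: "is_lift I g G \<Longrightarrow> t \<in> S \<Longrightarrow> \<pi> (G t) = g (\<pi> t)"
  unfolding is_lift_def by auto

lemma lift_funpow:
  assumes G: "is_lift I g G" and g: "g \<in> points I \<rightarrow> points I"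
  shows "t \<in> S \<Longrightarrow> (G ^^ n) t \<in> S" "t \<in> S \<Longrightarrow> \<pi> ((G ^^ n) t) = (g ^^ n) (\<pi> t)"
      "is_lift I (g ^^ n) (G ^^ n)"
proof -
  show 1: "t \<in> S \<Longrightarrow> (G ^^ n) t \<in> S" for t n by (induction n) (auto intro: lift_into[OF G g])
  show 2: "t \<in> S \<Longrightarrow> \<pi> ((G ^^ n) t) = (g ^^ n) (\<pi> t)" for t n
      by (induction n) (auto simp: lift_eq[OF G] 1)
  have c: "continuous_on S G" using G unfolding is_lift_def by auto
  have "continuous_on S (G ^^ n)"
  proof (induction n)
    case (Suc n)
    then show ?case using continuous_on_compose[OF Suc continuous_on_subset[OF c]] 1
        by (auto simp: image_subset_iff)
  qed (simp add: id_def)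
  then show "is_lift I (g ^^ n) (G ^^ n)" unfolding is_lift_def using 2 by auto
qed

lemma funpow_points: "g \<in> points I \<rightarrow> points I \<Longrightarrow> g ^^ n \<in> points I \<rightarrow> points I"
  by (induction n) auto

text \<open>The parameter domain of the circle is not compact. A pair of near points is translated
  so that the first one lies in the fundamental interval; a margin of length 1 then contains the
  second.\<close>

lemma invariant_uniformly_continuous:
  fixes v :: "real \<Rightarrow> real"
  assumes c: "continuous_on S v" and i: "\<And>s t. s \<in> S \<Longrightarrow> t \<in> S \<Longrightarrow> \<pi> s = \<pi> t \<Longrightarrow> v s = v t" and e: "e > 0"
  obtains d where "d > 0" "\<And>s t. s \<in> S \<Longrightarrow> t \<in> S \<Longrightarrow> \<bar>s - t\<bar> < d \<Longrightarrow> \<bar>v s - v t\<bar> < e"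
proof -
  define T where "T = S \<inter> {-1..lam + 1}"
  have "compact T" unfolding T_def using closedS by (simp add: closed_Int_compact)
  moreover have "continuous_on T v" by (rule continuous_on_subset[OF c]) (auto simp: T_def)
  ultimately have "uniformly_continuous_on T v" by (intro compact_uniformly_continuous)
  then obtain d where d: "d > 0" "\<And>s t. s \<in> T \<Longrightarrow> t \<in> T \<Longrightarrow> \<bar>t - s\<bar> < d \<Longrightarrow> \<bar>v t - v s\<bar> < e"
    using e unfolding uniformly_continuous_on_def dist_real_def by metis
  show ?thesis
  proof
    show "min d 1 > 0" using d by simp
    fix s t assume st: "s \<in> S" "t \<in> S" "\<bar>s - t\<bar> < min d 1"
    obtain s0 where s0: "s0 \<in> {0..lam}" "\<pi> s0 = \<pi> s" using onto st by blast
    have s0S: "s0 \<in> S" using s0 lam by auto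
    have t0: "s0 + (t - s) \<in> S" "\<pi> (s0 + (t - s)) = \<pi> t"
      using shift[OF s0S st(1), of "t - s"] st(2) s0(2) by auto
    have "\<bar>v s0 - v (s0 + (t - s))\<bar> < e"
      by (rule d(2)) (use st s0 s0S t0 in \<open>auto simp: T_def\<close>)
    then show "\<bar>v s - v t\<bar> < e" using i[OF s0S st(1) s0(2)] i[OF t0(1) st(2) t0(2)] by simp
  qed
qed

lemma invariant_bounded:
  fixes v :: "real \<Rightarrow> real"
  assumes c: "continuous_on S v" and i: "\<And>s t. s \<in> S \<Longrightarrow> t \<in> S \<Longrightarrow> \<pi> s = \<pi> t \<Longrightarrow> v s = v t"
  obtains B where "\<And>s. s \<in> S \<Longrightarrow> \<bar>v s\<bar> \<le> B"
proof -
  have "compact (v ` {0..lam})" using c lam(2)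
      by (intro compact_continuous_image continuous_on_subset[OF c]) auto
  then have "bounded (v ` {0..lam})" by (rule compact_imp_bounded)
  then obtain B where B: "\<And>y. y \<in> v ` {0..lam} \<Longrightarrow> \<bar>y\<bar> \<le> B" unfolding bounded_iff by auto
  show ?thesis
  proof
    fix s assume s: "s \<in> S"
    then obtain s0 where "s0 \<in> {0..lam}" "\<pi> s0 = \<pi> s" using onto by blast
    then show "\<bar>v s\<bar> \<le> B" using B[of "v s0"] i[of s0 s] s lam(2) by auto
  qed
qed

text \<open>Choose the lift of \<open>g\<close> that is near \<open>F\<close> at 0. By
  \<open>near\<close> the continuous function \<bar>F - G\<bar> takes no value between 2 \<rho> and
  1, so by connectedness it stays below the gap.\<close>

lemma near_lift:
  assumes F: "is_lift I f F" and G0: "is_lift I g G0" and f: "f \<in> points I \<rightarrow> points I"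
      and g: "g \<in> points I \<rightarrow> points I"
    and d: "\<And>x. x \<in> points I \<Longrightarrow> dist (f x) (g x) \<le> \<rho>" and \<rho>: "2 * \<rho> < 1"
  obtains G where "is_lift I g G" "\<And>t. t \<in> S \<Longrightarrow> \<bar>F t - G t\<bar> \<le> 2 * \<rho>"
proof -
  have 0: "0 \<in> S" using lam by auto
  have FS: "F t \<in> S" and G0S: "G0 t \<in> S" if "t \<in> S" for t
      using lift_into[OF F f that] lift_into[OF G0 g that] by auto
  have pd: "dist (\<pi> (F t)) (\<pi> (G0 t)) \<le> \<rho>" if "t \<in> S" for t
    using d[of "\<pi> t"] that lift_eq[OF F that] lift_eq[OF G0 that] unfolding points_def by auto
  obtain t' where t': "t' \<in> S" "\<pi> t' = \<pi> (G0 0)" "\<bar>F 0 - t'\<bar> \<le> 2 * dist (\<pi> (F 0)) (\<pi> (G0 0))"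
    using local_lift[OF FS[OF 0] G0S[OF 0]] by blast
  define c where "c = t' - G0 0"
  define G where "G = (\<lambda>t. G0 t + c)"
  have GS: "G t \<in> S \<and> \<pi> (G t) = \<pi> (G0 t)" if "t \<in> S" for t
    using shift[OF t'(1) G0S[OF 0], of "G0 t - G0 0"] G0S[OF that] t'(2) unfolding G_def c_def
      by (auto simp: algebra_simps)
  have lG: "is_lift I g G" unfolding is_lift_def
  proof
    show "continuous_on S G" unfolding G_def using G0
        by (auto simp: is_lift_def intro!: continuous_intros)
    show "\<forall>t\<in>S. \<pi> (G t) = g (\<pi> t)" using GS lift_eq[OF G0] by auto
  qed
  have dich: "\<bar>F t - G t\<bar> \<le> 2 * \<rho>" if "t \<in> S" "\<bar>F t - G t\<bar> \<le> 1" for t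
    using near[OF FS[OF that(1)] _ that(2)] GS[OF that(1)] pd[OF that(1)] by auto
  have "\<bar>F t - G t\<bar> \<le> 2 * \<rho>" if t: "t \<in> S" for t
  proof (rule ccontr)
    assume n: "\<not> ?thesis"
    have "continuous_on S (\<lambda>t. \<bar>F t - G t\<bar>)" using F lG
        by (auto simp: is_lift_def intro!: continuous_intros)
    then have con: "connected ((\<lambda>t. \<bar>F t - G t\<bar>) ` S)"
        by (intro connected_continuous_image convex_connected convS)
    have a0: "\<bar>F 0 - G 0\<bar> \<le> 2 * \<rho>" using t'(3) pd[OF 0] unfolding G_def c_def by auto
    have b0: "\<bar>F t - G t\<bar> > 1" using dich[OF t] n by linarith
    define y where "y = (2 * \<rho> + 1) / 2"
    have y: "2 * \<rho> < y" "y < 1" using \<rho> unfolding y_def by auto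
    have "y \<in> (\<lambda>t. \<bar>F t - G t\<bar>) ` S"
      by (rule connectedD_interval[OF con, of "\<bar>F 0 - G 0\<bar>" "\<bar>F t - G t\<bar>"]) (use 0 t a0 b0 y in
        auto)
    then obtain s where "s \<in> S" "\<bar>F s - G s\<bar> = y" by auto
    then show False using dich[of s] y by auto
  qed
  then show ?thesis using that[OF lG] by blast
qed

end

section \<open>Horseshoes and lower semicontinuity of entropy\<close>

text \<open>Take the first point behind \<open>p\<close> with value \<open>d\<close>, then the last
  point before it with value \<open>c\<close>: in between the values cannot leave
  \<open>{c..d}\<close>. If \<open>d\<close> is attained to the left of \<open>c\<close>, pass to
  the negative function.\<close>

lemma interval_preimage:
  fixes f :: "real \<Rightarrow> real"
  assumes "continuous_on {a..b} f" "c \<le> d" "{c..d} \<subseteq> f ` {a..b}"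
  obtains x y where "x \<le> y" "{x..y} \<subseteq> {a..b}" "f ` {x..y} = {c..d}"
proof -
  have *: "\<exists>x y. x \<le> y \<and> {x..y} \<subseteq> {a..b} \<and> f ` {x..y} = {c..d}"
    if cont: "continuous_on {a..b} f" and cd: "c \<le> d"
        and pq: "p \<in> {a..b}" "q \<in> {a..b}" "f p = c" "f q = d" "p \<le> q"
    for f :: "real \<Rightarrow> real" and c d p q
  proof -
    have cpq: "continuous_on {s..t} f" if "p \<le> s" "t \<le> q" for s t
      by (rule continuous_on_subset[OF cont]) (use that pq in auto)
    define B where "B = {t\<in>{p..q}. f t = d}"
    have cB: "closed B" unfolding B_def using continuous_closed_preimage_constant[OF cpq] by simp
    have "B \<noteq> {}" "bdd_below B" unfolding B_def using pq by (auto intro!: bdd_belowI[of _ p])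
    then have "Inf B \<in> B" using cB by (intro closed_contains_Inf)
    define y where "y = Inf B"
    have y: "p \<le> y" "y \<le> q" "f y = d" using \<open>Inf B \<in> B\<close> unfolding y_def B_def by auto
    have y2: "f t \<noteq> d" if "p \<le> t" "t < y" for t
    proof
      assume "f t = d"
      then have "t \<in> B" using that y unfolding B_def by auto
      then have "y \<le> t" unfolding y_def by (rule cInf_lower) (rule \<open>bdd_below B\<close>)
      then show False using that by simp
    qed
    define A where "A = {t\<in>{p..y}. f t = c}"
    have cA: "closed A" unfolding A_def
        using continuous_closed_preimage_constant[OF cpq, of p y] y by simp
    have "A \<noteq> {}" "bdd_above A" unfolding A_def using pq y by (auto intro!: bdd_aboveI[of _ y])
    then have "Sup A \<in> A" using cA by (intro closed_contains_Sup)
    define x where "x = Sup A"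
    have x: "p \<le> x" "x \<le> y" "f x = c" using \<open>Sup A \<in> A\<close> unfolding x_def A_def by auto
    have x2: "f t \<noteq> c" if "x < t" "t \<le> y" for t
    proof
      assume "f t = c"
      then have "t \<in> A" using that x unfolding A_def by auto
      then have "t \<le> x" unfolding x_def by (rule cSup_upper) (rule \<open>bdd_above A\<close>)
      then show False using that by simp
    qed
    have in1: "f t \<in> {c..d}" if t: "x \<le> t" "t \<le> y" for t
    proof (rule ccontr)
      assume n: "f t \<notin> {c..d}"
      then have "x < t" "t < y" using t x y cd by (auto simp: less_le)
      consider "f t < c" | "f t > d" using n by fastforce
      then show False
      proof cases
        case 1
        then obtain s where "t \<le> s" "s \<le> y" "f s = c" using IVT'[of f t c y] y cd t cpq[of t y] x
            by auto
        then show False using x2[of s] \<open>x < t\<close> by auto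
      next
        case 2
        then obtain s where "x \<le> s" "s \<le> t" "f s = d" using IVT'[of f x d t] x cd t cpq[of x t] y
            by auto
        then show False using y2[of s] \<open>t < y\<close> x by auto
      qed
    qed
    have in2: "z \<in> f ` {x..y}" if zcd: "z \<in> {c..d}" for z
    proof -
      obtain t where "x \<le> t" "t \<le> y" "f t = z" using IVT'[of f x z y] zcd x y cpq[of x y] by auto
      then show ?thesis by auto
    qed
    have "f ` {x..y} = {c..d}" using in1 in2 by (intro equalityI subsetI) auto
    then show ?thesis using x y pq by (intro exI[of _ x] exI[of _ y]) auto
  qed
  obtain p q where pq: "p \<in> {a..b}" "q \<in> {a..b}" "f p = c" "f q = d"
  proof -
    have "c \<in> f ` {a..b}" "d \<in> f ` {a..b}" using assms(2,3) by auto
    then show ?thesis using that by (elim imageE) blast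
  qed
  show ?thesis
  proof (cases "p \<le> q")
    case True
    then show ?thesis using *[OF assms(1,2) pq True] that by blast
  next
    case False
    have "\<exists>x y. x \<le> y \<and> {x..y} \<subseteq> {a..b} \<and> (\<lambda>t. - f t) ` {x..y} = {-d..-c}"
      by (rule *[of _ "-d" "-c" q p]) (use assms pq False in \<open>auto intro!: continuous_intros\<close>)
    then obtain x y where xy: "x \<le> y" "{x..y} \<subseteq> {a..b}" "(\<lambda>t. - f t) ` {x..y} = {-d..-c}" by blast
    have "f ` {x..y} = uminus ` ((\<lambda>t. - f t) ` {x..y})" by (simp add: image_image)
    also have "\<dots> = {c..d}" unfolding xy(3) by simp
    finally show ?thesis using that xy by blast
  qed
qed

text \<open>The setting for Misiurewicz's construction: \<phi> is an iterate of the map, and the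
  circle or interval is cut into \<open>3 * Q'\<close> cells, so short that images of cells have
  length at most 1/4. The number of cells is divisible by 3 so that residues modulo 3 are also
  consistent across the point where the circle closes up.\<close>

locale cells = arc I lam for I :: "'a::euclidean_space one_dim" and lam :: real +
  fixes \<phi> :: "'a \<Rightarrow> 'a" and \<Phi> :: "real \<Rightarrow> real" and LL :: real and Q' :: nat
  assumes \<Phi>: "is_lift I \<phi> \<Phi>" and \<phi>: "\<phi> \<in> points I \<rightarrow> points I"
    and LL: "LL \<ge> 1" "\<And>s t. s \<in> pdom I \<Longrightarrow> t \<in> pdom I \<Longrightarrow> \<bar>\<Phi> s - \<Phi> t\<bar> \<le> LL * \<bar>s - t\<bar>"
    and Q': "1 \<le> Q'" "LL * (lam / real (3 * Q')) \<le> 1 / 4"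
begin

definition "Q = 3 * Q'"
definition len :: real where "len = lam / real Q"
definition cell :: "nat \<Rightarrow> real set" where "cell c = {real c * len .. real (Suc c) * len}"
text \<open>The part of the image of \<open>J\<close> in one cell, brought back to the fundamental
  interval by comparing projections.\<close>

definition child :: "real set \<Rightarrow> nat \<Rightarrow> real set" where
  "child J c = {s \<in> cell c. \<exists>t\<in>J. \<pi> s = \<pi> (\<Phi> t)}"
definition piece :: "real set \<Rightarrow> bool" where
  "piece J \<longleftrightarrow> (\<exists>x y c. c < Q \<and> x \<le> y \<and> J = {x..y} \<and> J \<subseteq> cell c)"

lemma len: "0 < len" "len \<le> 1/4" "LL * len \<le> 1/4" "real Q * len = lam" "Q > 0"
proof -
  show "Q > 0" unfolding Q_def using Q' by simp
  then show l: "0 < len" "real Q * len = lam" unfolding len_def using lam by auto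
  show "LL * len \<le> 1/4" using Q'(2) unfolding len_def Q_def .
  moreover have "1 * len \<le> LL * len" using LL l by (intro mult_right_mono) auto
  ultimately show "len \<le> 1/4" by simp
qed

lemma cell_sub: "c < Q \<Longrightarrow> cell c \<subseteq> {0..lam}"
proof -
  assume c: "c < Q"
  have "real (Suc c) * len \<le> real Q * len" using c len by (intro mult_right_mono) auto
  then show ?thesis unfolding cell_def using len by auto
qed

lemma cell_S: "c < Q \<Longrightarrow> cell c \<subseteq> S"
  using cell_sub lam(2) by blast

lemma cell_diam: "s \<in> cell c \<Longrightarrow> t \<in> cell c \<Longrightarrow> \<bar>s - t\<bar> \<le> len"
  unfolding cell_def by (auto simp: algebra_simps abs_le_iff)

lemma cell_cover: "s \<in> {0..lam} \<Longrightarrow> \<exists>c<Q. s \<in> cell c"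
proof (cases "s = lam")
  case True
  have e: "lam = real (Suc (Q - 1)) * len" using len by simp
  have "real (Q - 1) * len \<le> real (Suc (Q - 1)) * len" using len by (intro mult_right_mono) auto
  then have "lam \<in> cell (Q - 1)" unfolding cell_def using e by simp
  then show ?thesis using True len by (intro exI[of _ "Q - 1"]) auto
next
  case False
  assume s: "s \<in> {0..lam}"
  define c where "c = nat \<lfloor>s / len\<rfloor>"
  have "0 \<le> s / len" using s len by auto
  then have c: "real c \<le> s / len" "s / len < real c + 1" unfolding c_def by linarith+
  then have "s \<in> cell c" unfolding cell_def using len by (auto simp: field_simps)
  moreover have "real c < real Q"
  proof -
    have "s / len < lam / len" using s False len by (intro divide_strict_right_mono) auto
    also have "lam / len = real Q" using len by (simp add: field_simps)
    finally show ?thesis using c by linarith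
  qed
  ultimately show ?thesis by auto
qed

lemma \<Phi>S: "t \<in> S \<Longrightarrow> \<Phi> t \<in> S"
  by (rule lift_into[OF \<Phi> \<phi>])

lemma pieceD:
  assumes "piece J"
  shows "J \<subseteq> S" "J \<noteq> {}" "\<And>s t. s \<in> J \<Longrightarrow> t \<in> J \<Longrightarrow> \<bar>s - t\<bar> \<le> len"
proof -
  from assms obtain x y c where J: "c < Q" "x \<le> y" "J = {x..y}" "J \<subseteq> cell c" unfolding piece_def
      by auto
  show "J \<subseteq> S" "J \<noteq> {}" using J cell_S by auto
  show "\<And>s t. s \<in> J \<Longrightarrow> t \<in> J \<Longrightarrow> \<bar>s - t\<bar> \<le> len" using J cell_diam by blast
qed

lemma piece_cell: "c < Q \<Longrightarrow> piece (cell c)"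
  unfolding piece_def cell_def using len
      by (intro exI[of _ "real c * len"] exI[of _ "real (Suc c) * len"] exI[of _ c]) (auto simp:
      mult_le_cancel_right)

text \<open>The image of a piece and the cell are both so short that only one translate of the image
  can meet the cell: two candidates for the same point are within distance 1 and have the same
  projection, so they agree by \<open>near\<close>.\<close>

lemma child_shift:
  assumes J: "piece J" and c: "c < Q" and ne: "child J c \<noteq> {}"
  obtains v where "child J c = {s \<in> cell c. s - v \<in> \<Phi> ` J}" "\<And>t. t \<in> J \<Longrightarrow>
      \<Phi> t + v \<in> S \<and> \<pi> (\<Phi> t + v) = \<pi> (\<Phi> t)"
proof -
  from ne obtain s0 t0 where s0: "s0 \<in> cell c" "t0 \<in> J" "\<pi> s0 = \<pi> (\<Phi> t0)" unfolding child_def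
      by auto
  note JS = pieceD(1)[OF J]
  have S0: "s0 \<in> S" "\<Phi> t0 \<in> S" using s0 cell_S[OF c] JS \<Phi>S by auto
  define v where "v = s0 - \<Phi> t0"
  have sh: "\<Phi> t + v \<in> S \<and> \<pi> (\<Phi> t + v) = \<pi> (\<Phi> t)" if "t \<in> J" for t
    using shift[OF S0, of "\<Phi> t - \<Phi> t0"] \<Phi>S[of t] JS that s0(3) unfolding v_def
      by (auto simp: algebra_simps)
  have "s \<in> child J c \<longleftrightarrow> s \<in> cell c \<and> s - v \<in> \<Phi> ` J" for s
  proof
    assume "s \<in> child J c"
    then obtain t where s: "s \<in> cell c" "t \<in> J" "\<pi> s = \<pi> (\<Phi> t)" unfolding child_def by auto
    have "\<bar>\<Phi> t - \<Phi> t0\<bar> \<le> LL * \<bar>t - t0\<bar>" using LL(2) JS s s0 by auto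
    also have "\<dots> \<le> LL * len" using pieceD(3)[OF J s(2) s0(2)] LL(1) by (intro mult_left_mono) auto
    finally have d1: "\<bar>\<Phi> t - \<Phi> t0\<bar> \<le> 1/4" using len by linarith
    have d2: "\<bar>s - s0\<bar> \<le> 1/4" using cell_diam[OF s(1) s0(1)] len by linarith
    have "\<bar>s - (\<Phi> t + v)\<bar> \<le> 1" using d1 d2 unfolding v_def by linarith
    then have "\<bar>s - (\<Phi> t + v)\<bar> \<le> 0" using near[of s "\<Phi> t + v"] sh[OF s(2)] s cell_S[OF c] by auto
    then show "s \<in> cell c \<and> s - v \<in> \<Phi> ` J" using s by (auto simp: image_iff intro!: bexI[of _ t])
  next
    assume s: "s \<in> cell c \<and> s - v \<in> \<Phi> ` J"
    then obtain t where "t \<in> J" "s = \<Phi> t + v" by (auto simp: algebra_simps)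
    then show "s \<in> child J c" using sh s unfolding child_def by auto
  qed
  then show ?thesis using that sh by blast
qed

lemma image_interval:
  assumes "piece J"
  obtains X Y where "X \<le> Y" "\<Phi> ` J = {X..Y}"
proof -
  from assms obtain x y c where J: "x \<le> y" "J = {x..y}" unfolding piece_def by auto
  have "continuous_on {x..y} \<Phi>" using \<Phi> pieceD(1)[OF assms] J unfolding is_lift_def
      by (auto intro: continuous_on_subset)
  then have "connected (\<Phi> ` J)" "compact (\<Phi> ` J)" unfolding J
    by (auto intro!: connected_continuous_image compact_continuous_image)
  then obtain X Y where "\<Phi> ` J = {X..Y}" by (metis connected_compact_interval_1)
  moreover have "\<Phi> ` J \<noteq> {}" using J by auto
  ultimately show ?thesis using that[of X Y] by (metis atLeastatMost_empty_iff2)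
qed

lemma piece_child:
  assumes J: "piece J" and c: "c < Q" and ne: "child J c \<noteq> {}"
  shows "piece (child J c)"
proof -
  obtain v where v: "child J c = {s \<in> cell c. s - v \<in> \<Phi> ` J}" by (rule child_shift[OF assms]) blast
  obtain X Y where XY: "\<Phi> ` J = {X..Y}" by (rule image_interval[OF J])
  have e: "child J c = {max (real c * len) (X + v) .. min (real (Suc c) * len) (Y + v)}"
    unfolding v XY cell_def by auto
  then have "max (real c * len) (X + v) \<le> min (real (Suc c) * len) (Y + v)" using ne
      by (metis atLeastatMost_empty_iff2)
  moreover have "child J c \<subseteq> cell c" unfolding child_def by auto
  ultimately show ?thesis unfolding piece_def using e c by blast
qed

lemma half_open_inj:
  assumes "s \<in> {0..lam}" "t \<in> {0..lam}" "\<bar>s - t\<bar> < lam" "\<pi> s = \<pi> t"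
  shows "s = t"
  using cyclic_dist[OF assms(1,2)] assms(3,4) by (auto simp: min_def split: if_splits)

text \<open>The image is an interval, so a cell that is met but not covered contains the projection
  of one of its two ends. Half-open cells make the cell unique, open on the left for the left end
  and open on the right for the right end.\<close>

lemma partial_children:
  assumes J: "piece J"
  shows "card {c. c < Q \<and> child J c \<noteq> {} \<and> child J c \<noteq> cell c} \<le> 2"
proof -
  obtain X Y where XY: "X \<le> Y" "\<Phi> ` J = {X..Y}" by (rule image_interval[OF J])
  have "X \<in> \<Phi> ` J" "Y \<in> \<Phi> ` J" using XY by auto
  then obtain tx ty where tx: "tx \<in> J" "\<Phi> tx = X" and ty: "ty \<in> J" "\<Phi> ty = Y" by (elim imageE) metis
  define LS where "LS = {c. c < Q \<and> (\<exists>z. \<pi> z = \<pi> X \<and> real c * len < z \<and> z \<le> real (Suc c) * len)}"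
  define RS where "RS = {c. c < Q \<and> (\<exists>z. \<pi> z = \<pi> Y \<and> real c * len \<le> z \<and> z < real (Suc c) * len)}"
  have sub: "{c. c < Q \<and> child J c \<noteq> {} \<and> child J c \<noteq> cell c} \<subseteq> LS \<union> RS"
  proof
    fix c assume "c \<in> {c. c < Q \<and> child J c \<noteq> {} \<and> child J c \<noteq> cell c}"
    then have c: "c < Q" "child J c \<noteq> {}" "child J c \<noteq> cell c" by auto
    obtain v where v: "child J c = {s \<in> cell c. s - v \<in> \<Phi> ` J}" "\<And>t. t \<in> J \<Longrightarrow>
        \<Phi> t + v \<in> S \<and> \<pi> (\<Phi> t + v) = \<pi> (\<Phi> t)"
      by (rule child_shift[OF J c(1,2)]) blast
    from c(2) obtain s where s: "s \<in> cell c" "X \<le> s - v" "s - v \<le> Y" unfolding v XY by auto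
    have "\<not> (X + v \<le> real c * len \<and> real (Suc c) * len \<le> Y + v)"
      using c(3) unfolding v XY cell_def by auto
    then consider "real c * len < X + v" | "Y + v < real (Suc c) * len" by linarith
    then show "c \<in> LS \<union> RS"
    proof cases
      case 1
      then have "c \<in> LS" unfolding LS_def using s v(2)[OF tx(1)] tx(2) c(1) unfolding cell_def
          by (auto intro!: exI[of _ "X + v"])
      then show ?thesis by simp
    next
      case 2
      then have "c \<in> RS" unfolding RS_def using s v(2)[OF ty(1)] ty(2) c(1) unfolding cell_def
          by (auto intro!: exI[of _ "Y + v"])
      then show ?thesis by simp
    qed
  qed
  have rng: "0 \<le> real c * len \<and> real (Suc c) * len \<le> lam" if "c < Q" for c
    using cell_sub[OF that] len unfolding cell_def by (auto simp: mult_le_cancel_right)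
  have le: "c = d" if "real c * len < real (Suc d) * len" "real d * len < real (Suc c) * len"
      for c d
    using that len by (simp add: mult_less_cancel_right)
  have "c = d" if cd: "c \<in> LS" "d \<in> LS" for c d
  proof -
    obtain z z' where z: "\<pi> z = \<pi> X" "real c * len < z" "z \<le> real (Suc c) * len" "\<pi> z' = \<pi> X"
        "real d * len < z'" "z' \<le> real (Suc d) * len" "c < Q" "d < Q"
      using cd unfolding LS_def by auto
    have "z = z'" by (rule half_open_inj) (use z rng[of c] rng[of d] in auto)
    then show ?thesis using le z by auto
  qed
  then have 1: "card LS \<le> 1" by (subst card_le_Suc0_iff_eq[folded One_nat_def]) (auto simp: LS_def)
  have "c = d" if cd: "c \<in> RS" "d \<in> RS" for c d
  proof -
    obtain z z' where z: "\<pi> z = \<pi> Y" "real c * len \<le> z" "z < real (Suc c) * len" "\<pi> z' = \<pi> Y"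
        "real d * len \<le> z'" "z' < real (Suc d) * len" "c < Q" "d < Q"
      using cd unfolding RS_def by auto
    have "z = z'" by (rule half_open_inj) (use z rng[of c] rng[of d] in auto)
    then show ?thesis using le z by auto
  qed
  then have 2: "card RS \<le> 1" by (subst card_le_Suc0_iff_eq[folded One_nat_def]) (auto simp: RS_def)
  have "card {c. c < Q \<and> child J c \<noteq> {} \<and> child J c \<noteq> cell c} \<le> card (LS \<union> RS)"
    by (rule card_mono[OF _ sub]) (auto simp: LS_def RS_def)
  also have "\<dots> \<le> card LS + card RS" by (rule card_Un_le)
  finally show ?thesis using 1 2 by simp
qed

text \<open>\<open>cnt V n J\<close> counts the itineraries of length \<open>n\<close> from \<open>J\<close> whose full children lie in \<open>V\<close>, and
  \<open>ret a k J\<close> those of length \<open>k\<close> that end by covering \<open>cell a\<close> completely.\<close>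

primrec cnt :: "nat set \<Rightarrow> nat \<Rightarrow> real set \<Rightarrow> nat" where
  "cnt V 0 J = 1"
| "cnt V (Suc n) J = (\<Sum>c<Q. if child J c \<noteq> {} \<and> (child J c = cell c \<longrightarrow>
    c \<in> V) then cnt V n (child J c) else 0)"

primrec ret :: "nat \<Rightarrow> nat \<Rightarrow> real set \<Rightarrow> nat" where
  "ret a 0 J = (if J = cell a then 1 else 0)"
| "ret a (Suc k) J = (\<Sum>c<Q. ret a k (child J c))"

text \<open>Itineraries are sorted by the last time \<open>k\<close> at which they cover
  \<open>cell a\<close> completely: \<open>ret\<close> counts the part before, and after it
  \<open>a\<close> is no longer among the full children.\<close>

lemma cnt_last_visit:
  assumes "a < Q" "a \<in> V"
  shows "cnt V n J \<le> cnt (V - {a}) n J + (\<Sum>k\<in>{1..n}. ret a k J * cnt (V - {a}) (n - k) (cell a))"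
proof (induction n arbitrary: J)
  case (Suc n)
  define U where "U = V - {a}"
  define ok where "ok = (\<lambda>W c. child J c \<noteq> {} \<and> (child J c = cell c \<longrightarrow> c \<in> W))"
  have trm: "(if ok V c then cnt V n (child J c) else 0)
      \<le> (if ok U c then cnt U n (child J c) else 0)
      + (ret a 0 (child J c) * cnt U n (cell a) + (\<Sum>k\<in>{1..n}. ret a k (child J c) * cnt U (n - k)
          (cell a)))" if "c < Q" for c
  proof (cases "ok V c")
    case True
    have 1: "cnt V n (child J c) \<le> cnt U n (child J c)
        + (\<Sum>k\<in>{1..n}. ret a k (child J c) * cnt U (n - k) (cell a))"
      using Suc unfolding U_def by blast
    have "cnt U n (child J c) \<le> (if ok U c then cnt U n (child J c) else 0)
        + ret a 0 (child J c) * cnt U n (cell a)"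
    proof (cases "ok U c")
      case False
      then have "child J c = cell a" using True unfolding ok_def U_def by auto
      then show ?thesis by simp
    qed simp
    then show ?thesis using 1 True by simp
  qed simp
  have "cnt V (Suc n) J \<le> (\<Sum>c<Q. (if ok U c then cnt U n (child J c) else 0)
      + (ret a 0 (child J c) * cnt U n (cell a) + (\<Sum>k\<in>{1..n}. ret a k (child J c) * cnt U (n - k)
          (cell a))))"
    unfolding cnt.simps ok_def by (rule sum_mono) (rule trm[unfolded ok_def], simp)
  also have "\<dots> = cnt U (Suc n) J + ((\<Sum>c<Q. ret a 0 (child J c) * cnt U n (cell a))
      + (\<Sum>c<Q. \<Sum>k\<in>{1..n}. ret a k (child J c) * cnt U (n - k) (cell a)))"
    by (simp only: cnt.simps ok_def sum.distrib)
  also have "(\<Sum>c<Q. ret a 0 (child J c) * cnt U n (cell a)) = ret a 1 J * cnt U n (cell a)"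
    by (simp only: sum_distrib_right[symmetric] One_nat_def ret.simps(2))
  also have "(\<Sum>c<Q. \<Sum>k\<in>{1..n}. ret a k (child J c) * cnt U (n - k) (cell a))
      = (\<Sum>k\<in>{1..n}. ret a (Suc k) J * cnt U (n - k) (cell a))"
    by (subst sum.swap) (simp only: sum_distrib_right[symmetric] ret.simps(2))
  also have "ret a 1 J * cnt U n (cell a) + (\<Sum>k\<in>{1..n}. ret a (Suc k) J * cnt U (n - k) (cell a))
      = (\<Sum>k\<in>{1..Suc n}. ret a k J * cnt U (Suc n - k) (cell a))"
  proof -
    have "(\<Sum>k\<in>{1..Suc n}. ret a k J * cnt U (Suc n - k) (cell a))
        = ret a 1 J * cnt U (Suc n - 1) (cell a) + (\<Sum>k\<in>{Suc 1..Suc n}. ret a k J * cnt U (Suc n -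
        k) (cell a))"
      by (rule sum.atLeast_Suc_atMost) simp
    also have "(\<Sum>k\<in>{Suc 1..Suc n}. ret a k J * cnt U (Suc n - k) (cell a))
        = (\<Sum>k\<in>{1..n}. ret a (Suc k) J * cnt U (Suc n - Suc k) (cell a))"
      by (rule sum.shift_bounds_cl_Suc_ivl)
    finally show ?thesis by simp
  qed
  finally show ?case unfolding U_def .
qed simp

text \<open>Partial children at most double at each step, so with \<open>x > 2\<close> they do not
  spoil the growth. The constant D = 1 + Q C / (x - 2) solves Q C + 2 D \<le> D x.\<close>

lemma cnt_from_full:
  assumes x: "x > 2" and C: "C \<ge> 0"
      and full: "\<And>c m. c \<in> V \<Longrightarrow> c < Q \<Longrightarrow> real (cnt V m (cell c)) \<le> C * x ^ m"
    and J: "piece J"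
  shows "real (cnt V n J) \<le> (1 + real Q * C / (x - 2)) * x ^ n"
  using J
proof (induction n arbitrary: J)
  case 0
  then show ?case using x C by simp
next
  case (Suc n)
  define D where "D = 1 + real Q * C / (x - 2)"
  have "D * (x - 2) = (x - 2) + real Q * C" using x unfolding D_def by (simp add: distrib_right)
  have D: "D \<ge> 0" "real Q * C + 2 * D \<le> D * x"
  proof -
    show "D \<ge> 0" using x C unfolding D_def by (intro add_nonneg_nonneg divide_nonneg_pos) auto
    have "D * x = D * (x - 2) + 2 * D" by (simp add: algebra_simps)
    then show "real Q * C + 2 * D \<le> D * x" using \<open>D * (x - 2) = (x - 2) + real Q * C\<close> x by linarith
  qed
  define P where "P = {c. c < Q \<and> child J c \<noteq> {} \<and> child J c \<noteq> cell c}"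
  have P: "P \<subseteq> {..<Q}" "real (card P) \<le> 2" using partial_children[OF Suc.prems] unfolding P_def
      by auto
  have "real (cnt V (Suc n) J) \<le> (\<Sum>c<Q. C * x ^ n + (if c \<in> P then D * x ^ n else 0))"
    unfolding cnt.simps of_nat_sum
  proof (rule sum_mono)
    fix c assume "c \<in> {..<Q}"
    then have c: "c < Q" by simp
    have nn: "0 \<le> C * x ^ n" "0 \<le> D * x ^ n" using C D x by auto
    show "real (if child J c \<noteq> {} \<and> (child J c = cell c \<longrightarrow> c \<in> V) then cnt V n (child J c) else 0)
      \<le> C * x ^ n + (if c \<in> P then D * x ^ n else 0)"
    proof (cases "child J c \<noteq> {} \<and> (child J c = cell c \<longrightarrow> c \<in> V)")
      case True
      show ?thesis
      proof (cases "child J c = cell c")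
        case full': True
        then show ?thesis using full[of c n] True c nn by auto
      next
        case False
        then have "real (cnt V n (child J c)) \<le> D * x ^ n"
            using Suc.IH[OF piece_child[OF Suc.prems c]] True unfolding D_def by auto
        then show ?thesis using True False c nn unfolding P_def by auto
      qed
    qed (use nn in auto)
  qed
  also have "\<dots> = real Q * (C * x ^ n) + (\<Sum>c<Q. if c \<in> P then D * x ^ n else 0)"
      by (simp add: sum.distrib)
  also have "(\<Sum>c<Q. if c \<in> P then D * x ^ n else 0) = real (card P) * (D * x ^ n)"
    using P(1) by (simp add: sum.If_cases Int_absorb1)
  also have "real Q * (C * x ^ n) + real (card P) * (D * x ^ n) \<le> real Q * (C * x ^ n)
      + 2 * (D * x ^ n)"
    using P(2) D x by (intro add_left_mono mult_right_mono) auto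
  also have "\<dots> = (real Q * C + 2 * D) * x ^ n" by (simp add: algebra_simps)
  also have "\<dots> \<le> (D * x) * x ^ n" using D x by (intro mult_right_mono) auto
  finally show ?case unfolding D_def by simp
qed

lemma cnt_growth:
  assumes x: "x > 2" "y < x" "0 \<le> y" and c0: "c0 \<ge> 0"
    and r: "\<And>a k. a < Q \<Longrightarrow> 1 \<le> k \<Longrightarrow> real (ret a k (cell a)) \<le> c0 * y ^ k"
  shows "V \<subseteq> {..<Q} \<Longrightarrow> \<exists>C\<ge>0. \<forall>a\<in>V. \<forall>n. real (cnt V n (cell a)) \<le> C * x ^ n"
proof (induction "card V" arbitrary: V)
  case 0
  then have "V = {}" using finite_subset by fastforce
  then show ?case by (intro exI[of _ 0]) auto
next
  case (Suc m)
  have fV: "finite V" using Suc.prems finite_subset by auto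
  have "\<exists>C\<ge>0. \<forall>n. real (cnt V n (cell a)) \<le> C * x ^ n" if a: "a \<in> V" for a
  proof -
    define U where "U = V - {a}"
    have aQ: "a < Q" using a Suc.prems by auto
    have "m = card U" using Suc.hyps(2) a fV unfolding U_def by simp
    then obtain C where C: "C \<ge> 0" "\<And>b n. b \<in> U \<Longrightarrow> real (cnt U n (cell b)) \<le> C * x ^ n"
      using Suc.hyps(1)[of U] Suc.prems unfolding U_def by blast
    define D where "D = 1 + real Q * C / (x - 2)"
    have D0: "D \<ge> 0" using C x unfolding D_def by simp
    have D: "real (cnt U n (cell a)) \<le> D * x ^ n" for n
      unfolding D_def by (rule cnt_from_full[OF x(1) C(1)]) (use C(2) piece_cell[OF aQ] in auto)
    define z where "z = y / x"
    have z: "0 \<le> z" "z < 1" using x unfolding z_def by auto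
    have "real (cnt V n (cell a)) \<le> (D + c0 * D / (1 - z)) * x ^ n" for n
    proof -
      have "real (cnt V n (cell a)) \<le> real (cnt U n (cell a))
          + (\<Sum>k\<in>{1..n}. real (ret a k (cell a)) * real (cnt U (n - k) (cell a)))"
        using cnt_last_visit[OF aQ a, of n "cell a"] unfolding U_def
        by (simp only: of_nat_add[symmetric] of_nat_mult[symmetric] of_nat_sum[symmetric]
          of_nat_le_iff)
      also have "\<dots> \<le> D * x ^ n + (\<Sum>k\<in>{1..n}. (c0 * D * x ^ n) * z ^ k)"
      proof (intro add_mono sum_mono D)
        fix k assume k: "k \<in> {1..n}"
        have "real (ret a k (cell a)) * real (cnt U (n - k) (cell a))
            \<le> (c0 * y ^ k) * (D * x ^ (n - k))"
          using r[OF aQ, of k] D[of "n - k"] k c0 x by (intro mult_mono) auto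
        also have "\<dots> = (c0 * D * x ^ n) * z ^ k"
          using k x unfolding z_def by (simp add: power_divide power_diff)
        finally show "real (ret a k (cell a)) * real (cnt U (n - k) (cell a))
            \<le> (c0 * D * x ^ n) * z ^ k" .
      qed
      also have "(\<Sum>k\<in>{1..n}. (c0 * D * x ^ n) * z ^ k) = (c0 * D * x ^ n) * (\<Sum>k\<in>{1..n}. z ^ k)"
          by (simp only: sum_distrib_left)
      also have "\<dots> \<le> (c0 * D * x ^ n) * (1 / (1 - z))"
      proof (rule mult_left_mono)
        have "(\<Sum>k\<in>{1..n}. z ^ k) \<le> (\<Sum>k. z ^ k)" using z
            by (intro sum_le_suminf summable_geometric) auto
        also have "\<dots> = 1 / (1 - z)" using z by (intro suminf_geometric) auto
        finally show "(\<Sum>k\<in>{1..n}. z ^ k) \<le> 1 / (1 - z)" .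
      qed (use c0 D0 x in auto)
      also have "D * x ^ n + (c0 * D * x ^ n) * (1 / (1 - z)) = (D + c0 * D / (1 - z)) * x ^ n"
          by (simp add: algebra_simps)
      finally show ?thesis by simp
    qed
    moreover have "0 \<le> D + c0 * D / (1 - z)" using D0 c0 z by simp
    ultimately show ?thesis by blast
  qed
  then have "\<forall>a\<in>V. \<exists>C. 0 \<le> C \<and> (\<forall>n. real (cnt V n (cell a)) \<le> C * x ^ n)" by blast
  from bchoice[OF this] obtain C
      where C': "\<forall>a\<in>V. 0 \<le> C a \<and> (\<forall>n. real (cnt V n (cell a)) \<le> C a * x ^ n)" by (rule exE)
  note C = bspec[OF C']
  have "real (cnt V n (cell a)) \<le> (\<Sum>a\<in>V. C a) * x ^ n" if "a \<in> V" for a n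
  proof -
    have "C a \<le> (\<Sum>a\<in>V. C a)" using C fV that by (intro member_le_sum) auto
    then have "C a * x ^ n \<le> (\<Sum>a\<in>V. C a) * x ^ n" using x by (intro mult_right_mono) auto
    then show ?thesis using C[OF that] by (meson order_trans)
  qed
  then show ?case using C by (intro exI[of _ "\<Sum>a\<in>V. C a"]) (auto intro: sum_nonneg)
qed

text \<open>Points of one piece are within \<open>len\<close> of each other, so their separation
  shows only after a step. The images are sorted by the cells that contain them, and the induction
  hypothesis applies to each child.\<close>

lemma separated_le_cnt:
  assumes "piece J" "finite E" "E \<subseteq> J"
    and sep: "\<And>s t. s \<in> E \<Longrightarrow> t \<in> E \<Longrightarrow> s \<noteq> t \<Longrightarrow> \<exists>i\<le>n. dist ((\<phi> ^^ i) (\<pi> s)) ((\<phi> ^^ i) (\<pi> t)) > len"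
  shows "card E \<le> cnt {..<Q} n J"
  using assms
proof (induction n arbitrary: J E)
  case 0
  have "s = t" if "s \<in> E" "t \<in> E" for s t
  proof (rule ccontr)
    assume "s \<noteq> t"
    then have "dist (\<pi> s) (\<pi> t) > len" using "0.prems"(4)[OF that] by auto
    moreover have "dist (\<pi> s) (\<pi> t) \<le> \<bar>s - t\<bar>"
        using dist_le pieceD(1)[OF "0.prems"(1)] "0.prems"(3) that by blast
    moreover have "\<bar>s - t\<bar> \<le> len" using pieceD(3)[OF "0.prems"(1)] "0.prems"(3) that by blast
    ultimately show False by linarith
  qed
  then show ?case using "0.prems"(2) by (simp add: card_le_Suc0_iff_eq)
next
  case (Suc n)
  note J = Suc.prems(1) and E = Suc.prems(2,3) and sep = Suc.prems(4)
  note JS = pieceD(1)[OF J]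
  have "\<forall>t\<in>E. \<exists>p. fst p < Q \<and> snd p \<in> cell (fst p) \<and> \<pi> (snd p) = \<pi> (\<Phi> t)"
  proof
    fix t assume "t \<in> E"
    then obtain s where s: "s \<in> {0..lam}" "\<pi> s = \<pi> (\<Phi> t)" using onto[of "\<Phi> t"] \<Phi>S JS E by blast
    then obtain c where "c < Q" "s \<in> cell c" using cell_cover by blast
    then show "\<exists>p. fst p < Q \<and> snd p \<in> cell (fst p) \<and> \<pi> (snd p) = \<pi> (\<Phi> t)" using s
        by (intro exI[of _ "(c, s)"]) auto
  qed
  from bchoice[OF this] obtain p
      where p': "\<forall>t\<in>E. fst (p t) < Q \<and> snd (p t) \<in> cell (fst (p t)) \<and> \<pi> (snd (p t)) = \<pi> (\<Phi> t)"
      by (rule exE)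
  note p = bspec[OF p']
  have im: "\<pi> (snd (p t)) = \<phi> (\<pi> t)" if "t \<in> E" for t using p[OF that] lift_eq[OF \<Phi>] JS E that
      by auto
  have one: "dist (\<pi> s) (\<pi> t) \<le> len" if "s \<in> E" "t \<in> E" for s t
    using dist_le[of s t] pieceD(3)[OF J, of s t] JS E that by (meson order_trans subsetD)
  have sep': "\<exists>i\<le>n. dist ((\<phi> ^^ i) (\<pi> (snd (p s)))) ((\<phi> ^^ i) (\<pi> (snd (p t)))) > len"
      if st: "s \<in> E" "t \<in> E" "s \<noteq> t" for s t
  proof -
    obtain i where i: "i \<le> Suc n" "dist ((\<phi> ^^ i) (\<pi> s)) ((\<phi> ^^ i) (\<pi> t)) > len" using sep[OF st]
        by blast
    then obtain j where j: "i = Suc j" using one[OF st(1,2)] by (cases i) auto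
    then show ?thesis using i im[OF st(1)] im[OF st(2)]
        by (intro exI[of _ j]) (auto simp: funpow_swap1)
  qed
  have inj: "inj_on (\<lambda>t. snd (p t)) E"
  proof (rule inj_onI, rule ccontr)
    fix s t assume "s \<in> E" "t \<in> E" "snd (p s) = snd (p t)" "s \<noteq> t"
    then show False using sep'[of s t] len by auto
  qed
  define Ec where "Ec = (\<lambda>c. (\<lambda>t. snd (p t)) ` {t\<in>E. fst (p t) = c})"
  have cE: "card E = (\<Sum>c<Q. card (Ec c))"
  proof -
    have "card (Ec c) = card {t\<in>E. fst (p t) = c}" for c unfolding Ec_def
        by (intro card_image inj_on_subset[OF inj]) auto
    moreover have "card E = (\<Sum>c<Q. card {t\<in>E. fst (p t) = c})"
    proof -
      have "(\<lambda>t. fst (p t)) ` E \<subseteq> {..<Q}" using p by auto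
      then show ?thesis using sum.group[of E "{..<Q}" "\<lambda>t. fst (p t)" "\<lambda>_. 1::nat"] E by simp
    qed
    ultimately show ?thesis by simp
  qed
  have "card (Ec c) \<le> (if child J c \<noteq> {} \<and> (child J c = cell c \<longrightarrow>
      c \<in> {..<Q}) then cnt {..<Q} n (child J c) else 0)" if c: "c < Q" for c
  proof (cases "Ec c = {}")
    case False
    have sub: "Ec c \<subseteq> child J c" unfolding Ec_def child_def using p E by auto
    then have ne: "child J c \<noteq> {}" using False by auto
    have "card (Ec c) \<le> cnt {..<Q} n (child J c)"
    proof (rule Suc.IH[OF piece_child[OF J c ne] _ sub])
      show "finite (Ec c)" unfolding Ec_def using E by auto
      fix s t assume "s \<in> Ec c" "t \<in> Ec c" "s \<noteq> t"
      then show "\<exists>i\<le>n. dist ((\<phi> ^^ i) (\<pi> s)) ((\<phi> ^^ i) (\<pi> t)) > len" unfolding Ec_def using sep'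
          by auto
    qed
    then show ?thesis using ne c by simp
  qed simp
  then have "(\<Sum>c<Q. card (Ec c)) \<le> cnt {..<Q} (Suc n) J" unfolding cnt.simps
      by (intro sum_mono) auto
  then show ?case using cE by simp
qed

end

context arc
begin

lemma deck_shift:
  assumes "z0 \<in> S" "z0 + v \<in> S" "\<pi> (z0 + v) = \<pi> z0" "z \<in> S"
  shows "z + v \<in> S" "\<pi> (z + v) = \<pi> z"
  using shift[OF assms(2,1), of "z - z0"] assms(3,4) by (auto simp: algebra_simps)

text \<open>\<open>F (z + v) - F z\<close> is a deck translation for every \<open>z\<close>. By
  \<open>near\<close> its values are at least 1 apart, so by continuity on a connected set it is
  constant.\<close>

lemma lift_deck_shift:
  assumes F: "is_lift I f F" and f: "f \<in> points I \<rightarrow> points I"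
      and z0: "z0 \<in> S" "z0 + v \<in> S" "\<pi> (z0 + v) = \<pi> z0"
  obtains w where "\<And>z. z \<in> S \<Longrightarrow> F (z + v) = F z + w" "\<And>z. z \<in> S \<Longrightarrow> z + w \<in> S \<and> \<pi> (z + w) = \<pi> z"
proof -
  note dk = deck_shift[OF z0]
  have cF: "continuous_on S F" using F unfolding is_lift_def by auto
  have c: "continuous_on S (\<lambda>z. F (z + v) - F z)"
    by (intro continuous_intros cF continuous_on_compose2[OF cF]) (use dk in auto)
  have FS: "F z \<in> S" if "z \<in> S" for z by (rule lift_into[OF F f that])
  have e: "\<pi> (F (z + v)) = \<pi> (F z)" if "z \<in> S" for z
    using lift_eq[OF F] dk[OF that] that by simp
  have "(\<lambda>z. F (z + v) - F z) constant_on S"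
  proof (rule continuous_discrete_range_constant[OF convex_connected[OF convS] c])
    fix x assume x: "x \<in> S"
    have "1 \<le> norm ((F (y + v) - F y) - (F (x + v) - F x))"
        if y: "y \<in> S" "F (y + v) - F y \<noteq> F (x + v) - F x" for y
    proof (rule ccontr)
      assume "\<not> ?thesis"
      then have l: "\<bar>(F (x + v) + (F y - F x)) - F (y + v)\<bar> \<le> 1" by (simp add: algebra_simps)
      have s: "F (x + v) + (F y - F x) \<in> S" "\<pi> (F (x + v) + (F y - F x)) = \<pi> (F y)"
        using shift[OF FS[OF dk(1)[OF x]] FS[OF x], of "F y - F x"] FS[OF y(1)] e[OF x] by auto
      have "\<bar>(F (x + v) + (F y - F x)) - F (y + v)\<bar>
          \<le> 2 * dist (\<pi> (F (x + v) + (F y - F x))) (\<pi> (F (y + v)))"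
        by (rule near[OF s(1) FS[OF dk(1)[OF y(1)]] l])
      then have "(F (x + v) + (F y - F x)) - F (y + v) = 0" using s(2) e[OF y(1)] by simp
      then show False using y(2) by simp
    qed
    then show "\<exists>e>0. \<forall>y. y \<in> S \<and> F (y + v) - F y \<noteq> F (x + v) - F x \<longrightarrow>
        e \<le> norm (F (y + v) - F y - (F (x + v) - F x))"
      by (intro exI[of _ 1]) auto
  qed
  then obtain w where w: "\<And>z. z \<in> S \<Longrightarrow> F (z + v) - F z = w" by (auto simp: constant_on_def)
  have w1: "F (z + v) = F z + w" if "z \<in> S" for z using w[OF that] by simp
  have "F z0 + w \<in> S" "\<pi> (F z0 + w) = \<pi> (F z0)" using w1[OF z0(1)] FS[OF z0(2)] e[OF z0(1)] by auto
  then show ?thesis using that[OF w1] deck_shift[OF FS[OF z0(1)]] by blast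
qed

end

context cells
begin

text \<open>Two different cells with the same residue have at least two cells between them, in both
  directions around the circle.\<close>

lemma cells_far:
  assumes c: "c < Q" "c' < Q" "c mod 3 = c' mod 3" "c \<noteq> c'" and s: "s \<in> cell c" "s' \<in> cell c'"
  shows "len \<le> 2 * dist (\<pi> s) (\<pi> s')"
proof -
  have *: "len \<le> \<bar>s - s'\<bar> \<and> len \<le> lam - \<bar>s - s'\<bar>" if c: "c' < Q" "c mod 3 = c' mod 3" "c < c'"
      and s: "s \<in> cell c" "s' \<in> cell c'" for c c' s s'
  proof -
    obtain m where m: "c' = c + 3 * m" using c by (metis less_imp_le mod_eq_nat2E)
    have "m \<ge> 1" using m c by (cases m) auto
    have "m < Q'" using c(1) unfolding m Q_def by linarith
    then have q: "real (Suc c') - real c \<le> real Q - 2" unfolding m Q_def by simp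
    have "s' - s \<le> (real (Suc c') - real c) * len" using s unfolding cell_def
        by (auto simp: algebra_simps)
    also have "\<dots> \<le> (real Q - 2) * len" using q len by (intro mult_right_mono) auto
    also have "\<dots> = lam - 2 * len" using len by (simp add: left_diff_distrib)
    finally have 1: "s' - s \<le> lam - 2 * len" .
    have "2 * len \<le> (real c' - real (Suc c)) * len" using m \<open>m \<ge> 1\<close> len
        by (intro mult_right_mono) auto
    also have "\<dots> \<le> s' - s" using s unfolding cell_def by (auto simp: algebra_simps)
    finally have 2: "2 * len \<le> s' - s" .
    then show ?thesis using 1 len by linarith
  qed
  have "len \<le> \<bar>s - s'\<bar> \<and> len \<le> lam - \<bar>s - s'\<bar>"
  proof (cases "c < c'")
    case True
    then show ?thesis using *[of c' c s s'] c s by auto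
  next
    case False
    then show ?thesis using *[of c c' s' s] c s by (auto simp: abs_minus_commute)
  qed
  then show ?thesis using cyclic_dist[of s s'] cell_sub[OF c(1)] cell_sub[OF c(2)] s by fastforce
qed

lemma ret_empty: "b < Q \<Longrightarrow> ret b k {} = 0"
proof (induction k)
  case 0
  then show ?case using pieceD(2)[OF piece_cell, of b] by auto
next
  case (Suc k)
  have "child {} c = {}" for c unfolding child_def by auto
  then show ?case using Suc by simp
qed

text \<open>Each itinerary counted by \<open>ret\<close> is pulled back to an interval that covers a
  translate of \<open>cell b\<close> after \<open>k\<close> steps. Adjacent cells would not be
  separated, so at each step only the children in one residue class modulo 3 are kept, at the price
  of a factor 3. Intervals with different itineraries then are apart at some time.\<close>

lemma horseshoe:
  assumes b: "b < Q"
  shows "piece J \<Longrightarrow> \<exists>\<J>. finite \<J> \<and> ret b k J \<le> 3 ^ k * card \<J> \<and> (\<forall>T\<in>\<J>. (\<exists>x y. x \<le> y \<and> T = {x..y}) \<and>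
      T \<subseteq> J) \<and>
     (\<forall>T\<in>\<J>. \<exists>v. \<forall>s\<in>cell b. s - v \<in> (\<Phi> ^^ k) ` T \<and> \<pi> (s - v) = \<pi> s) \<and>
     (\<forall>T\<in>\<J>. \<forall>T'\<in>\<J>. T \<noteq> T' \<longrightarrow> (\<forall>t\<in>T. \<forall>t'\<in>T'. \<exists>i\<le>k. len \<le> 2 * dist ((\<phi> ^^ i) (\<pi> t)) ((\<phi> ^^ i) (\<pi>
         t'))))"
proof (induction k arbitrary: J)
  case 0
  show ?case
  proof (cases "J = cell b")
    case True
    have "\<exists>x y. x \<le> y \<and> J = {x..y}" using 0 unfolding piece_def by auto
    moreover have "\<exists>v. \<forall>s\<in>cell b. s - v \<in> (\<Phi> ^^ 0) ` J \<and> \<pi> (s - v) = \<pi> s"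
      using True by (intro exI[of _ 0]) simp
    ultimately show ?thesis using True by (intro exI[of _ "{J}"]) simp
  qed (auto intro!: exI[of _ "{}"])
next
  case (Suc k)
  note J = Suc.prems
  note JS = pieceD(1)[OF J]
  \<comment> \<open>Some residue class carries at least a third of the total.\<close>
  obtain \<rho> where \<rho>: "(\<Sum>c<Q. ret b k (child J c)) \<le> 3 * (\<Sum>c\<in>{c. c < Q \<and>
      c mod 3 = \<rho>}. ret b k (child J c))"
  proof -
    have "(\<Sum>c<Q. ret b k (child J c)) = (\<Sum>\<rho><3. \<Sum>c\<in>{c\<in>{..<Q}. c mod 3 = \<rho>}. ret b k (child J c))"
      by (rule sum.group[symmetric]) auto
    also have "\<dots> = (\<Sum>\<rho><3. \<Sum>c\<in>{c. c < Q \<and> c mod 3 = \<rho>}. ret b k (child J c))" by simp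
    finally have e: "(\<Sum>c<Q. ret b k (child J c)) = (\<Sum>\<rho><3. \<Sum>c\<in>{c. c < Q \<and>
        c mod 3 = \<rho>}. ret b k (child J c))" .
    have "\<exists>\<rho>. (\<Sum>c<Q. ret b k (child J c)) \<le> 3 * (\<Sum>c\<in>{c. c < Q \<and> c mod 3 = \<rho>}. ret b k (child J c))"
    proof (rule ccontr)
      assume "\<not> ?thesis"
      then have l: "3 * (\<Sum>c\<in>{c. c < Q \<and> c mod 3 = \<rho>}. ret b k (child J c))
          < (\<Sum>c<Q. ret b k (child J c))" for \<rho> by (simp add: not_le)
      have "{..<3::nat} = {0,1,2}" by auto
      then show False using e l[of 0] l[of 1] l[of 2] by simp
    qed
    then show ?thesis using that by blast
  qed
  define C where "C = {c. c < Q \<and> c mod 3 = \<rho> \<and> child J c \<noteq> {}}"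
  have fC: "finite C" unfolding C_def by auto
  have "(\<Sum>c\<in>{c. c < Q \<and> c mod 3 = \<rho>}. ret b k (child J c)) = (\<Sum>c\<in>C. ret b k (child J c))"
    by (rule sum.mono_neutral_right) (auto simp: C_def ret_empty[OF b])
  with \<rho> have \<rho>2: "ret b (Suc k) J \<le> 3 * (\<Sum>c\<in>C. ret b k (child J c))" by simp
  have "\<forall>c\<in>C. \<exists>v. child J c = {s \<in> cell c. s - v \<in> \<Phi> ` J} \<and>
      (\<forall>t\<in>J. \<Phi> t + v \<in> S \<and> \<pi> (\<Phi> t + v) = \<pi> (\<Phi> t))"
  proof
    fix c assume "c \<in> C"
    then have c: "c < Q" "child J c \<noteq> {}" unfolding C_def by auto
    show "\<exists>v. child J c = {s \<in> cell c. s - v \<in> \<Phi> ` J} \<and> (\<forall>t\<in>J. \<Phi> t + v \<in> S \<and> \<pi> (\<Phi> t + v) = \<pi> (\<Phi> t))"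
      by (rule child_shift[OF J c]) blast
  qed
  from bchoice[OF this] obtain v
      where v': "\<forall>c\<in>C. child J c = {s \<in> cell c. s - v c \<in> \<Phi> ` J} \<and>
      (\<forall>t\<in>J. \<Phi> t + v c \<in> S \<and> \<pi> (\<Phi> t + v c) = \<pi> (\<Phi> t))" by (rule exE)
  note v = bspec[OF v']
  define R where "R = (\<lambda>J \<J>. finite \<J> \<and> ret b k J \<le> 3 ^ k * card \<J> \<and>
      (\<forall>T\<in>\<J>. (\<exists>x y. x \<le> y \<and> T = {x..y}) \<and> T \<subseteq> J) \<and>
     (\<forall>T\<in>\<J>. \<exists>v. \<forall>s\<in>cell b. s - v \<in> (\<Phi> ^^ k) ` T \<and> \<pi> (s - v) = \<pi> s) \<and>
     (\<forall>T\<in>\<J>. \<forall>T'\<in>\<J>. T \<noteq> T' \<longrightarrow> (\<forall>t\<in>T. \<forall>t'\<in>T'. \<exists>i\<le>k. len \<le> 2 * dist ((\<phi> ^^ i) (\<pi> t)) ((\<phi> ^^ i) (\<pi>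
         t')))))"
  have "\<forall>c\<in>C. \<exists>\<J>. R (child J c) \<J>"
    using Suc.IH piece_child[OF J] unfolding C_def R_def by blast
  from bchoice[OF this] obtain \<J> where \<J>': "\<forall>c\<in>C. R (child J c) (\<J> c)" by (rule exE)
  note rj = bspec[OF \<J>', unfolded R_def]
  note rj5 = rj[THEN conjunct2, THEN conjunct2, THEN conjunct2, THEN conjunct2]
  have \<J>: "finite (\<J> c)" "ret b k (child J c) \<le> 3 ^ k * card (\<J> c)" if "c \<in> C" for c
    using rj[OF that] by simp_all
  have \<J>3: "(\<exists>x y. x \<le> y \<and> T = {x..y}) \<and> T \<subseteq> child J c" if "c \<in> C" "T \<in> \<J> c" for c T
    using rj[OF that(1), THEN conjunct2, THEN conjunct2, THEN conjunct1] that(2) by (rule bspec)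
  have \<J>4: "\<exists>v. \<forall>s\<in>cell b. s - v \<in> (\<Phi> ^^ k) ` T \<and> \<pi> (s - v) = \<pi> s" if "c \<in> C" "T \<in> \<J> c" for c T
    using rj[OF that(1), THEN conjunct2, THEN conjunct2, THEN conjunct2, THEN conjunct1] that(2)
      by (rule bspec)
  have \<J>5: "\<exists>i\<le>k. len \<le> 2 * dist ((\<phi> ^^ i) (\<pi> t)) ((\<phi> ^^ i) (\<pi> t'))"
    if "c \<in> C" "T \<in> \<J> c" "T' \<in> \<J> c" "T \<noteq> T'" "t \<in> T" "t' \<in> T'" for c T T' t t'
    using rj5[OF that(1), rule_format, OF that(2-6)] .
  have "\<forall>p\<in>Sigma C \<J>. \<exists>T. (\<exists>x y. x \<le> y \<and> T = {x..y}) \<and> T \<subseteq> J \<and> (\<lambda>t. \<Phi> t + v (fst p)) ` T = snd p"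
  proof
    fix p assume "p \<in> Sigma C \<J>"
    then obtain c T' where p: "p = (c, T')" "c \<in> C" "T' \<in> \<J> c" by auto
    obtain x' y' where T': "x' \<le> y'" "T' = {x'..y'}" "T' \<subseteq> child J c" using \<J>3[OF p(2,3)] by auto
    obtain x y where Jxy: "x \<le> y" "J = {x..y}" using J unfolding piece_def by auto
    have cont: "continuous_on {x..y} (\<lambda>t. \<Phi> t + v c)" using \<Phi> JS Jxy unfolding is_lift_def
        by (auto intro!: continuous_intros intro: continuous_on_subset)
    have sub: "{x'..y'} \<subseteq> (\<lambda>t. \<Phi> t + v c) ` {x..y}"
    proof
      fix s assume "s \<in> {x'..y'}"
      then have "s - v c \<in> \<Phi> ` J" using T' v[OF p(2)] by auto
      then show "s \<in> (\<lambda>t. \<Phi> t + v c) ` {x..y}" using Jxy by (auto simp: image_iff algebra_simps)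
    qed
    obtain x1 y1 where "x1 \<le> y1" "{x1..y1} \<subseteq> {x..y}" "(\<lambda>t. \<Phi> t + v c) ` {x1..y1} = {x'..y'}"
      by (rule interval_preimage[OF cont T'(1) sub])
    then show "\<exists>T. (\<exists>x y. x \<le> y \<and> T = {x..y}) \<and> T \<subseteq> J \<and> (\<lambda>t. \<Phi> t + v (fst p)) ` T = snd p"
      using p T' Jxy by (intro exI[of _ "{x1..y1}"]) auto
  qed
  from bchoice[OF this] obtain pl
      where pl': "\<forall>p\<in>Sigma C \<J>. (\<exists>x y. x \<le> y \<and> pl p = {x..y}) \<and> pl p \<subseteq> J \<and>
      (\<lambda>t. \<Phi> t + v (fst p)) ` pl p = snd p" by (rule exE)
  have pl: "\<exists>x y. x \<le> y \<and> pl (c, T) = {x..y}" "pl (c, T) \<subseteq> J" "(\<lambda>t. \<Phi> t + v c) ` pl (c, T) = T"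
      if "c \<in> C" "T \<in> \<J> c" for c T
    using bspec[OF pl', of "(c, T)"] that by auto
  have step: "\<phi> (\<pi> t) = \<pi> (\<Phi> t + v c)" if "c \<in> C" "t \<in> J" for c t
    using v[OF that(1)] that(2) lift_eq[OF \<Phi>, of t] JS by auto
  have sep: "\<exists>i\<le>Suc k. len \<le> 2 * dist ((\<phi> ^^ i) (\<pi> t)) ((\<phi> ^^ i) (\<pi> t'))"
    if p: "c \<in> C" "T \<in> \<J> c" "c' \<in> C" "T' \<in> \<J> c'" "(c, T) \<noteq> (c', T')" "t \<in> pl (c, T)"
        "t' \<in> pl (c', T')" for c T c' T' t t'
  proof -
    have tJ: "t \<in> J" "t' \<in> J" using pl(2) p by blast+
    have im: "\<Phi> t + v c \<in> T" "\<Phi> t' + v c' \<in> T'" using pl(3) p by blast+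
    show ?thesis
    proof (cases "c = c'")
      case True
      then obtain i where "i \<le> k" "len \<le> 2 * dist ((\<phi> ^^ i) (\<pi> (\<Phi> t + v c)))
          ((\<phi> ^^ i) (\<pi> (\<Phi> t' + v c')))"
        using \<J>5[OF p(1,2) _ _ im] p(4,5) by blast
      then show ?thesis using step[OF p(1) tJ(1)] step[OF p(3) tJ(2)]
          by (intro exI[of _ "Suc i"]) (auto simp: funpow_swap1)
    next
      case False
      have "\<Phi> t + v c \<in> cell c" "\<Phi> t' + v c' \<in> cell c'" using im \<J>3[OF p(1,2)] \<J>3[OF p(3,4)]
          unfolding child_def by auto
      then have "len \<le> 2 * dist (\<pi> (\<Phi> t + v c)) (\<pi> (\<Phi> t' + v c'))"
        using p False by (intro cells_far[of c c']) (auto simp: C_def)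
      then show ?thesis using step[OF p(1) tJ(1)] step[OF p(3) tJ(2)] by (intro exI[of _ 1]) auto
    qed
  qed
  have inj: "inj_on pl (Sigma C \<J>)"
  proof (rule inj_onI, rule ccontr)
    fix p p' assume a: "p \<in> Sigma C \<J>" "p' \<in> Sigma C \<J>" "pl p = pl p'" "p \<noteq> p'"
    obtain c T c' T' where p: "p = (c, T)" "p' = (c', T')" "c \<in> C" "T \<in> \<J> c" "c' \<in> C" "T' \<in> \<J> c'"
        using a by auto
    obtain t y where "t \<le> y" "pl (c, T) = {t..y}" using pl(1)[OF p(3,4)] by blast
    then have "t \<in> pl p" using p(1) by simp
    then show False using sep[OF p(3-6), of t t] a p len by auto
  qed
  have "ret b (Suc k) J \<le> 3 * (\<Sum>c\<in>C. 3 ^ k * card (\<J> c))"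
    using \<rho>2 \<J>(2) by (meson le_trans mult_le_mono2 sum_mono)
  also have "\<dots> = 3 ^ Suc k * (\<Sum>c\<in>C. card (\<J> c))" by (simp add: sum_distrib_left mult.assoc)
  also have "(\<Sum>c\<in>C. card (\<J> c)) = card (Sigma C \<J>)" using fC \<J>(1) by (simp add: card_SigmaI)
  also have "\<dots> = card (pl ` Sigma C \<J>)" using card_image[OF inj] by simp
  finally have crd: "ret b (Suc k) J \<le> 3 ^ Suc k * card (pl ` Sigma C \<J>)" .
  show ?case
  proof (intro exI[of _ "pl ` Sigma C \<J>"] conjI crd ballI impI)
    show "finite (pl ` Sigma C \<J>)" using fC \<J>(1) by (intro finite_imageI finite_SigmaI)
    fix T assume "T \<in> pl ` Sigma C \<J>"
    then obtain c T0 where T: "T = pl (c, T0)" "c \<in> C" "T0 \<in> \<J> c" by auto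
    show "\<exists>x y. x \<le> y \<and> T = {x..y}" "T \<subseteq> J" using pl(1,2)[OF T(2,3)] T(1) by auto
    show "\<exists>v. \<forall>s\<in>cell b. s - v \<in> (\<Phi> ^^ Suc k) ` T \<and> \<pi> (s - v) = \<pi> s"
    proof -
      obtain v1 where v1: "\<And>s. s \<in> cell b \<Longrightarrow> s - v1 \<in> (\<Phi> ^^ k) ` T0 \<and> \<pi> (s - v1) = \<pi> s"
          using \<J>4[OF T(2,3)] by blast
      obtain t0 where t0: "t0 \<in> J" using pieceD(2)[OF J] by auto
      note lf = lift_funpow[OF \<Phi> \<phi>]
      have z: "\<Phi> t0 \<in> S" "\<Phi> t0 + v c \<in> S" "\<pi> (\<Phi> t0 + v c) = \<pi> (\<Phi> t0)" using \<Phi>S JS t0 v[OF T(2)]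
          by auto
      \<comment> \<open>The child is the image moved by \<open>v c\<close>. Under the remaining
        iterate this move becomes a deck translation \<open>w\<close>, which is added to the
        translation \<open>v1\<close> of the later steps.\<close>
      obtain w where w: "\<And>z. z \<in> S \<Longrightarrow> (\<Phi> ^^ k) (z + v c) = (\<Phi> ^^ k) z + w" "\<And>z. z \<in> S \<Longrightarrow>
          z + w \<in> S \<and> \<pi> (z + w) = \<pi> z"
        using lift_deck_shift[OF lf(3)[of k] funpow_points[OF \<phi>] z] by blast
      have "s - (v1 + w) \<in> (\<Phi> ^^ Suc k) ` T \<and> \<pi> (s - (v1 + w)) = \<pi> s" if s: "s \<in> cell b" for s
      proof -
        obtain z where "z \<in> T0" "s - v1 = (\<Phi> ^^ k) z" using v1[OF s] by auto
        then obtain t where t: "t \<in> T" "z = \<Phi> t + v c" using pl(3)[OF T(2,3)] T(1) by blast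
        have tS: "\<Phi> t \<in> S" using t T pl(2)[OF T(2,3)] JS \<Phi>S by auto
        have e: "s - v1 = (\<Phi> ^^ k) (\<Phi> t) + w" using w(1)[OF tS] t \<open>s - v1 = (\<Phi> ^^ k) z\<close> by simp
        then have e2: "s - (v1 + w) = (\<Phi> ^^ Suc k) t" by (simp add: funpow_swap1)
        have "(\<Phi> ^^ k) (\<Phi> t) \<in> S" using lf(1)[OF tS] .
        then have "\<pi> ((\<Phi> ^^ k) (\<Phi> t) + w) = \<pi> ((\<Phi> ^^ k) (\<Phi> t))" using w(2) by blast
        then have "\<pi> (s - (v1 + w)) = \<pi> s" using v1[OF s] e by (simp add: algebra_simps)
        then show ?thesis using e2 t by blast
      qed
      then show ?thesis by blast
    qed
    fix T' t t' assume T': "T' \<in> pl ` Sigma C \<J>" "T \<noteq> T'" "t \<in> T" "t' \<in> T'"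
    then obtain c' T0' where "T' = pl (c', T0')" "c' \<in> C" "T0' \<in> \<J> c'" by auto
    then show "\<exists>i\<le>Suc k. len \<le> 2 * dist ((\<phi> ^^ i) (\<pi> t)) ((\<phi> ^^ i) (\<pi> t'))"
        using sep[OF T(2,3), of c' T0'] T T' by auto
  qed
qed

end

context arc
begin

section \<open>Entropy of a horseshoe and its persistence under perturbation\<close>

text \<open>Separated sets are built backwards: for each \<open>T\<close> and each point
  \<open>e\<close> of the set for N take a point of \<open>T\<close> that \<open>g ^^ m\<close>
  sends to \<open>e\<close>. Different choices of \<open>T\<close> are separated during the first
  \<open>m\<close> steps, different choices of \<open>e\<close> afterwards.\<close>

lemma entropy_of_horseshoe:
  assumes g: "g \<in> points I \<rightarrow> points I" and fin: "finite \<T>" "\<T> \<noteq> {}"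
      and TS: "\<And>T. T \<in> \<T> \<Longrightarrow> T \<subseteq> S \<and> T \<noteq> {}"
    and cov: "\<And>T e. T \<in> \<T> \<Longrightarrow> e \<in> \<Union>\<T> \<Longrightarrow> \<exists>t\<in>T. (g ^^ m) (\<pi> t) = \<pi> e"
    and sep: "\<And>T T' t t'. T \<in> \<T> \<Longrightarrow> T' \<in> \<T> \<Longrightarrow> T \<noteq> T' \<Longrightarrow> t \<in> T \<Longrightarrow> t' \<in> T' \<Longrightarrow>
        \<exists>i\<le>m. dist ((g ^^ i) (\<pi> t)) ((g ^^ i) (\<pi> t')) > \<eta>"
    and m: "m \<ge> 1" and \<eta>: "\<eta> > 0"
  shows "ereal (ln (real (card \<T>)) / real m) \<le> top_entropy (points I) g"
proof -
  have "\<forall>p\<in>\<T> \<times> \<Union>\<T>. \<exists>t. t \<in> fst p \<and> (g ^^ m) (\<pi> t) = \<pi> (snd p)" using cov by fastforce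
  from bchoice[OF this] obtain h
      where h': "\<forall>p\<in>\<T> \<times> \<Union>\<T>. h p \<in> fst p \<and> (g ^^ m) (\<pi> (h p)) = \<pi> (snd p)" by (rule exE)
  have h: "h (T, e) \<in> T" "(g ^^ m) (\<pi> (h (T, e))) = \<pi> e" if "T \<in> \<T>" "e \<in> \<Union>\<T>" for T e
    using bspec[OF h', of "(T, e)"] that by auto
  have ex: "\<exists>E. finite E \<and> E \<subseteq> \<Union>\<T> \<and> card E = card \<T> ^ N \<and> E \<noteq> {} \<and>
    (\<forall>s\<in>E. \<forall>t\<in>E. s \<noteq> t \<longrightarrow> (\<exists>i\<le>m * N. dist ((g ^^ i) (\<pi> s)) ((g ^^ i) (\<pi> t)) > \<eta>))" for N
  proof (induction N)
    case 0
    obtain T t where "T \<in> \<T>" "t \<in> T" using fin TS by fastforce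
    then show ?case by (intro exI[of _ "{t}"]) auto
  next
    case (Suc N)
    then obtain E where E': "finite E \<and> E \<subseteq> \<Union>\<T> \<and> card E = card \<T> ^ N \<and> E \<noteq> {} \<and>
      (\<forall>s\<in>E. \<forall>t\<in>E. s \<noteq> t \<longrightarrow> (\<exists>i\<le>m * N. dist ((g ^^ i) (\<pi> s)) ((g ^^ i) (\<pi> t)) > \<eta>))" by (rule exE)
    note E = E'[THEN conjunct1] E'[THEN conjunct2, THEN conjunct1] E'[THEN conjunct2, THEN
        conjunct2, THEN conjunct1]
      E'[THEN conjunct2, THEN conjunct2, THEN conjunct2, THEN conjunct1]
    have E5: "\<exists>i\<le>m * N. dist ((g ^^ i) (\<pi> s)) ((g ^^ i) (\<pi> t)) > \<eta>" if "s \<in> E" "t \<in> E" "s \<noteq> t"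
        for s t
      using E'[THEN conjunct2, THEN conjunct2, THEN conjunct2, THEN conjunct2, rule_format, OF
        that] .
    have eU: "e \<in> \<Union>\<T>" if "e \<in> E" for e using that E(2) by auto
    have sp: "\<exists>i\<le>m * Suc N. dist ((g ^^ i) (\<pi> (h (T, e)))) ((g ^^ i) (\<pi> (h (T', e')))) > \<eta>"
      if p: "T \<in> \<T>" "e \<in> E" "T' \<in> \<T>" "e' \<in> E" "(T, e) \<noteq> (T', e')" for T e T' e'
    proof (cases "T = T'")
      case False
      then obtain i where "i \<le> m" "dist ((g ^^ i) (\<pi> (h (T, e)))) ((g ^^ i) (\<pi> (h (T', e')))) > \<eta>"
        using sep[OF p(1,3) False h(1)[OF p(1) eU[OF p(2)]] h(1)[OF p(3) eU[OF p(4)]]] by blast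
      then show ?thesis by (intro exI[of _ i]) auto
    next
      case True
      then obtain i where i: "i \<le> m * N" "dist ((g ^^ i) (\<pi> e)) ((g ^^ i) (\<pi> e')) > \<eta>"
          using E5[OF p(2,4)] p(5) True by blast
      have "(g ^^ (i + m)) (\<pi> (h (T, e))) = (g ^^ i) (\<pi> e)" "(g ^^ (i + m)) (\<pi> (h (T', e')))
          = (g ^^ i) (\<pi> e')"
        using h(2)[OF p(1) eU[OF p(2)]] h(2)[OF p(3) eU[OF p(4)]] by (simp_all add: funpow_add)
      then show ?thesis using i by (intro exI[of _ "i + m"]) auto
    qed
    have inj: "inj_on h (\<T> \<times> E)"
    proof (rule inj_onI, rule ccontr)
      fix p q assume a: "p \<in> \<T> \<times> E" "q \<in> \<T> \<times> E" "h p = h q" "p \<noteq> q"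
      then show False using sp[of "fst p" "snd p" "fst q" "snd q"] \<eta> by auto
    qed
    show ?case
    proof (intro exI[of _ "h ` (\<T> \<times> E)"] conjI ballI impI)
      show "finite (h ` (\<T> \<times> E))" using fin E by auto
      show "h ` (\<T> \<times> E) \<subseteq> \<Union>\<T>" using h(1) E(2) by blast
      show "card (h ` (\<T> \<times> E)) = card \<T> ^ Suc N" using card_image[OF inj] E(3)
          by (simp add: card_cartesian_product)
      show "h ` (\<T> \<times> E) \<noteq> {}" using fin E by auto
      fix s t assume "s \<in> h ` (\<T> \<times> E)" "t \<in> h ` (\<T> \<times> E)" "s \<noteq> t"
      then obtain T e T' e'
          where p: "T \<in> \<T>" "e \<in> E" "T' \<in> \<T>" "e' \<in> E" "s = h (T, e)" "t = h (T', e')" by auto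
      then have "(T, e) \<noteq> (T', e')" using \<open>s \<noteq> t\<close> by auto
      then show "\<exists>i\<le>m * Suc N. dist ((g ^^ i) (\<pi> s)) ((g ^^ i) (\<pi> t)) > \<eta>"
          using sp[OF p(1-4)] p(5,6) by simp
    qed
  qed
  define X where "X = (\<lambda>n. SUP E\<in>{E. finite E \<and> E \<noteq> {} \<and>
      separated (points I) g n \<eta> E}. ereal (ln (real (card E)) / real n))"
  have low: "ereal (real N * ln (real (card \<T>)) / real (m * N + 1)) \<le> X (m * N + 1)" for N
  proof -
    obtain E where E: "finite E" "E \<subseteq> \<Union>\<T>" "card E = card \<T> ^ N" "E \<noteq> {}"
      "\<And>s t. s \<in> E \<Longrightarrow> t \<in> E \<Longrightarrow> s \<noteq> t \<Longrightarrow> \<exists>i\<le>m * N. dist ((g ^^ i) (\<pi> s)) ((g ^^ i) (\<pi> t)) > \<eta>"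
          using ex[of N] by blast
    have inj: "inj_on \<pi> E"
    proof (rule inj_onI, rule ccontr)
      fix s t assume a: "s \<in> E" "t \<in> E" "\<pi> s = \<pi> t" "s \<noteq> t"
      then show False using E(5)[OF a(1,2,4)] \<eta> by auto
    qed
    have "\<exists>i<m * N + 1. dist ((g ^^ i) (\<pi> s)) ((g ^^ i) (\<pi> t)) > \<eta>" if "s \<in> E" "t \<in> E" "\<pi> s \<noteq> \<pi> t"
        for s t
    proof -
      have "s \<noteq> t" using that by auto
      then show ?thesis using E(5)[OF that(1,2)] by (metis Suc_eq_plus1 less_Suc_eq_le)
    qed
    moreover have "\<pi> ` E \<subseteq> points I" using E(2) TS unfolding points_def by blast
    ultimately have "separated (points I) g (m * N + 1) \<eta> (\<pi> ` E)" unfolding separated_def by blast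
    then have "ereal (ln (real (card (\<pi> ` E))) / real (m * N + 1)) \<le> X (m * N + 1)"
      unfolding X_def using E by (intro SUP_upper) auto
    also have "card (\<pi> ` E) = card \<T> ^ N" using card_image[OF inj] E(3) by simp
    also have "ln (real (card \<T> ^ N)) = real N * ln (real (card \<T>))"
      using fin by (simp add: ln_realpow card_gt_0_iff)
    finally show ?thesis .
  qed
  have "(\<lambda>N. real N * ln (real (card \<T>)) / real (m * N + 1)) \<longlonglongrightarrow> ln (real (card \<T>))
      * inverse (real m)"
    using m by real_asymp
  also have "ln (real (card \<T>)) * inverse (real m) = ln (real (card \<T>)) / real m"
      by (simp add: divide_inverse)
  finally have "(\<lambda>N. real N * ln (real (card \<T>)) / real (m * N + 1)) \<longlonglongrightarrow> ln (real (card \<T>))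
      / real m" .
  then have "(\<lambda>N. ereal (real N * ln (real (card \<T>)) / real (m * N + 1))) \<longlonglongrightarrow> ereal
      (ln (real (card \<T>)) / real m)" by simp
  then have "ereal (ln (real (card \<T>)) / real m)
      = limsup (\<lambda>N. ereal (real N * ln (real (card \<T>)) / real (m * N + 1)))"
    by (rule lim_imp_Limsup[symmetric, rotated]) simp
  \<comment> \<open>Separated sets have been found for the lengths \<open>m * N + 1\<close> only;
    for the upper limit this subsequence is enough.\<close>
  also have "\<dots> \<le> limsup (X \<circ> (\<lambda>N. m * N + 1))"
    by (rule Limsup_mono) (use low in auto)
  also have "\<dots> \<le> limsup X" by (rule limsup_subseq_mono) (use m in \<open>auto simp: strict_mono_def\<close>)
  also have "\<dots> \<le> top_entropy (points I) g" unfolding top_entropy_def X_def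
    using \<eta> by (intro SUP_upper2[of \<eta>]) auto
  finally show ?thesis .
qed

lemma lipschitz_funpow:
  assumes F: "is_lift I f F" and f: "f \<in> points I \<rightarrow> points I"
    and Lp: "L \<ge> 1" "\<And>s t. s \<in> S \<Longrightarrow> t \<in> S \<Longrightarrow> \<bar>F s - F t\<bar> \<le> L * \<bar>s - t\<bar>"
  shows "s \<in> S \<Longrightarrow> t \<in> S \<Longrightarrow> \<bar>(F ^^ n) s - (F ^^ n) t\<bar> \<le> L ^ n * \<bar>s - t\<bar>"
proof (induction n)
  case (Suc n)
  have "\<bar>F ((F ^^ n) s) - F ((F ^^ n) t)\<bar> \<le> L * \<bar>(F ^^ n) s - (F ^^ n) t\<bar>"
    using Lp(2) lift_funpow(1)[OF F f] Suc.prems by blast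
  also have "\<dots> \<le> L * (L ^ n * \<bar>s - t\<bar>)" using Suc Lp by (intro mult_left_mono) auto
  finally show ?case by (simp add: mult.assoc)
qed simp

lemma funpow_close:
  assumes F: "is_lift I f F" and f: "f \<in> points I \<rightarrow> points I" and G: "is_lift I g G"
      and g: "g \<in> points I \<rightarrow> points I"
    and Lp: "L \<ge> 1" "\<And>s t. s \<in> S \<Longrightarrow> t \<in> S \<Longrightarrow> \<bar>F s - F t\<bar> \<le> L * \<bar>s - t\<bar>"
    and d: "\<And>t. t \<in> S \<Longrightarrow> \<bar>F t - G t\<bar> \<le> e" "e \<ge> 0"
  shows "t \<in> S \<Longrightarrow> \<bar>(F ^^ n) t - (G ^^ n) t\<bar> \<le> e * (real n * L ^ n)"
proof (induction n)
  case (Suc n)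
  let ?z = "(G ^^ n) t"
  have zS: "?z \<in> S" "(F ^^ n) t \<in> S"
      using lift_funpow(1)[OF G g Suc.prems] lift_funpow(1)[OF F f Suc.prems] .
  have "\<bar>F ((F ^^ n) t) - F ?z\<bar> \<le> L * \<bar>(F ^^ n) t - ?z\<bar>" using Lp(2) zS by blast
  also have "\<dots> \<le> L * (e * (real n * L ^ n))" using Suc Lp by (intro mult_left_mono) auto
  finally have "\<bar>F ((F ^^ n) t) - G ?z\<bar> \<le> L * (e * (real n * L ^ n)) + e" using d(1)[OF zS(1)]
      by linarith
  also have "\<dots> \<le> L * (e * (real n * L ^ n)) + e * L ^ Suc n"
    using one_le_power[OF Lp(1), of "Suc n"] d(2) by (simp add: mult_le_cancel_left1)
  also have "\<dots> = e * (real (Suc n) * L ^ Suc n)" by (simp add: algebra_simps)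
  finally show ?case by simp
qed simp

text \<open>Large entropy forces a cell with many complete returns under an iterate of
  \<open>f\<close>, hence a horseshoe. Since its intervals can be chosen inside the cell, away from
  the ends, they still cover each other for maps near \<open>f\<close> in the uniform
  distance.\<close>

lemma entropy_lower_semicontinuous:
  assumes F: "is_lift I f F" and f: "f \<in> points I \<rightarrow> points I"
    and Lp: "L \<ge> 1" "\<And>s t. s \<in> S \<Longrightarrow> t \<in> S \<Longrightarrow> \<bar>F s - F t\<bar> \<le> L * \<bar>s - t\<bar>"
    and a: "a \<ge> 0" "ereal a < top_entropy (points I) f"
  obtains \<rho> where "\<rho> > 0" "\<And>g G0. is_lift I g G0 \<Longrightarrow> g \<in> points I \<rightarrow> points I \<Longrightarrow>
      (\<And>x. x \<in> points I \<Longrightarrow> dist (f x) (g x) \<le> \<rho>) \<Longrightarrow>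
     ereal a \<le> top_entropy (points I) g"
proof -
  obtain a2 where a2: "ereal a < ereal a2" "ereal a2 < top_entropy (points I) f"
      using ereal_dense2[OF a(2)] by blast
  then have aa2: "a < a2" by simp
  from a2(2) obtain \<epsilon> where \<epsilon>: "\<epsilon> > 0"
      and ls: "ereal a2 < limsup (\<lambda>n. SUP E\<in>{E. finite E \<and> E \<noteq> {} \<and>
      separated (points I) f n \<epsilon> E}. ereal (ln (real (card E)) / real n))"
    unfolding top_entropy_def less_SUP_iff by auto
  have big: "\<exists>n\<ge>n0. \<exists>E. finite E \<and> separated (points I) f n \<epsilon> E \<and>
      a2 < ln (real (card E)) / real n" for n0
  proof (rule ccontr)
    assume n: "\<not> ?thesis"
    have "limsup (\<lambda>n. SUP E\<in>{E. finite E \<and> E \<noteq> {} \<and>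
        separated (points I) f n \<epsilon> E}. ereal (ln (real (card E)) / real n)) \<le> ereal a2"
    proof (rule Limsup_bounded, unfold eventually_sequentially, intro exI[of _ n0] allI impI
        SUP_least)
      fix m E assume "n0 \<le> m" "E \<in> {E. finite E \<and> E \<noteq> {} \<and> separated (points I) f m \<epsilon> E}"
      then have "\<not> a2 < ln (real (card E)) / real m" using n by blast
      then show "ereal (ln (real (card E)) / real m) \<le> ereal a2" by simp
    qed
    then show False using ls by simp
  qed
  define a1 where "a1 = (a + a2) / 2"
  have a1: "a < a1" "a1 < a2" "0 < a1" using aa2 a unfolding a1_def by auto
  \<comment> \<open>The iterate is so high that the loss of a factor 3 per step in
    \<open>horseshoe\<close> is less than the gain exp (p (a1 - a)). It also gives y \<ge> 3, hence
    x > 2 as in \<open>cnt_growth\<close>.\<close>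
  obtain p :: nat where p: "ln 3 / (a1 - a) \<le> real p" using real_arch_simple by blast
  have ln3: "ln 3 > (0::real)" by simp
  have p1: "p \<ge> 1"
  proof -
    have "0 < ln 3 / (a1 - a)" using a1 ln3 by simp
    then have "real p > 0" using p by linarith
    then show ?thesis by simp
  qed
  have pl3: "ln 3 \<le> real p * (a1 - a)" using p a1 by (simp add: field_simps)
  define x where "x = exp (real p * ((a1 + a2) / 2))"
  define y where "y = exp (real p * a1)"
  have y3: "3 * exp (real p * a) \<le> y"
  proof -
    have "3 * exp (real p * a) = exp (ln 3 + real p * a)" by (simp add: exp_add)
    also have "\<dots> \<le> y" unfolding y_def using pl3 by (simp add: algebra_simps)
    finally show ?thesis .
  qed
  have "1 \<le> exp (real p * a)" using a by simp
  then have y: "3 \<le> y" using y3 by linarith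
  have yx: "y < x" using a1 p1 unfolding x_def y_def by auto
  define LL where "LL = L ^ p"
  have LL1: "LL \<ge> 1" unfolding LL_def using Lp by simp
  \<comment> \<open>1/4 is what \<open>cells\<close> requires of images of cells. \<epsilon>/4 makes
    cells so short that points within \<open>len\<close>, lifted at the price of a factor 2, cannot
    become \<epsilon>-separated in fewer than \<open>p\<close> further steps.\<close>
  define \<mu> where "\<mu> = min (1/4) (\<epsilon> / 4)"
  have \<mu>: "\<mu> \<le> 1/4" "\<mu> \<le> \<epsilon> / 4" unfolding \<mu>_def by auto
  obtain Q' :: nat where Q': "LL * lam / \<mu> \<le> real Q'" using real_arch_simple by blast
  have mn: "0 < \<mu>" unfolding \<mu>_def using \<epsilon> by simp
  have Q'1: "1 \<le> Q'"
  proof -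
    have "0 < LL * lam / \<mu>" using LL1 lam(1) mn by (intro divide_pos_pos) auto
    then have "0 < real Q'" using Q' by linarith
    then show ?thesis by simp
  qed
  have Q'2: "LL * (lam / real (3 * Q')) \<le> \<mu>"
  proof -
    have "LL * lam \<le> real Q' * \<mu>" using Q' mn by (simp add: pos_divide_le_eq)
    also have "\<dots> \<le> real (3 * Q') * \<mu>" using mn by (intro mult_right_mono) auto
    finally show ?thesis using Q'1 by (simp add: pos_divide_le_eq mult.commute)
  qed
  define \<phi> where "\<phi> = f ^^ p"
  define \<Phi> where "\<Phi> = F ^^ p"
  interpret C: cells I lam \<phi> \<Phi> LL Q'
  proof
    show "is_lift I \<phi> \<Phi>" unfolding \<phi>_def \<Phi>_def by (rule lift_funpow[OF F f])
    show "\<phi> \<in> points I \<rightarrow> points I" unfolding \<phi>_def by (rule funpow_points[OF f])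
    show "\<bar>\<Phi> s - \<Phi> t\<bar> \<le> LL * \<bar>s - t\<bar>" if "s \<in> S" "t \<in> S" for s t
      unfolding \<Phi>_def LL_def by (rule lipschitz_funpow[OF F f Lp that])
    show "LL * (lam / real (3 * Q')) \<le> 1 / 4" using Q'2 \<mu>(1) by (rule order_trans)
  qed (use LL1 Q'1 Q'2 \<mu> in auto)
  have len\<epsilon>: "2 * (LL * C.len) < \<epsilon>" using Q'2 \<epsilon> \<mu> unfolding C.len_def C.Q_def by auto
  have \<phi>pow: "(\<phi> ^^ i) z = (f ^^ (p * i)) z" for i z unfolding \<phi>_def
      by (simp add: funpow_mult mult.commute)
  \<comment> \<open>Otherwise \<open>cnt_growth\<close> bounds separated sets by a constant times
    x^(n/p), and x is the exponential of p times a number below \<open>a2\<close>.\<close>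
  have "\<exists>b<C.Q. \<exists>k\<ge>1. 3 * y ^ k < real (C.ret b k (C.cell b))"
  proof (rule ccontr)
    assume n: "\<not> ?thesis"
    have "\<exists>C\<ge>0. \<forall>a\<in>{..<C.Q}. \<forall>n. real (C.cnt {..<C.Q} n (C.cell a)) \<le> C * x ^ n"
    proof (rule C.cnt_growth[of x y 3])
      show "real (C.ret b k (C.cell b)) \<le> 3 * y ^ k" if "b < C.Q" "1 \<le> k" for b k using n that
          by (meson not_less)
    qed (use y yx in auto)
    then obtain D where D: "D \<ge> 0" "\<And>c n. c < C.Q \<Longrightarrow>
        real (C.cnt {..<C.Q} n (C.cell c)) \<le> D * x ^ n" by auto
    have crd: "real (card E) \<le> real C.Q * D * x ^ (n div p)"
        if E: "finite E" "separated (points I) f n \<epsilon> E" for n E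
    proof -
      have EX: "E \<subseteq> points I" using E unfolding separated_def by auto
      have "\<forall>e\<in>E. \<exists>q. fst q < C.Q \<and> snd q \<in> C.cell (fst q) \<and> \<pi> (snd q) = e"
      proof
        fix e assume "e \<in> E"
        then obtain t where "t \<in> {0..lam}" "\<pi> t = e" using EX points_eq by auto
        then show "\<exists>q. fst q < C.Q \<and> snd q \<in> C.cell (fst q) \<and> \<pi> (snd q) = e"
            using C.cell_cover[of t] by auto
      qed
      from bchoice[OF this] obtain q
          where q': "\<forall>e\<in>E. fst (q e) < C.Q \<and> snd (q e) \<in> C.cell (fst (q e)) \<and> \<pi> (snd (q e)) = e"
          by (rule exE)
      note q = bspec[OF q']
      define Ec where "Ec = (\<lambda>c. {e\<in>E. fst (q e) = c})"
      have inj: "inj_on (\<lambda>e. snd (q e)) E" by (rule inj_onI) (metis q)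
      have one: "card (Ec c) \<le> C.cnt {..<C.Q} (n div p) (C.cell c)" if c: "c < C.Q" for c
      proof -
        have "card (Ec c) = card ((\<lambda>e. snd (q e)) ` Ec c)"
            by (rule card_image[symmetric], rule inj_on_subset[OF inj]) (auto simp: Ec_def)
        also have "\<dots> \<le> C.cnt {..<C.Q} (n div p) (C.cell c)"
        proof (rule C.separated_le_cnt[OF C.piece_cell[OF c]])
          show "finite ((\<lambda>e. snd (q e)) ` Ec c)" using E unfolding Ec_def by auto
          show "(\<lambda>e. snd (q e)) ` Ec c \<subseteq> C.cell c" using q unfolding Ec_def by auto
          fix s t assume "s \<in> (\<lambda>e. snd (q e)) ` Ec c" "t \<in> (\<lambda>e. snd (q e)) ` Ec c" "s \<noteq> t"
          then obtain e e' where e: "e \<in> E" "e' \<in> E" "s = snd (q e)" "t = snd (q e')" "e \<noteq> e'"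
              unfolding Ec_def by auto
          then obtain j where j: "j < n" "dist ((f ^^ j) e) ((f ^^ j) e') > \<epsilon>" using E(2)
              unfolding separated_def by blast
          \<comment> \<open>Separation of orbits of \<open>f\<close> at time \<open>j\<close> is
            traced back to the last multiple of \<open>p\<close>, the times seen by \<phi>; the
            fewer than \<open>p\<close> steps in between expand by at most
            \<open>LL\<close>.\<close>
          define i where "i = j div p"
          define l where "l = j mod p"
          have jl: "j = l + p * i" "l < p" using p1 unfolding i_def l_def by auto
          have il: "i \<le> n div p" unfolding i_def using j by (intro div_le_mono) auto
          let ?X = "(\<phi> ^^ i) e" and ?Y = "(\<phi> ^^ i) e'"
          have XY: "?X \<in> points I" "?Y \<in> points I" using funpow_points[OF C.\<phi>, of i] e EX by auto
          then obtain s1 t1 where s1: "s1 \<in> S" "\<pi> s1 = ?X" "t1 \<in> S" "\<pi> t1 = ?Y"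
              unfolding points_def by (metis imageE)
          obtain t2 where t2: "t2 \<in> S" "\<pi> t2 = ?Y" "\<bar>s1 - t2\<bar> \<le> 2 * dist ?X ?Y"
              using local_lift[OF s1(1,3)] s1 by auto
          note lf = lift_funpow[OF F f]
          have "\<epsilon> < dist ((f ^^ l) ?X) ((f ^^ l) ?Y)" using j(2) unfolding jl(1) \<phi>pow
              by (simp add: funpow_add)
          also have "\<dots> = dist (\<pi> ((F ^^ l) s1)) (\<pi> ((F ^^ l) t2))" using lf(2) s1 t2 by auto
          also have "\<dots> \<le> \<bar>(F ^^ l) s1 - (F ^^ l) t2\<bar>" using dist_le lf(1) s1 t2 by blast
          also have "\<dots> \<le> L ^ l * \<bar>s1 - t2\<bar>" by (rule lipschitz_funpow[OF F f Lp s1(1) t2(1)])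
          also have "\<dots> \<le> LL * (2 * dist ?X ?Y)"
            unfolding LL_def using t2(3) Lp jl by (intro mult_mono power_increasing) auto
          finally have "2 * (LL * C.len) < 2 * (LL * dist ?X ?Y)" using len\<epsilon> by linarith
          then have "C.len < dist ?X ?Y" using LL1 by simp
          then show "\<exists>i\<le>n div p. dist ((\<phi> ^^ i) (\<pi> s)) ((\<phi> ^^ i) (\<pi> t)) > C.len" using il q e
              by auto
        qed
        finally show ?thesis .
      qed
      have "card E = (\<Sum>c<C.Q. card (Ec c))"
      proof -
        have "(\<lambda>e. fst (q e)) ` E \<subseteq> {..<C.Q}" using q by auto
        then show ?thesis using sum.group[of E "{..<C.Q}" "\<lambda>e. fst (q e)" "\<lambda>_. 1::nat"] E
            unfolding Ec_def by simp
      qed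
      then have "real (card E) = (\<Sum>c<C.Q. real (card (Ec c)))" by simp
      also have "\<dots> \<le> (\<Sum>c<C.Q. D * x ^ (n div p))"
      proof (rule sum_mono)
        fix c assume "c \<in> {..<C.Q}"
        then have c: "c < C.Q" by simp
        have "real (card (Ec c)) \<le> real (C.cnt {..<C.Q} (n div p) (C.cell c))" using one[OF c]
            by simp
        then show "real (card (Ec c)) \<le> D * x ^ (n div p)" using D(2)[OF c, of "n div p"]
            by linarith
      qed
      finally show ?thesis by simp
    qed
    define B where "B = max 1 (real C.Q * D)"
    have B: "B \<ge> 1" "real C.Q * D \<le> B" unfolding B_def by auto
    obtain n0 :: nat where n0: "ln B / ((a2 - a1) / 2) < real n0" using reals_Archimedean2 by blast
    obtain n E where nE: "n \<ge> n0 + 1" "finite E" "separated (points I) f n \<epsilon> E"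
        "a2 < ln (real (card E)) / real n" using big by blast
    have n: "real n > 0" using nE by simp
    have l: "a2 * real n < ln (real (card E))" using nE(4) n by (simp add: pos_less_divide_eq)
    have "0 < a2 * real n" using n a1 by simp
    then have cE: "real (card E) > 0" using l by (cases "card E = 0") auto
    have x1: "1 \<le> x" using y yx by linarith
    have "real (card E) \<le> B * x ^ (n div p)"
      using crd[OF nE(2,3)] B x1 by (meson mult_right_mono order_trans zero_le_power zero_le_one)
    then have "ln (real (card E)) \<le> ln (B * x ^ (n div p))" using cE by (intro ln_mono) auto
    also have "\<dots> = ln B + real (n div p) * (real p * ((a1 + a2) / 2))"
      using B x1 by (simp add: ln_mult ln_realpow x_def)
    also have "real (n div p) * (real p * ((a1 + a2) / 2)) = real (n div p * p) * ((a1 + a2) / 2)"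
        by simp
    also have "\<dots> \<le> real n * ((a1 + a2) / 2)"
    proof (rule mult_right_mono)
      show "real (n div p * p) \<le> real n" by (simp only: of_nat_le_iff div_times_less_eq_dividend)
    qed (use a1 in auto)
    finally have "a2 * real n < ln B + real n * ((a1 + a2) / 2)" using l by linarith
    moreover have "real n * ((a1 + a2) / 2) = a2 * real n - (a2 - a1) / 2 * real n"
        by (simp add: field_simps)
    ultimately have "(a2 - a1) / 2 * real n < ln B" by linarith
    moreover have "ln B < (a2 - a1) / 2 * real n0" using n0 a1 by (simp add: field_simps)
    moreover have "(a2 - a1) / 2 * real n0 \<le> (a2 - a1) / 2 * real n" using nE(1) a1
        by (intro mult_left_mono) auto
    ultimately show False by linarith
  qed
  then obtain b k where bk: "b < C.Q" "k \<ge> 1" "3 * y ^ k < real (C.ret b k (C.cell b))" by blast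
  from C.horseshoe[OF bk(1) C.piece_cell[OF bk(1)], of k] obtain \<J> where rj:
    "finite \<J> \<and> C.ret b k (C.cell b) \<le> 3 ^ k * card \<J> \<and> (\<forall>T\<in>\<J>. (\<exists>x y. x \<le> y \<and> T = {x..y}) \<and>
        T \<subseteq> C.cell b) \<and>
     (\<forall>T\<in>\<J>. \<exists>v. \<forall>s\<in>C.cell b. s - v \<in> (\<Phi> ^^ k) ` T \<and> \<pi> (s - v) = \<pi> s) \<and>
     (\<forall>T\<in>\<J>. \<forall>T'\<in>\<J>. T \<noteq> T' \<longrightarrow> (\<forall>t\<in>T. \<forall>t'\<in>T'. \<exists>i\<le>k. C.len \<le> 2 * dist ((\<phi> ^^ i) (\<pi> t)) ((\<phi> ^^ i) (\<pi>
         t'))))"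
    by (rule exE)
  note rj5 = rj[THEN conjunct2, THEN conjunct2, THEN conjunct2, THEN conjunct2]
  have \<J>: "finite \<J>" "C.ret b k (C.cell b) \<le> 3 ^ k * card \<J>" using rj by simp_all
  have \<J>3: "(\<exists>x y. x \<le> y \<and> T = {x..y}) \<and> T \<subseteq> C.cell b" if "T \<in> \<J>" for T
    using rj[THEN conjunct2, THEN conjunct2, THEN conjunct1] that by (rule bspec)
  have \<J>4: "\<exists>v. \<forall>s\<in>C.cell b. s - v \<in> (\<Phi> ^^ k) ` T \<and> \<pi> (s - v) = \<pi> s" if "T \<in> \<J>" for T
    using rj[THEN conjunct2, THEN conjunct2, THEN conjunct2, THEN conjunct1] that by (rule bspec)
  have \<J>5: "\<exists>i\<le>k. C.len \<le> 2 * dist ((\<phi> ^^ i) (\<pi> t)) ((\<phi> ^^ i) (\<pi> t'))"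
    if "T \<in> \<J>" "T' \<in> \<J>" "T \<noteq> T'" "t \<in> T" "t' \<in> T'" for T T' t t'
    using rj5[rule_format, OF that] .
  define \<alpha> where "\<alpha> = real b * C.len"
  define \<beta> where "\<beta> = real (Suc b) * C.len"
  have cb: "C.cell b = {\<alpha>..\<beta>}" unfolding \<alpha>_def \<beta>_def C.cell_def ..
  have ab: "\<alpha> \<in> C.cell b" "\<beta> \<in> C.cell b" unfolding cb \<alpha>_def \<beta>_def using C.len
      by (auto simp: mult_le_cancel_right)
  define m where "m = p * k"
  have m1: "m \<ge> 1" unfolding m_def using p1 bk(2) by simp
  define A where "A = exp (real m * a)"
  have A1: "A \<ge> 1" unfolding A_def using a by simp
  have N0: "3 * A < real (card \<J>)"
  proof -
    have "A = exp (real p * a) ^ k" unfolding A_def m_def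
        by (simp add: exp_of_nat_mult[symmetric] mult_ac)
    then have "3 ^ k * A = (3 * exp (real p * a)) ^ k" by (simp add: power_mult_distrib)
    also have "\<dots> \<le> y ^ k" by (rule power_mono[OF y3]) simp
    finally have "3 * (3 ^ k * A) < real (3 ^ k * card \<J>)" using bk(3) \<J>(2) by linarith
    then show ?thesis by simp
  qed
  have disj: "T = T'" if T: "T \<in> \<J>" "T' \<in> \<J>" "z \<in> T" "z \<in> T'" for T T' z
  proof (rule ccontr)
    assume "T \<noteq> T'"
    from \<J>5[OF T(1,2) this T(3,4)] show False using C.len by auto
  qed
  \<comment> \<open>The intervals are disjoint, so at most one contains \<alpha> and at most one
    \<beta>. The others keep a positive distance from the ends of the cell. By \<open>N0\<close> at
    least 3 A - 2 \<ge> A remain.\<close>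
  define \<J>' where "\<J>' = {T\<in>\<J>. \<alpha> \<notin> T \<and> \<beta> \<notin> T}"
  have f': "finite \<J>'" unfolding \<J>'_def using \<J>(1) by simp
  have c1: "card {T\<in>\<J>. z \<in> T} \<le> Suc 0" for z
    using \<J>(1) disj by (subst card_le_Suc0_iff_eq) auto
  have "card \<J> \<le> card (\<J>' \<union> ({T\<in>\<J>. \<alpha> \<in> T} \<union> {T\<in>\<J>. \<beta> \<in> T}))"
    by (rule card_mono) (use \<J>(1) in \<open>auto simp: \<J>'_def\<close>)
  also have "\<dots> \<le> card \<J>' + card ({T\<in>\<J>. \<alpha> \<in> T} \<union> {T\<in>\<J>. \<beta> \<in> T})" by (rule card_Un_le)
  also have "\<dots> \<le> card \<J>' + (card {T\<in>\<J>. \<alpha> \<in> T} + card {T\<in>\<J>. \<beta> \<in> T})" using card_Un_le by simp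
  also have "\<dots> \<le> card \<J>' + 2" using c1[of \<alpha>] c1[of \<beta>] by simp
  finally have "real (card \<J>) \<le> real (card \<J>') + 2" by simp
  then have cA: "A \<le> real (card \<J>')" using N0 A1 by linarith
  have ne: "\<J>' \<noteq> {}" using cA A1 by auto
  have "\<forall>T\<in>\<J>'. \<exists>d>0. T \<subseteq> {\<alpha> + d..\<beta> - d}"
  proof
    fix T assume "T \<in> \<J>'"
    then have T: "T \<in> \<J>" "\<alpha> \<notin> T" "\<beta> \<notin> T" unfolding \<J>'_def by auto
    obtain s t where st: "s \<le> t" "T = {s..t}" "T \<subseteq> {\<alpha>..\<beta>}" using \<J>3[OF T(1)] unfolding cb by auto
    then have "\<alpha> < s" "t < \<beta>" using T by (auto simp: less_le)
    then show "\<exists>d>0. T \<subseteq> {\<alpha> + d..\<beta> - d}" using st by (intro exI[of _ "min (s - \<alpha>) (\<beta> - t)"]) auto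
  qed
  from bchoice[OF this] obtain d where d': "\<forall>T\<in>\<J>'. 0 < d T \<and> T \<subseteq> {\<alpha> + d T..\<beta> - d T}" by (rule exE)
  note d = bspec[OF d']
  define \<eta> where "\<eta> = Min (insert (C.len / 2) (d ` \<J>'))"
  have fin: "finite (insert (C.len / 2) (d ` \<J>'))" using f' by simp
  have \<eta>0: "\<eta> > 0" unfolding \<eta>_def using fin C.len d by (subst Min_gr_iff) auto
  have "\<eta> \<le> C.len / 2" unfolding \<eta>_def using fin by (intro Min_le) auto
  note \<eta> = \<eta>0 this
  have \<eta>d: "T \<subseteq> {\<alpha> + \<eta>..\<beta> - \<eta>}" if "T \<in> \<J>'" for T
  proof -
    have "\<eta> \<le> d T" unfolding \<eta>_def using fin that by (intro Min_le) auto
    then show ?thesis using d[OF that] by auto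
  qed
  \<comment> \<open>1/4 is the bound for \<open>near_lift\<close>. The second bound makes lifts at
    distance 2 \<rho> follow each other up to \<eta>/4 for \<open>m\<close> steps, by
    \<open>funpow_close\<close>.\<close>
  define \<rho> where "\<rho> = min (1/4) (\<eta> / (8 * (real m * L ^ m)))"
  have mL: "real m * L ^ m > 0" using m1 Lp by simp
  have \<rho>: "\<rho> > 0" "2 * \<rho> < 1" "2 * \<rho> * (real m * L ^ m) \<le> \<eta> / 4"
  proof -
    show "\<rho> > 0" "2 * \<rho> < 1" unfolding \<rho>_def using \<eta> mL by auto
    have "2 * \<rho> * (real m * L ^ m) \<le> 2 * (\<eta> / (8 * (real m * L ^ m))) * (real m * L ^ m)"
      unfolding \<rho>_def using mL by (intro mult_right_mono) auto
    also have "\<dots> = \<eta> / 4"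
    proof -
      have "2 * (\<eta> / (8 * Z)) * Z = \<eta> / 4" if "Z > 0" for Z using that by (simp add: field_simps)
      from this[OF mL] show ?thesis .
    qed
    finally show "2 * \<rho> * (real m * L ^ m) \<le> \<eta> / 4" .
  qed
  have \<Phi>k: "\<Phi> ^^ k = F ^^ m" unfolding \<Phi>_def m_def by (simp add: funpow_mult mult.commute)
  show ?thesis
  proof (rule that[OF \<rho>(1)])
    fix g G0 assume G0: "is_lift I g G0" and g: "g \<in> points I \<rightarrow> points I"
        and dg: "\<And>x. x \<in> points I \<Longrightarrow> dist (f x) (g x) \<le> \<rho>"
    obtain G where G: "is_lift I g G" "\<And>t. t \<in> S \<Longrightarrow> \<bar>F t - G t\<bar> \<le> 2 * \<rho>"
      by (rule near_lift[OF F G0 f g _ \<rho>(2)], erule dg, rule that)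
    have close: "\<bar>(F ^^ i) t - (G ^^ i) t\<bar> \<le> \<eta> / 4" if "t \<in> S" "i \<le> m" for t i
    proof -
      have "\<bar>(F ^^ i) t - (G ^^ i) t\<bar> \<le> 2 * \<rho> * (real i * L ^ i)"
        by (rule funpow_close[OF F f G(1) g Lp G(2) _ that(1)]) (use \<rho> in auto)
      also have "\<dots> \<le> 2 * \<rho> * (real m * L ^ m)"
        using \<rho> Lp that by (intro mult_left_mono mult_mono power_increasing) auto
      finally show ?thesis using \<rho>(3) by linarith
    qed
    note lF = lift_funpow[OF F f] and lG = lift_funpow[OF G(1) g]
    have TS: "T \<subseteq> S" "T \<noteq> {}" "T \<in> \<J>" if "T \<in> \<J>'" for T
      using that \<J>3[of T] C.cell_S[OF bk(1)] unfolding \<J>'_def by auto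
    have "ereal (ln (real (card \<J>')) / real m) \<le> top_entropy (points I) g"
    proof (rule entropy_of_horseshoe[OF g f' ne _ _ _ m1, of "\<eta> / 4"])
      show "T \<subseteq> S \<and> T \<noteq> {}" if "T \<in> \<J>'" for T using TS[OF that] by auto
      show "\<eta> / 4 > 0" using \<eta> by simp
      show "\<exists>t\<in>T. (g ^^ m) (\<pi> t) = \<pi> e" if T: "T \<in> \<J>'" and e: "e \<in> \<Union>\<J>'" for T e
      proof -
        have er: "\<alpha> + \<eta> \<le> e" "e \<le> \<beta> - \<eta>" using e \<eta>d by fastforce+
        obtain v where v: "\<And>s. s \<in> C.cell b \<Longrightarrow> s - v \<in> (F ^^ m) ` T \<and> \<pi> (s - v) = \<pi> s"
          using \<J>4[OF TS(3)[OF T]] unfolding \<Phi>k by blast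
        obtain t1 t2 where t: "t1 \<in> T" "\<alpha> - v = (F ^^ m) t1" "t2 \<in> T" "\<beta> - v = (F ^^ m) t2"
          using v[OF ab(1)] v[OF ab(2)] by auto
        have tS: "t1 \<in> S" "t2 \<in> S" using t TS[OF T] by auto
        \<comment> \<open>\<open>e\<close> stays \<eta> away from the ends of the cell, and the
          perturbation moves the covering points by at most \<eta>/4, so the intermediate value
          theorem still applies.\<close>
        have b1: "(G ^^ m) t1 \<le> e - v" using close[OF tS(1), of m] t(2) er \<eta> by linarith
        have b2: "e - v \<le> (G ^^ m) t2" using close[OF tS(2), of m] t(4) er \<eta> by linarith
        obtain x1 y1 where T1: "T = {x1..y1}" using \<J>3[OF TS(3)[OF T]] by auto
        have "continuous_on T (G ^^ m)" using lG(3)[of m] TS[OF T] unfolding is_lift_def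
            by (auto intro: continuous_on_subset)
        then have "connected ((G ^^ m) ` T)" unfolding T1 by (intro connected_continuous_image) auto
        then have "e - v \<in> (G ^^ m) ` T" using b1 b2 t by (meson connectedD_interval imageI)
        then obtain t where t: "t \<in> T" "e - v = (G ^^ m) t" by auto
        have "e \<in> C.cell b" unfolding cb using er \<eta> by auto
        then have "\<pi> (e - v) = \<pi> e" using v by blast
        moreover have "\<pi> ((G ^^ m) t) = (g ^^ m) (\<pi> t)" using lG(2) t TS[OF T] by auto
        ultimately show ?thesis using t by auto
      qed
      show "\<exists>i\<le>m. dist ((g ^^ i) (\<pi> t)) ((g ^^ i) (\<pi> t')) > \<eta> / 4"
        if T: "T \<in> \<J>'" "T' \<in> \<J>'" "T \<noteq> T'" "t \<in> T" "t' \<in> T'" for T T' t t'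
      proof -
        obtain i where i: "i \<le> k" "C.len \<le> 2 * dist ((\<phi> ^^ i) (\<pi> t)) ((\<phi> ^^ i) (\<pi> t'))"
          using \<J>5[OF TS(3)[OF T(1)] TS(3)[OF T(2)] T(3,4,5)] by blast
        have im: "p * i \<le> m" unfolding m_def using i by simp
        have tS: "t \<in> S" "t' \<in> S" using T TS by auto
        have e: "dist ((f ^^ (p * i)) (\<pi> s)) ((g ^^ (p * i)) (\<pi> s)) \<le> \<eta> / 4" if "s \<in> S" for s
        proof -
          have "dist (\<pi> ((F ^^ (p * i)) s)) (\<pi> ((G ^^ (p * i)) s)) \<le> \<bar>(F ^^ (p * i)) s
              - (G ^^ (p * i)) s\<bar>"
            by (rule dist_le[OF lF(1)[OF that] lG(1)[OF that]])
          then show ?thesis using close[OF that im] lF(2)[OF that] lG(2)[OF that] by simp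
        qed
        have "\<eta> \<le> dist ((f ^^ (p * i)) (\<pi> t)) ((f ^^ (p * i)) (\<pi> t'))" using i(2) \<eta>(2)
            unfolding \<phi>pow by linarith
        also have "\<dots> \<le> \<eta> / 4 + dist ((g ^^ (p * i)) (\<pi> t)) ((g ^^ (p * i)) (\<pi> t')) + \<eta> / 4"
          using e[OF tS(1)] e[OF tS(2)] by (smt (verit) dist_commute dist_triangle)
        finally show ?thesis using im \<eta> by (intro exI[of _ "p * i"]) auto
      qed
    qed
    moreover have "a \<le> ln (real (card \<J>')) / real m"
    proof -
      have "real m * a = ln A" unfolding A_def by simp
      also have "\<dots> \<le> ln (real (card \<J>'))" using cA A1 by (intro ln_mono) auto
      finally show ?thesis using m1 by (simp add: field_simps)
    qed
    ultimately show "ereal a \<le> top_entropy (points I) g" by (meson ereal_less_eq(3) order_trans)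
  qed
qed

end

section \<open>Uniform estimates near a map of class $C^r$\<close>

text \<open>Fekete's subadditive lemma: write n = q p + s with s < p for a \<open>p\<close> whose
  quotient is nearly the infimum.\<close>

lemma fekete_lim:
  fixes a :: "nat \<Rightarrow> real"
  assumes nn: "\<And>n. 0 \<le> a n" and sub: "\<And>m n. a (m + n) \<le> a m + a n"
  shows "(\<lambda>n. a n / real n) \<longlonglongrightarrow> (INF n\<in>{1..}. a n / real n)"
proof -
  define l where "l = (INF n\<in>{1..}. a n / real n)"
  have bdd: "bdd_below ((\<lambda>n. a n / real n) ` {1..})" by (rule bdd_belowI[of _ 0]) (use nn in auto)
  have low: "l \<le> a n / real n" if "n \<ge> 1" for n unfolding l_def using bdd that
      by (intro cINF_lower) auto
  have mult: "a (q * p + s) \<le> real q * a p + a s" for q p s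
  proof (induction q)
    case (Suc q)
    have "a (Suc q * p + s) = a (p + (q * p + s))" by (simp add: algebra_simps)
    also have "\<dots> \<le> a p + a (q * p + s)" by (rule sub)
    finally show ?case using Suc by (simp add: algebra_simps)
  qed simp
  show ?thesis unfolding l_def[symmetric]
  proof (rule LIMSEQ_I)
    fix e :: real assume e: "0 < e"
    have "l < l + e / 2" using e by simp
    then obtain p where p: "p \<ge> 1" "a p / real p < l + e / 2"
      unfolding l_def using bdd by (subst (asm) cINF_less_iff) auto
    define C where "C = (\<Sum>s<p. a s)"
    have C: "a s \<le> C" if "s < p" for s unfolding C_def using nn that by (intro member_le_sum) auto
    have C0: "C \<ge> 0" unfolding C_def using nn by (intro sum_nonneg) auto
    obtain n0 :: nat where n0: "2 * C / e < real n0" using reals_Archimedean2 by blast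
    show "\<exists>no. \<forall>n\<ge>no. norm (a n / real n - l) < e"
    proof (intro exI[of _ "n0 + 1"] allI impI)
      fix n assume n: "n0 + 1 \<le> n"
      have n1: "real n > 0" using n by simp
      have "a n \<le> real (n div p) * a p + a (n mod p)" using mult[of "n div p" p "n mod p"] by simp
      also have "\<dots> \<le> real (n div p) * a p + C" using C[of "n mod p"] p by simp
      also have "real (n div p) * a p = real (n div p * p) * (a p / real p)" using p by simp
      also have "\<dots> \<le> real n * (a p / real p)"
      proof (rule mult_right_mono)
        show "real (n div p * p) \<le> real n" by (simp only: of_nat_le_iff div_times_less_eq_dividend)
      qed (use nn in auto)
      also have "\<dots> \<le> real n * (l + e / 2)" using p n1 by (intro mult_left_mono) auto
      finally have "a n / real n \<le> l + e / 2 + C / real n" using n1 by (simp add: field_simps)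
      moreover have "C / real n < e / 2"
      proof -
        have "2 * C / e < real n" using n0 n by linarith
        then show ?thesis using e n1 by (simp add: field_simps)
      qed
      moreover have "l \<le> a n / real n" by (rule low) (use n in simp)
      ultimately have "\<bar>a n / real n - l\<bar> < e" by linarith
      then show "norm (a n / real n - l) < e" by simp
    qed
  qed
qed

context arc
begin

lemma within_nontrivial: "t \<in> S \<Longrightarrow> at t within S \<noteq> bot"
proof -
  assume t: "t \<in> S"
  have "0 \<in> S" "1 \<in> S" using lam by auto
  then have "\<not> (\<exists>x. S = {x})" by (metis singletonD zero_neq_one)
  then have "t islimpt S" using connected_imp_perfect convex_connected[OF convS] t by blast
  then show ?thesis by (simp add: trivial_limit_within)
qed

lemma nth_deriv_unique:
  assumes "(f has_real_derivative y) (at t within S)" "t \<in> S"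
  shows "vector_derivative f (at t within S) = y"
  using vector_derivative_within[OF within_nontrivial[OF assms(2)]] assms(1)
  by (simp add: has_real_derivative_iff_has_vector_derivative)

lemma cr_derivs:
  assumes g: "cr_map I r g" and r: "r > 1" and G: "is_lift I g G"
  defines "k \<equiv> nat \<lfloor>r\<rfloor>"
  shows "\<And>i t. i < k \<Longrightarrow> t \<in> S \<Longrightarrow> (nth_deriv S i G has_real_derivative nth_deriv S (Suc i) G t)
      (at t within S)"
    and "continuous_on S (nth_deriv S k G)" and "holder_on (r - \<lfloor>r\<rfloor>) S (nth_deriv S k G)"
proof -
  from g obtain G0 where G0: "is_lift I g G0" "Ck_on k S G0"
      "holder_on (r - \<lfloor>r\<rfloor>) S (nth_deriv S k G0)"
    unfolding cr_map_def k_def by auto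
  obtain c where c: "\<And>t. t \<in> S \<Longrightarrow> G t = G0 t + c" using lift_diff[OF G G0(1)] by blast
  have k1: "1 \<le> k" using r unfolding k_def by (simp add: le_nat_floor)
  have e: "nth_deriv S i G t = nth_deriv S i G0 t" if "1 \<le> i" "t \<in> S" for i t
    by (rule nth_deriv_diff[OF c that])
  have d0: "(nth_deriv S i G0 has_real_derivative nth_deriv S (Suc i) G0 t) (at t within S)"
      if "i < k" "t \<in> S" for i t
    using G0(2) that unfolding Ck_on_def differentiable_on_def
    by (simp add: has_real_derivative_iff_has_vector_derivative vector_derivative_works[symmetric])
  show "(nth_deriv S i G has_real_derivative nth_deriv S (Suc i) G t) (at t within S)"
      if it: "i < k" "t \<in> S" for i t
  proof (cases "i = 0")
    case True
    have "((\<lambda>t. G0 t + c) has_real_derivative nth_deriv S 1 G0 t) (at t within S)"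
      using d0[of 0 t] it True by (auto intro!: derivative_eq_intros)
    then have "(G has_real_derivative nth_deriv S 1 G0 t) (at t within S)"
      by (rule has_field_derivative_transform_within[OF _ zero_less_one it(2)]) (simp add: c)
    then show ?thesis using e[of 1 t] it True by simp
  next
    case False
    have "(nth_deriv S i G has_real_derivative nth_deriv S (Suc i) G0 t) (at t within S)"
      by (rule has_field_derivative_transform_within[OF d0[OF it] zero_less_one it(2)]) (use e
        False in auto)
    then show ?thesis using e[of "Suc i" t] it by simp
  qed
  show "continuous_on S (nth_deriv S k G)"
    using G0(2) e[OF k1] unfolding Ck_on_def by (metis continuous_on_cong)
  show "holder_on (r - \<lfloor>r\<rfloor>) S (nth_deriv S k G)" using G0(3) e[OF k1] unfolding holder_on_def
      by simp
qed

lemma cr_deriv_continuous: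
  assumes g: "cr_map I r g" and r: "r > 1" and G: "is_lift I g G" and i: "i \<le> nat \<lfloor>r\<rfloor>"
  shows "continuous_on S (nth_deriv S i G)"
proof (cases "i = nat \<lfloor>r\<rfloor>")
  case True
  then show ?thesis using cr_derivs(2)[OF g r G] by simp
next
  case False
  then show ?thesis using cr_derivs(1)[OF g r G, of i] i by (intro DERIV_continuous_on) auto
qed

lemma cr_lift:
  assumes "cr_map I r g"
  obtains G where "is_lift I g G" "g \<in> points I \<rightarrow> points I"
  using assms unfolding cr_map_def by blast

lemma sup_nth_deriv:
  assumes g: "cr_map I r g" and r: "r > 1" and G: "is_lift I g G" and i: "1 \<le> i" "i \<le> nat \<lfloor>r\<rfloor>"
  shows "bdd_above ((\<lambda>t. \<bar>nth_deriv S i G t\<bar>) ` S)" "0 \<le> (SUP t\<in>S. \<bar>nth_deriv S i G t\<bar>)"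
proof -
  obtain B where B: "\<And>s. s \<in> S \<Longrightarrow> \<bar>nth_deriv S i G s\<bar> \<le> B"
    using invariant_bounded[OF cr_deriv_continuous[OF g r G i(2)]] nth_deriv_eq[OF G _ _ _ i(1)]
      by metis
  then show b: "bdd_above ((\<lambda>t. \<bar>nth_deriv S i G t\<bar>) ` S)" by (auto intro!: bdd_aboveI[of _ B])
  have "0 \<in> S" using lam by auto
  then have "\<bar>nth_deriv S i G 0\<bar> \<le> (SUP t\<in>S. \<bar>nth_deriv S i G t\<bar>)" using b
      by (intro cSUP_upper) auto
  then show "0 \<le> (SUP t\<in>S. \<bar>nth_deriv S i G t\<bar>)" by linarith
qed

text \<open>For integral r the exponent is 0 and the norm contains no Hoelder term; then the
  oscillation is at most twice the supremum. The constant \<open>2 * K\<close> serves this case and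
  the Hoelder case alike, and so \<open>branch_splitting\<close> applies to all r > 1 in the same
  form.\<close>

lemma cr_norm_holder:
  assumes g: "cr_map I r g" and r: "r > 1" and G: "is_lift I g G" and K: "cr_norm I r g \<le> K"
    and st: "s \<in> S" "t \<in> S" "0 < h" "h \<le> 1" "\<bar>s - t\<bar> \<le> h"
  defines "k \<equiv> nat \<lfloor>r\<rfloor>"
  shows "\<bar>nth_deriv S k G s - nth_deriv S k G t\<bar> \<le> 2 * K * h powr (r - \<lfloor>r\<rfloor>)"
proof -
  define G1 where "G1 = some_lift I g"
  have G1: "is_lift I g G1" unfolding G1_def by (rule some_lift[OF G])
  have k1: "1 \<le> k" using r unfolding k_def by (simp add: le_nat_floor)
  have e: "nth_deriv S k G z = nth_deriv S k G1 z" if "z \<in> S" for z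
    using some_lift_nth_deriv[OF G k1 that] unfolding G1_def by simp
  note sp = sup_nth_deriv[OF g r G1, folded k_def]
  obtain G' where gp: "g \<in> points I \<rightarrow> points I" using g unfolding cr_map_def by blast
  have s0: "0 \<le> (SUP x\<in>points I. norm (g x))"
  proof -
    have "bounded (points I)" using points_compact compact_imp_bounded by blast
    then obtain B where "\<And>x. x \<in> points I \<Longrightarrow> norm x \<le> B" unfolding bounded_iff by auto
    then have b: "bdd_above ((\<lambda>x. norm (g x)) ` points I)" using gp
        by (intro bdd_aboveI[of _ B]) auto
    have "\<pi> 0 \<in> points I" using lam unfolding points_def by (intro imageI) auto
    then have "norm (g (\<pi> 0)) \<le> (SUP x\<in>points I. norm (g x))" using b by (intro cSUP_upper) auto
    then show ?thesis by (meson norm_ge_zero order_trans)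
  qed
  define T where "T = (if r \<in> \<int> then 0 else holder_seminorm (r - \<lfloor>r\<rfloor>) S (nth_deriv S k G1))"
  have norm: "(SUP x\<in>points I. norm (g x)) + (\<Sum>i=1..k. SUP t\<in>S. \<bar>nth_deriv S i G1 t\<bar>) + T \<le> K"
    using K unfolding cr_norm_def k_def G1_def T_def by simp
  have sumn: "0 \<le> (SUP t\<in>S. \<bar>nth_deriv S i G1 t\<bar>)" if "i \<in> {1..k}" for i using sp(2)[of i] that
      by auto
  define al where "al = r - \<lfloor>r\<rfloor>"
  have al: "0 \<le> al" unfolding al_def by linarith
  show ?thesis
  proof (cases "r \<in> \<int>")
    case True
    then have al0: "al = 0" unfolding al_def by (auto elim!: Ints_cases)
    have "(SUP t\<in>S. \<bar>nth_deriv S k G1 t\<bar>) \<le> (\<Sum>i=1..k. SUP t\<in>S. \<bar>nth_deriv S i G1 t\<bar>)"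
      using sumn k1 by (intro member_le_sum) auto
    then have sK: "(SUP t\<in>S. \<bar>nth_deriv S k G1 t\<bar>) \<le> K" using norm s0 True unfolding T_def by simp
    have b: "\<bar>nth_deriv S k G1 z\<bar> \<le> K" if "z \<in> S" for z
      using cSUP_upper[OF that sp(1)[OF k1 order_refl]] sK by linarith
    have "\<bar>nth_deriv S k G s - nth_deriv S k G t\<bar> \<le> 2 * K" using b[OF st(1)] b[OF st(2)] e st
        by auto
    then show ?thesis using al0 st unfolding al_def by simp
  next
    case False
    define A where "A = {(s, t). s \<in> S \<and> t \<in> S \<and> s \<noteq> t}"
    define q where "q = (\<lambda>(s, t). \<bar>nth_deriv S k G1 s - nth_deriv S k G1 t\<bar> / \<bar>s - t\<bar> powr al)"
    have hs: "holder_seminorm al S (nth_deriv S k G1) = (SUP p\<in>A. q p)"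
        unfolding holder_seminorm_def A_def q_def ..
    obtain C where C: "\<And>s t. s \<in> S \<Longrightarrow> t \<in> S \<Longrightarrow> \<bar>nth_deriv S k G1 s - nth_deriv S k G1 t\<bar> \<le> C * \<bar>s
        - t\<bar> powr al"
      using cr_derivs(3)[OF g r G1] unfolding holder_on_def k_def al_def by blast
    have bdd: "bdd_above (q ` A)"
    proof (rule bdd_aboveI)
      fix y assume "y \<in> q ` A"
      then obtain s t where "s \<in> S" "t \<in> S" "s \<noteq> t"
          "y = \<bar>nth_deriv S k G1 s - nth_deriv S k G1 t\<bar> / \<bar>s - t\<bar> powr al"
        unfolding A_def q_def by auto
      then show "y \<le> C" using C[of s t] by (simp add: pos_divide_le_eq)
    qed
    have up: "\<bar>nth_deriv S k G1 s - nth_deriv S k G1 t\<bar> \<le> T * \<bar>s - t\<bar> powr al"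
        if "s \<in> S" "t \<in> S" "s \<noteq> t" for s t
    proof -
      have "q (s, t) \<le> T" using False hs cSUP_upper[OF _ bdd, of "(s, t)"] that
          unfolding T_def A_def al_def by auto
      then show ?thesis using that unfolding q_def by (simp add: pos_divide_le_eq)
    qed
    have "0 \<le> T"
    proof -
      have "(0, 1) \<in> A" using lam unfolding A_def by auto
      then have "q (0, 1) \<le> T" using False hs cSUP_upper[OF _ bdd] unfolding T_def al_def by auto
      moreover have "0 \<le> q (0, 1)" unfolding q_def by simp
      ultimately show ?thesis by linarith
    qed
    moreover have "0 \<le> (\<Sum>i=1..k. SUP t\<in>S. \<bar>nth_deriv S i G1 t\<bar>)" by (rule sum_nonneg) (rule sumn)
    ultimately have TK: "0 \<le> T" "T \<le> K" using norm s0 by linarith+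
    show ?thesis
    proof (cases "s = t")
      case True
      then show ?thesis using TK by simp
    next
      case ne: False
      have "\<bar>nth_deriv S k G s - nth_deriv S k G t\<bar> \<le> T * \<bar>s - t\<bar> powr al"
          using up[OF st(1,2) ne] e st by simp
      also have "\<dots> \<le> (2 * K) * h powr al" using TK st al by (intro mult_mono powr_mono2) auto
      finally show ?thesis unfolding al_def by simp
    qed
  qed
qed

text \<open>\<open>branch_splitting\<close> for the derivative of the lift, which has one derivative
  less than the lift: \<rho> is r - 1. The constant depends on \<open>r\<close> and \<open>K\<close>
  only, hence is uniform over the weak neighbourhood.\<close>

lemma cr_split:
  assumes g: "cr_map I r g" and r: "r > 1" and G: "is_lift I g G" and K: "cr_norm I r g \<le> K" "K > 0"
    and w: "0 < w" "w \<le> 1"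
  defines "CA \<equiv> split_const (nat \<lfloor>r\<rfloor> - 1) (r - 1) (2 * K)"
  defines "u \<equiv> nth_deriv S 1 G"
  shows "\<exists>col :: real \<Rightarrow> nat.
      (\<forall>t\<in>{x0..x0+w}. real (col t) + 1 \<le> CA * exp (real m / (r - 1))) \<and>
      (\<forall>s\<in>S \<inter> {x0..x0+w}. \<forall>t\<in>S \<inter> {x0..x0+w}. s < t \<longrightarrow> col s = col t \<longrightarrow>
         t - s \<le> w * exp (- real m / (r - 1)) \<and>
         (\<bar>u s\<bar> \<le> exp (- real m) \<longrightarrow> \<bar>u t\<bar> \<le> exp (- real m) \<longrightarrow> (\<forall>c\<in>{s..t}. \<bar>u c\<bar> \<le> CA * exp (- real
             m))) \<and>
         (\<bar>u s\<bar> > exp (- real m - 1) \<longrightarrow> \<bar>u t\<bar> > exp (- real m - 1) \<longrightarrow> (\<forall>c\<in>{s..t}. u c \<noteq> 0)))"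
proof -
  define k where "k = nat \<lfloor>r\<rfloor>"
  have k1: "1 \<le> k" using r unfolding k_def by (simp add: le_nat_floor)
  define v where "v = (\<lambda>i. nth_deriv S (Suc i) G)"
  have kr: "real (k - 1) + (r - \<lfloor>r\<rfloor>) = r - 1" using k1 r unfolding k_def by (simp add: of_nat_diff)
  have der: "(v i has_real_derivative v (Suc i) t) (at t within S)" if "i < k - 1" "t \<in> S" for i t
    using cr_derivs(1)[OF g r G, of "Suc i" t] that unfolding v_def k_def by auto
  have osc: "\<bar>v (k - 1) s - v (k - 1) t\<bar> \<le> 2 * K * h powr (r - \<lfloor>r\<rfloor>)"
      if "s \<in> S" "t \<in> S" "0 < h" "h \<le> 1" "\<bar>s - t\<bar> \<le> h" for s t h
  proof -
    have "Suc (k - 1) = k" using k1 by simp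
    then show ?thesis using cr_norm_holder[OF g r G K(1) that] unfolding v_def k_def by metis
  qed
  have v0: "v 0 = u" unfolding v_def u_def by simp
  have r1: "r - 1 > 0" and K2: "2 * K > 0" using r K by auto
  show ?thesis
    unfolding CA_def k_def[symmetric]
  proof (rule branch_splitting[OF convS r1 kr K2 der osc w, where m=m and ?x0.0=x0])
    fix col :: "real \<Rightarrow> nat"
    let ?C = "split_const (k - 1) (r - 1) (2 * K)"
    assume c: "\<And>t. t \<in> {x0..x0+w} \<Longrightarrow> real (col t) + 1 \<le> ?C * exp (real m / (r - 1))"
      "\<And>s t. s \<in> S \<inter> {x0..x0+w} \<Longrightarrow> t \<in> S \<inter> {x0..x0+w} \<Longrightarrow> s < t \<Longrightarrow> col s = col t \<Longrightarrow>
        t - s \<le> w * exp (- real m / (r - 1))"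
      "\<And>s t c. s \<in> S \<inter> {x0..x0+w} \<Longrightarrow> t \<in> S \<inter> {x0..x0+w} \<Longrightarrow> s < t \<Longrightarrow> col s = col t \<Longrightarrow>
       \<bar>v 0 s\<bar> \<le> exp (- real m) \<Longrightarrow> \<bar>v 0 t\<bar> \<le> exp (- real m) \<Longrightarrow> c \<in> {s..t} \<Longrightarrow>
       \<bar>v 0 c\<bar> \<le> ?C * exp (- real m)"
      "\<And>s t c. s \<in> S \<inter> {x0..x0+w} \<Longrightarrow> t \<in> S \<inter> {x0..x0+w} \<Longrightarrow> s < t \<Longrightarrow> col s = col t \<Longrightarrow>
       \<bar>v 0 s\<bar> > exp (- real m - 1) \<Longrightarrow> \<bar>v 0 t\<bar> > exp (- real m - 1) \<Longrightarrow> c \<in> {s..t} \<Longrightarrow> v 0 c \<noteq> 0"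
    show "\<exists>col :: real \<Rightarrow> nat.
      (\<forall>t\<in>{x0..x0+w}. real (col t) + 1 \<le> ?C * exp (real m / (r - 1))) \<and>
      (\<forall>s\<in>S \<inter> {x0..x0+w}. \<forall>t\<in>S \<inter> {x0..x0+w}. s < t \<longrightarrow> col s = col t \<longrightarrow>
         t - s \<le> w * exp (- real m / (r - 1)) \<and>
         (\<bar>u s\<bar> \<le> exp (- real m) \<longrightarrow> \<bar>u t\<bar> \<le> exp (- real m) \<longrightarrow> (\<forall>c\<in>{s..t}. \<bar>u c\<bar> \<le> ?C * exp (- real
             m))) \<and>
         (\<bar>u s\<bar> > exp (- real m - 1) \<longrightarrow> \<bar>u t\<bar> > exp (- real m - 1) \<longrightarrow> (\<forall>c\<in>{s..t}. u c \<noteq> 0)))"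
    proof (rule exI[of _ col], intro conjI ballI impI)
      show "real (col t) + 1 \<le> ?C * exp (real m / (r - 1))" if "t \<in> {x0..x0+w}" for t
          by (rule c(1)[OF that])
    qed (rule c(2) c(3)[unfolded v0] c(4)[unfolded v0], assumption+)+
  qed
qed

lemma split_const_ge: "1 \<le> split_const k \<rho> B"
  unfolding split_const_def by simp

lemma lift_derivative:
  assumes g: "cr_map I r g" and r: "r > 1" and G: "is_lift I g G" and t: "t \<in> S"
  shows "(G has_real_derivative nth_deriv S 1 G t) (at t within S)"
proof -
  have "0 < nat \<lfloor>r\<rfloor>" using r by simp
  from cr_derivs(1)[OF g r G this t] show ?thesis by simp
qed

lemma cr_maps: "cr_map I r g \<Longrightarrow> g \<in> points I \<rightarrow> points I"
  unfolding cr_map_def by blast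

lemma lift_deriv_continuous:
  assumes "cr_map I r g" "r > 1" "is_lift I g G"
  shows "continuous_on S (nth_deriv S 1 G)"
  by (rule cr_deriv_continuous[OF assms]) (use assms(2) in \<open>simp add: le_nat_floor\<close>)

lemma lift_deriv_invariant:
  assumes "is_lift I g G" "s \<in> S" "t \<in> S" "\<pi> s = \<pi> t"
  shows "nth_deriv S 1 G s = nth_deriv S 1 G t"
  by (rule nth_deriv_eq[OF assms order_refl])

lemma lift_deriv_bounded:
  assumes "cr_map I r g" "r > 1" "is_lift I g G"
  obtains L where "L \<ge> 1" "\<And>t. t \<in> S \<Longrightarrow> \<bar>nth_deriv S 1 G t\<bar> \<le> L"
proof -
  obtain B where B: "\<And>s. s \<in> S \<Longrightarrow> \<bar>nth_deriv S 1 G s\<bar> \<le> B"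
    using invariant_bounded[OF lift_deriv_continuous[OF assms] lift_deriv_invariant[OF assms(3)]]
      by blast
  show ?thesis
  proof
    show "\<bar>nth_deriv S 1 G t\<bar> \<le> max 1 B" if "t \<in> S" for t using B[OF that] by linarith
  qed simp
qed

lemma deriv_bound_lipschitz:
  assumes d: "\<And>t. t \<in> S \<Longrightarrow> (G has_real_derivative u t) (at t within S)"
      and b: "\<And>t. t \<in> S \<Longrightarrow> \<bar>u t\<bar> \<le> L"
    and st: "s \<in> S" "t \<in> S"
  shows "\<bar>G s - G t\<bar> \<le> L * \<bar>s - t\<bar>"
  using field_differentiable_bound[OF convS d _ st, of L] b by (simp add: real_norm_def)

lemma funpow_derivative:
  assumes g: "cr_map I r g" and r: "r > 1" and G: "is_lift I g G"
  shows "t \<in> S \<Longrightarrow> ((G ^^ n) has_real_derivative (\<Prod>i<n. nth_deriv S 1 G ((G ^^ i) t)))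
      (at t within S)"
proof (induction n)
  case 0
  show ?case by (simp add: id_def)
next
  case (Suc n)
  note lf = lift_funpow(1)[OF G cr_maps[OF g]]
  have "(G has_real_derivative nth_deriv S 1 G ((G ^^ n) t)) (at ((G ^^ n) t) within S)"
    by (rule lift_derivative[OF g r G lf[OF Suc.prems]])
  then have "(G has_real_derivative nth_deriv S 1 G ((G ^^ n) t)) (at ((G ^^ n) t) within (G ^^ n)
      ` S)"
    by (rule DERIV_subset) (use lf in auto)
  from DERIV_image_chain[OF this Suc.IH[OF Suc.prems]] show ?case by (simp add: mult.commute o_def)
qed

lemma gderiv_funpow:
  assumes g: "cr_map I r g" and r: "r > 1" and G: "is_lift I g G" and t: "t \<in> S"
  shows "gderiv I (g ^^ n) (\<pi> t) = (\<Prod>i<n. nth_deriv S 1 G ((G ^^ i) t))"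
  using gderiv_lift[OF lift_funpow(3)[OF G cr_maps[OF g]] t] nth_deriv_unique[OF
    funpow_derivative[OF g r G t] t] by simp

text \<open>By the chain rule the suprema of the derivatives of iterates are submultiplicative, so
  by Fekete's lemma the limit is an infimum; hence a single iterate \<open>p\<close> witnesses any
  \<open>R\<close> above it, which is an open condition on the map.\<close>

lemma growth_rate_bound:
  assumes g: "cr_map I r g" and r: "r > 1" and G: "is_lift I g G"
  shows "0 \<le> growth_rate I g"
    and "growth_rate I g < R \<Longrightarrow>
        \<exists>p\<ge>1. \<exists>B<exp (real p * R). \<forall>t\<in>S. \<bar>\<Prod>i<p. nth_deriv S 1 G ((G ^^ i) t)\<bar> \<le> B"
proof -
  let ?D = "\<lambda>n t. \<Prod>i<n. nth_deriv S 1 G ((G ^^ i) t)"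
  note lf = lift_funpow(1)[OF G cr_maps[OF g]]
  obtain L where L: "L \<ge> 1" "\<And>t. t \<in> S \<Longrightarrow> \<bar>nth_deriv S 1 G t\<bar> \<le> L"
    using lift_deriv_bounded[OF g r G] by blast
  have DL: "\<bar>?D n t\<bar> \<le> L ^ n" if "t \<in> S" for n t
  proof -
    have "\<bar>?D n t\<bar> = (\<Prod>i<n. \<bar>nth_deriv S 1 G ((G ^^ i) t)\<bar>)" by (rule abs_prod)
    also have "\<dots> \<le> (\<Prod>i<n. L)" using L(2) lf[OF that] by (intro prod_mono) auto
    finally show ?thesis by simp
  qed
  define A where "A n = (SUP x\<in>points I. \<bar>gderiv I (g ^^ n) x\<bar>)" for n
  have A_eq: "A n = (SUP t\<in>S. \<bar>?D n t\<bar>)" for n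
    unfolding A_def points_def image_image using gderiv_funpow[OF g r G] by (intro SUP_cong) auto
  have S0: "0 \<in> S" using lam by auto
  have bdd: "bdd_above ((\<lambda>t. \<bar>?D n t\<bar>) ` S)" for n using DL by (intro bdd_aboveI[of _ "L ^ n"]) auto
  have up: "\<bar>?D n t\<bar> \<le> A n" if "t \<in> S" for n t unfolding A_eq by (rule cSUP_upper[OF that bdd])
  have A0: "0 \<le> A n" for n using up[OF S0, of n] by linarith
  have sub: "A (m + n) \<le> A m * A n" for m n
    unfolding A_eq[of "m + n"]
  proof (rule cSUP_least)
    show "S \<noteq> {}" using S0 by auto
    fix t assume t: "t \<in> S"
    have "?D (m + n) t = ?D n t * ?D m ((G ^^ n) t)"
    proof (induction m)
      case (Suc m)
      have "(G ^^ (m + n)) t = (G ^^ m) ((G ^^ n) t)" by (simp add: funpow_add)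
      then show ?case using Suc by (simp add: mult.assoc)
    qed simp
    then have "\<bar>?D (m + n) t\<bar> = \<bar>?D n t\<bar> * \<bar>?D m ((G ^^ n) t)\<bar>" by (simp add: abs_mult)
    also have "\<dots> \<le> A n * A m" by (intro mult_mono up lf t A0) auto
    finally show "\<bar>?D (m + n) t\<bar> \<le> A m * A n" by (simp add: mult.commute)
  qed
  define a where "a n = max 0 (ln (A n))" for n
  \<comment> \<open>Cutting off at 0 preserves subadditivity. If the supremum vanishes,
    \<open>ln 0 = 0\<close> makes the left-hand side 0.\<close>
  have asub: "a (m + n) \<le> a m + a n" for m n
  proof (cases "A (m + n) = 0")
    case True
    then show ?thesis unfolding a_def by simp
  next
    case False
    then have p: "0 < A (m + n)" using A0[of "m + n"] by simp
    then have "0 < A m * A n" using sub[of m n] by linarith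
    then have mn: "0 < A m" "0 < A n" using A0[of m] A0[of n] by (auto simp: zero_less_mult_iff)
    have "ln (A (m + n)) \<le> ln (A m * A n)" using sub[of m n] p by simp
    also have "\<dots> = ln (A m) + ln (A n)" using mn by (simp add: ln_mult)
    finally show ?thesis unfolding a_def by simp
  qed
  have "(\<lambda>n. a n / real n) \<longlonglongrightarrow> (INF n\<in>{1..}. a n / real n)"
    by (rule fekete_lim[OF _ asub]) (simp add: a_def)
  then have gr: "growth_rate I g = (INF n\<in>{1..}. a n / real n)"
    unfolding growth_rate_def a_def A_def by (rule limI)
  have b0: "bdd_below ((\<lambda>n. a n / real n) ` {1..})" by (intro bdd_belowI[of _ 0]) (auto simp: a_def)
  show "0 \<le> growth_rate I g" unfolding gr by (intro cINF_greatest) (auto simp: a_def)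
  show "\<exists>p\<ge>1. \<exists>B<exp (real p * R). \<forall>t\<in>S. \<bar>?D p t\<bar> \<le> B" if "growth_rate I g < R"
  proof -
    have "\<exists>p\<in>{1..}. a p / real p < R" using that unfolding gr
        by (subst (asm) cINF_less_iff[OF _ b0]) auto
    then obtain p where p: "p \<ge> 1" "a p / real p < R" by auto
    then have "a p < real p * R" by (simp add: pos_divide_less_eq mult.commute)
    then have l: "ln (A p) < real p * R" unfolding a_def by simp
    have "A p < exp (real p * R)"
    proof (cases "A p = 0")
      case False
      then have "A p = exp (ln (A p))" using A0[of p] by simp
      also have "\<dots> < exp (real p * R)" using l by simp
      finally show ?thesis .
    qed simp
    then show ?thesis using p(1) up by blast
  qed
qed

lemma c1_dist_close:
  assumes f: "cr_map I r f" and g: "cr_map I r g" and r: "r > 1" and d: "c1_dist I f g < \<rho>"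
      and x: "x \<in> points I"
  shows "dist (f x) (g x) < \<rho>" "\<bar>gderiv I f x - gderiv I g x\<bar> < \<rho>"
proof -
  have fp: "f \<in> points I \<rightarrow> points I" and gp: "g \<in> points I \<rightarrow> points I" using cr_maps f g by auto
  obtain F where F: "is_lift I f F" using cr_lift[OF f] by blast
  obtain G where G: "is_lift I g G" using cr_lift[OF g] by blast
  obtain L1 where L1: "\<And>t. t \<in> S \<Longrightarrow> \<bar>nth_deriv S 1 F t\<bar> \<le> L1" using lift_deriv_bounded[OF f r F]
      by blast
  obtain L2 where L2: "\<And>t. t \<in> S \<Longrightarrow> \<bar>nth_deriv S 1 G t\<bar> \<le> L2" using lift_deriv_bounded[OF g r G]
      by blast
  have "bounded (points I)" using points_compact compact_imp_bounded by blast
  then obtain e where e: "\<And>y z. y \<in> points I \<Longrightarrow> z \<in> points I \<Longrightarrow> dist y z \<le> e"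
      unfolding bounded_two_points by auto
  have b1: "bdd_above ((\<lambda>x. dist (f x) (g x)) ` points I)" using e fp gp
      by (intro bdd_aboveI[of _ e]) auto
  have b2: "bdd_above ((\<lambda>x. \<bar>gderiv I f x - gderiv I g x\<bar>) ` points I)"
  proof (rule bdd_aboveI[of _ "L1 + L2"])
    fix y assume "y \<in> (\<lambda>x. \<bar>gderiv I f x - gderiv I g x\<bar>) ` points I"
    then obtain t where t: "t \<in> S" "y = \<bar>nth_deriv S 1 F t - nth_deriv S 1 G t\<bar>"
      unfolding points_def using gderiv_lift[OF F] gderiv_lift[OF G] by auto
    then show "y \<le> L1 + L2" using L1[OF t(1)] L2[OF t(1)] by linarith
  qed
  have 1: "dist (f x) (g x) \<le> (SUP x\<in>points I. dist (f x) (g x))" by (rule cSUP_upper[OF x b1])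
  have 2: "\<bar>gderiv I f x - gderiv I g x\<bar> \<le> (SUP x\<in>points I. \<bar>gderiv I f x - gderiv I g x\<bar>)"
      by (rule cSUP_upper[OF x b2])
  show "dist (f x) (g x) < \<rho>" "\<bar>gderiv I f x - gderiv I g x\<bar> < \<rho>"
    using d 1 2 zero_le_dist[of "f x" "g x"] unfolding c1_dist_def by linarith+
qed

lemma funpow_deriv_close:
  assumes f: "cr_map I r f" and r: "r > 1" and F: "is_lift I f F" and \<eta>: "\<eta> > 0"
  shows "\<exists>\<rho>>0. \<forall>g G. is_lift I g G \<longrightarrow> g \<in> points I \<rightarrow> points I \<longrightarrow> (\<forall>t\<in>S. \<bar>F t - G t\<bar> \<le> \<rho>) \<longrightarrow>
      (\<forall>t\<in>S. \<bar>nth_deriv S 1 F t - nth_deriv S 1 G t\<bar> \<le> \<rho>) \<longrightarrow>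
      (\<forall>t\<in>S. \<bar>(\<Prod>i<n. nth_deriv S 1 F ((F ^^ i) t)) - (\<Prod>i<n. nth_deriv S 1 G ((G ^^ i) t))\<bar> \<le> \<eta>)"
  using \<eta>
proof (induction n arbitrary: \<eta>)
  case 0
  then show ?case by (intro exI[of _ 1]) simp
next
  case (Suc n)
  let ?uF = "nth_deriv S 1 F"
  obtain L where L: "L \<ge> 1" "\<And>t. t \<in> S \<Longrightarrow> \<bar>?uF t\<bar> \<le> L" using lift_deriv_bounded[OF f r F] by blast
  \<comment> \<open>The difference of products is split into a change of the last factor and a
    change of the others, each allowed half of \<eta>: 2 e L^n and e' (L + 1). The last entry in
    \<rho> below keeps the two orbits within \<open>d\<close>, where the derivative of
    \<open>F\<close> varies by less than \<open>e\<close>.\<close>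
  define e where "e = \<eta> / (4 * L ^ n)"
  have e: "e > 0" using Suc.prems L unfolding e_def by simp
  define e' where "e' = \<eta> / (2 * (L + 1))"
  have e': "e' > 0" using Suc.prems L unfolding e'_def by simp
  obtain d where d: "d > 0" "\<And>s t. s \<in> S \<Longrightarrow> t \<in> S \<Longrightarrow> \<bar>s - t\<bar> < d \<Longrightarrow> \<bar>?uF s - ?uF t\<bar> < e"
    using invariant_uniformly_continuous[OF lift_deriv_continuous[OF f r F]
      lift_deriv_invariant[OF F] e] by blast
  from Suc.IH[OF e'] obtain \<rho>1 where \<rho>1: "\<rho>1 > 0" "\<And>g G. is_lift I g G \<Longrightarrow> g \<in> points I \<rightarrow> points I \<Longrightarrow>
      (\<forall>t\<in>S. \<bar>F t - G t\<bar> \<le> \<rho>1) \<Longrightarrow>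
      (\<forall>t\<in>S. \<bar>?uF t - nth_deriv S 1 G t\<bar> \<le> \<rho>1) \<Longrightarrow>
      (\<forall>t\<in>S. \<bar>(\<Prod>i<n. ?uF ((F ^^ i) t)) - (\<Prod>i<n. nth_deriv S 1 G ((G ^^ i) t))\<bar> \<le> e')" by blast
  define \<rho> where "\<rho> = min (min \<rho>1 1) (min e (d / (2 * (real n * L ^ n + 1))))"
  have nL: "0 \<le> real n * L ^ n" using L by simp
  have \<rho>: "0 < \<rho>" using \<rho>1(1) e d(1) nL unfolding \<rho>_def by simp
  have \<rho>': "\<rho> \<le> \<rho>1" "\<rho> \<le> 1" "\<rho> \<le> e" unfolding \<rho>_def by auto
  have "\<rho> \<le> d / (2 * (real n * L ^ n + 1))" unfolding \<rho>_def by auto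
  then have "\<rho> * (2 * (real n * L ^ n + 1)) \<le> d" using nL by (simp add: pos_le_divide_eq)
  then have \<rho>d: "\<rho> * (real n * L ^ n) < d" using \<rho> nL d(1) by (simp add: algebra_simps)
  show ?case
  proof (intro exI[of _ \<rho>] conjI allI impI ballI)
    fix g G t
    assume G: "is_lift I g G" and g: "g \<in> points I \<rightarrow> points I" and FG: "\<forall>t\<in>S. \<bar>F t - G t\<bar> \<le> \<rho>"
      and uu: "\<forall>t\<in>S. \<bar>?uF t - nth_deriv S 1 G t\<bar> \<le> \<rho>" and t: "t \<in> S"
    let ?uG = "nth_deriv S 1 G"
    define x where "x = (F ^^ n) t"
    define y where "y = (G ^^ n) t"
    have xS: "x \<in> S" "y \<in> S" unfolding x_def y_def
        by (rule lift_funpow(1)[OF F cr_maps[OF f] t]) (rule lift_funpow(1)[OF G g t])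
    have "\<bar>x - y\<bar> \<le> \<rho> * (real n * L ^ n)" unfolding x_def y_def
      by (rule funpow_close[OF F cr_maps[OF f] G g L(1) deriv_bound_lipschitz[OF
        lift_derivative[OF f r F] L(2)] _ _ t])
        (use FG \<rho> in auto)
    then have "\<bar>?uF x - ?uF y\<bar> < e" using d(2)[OF xS] \<rho>d by linarith
    then have 1: "\<bar>?uF x - ?uG y\<bar> \<le> 2 * e" using bspec[OF uu xS(2)] \<rho>'(3) by linarith
    have 2: "\<bar>?uG y\<bar> \<le> L + 1" using bspec[OF uu xS(2)] \<rho>'(2) L(2)[OF xS(2)] by linarith
    define DF where "DF = (\<Prod>i<n. ?uF ((F ^^ i) t))"
    define DG where "DG = (\<Prod>i<n. ?uG ((G ^^ i) t))"
    have "\<forall>t\<in>S. \<bar>F t - G t\<bar> \<le> \<rho>1" "\<forall>t\<in>S. \<bar>?uF t - ?uG t\<bar> \<le> \<rho>1" using FG uu \<rho>'(1) by force+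
    from \<rho>1(2)[OF G g this] t have 3: "\<bar>DF - DG\<bar> \<le> e'" unfolding DF_def DG_def by blast
    have 4: "\<bar>DF\<bar> \<le> L ^ n"
    proof -
      have "\<bar>DF\<bar> = (\<Prod>i<n. \<bar>?uF ((F ^^ i) t)\<bar>)" unfolding DF_def by (rule abs_prod)
      also have "\<dots> \<le> (\<Prod>i<n. L)" using L(2) lift_funpow(1)[OF F cr_maps[OF f] t]
          by (intro prod_mono) auto
      finally show ?thesis by simp
    qed
    have "\<bar>DF * ?uF x - DG * ?uG y\<bar> = \<bar>DF * (?uF x - ?uG y) + (DF - DG) * ?uG y\<bar>"
        by (simp add: algebra_simps)
    also have "\<dots> \<le> \<bar>DF\<bar> * \<bar>?uF x - ?uG y\<bar> + \<bar>DF - DG\<bar> * \<bar>?uG y\<bar>"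
        by (metis abs_mult abs_triangle_ineq)
    also have "\<dots> \<le> L ^ n * (2 * e) + e' * (L + 1)" using 1 2 3 4 L e e'
        by (intro add_mono mult_mono) auto
    also have "\<dots> = \<eta>" unfolding e_def e'_def using L by (simp add: field_simps)
    finally show "\<bar>(\<Prod>i<Suc n. ?uF ((F ^^ i) t)) - (\<Prod>i<Suc n. ?uG ((G ^^ i) t))\<bar> \<le> \<eta>"
      unfolding DF_def DG_def x_def y_def by simp
  qed (rule \<rho>)
qed

section \<open>Separated sets, spanning sets and the constants of the coding\<close>

text \<open>Two points whose parameters lie in the same interval of length \<open>e / L ^ n\<close>
  cannot be separated within \<open>n\<close> steps.\<close>

lemma separated_card_le:
  assumes F: "is_lift I f F" and f: "f \<in> points I \<rightarrow> points I"
    and Lp: "L \<ge> 1" "\<And>s t. s \<in> S \<Longrightarrow> t \<in> S \<Longrightarrow> \<bar>F s - F t\<bar> \<le> L * \<bar>s - t\<bar>"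
    and e: "e > 0" and E: "separated (points I) f n e E"
  shows "real (card E) \<le> lam * L ^ n / e + 1"
proof -
  define w where "w = e / L ^ n"
  have w: "w > 0" using e Lp unfolding w_def by simp
  have Es: "E \<subseteq> points I" using E unfolding separated_def by blast
  then have "\<forall>x\<in>E. \<exists>t\<in>{0..lam}. \<pi> t = x" unfolding points_eq by auto
  then have "\<forall>x\<in>E. \<exists>t. t \<in> {0..lam} \<and> \<pi> t = x" by blast
  from bchoice[OF this] obtain \<tau> where \<tau>: "\<forall>x\<in>E. \<tau> x \<in> {0..lam} \<and> \<pi> (\<tau> x) = x" by (rule exE)
  define q where "q x = nat \<lfloor>\<tau> x / w\<rfloor>" for x
  have inj: "inj_on q E"
  proof (rule inj_onI, rule ccontr)
    fix x y assume xy: "x \<in> E" "y \<in> E" "q x = q y" "x \<noteq> y"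
    have t: "0 \<le> \<tau> x" "0 \<le> \<tau> y" "\<tau> x \<in> S" "\<tau> y \<in> S" using \<tau> xy lam by auto
    have "0 \<le> \<tau> x / w" "0 \<le> \<tau> y / w" using t w by auto
    then have "\<lfloor>\<tau> x / w\<rfloor> = \<lfloor>\<tau> y / w\<rfloor>" using xy(3) unfolding q_def by (simp add: eq_nat_nat_iff)
    then have "\<bar>\<tau> x / w - \<tau> y / w\<bar> \<le> 1" by linarith
    then have "\<bar>(\<tau> x - \<tau> y) / w\<bar> \<le> 1" by (simp add: diff_divide_distrib)
    then have d: "\<bar>\<tau> x - \<tau> y\<bar> \<le> w" using w by (simp add: abs_divide)
    obtain i where i: "i < n" "dist ((f ^^ i) x) ((f ^^ i) y) > e" using E xy
        unfolding separated_def by blast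
    have "dist ((f ^^ i) x) ((f ^^ i) y) = dist (\<pi> ((F ^^ i) (\<tau> x))) (\<pi> ((F ^^ i) (\<tau> y)))"
      using lift_funpow(2)[OF F f] t \<tau> xy by simp
    also have "\<dots> \<le> \<bar>(F ^^ i) (\<tau> x) - (F ^^ i) (\<tau> y)\<bar>" using lift_funpow(1)[OF F f] t
        by (intro dist_le) auto
    also have "\<dots> \<le> L ^ i * \<bar>\<tau> x - \<tau> y\<bar>" by (rule lipschitz_funpow[OF F f Lp t(3,4)])
    also have "\<dots> \<le> L ^ n * w" using d Lp i w by (intro mult_mono power_increasing) auto
    also have "\<dots> = e" unfolding w_def using Lp by simp
    finally show False using i by simp
  qed
  have sub: "q ` E \<subseteq> {..nat \<lfloor>lam / w\<rfloor>}"
    unfolding q_def using \<tau> w by (auto intro!: nat_mono floor_mono divide_right_mono)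
  have "card E \<le> nat \<lfloor>lam / w\<rfloor> + 1" using card_inj_on_le[OF inj sub] by simp
  then have "real (card E) \<le> real (nat \<lfloor>lam / w\<rfloor>) + 1" by linarith
  also have "\<dots> \<le> lam / w + 1" using lam w by simp
  also have "lam / w = lam * L ^ n / e" unfolding w_def by simp
  finally show ?thesis .
qed

text \<open>Its purpose is to make the entropy of \<open>f\<close> a finite number, with which the
  later constants can be computed.\<close>

lemma top_entropy_le_lipschitz:
  assumes F: "is_lift I f F" and f: "f \<in> points I \<rightarrow> points I"
    and Lp: "L \<ge> 1" "\<And>s t. s \<in> S \<Longrightarrow> t \<in> S \<Longrightarrow> \<bar>F s - F t\<bar> \<le> L * \<bar>s - t\<bar>"
  shows "top_entropy (points I) f \<le> ereal (ln L)"
  unfolding top_entropy_def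
proof (rule SUP_least)
  fix e :: real assume "e \<in> {0<..}"
  then have e: "e > 0" by simp
  define C where "C = ln (lam / e + 1)"
  have le1: "1 \<le> lam / e + 1" using lam e by simp
  have "limsup (\<lambda>n. SUP E\<in>{E. finite E \<and> E \<noteq> {} \<and>
      separated (points I) f n e E}. ereal (ln (real (card E)) / real n))
     \<le> limsup (\<lambda>n. ereal (ln L + C / real n))"
  proof (rule Limsup_mono, unfold eventually_sequentially, intro exI[of _ 1] allI impI SUP_least)
    fix n E assume n: "1 \<le> (n::nat)" and "E \<in> {E. finite E \<and> E \<noteq> {} \<and> separated (points I) f n e E}"
    then have E: "finite E" "E \<noteq> {}" "separated (points I) f n e E" by auto
    have c: "0 < real (card E)" using E by (simp add: card_gt_0_iff)
    have Ln: "1 \<le> L ^ n" using Lp by simp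
    have "real (card E) \<le> lam * L ^ n / e + 1" by (rule separated_card_le[OF F f Lp e E(3)])
    also have "\<dots> \<le> (lam / e + 1) * L ^ n" using Ln by (simp add: algebra_simps)
    finally have "ln (real (card E)) \<le> ln ((lam / e + 1) * L ^ n)" using c by simp
    also have "\<dots> = C + real n * ln L" unfolding C_def using le1 Lp by (simp add: ln_mult ln_realpow)
    finally have "ln (real (card E)) / real n \<le> (C + real n * ln L) / real n" using n
        by (intro divide_right_mono) auto
    also have "\<dots> = ln L + C / real n" using n by (simp add: field_simps)
    finally show "ereal (ln (real (card E)) / real n) \<le> ereal (ln L + C / real n)" by simp
  qed
  also have "\<dots> = ereal (ln L)"
  proof (rule lim_imp_Limsup)
    have "(\<lambda>n. ln L + C / real n) \<longlonglongrightarrow> ln L + 0" by (intro tendsto_intros lim_const_over_n)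
    then show "(\<lambda>n. ereal (ln L + C / real n)) \<longlonglongrightarrow> ereal (ln L)" by simp
  qed simp
  finally show "limsup (\<lambda>n. SUP E\<in>{E. finite E \<and> E \<noteq> {} \<and>
      separated (points I) f n e E}. ereal (ln (real (card E)) / real n)) \<le> ereal (ln L)" .
qed

text \<open>A separated set of maximal cardinality is spanning. For large \<open>N\<close> separated
  sets have at most \<open>exp (real N * H)\<close> points by the definition of the entropy, so a
  maximal one exists.\<close>

lemma spanning_set:
  assumes h: "top_entropy (points I) f < ereal H" and e: "e > 0"
  obtains N E where "N \<ge> 1" "finite E" "real (card E) \<le> exp (real N * H)"
    "\<And>x. x \<in> points I \<Longrightarrow> \<exists>y\<in>E. y \<in> points I \<and> (\<forall>i<N. dist ((f ^^ i) x) ((f ^^ i) y) \<le> e)"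
proof -
  let ?s = "\<lambda>n. SUP E\<in>{E. finite E \<and> E \<noteq> {} \<and>
      separated (points I) f n e E}. ereal (ln (real (card E)) / real n)"
  have "limsup ?s \<le> top_entropy (points I) f" unfolding top_entropy_def using e
      by (intro SUP_upper) auto
  then have "limsup ?s < ereal H" using h by order
  then have "\<forall>\<^sub>F n in sequentially. ?s n < ereal H" by (rule Limsup_lessD)
  then obtain n0 where n0: "\<And>n. n \<ge> n0 \<Longrightarrow> ?s n < ereal H" unfolding eventually_sequentially by blast
  define N where "N = max n0 1"
  have N: "N \<ge> 1" "?s N < ereal H" using n0[of N] unfolding N_def by auto
  have c: "real (card E) \<le> exp (real N * H)" if "finite E" "E \<noteq> {}" "separated (points I) f N e E"
      for E
  proof -
    have "ereal (ln (real (card E)) / real N) \<le> ?s N" by (rule SUP_upper) (use that in auto)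
    then have "ereal (ln (real (card E)) / real N) < ereal H" using N(2) by order
    then have "ln (real (card E)) < real N * H" using N(1)
        by (simp add: pos_divide_less_eq mult.commute)
    moreover have "0 < real (card E)" using that by (simp add: card_gt_0_iff)
    ultimately have "real (card E) < exp (real N * H)" by (metis exp_less_mono exp_ln)
    then show ?thesis by simp
  qed
  let ?P = "\<lambda>E. finite E \<and> E \<noteq> {} \<and> separated (points I) f N e E"
  have "\<pi> 0 \<in> points I" using lam unfolding points_def by (intro imageI) auto
  then have p0: "?P {\<pi> 0}" unfolding separated_def by auto
  define b where "b = nat \<lceil>exp (real N * H)\<rceil> + 1"
  have "\<forall>E. ?P E \<longrightarrow> card E < b"
  proof (intro allI impI)
    fix E assume "?P E"
    then have "real (card E) \<le> exp (real N * H)" using c by blast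
    then show "card E < b" unfolding b_def by linarith
  qed
  from ex_has_greatest_nat[where P="?P" and f=card, OF p0 this]
  obtain E where E: "finite E" "E \<noteq> {}" "separated (points I) f N e E"
      and mx: "\<And>E'. ?P E' \<Longrightarrow> card E' \<le> card E" by blast
  show ?thesis
  proof (rule that[OF N(1) E(1) c[OF E]])
    fix x assume x: "x \<in> points I"
    have Ep: "E \<subseteq> points I" using E(3) unfolding separated_def by blast
    show "\<exists>y\<in>E. y \<in> points I \<and> (\<forall>i<N. dist ((f ^^ i) x) ((f ^^ i) y) \<le> e)"
    proof (rule ccontr)
      assume "\<not> ?thesis"
      then have n: "\<exists>i<N. dist ((f ^^ i) x) ((f ^^ i) y) > e" if "y \<in> E" for y using that Ep
          by force
      then have xE: "x \<notin> E" using e by force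
      have "separated (points I) f N e (insert x E)"
        using E(3) n x unfolding separated_def by (auto simp: dist_commute)
      then have "card (insert x E) \<le> card E" using mx[of "insert x E"] E(1) by auto
      then show False using xE E(1) by simp
    qed
  qed
qed

text \<open>One iterate \<open>p\<close> with derivative below exp (p R) is kept by all C^1-close
  maps. Splitting n = l + p q with l < p gives the growth rate \<open>R\<close> for all times, with
  \<open>C0 = L ^ p\<close> for the remainder.\<close>

lemma perturbation_bounds:
  assumes f: "cr_map I r f" and r: "r > 1" and F: "is_lift I f F"
      and R: "growth_rate I f < R" "R > 0"
  shows "\<exists>L C0 \<rho>. L \<ge> 1 \<and> C0 \<ge> 1 \<and> \<rho> > 0 \<and>
    (\<forall>g G. cr_map I r g \<longrightarrow> is_lift I g G \<longrightarrow> (\<forall>t\<in>S. \<bar>F t - G t\<bar> \<le> \<rho>) \<longrightarrow>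
       (\<forall>t\<in>S. \<bar>nth_deriv S 1 F t - nth_deriv S 1 G t\<bar> \<le> \<rho>) \<longrightarrow>
       (\<forall>a\<in>S. \<forall>b\<in>S. \<bar>G a - G b\<bar> \<le> L * \<bar>a - b\<bar> \<and> (\<forall>n. \<bar>(G ^^ n) a - (G ^^ n) b\<bar> \<le> C0 * exp (R *
           real n) * \<bar>a - b\<bar>)))"
proof -
  obtain L0 where L0: "L0 \<ge> 1" "\<And>t. t \<in> S \<Longrightarrow> \<bar>nth_deriv S 1 F t\<bar> \<le> L0"
      using lift_deriv_bounded[OF f r F] by blast
  obtain p B where p: "p \<ge> 1" "B < exp (real p * R)" "\<And>t. t \<in> S \<Longrightarrow>
      \<bar>\<Prod>i<p. nth_deriv S 1 F ((F ^^ i) t)\<bar> \<le> B"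
    using growth_rate_bound(2)[OF f r F R(1)] by blast
  have "exp (real p * R) - B > 0" using p by simp
  from funpow_deriv_close[OF f r F this, of p] obtain \<rho>0 where \<rho>0: "\<rho>0 > 0"
    "\<And>g G. is_lift I g G \<Longrightarrow> g \<in> points I \<rightarrow> points I \<Longrightarrow> \<forall>t\<in>S. \<bar>F t - G t\<bar> \<le> \<rho>0 \<Longrightarrow>
      \<forall>t\<in>S. \<bar>nth_deriv S 1 F t - nth_deriv S 1 G t\<bar> \<le> \<rho>0 \<Longrightarrow>
      \<forall>t\<in>S. \<bar>(\<Prod>i<p. nth_deriv S 1 F ((F ^^ i) t)) - (\<Prod>i<p. nth_deriv S 1 G ((G ^^ i) t))\<bar> \<le> exp
          (real p * R) - B" by blast
  define L where "L = L0 + 1"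
  have L1: "L \<ge> 1" using L0 unfolding L_def by simp
  define \<rho> where "\<rho> = min 1 \<rho>0"
  have \<rho>: "\<rho> > 0" "\<rho> \<le> 1" "\<rho> \<le> \<rho>0" using \<rho>0 unfolding \<rho>_def by auto
  show ?thesis
  proof (rule exI[of _ L], rule exI[of _ "L ^ p"], rule exI[of _ \<rho>], intro conjI allI impI ballI)
    show "1 \<le> L ^ p" using L1 by simp
    fix g G a b assume g: "cr_map I r g" and G: "is_lift I g G" and FG: "\<forall>t\<in>S. \<bar>F t - G t\<bar> \<le> \<rho>"
      and uu: "\<forall>t\<in>S. \<bar>nth_deriv S 1 F t - nth_deriv S 1 G t\<bar> \<le> \<rho>" and ab: "a \<in> S" "b \<in> S"
    note lf = lift_funpow(1)[OF G cr_maps[OF g]]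
    have uL: "\<bar>nth_deriv S 1 G t\<bar> \<le> L" if "t \<in> S" for t
      using bspec[OF uu that] L0(2)[OF that] \<rho>(2) unfolding L_def by linarith
    have lip: "\<bar>G s - G t\<bar> \<le> L * \<bar>s - t\<bar>" if "s \<in> S" "t \<in> S" for s t
      by (rule deriv_bound_lipschitz[OF lift_derivative[OF g r G] uL that])
    then show "\<bar>G a - G b\<bar> \<le> L * \<bar>a - b\<bar>" using ab by blast
    have "\<forall>t\<in>S. \<bar>F t - G t\<bar> \<le> \<rho>0" "\<forall>t\<in>S. \<bar>nth_deriv S 1 F t - nth_deriv S 1 G t\<bar> \<le> \<rho>0"
        using FG uu \<rho>(3) by force+
    note cl = \<rho>0(2)[OF G cr_maps[OF g] this]
    have D: "\<bar>\<Prod>i<p. nth_deriv S 1 G ((G ^^ i) t)\<bar> \<le> exp (real p * R)" if "t \<in> S" for t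
      using bspec[OF cl that] p(3)[OF that] by linarith
    have lp: "\<bar>(G ^^ p) s - (G ^^ p) t\<bar> \<le> exp (real p * R) * \<bar>s - t\<bar>" if "s \<in> S" "t \<in> S" for s t
      by (rule deriv_bound_lipschitz[OF funpow_derivative[OF g r G] D that])
    have lq: "\<bar>(G ^^ (p * q)) s - (G ^^ (p * q)) t\<bar> \<le> exp (real p * R) ^ q * \<bar>s - t\<bar>"
        if "s \<in> S" "t \<in> S" for s t q
    proof (induction q)
      case (Suc q)
      have e: "(G ^^ (p * Suc q)) x = (G ^^ p) ((G ^^ (p * q)) x)" for x by (simp add: funpow_add)
      have "\<bar>(G ^^ (p * Suc q)) s - (G ^^ (p * Suc q)) t\<bar> \<le> exp (real p * R) * \<bar>(G ^^ (p * q)) s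
          - (G ^^ (p * q)) t\<bar>"
        unfolding e by (rule lp) (use lf that in auto)
      also have "\<dots> \<le> exp (real p * R) * (exp (real p * R) ^ q * \<bar>s - t\<bar>)" using Suc
          by (intro mult_left_mono) auto
      finally show ?case by simp
    qed simp
    fix n
    define q where "q = n div p"
    define l where "l = n mod p"
    have n: "n = l + p * q" "l < p" unfolding q_def l_def using p(1) by auto
    have "\<bar>(G ^^ n) a - (G ^^ n) b\<bar> = \<bar>(G ^^ l) ((G ^^ (p * q)) a) - (G ^^ l) ((G ^^ (p * q)) b)\<bar>"
      unfolding n(1) by (simp add: funpow_add)
    also have "\<dots> \<le> L ^ l * \<bar>(G ^^ (p * q)) a - (G ^^ (p * q)) b\<bar>"
      by (rule lipschitz_funpow[OF G cr_maps[OF g] L1 lip]) (use lf ab in auto)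
    also have "\<dots> \<le> L ^ p * (exp (real p * R) ^ q * \<bar>a - b\<bar>)"
      using lq[OF ab] L1 n by (intro mult_mono power_increasing) auto
    also have "exp (real p * R) ^ q = exp (R * real (p * q))"
        by (simp add: exp_of_nat_mult[symmetric] algebra_simps)
    also have "L ^ p * (exp (R * real (p * q)) * \<bar>a - b\<bar>) \<le> L ^ p * (exp (R * real n) * \<bar>a - b\<bar>)"
      using n R L1 by (intro mult_left_mono mult_right_mono) auto
    finally show "\<bar>(G ^^ n) a - (G ^^ n) b\<bar> \<le> L ^ p * exp (R * real n) * \<bar>a - b\<bar>" by simp
  qed (use L1 \<rho> in auto)
qed

text \<open>The colour names the point of the spanning set that shadows \<pi> t. Passing between
  \<open>f\<close> and \<open>g\<close> and through that point gives 4 e, and \<open>near\<close>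
  doubles it on the line.\<close>

lemma spanning_colour:
  assumes E: "finite E"
      and sp: "\<And>x. x \<in> points I \<Longrightarrow> \<exists>y\<in>E. y \<in> points I \<and> (\<forall>i<N. dist ((f ^^ i) x) ((f ^^ i) y) \<le> e)"
    and G: "is_lift I g G" and g: "g \<in> points I \<rightarrow> points I"
    and cl: "\<And>i x. i < N \<Longrightarrow> x \<in> points I \<Longrightarrow> dist ((f ^^ i) x) ((g ^^ i) x) \<le> e"
  obtains ycol :: "real \<Rightarrow> nat" where "\<And>t. t \<in> S \<Longrightarrow> ycol t < card E"
    "\<And>a b i. a \<in> S \<Longrightarrow> b \<in> S \<Longrightarrow> ycol a = ycol b \<Longrightarrow> i < N \<Longrightarrow> \<bar>(G ^^ i) a - (G ^^ i) b\<bar> \<le> 1 \<Longrightarrow>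
        \<bar>(G ^^ i) a - (G ^^ i) b\<bar> \<le> 8 * e"
proof -
  obtain k where k: "bij_betw k E {..<card E}" using ex_bij_betw_finite_nat[OF E]
      by (auto simp: atLeast0LessThan)
  have "\<forall>x\<in>points I. \<exists>y. y \<in> E \<and> (\<forall>i<N. dist ((f ^^ i) x) ((f ^^ i) y) \<le> e)" using sp by blast
  from bchoice[OF this] obtain c
      where c: "\<forall>x\<in>points I. c x \<in> E \<and> (\<forall>i<N. dist ((f ^^ i) x) ((f ^^ i) (c x)) \<le> e)" by (rule exE)
  have pS: "\<pi> t \<in> points I" if "t \<in> S" for t using that unfolding points_def by auto
  show ?thesis
  proof (rule that[of "\<lambda>t. k (c (\<pi> t))"])
    fix t assume "t \<in> S"
    then show "k (c (\<pi> t)) < card E" using k c pS unfolding bij_betw_def by blast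
  next
    fix a b i assume ab: "a \<in> S" "b \<in> S" "k (c (\<pi> a)) = k (c (\<pi> b))" and i: "i < N"
        and d: "\<bar>(G ^^ i) a - (G ^^ i) b\<bar> \<le> 1"
    have "inj_on k E" using k bij_betw_def by blast
    then have e: "c (\<pi> a) = c (\<pi> b)" using ab c pS by (meson inj_onD)
    have 1: "dist ((f ^^ i) (\<pi> a)) ((f ^^ i) (c (\<pi> b))) \<le> e"
        "dist ((f ^^ i) (\<pi> b)) ((f ^^ i) (c (\<pi> b))) \<le> e"
      using bspec[OF c pS[OF ab(1)]] bspec[OF c pS[OF ab(2)]] i e by auto
    have 2: "dist ((f ^^ i) (\<pi> a)) ((g ^^ i) (\<pi> a)) \<le> e" "dist ((f ^^ i) (\<pi> b)) ((g ^^ i) (\<pi> b))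
        \<le> e"
      using cl[OF i pS[OF ab(1)]] cl[OF i pS[OF ab(2)]] by auto
    have tri: "dist (ga::'a) gb \<le> 4 * e"
        if "dist fa y \<le> e" "dist fb y \<le> e" "dist fa ga \<le> e" "dist fb gb \<le> e" for ga gb fa fb y
      using that dist_triangle[of ga gb fa] dist_triangle[of fa gb y] dist_triangle[of y gb fb]
      by (simp add: dist_commute)
    have 3: "dist ((g ^^ i) (\<pi> a)) ((g ^^ i) (\<pi> b)) \<le> 4 * e" by (rule tri[OF 1 2])
    have "\<bar>(G ^^ i) a - (G ^^ i) b\<bar> \<le> 2 * dist (\<pi> ((G ^^ i) a)) (\<pi> ((G ^^ i) b))"
      using lift_funpow(1)[OF G g] ab d by (intro near) auto
    also have "\<dots> \<le> 2 * (4 * e)" using 3 lift_funpow(2)[OF G g] ab by simp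
    finally show "\<bar>(G ^^ i) a - (G ^^ i) b\<bar> \<le> 8 * e" by simp
  qed
qed

text \<open>The order of choices matters. \<open>C0\<close>, \<open>CA\<close> and
  \<open>Mmin\<close> come first. Given \<open>M\<close>, uniform continuity of the derivative of
  \<open>f\<close> gives \<open>\<epsilon>\<close>, a spanning set at scale
  \<open>\<epsilon> / 8\<close> gives \<open>N\<close>, then \<open>M'\<close> is taken so large
  that the gain of a deep visit pays for a block, and last the neighbourhood is chosen. The instance
  with M' = M serves \<open>entropy_le_contraction\<close>, the other one
  \<open>entropy_le_recovery\<close>.\<close>

lemma branching_family:
  assumes f: "cr_map I r f" and r: "r > 1" and K: "K > 0" and R: "growth_rate I f < R" "R > 0"
    and H: "top_entropy (points I) f < ereal H" "H \<ge> 0" and \<kappa>: "\<kappa> > 0"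
        and gam: "gam > 0" "gam < (\<kappa> * r - 1) / (r - 1)"
  shows "\<exists>C0 CA Mmin. C0 \<ge> 1 \<and> CA \<ge> 1 \<and> Mmin \<ge> 1 \<and>
    (\<forall>m\<ge>Mmin. gam * real m + ln CA + real m / (r - 1) \<le> \<kappa> * (real m * (r / (r - 1)) - ln (CA *
        C0)) \<and>
       real m + 1 \<le> real m * (r / (r - 1)) - ln (CA * C0)) \<and>
    (\<forall>M\<ge>Mmin. \<exists>M'\<ge>M. \<exists>\<rho>>0. \<forall>g. cr_map I r g \<and> c1_dist I f g < \<rho> \<and> cr_norm I r g \<le> K \<longrightarrow>
       (\<exists>G L \<epsilon> N NY ycol. is_lift I g G \<and>
          branching S G (nth_deriv S 1 G) r L R C0 CA \<epsilon> H gam \<kappa> M M N NY ycol \<and>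
          branching S G (nth_deriv S 1 G) r L R C0 CA \<epsilon> H gam \<kappa> M M' N NY ycol \<and>
          (\<forall>m\<ge>M'. gam * real m + ln CA + real m / (r - 1) + real N * H \<le> \<kappa> * (real m * (r / (r -
              1)) - ln (CA * C0)))))"
proof -
  obtain F where F: "is_lift I f F" using cr_lift[OF f] by blast
  obtain L C0 \<rho>0 where L: "L \<ge> 1" and C0: "C0 \<ge> 1" and \<rho>0: "\<rho>0 > 0" and
    pb: "\<And>g G a b. cr_map I r g \<Longrightarrow> is_lift I g G \<Longrightarrow> (\<forall>t\<in>S. \<bar>F t - G t\<bar> \<le> \<rho>0) \<Longrightarrow>
       (\<forall>t\<in>S. \<bar>nth_deriv S 1 F t - nth_deriv S 1 G t\<bar> \<le> \<rho>0) \<Longrightarrow> a \<in> S \<Longrightarrow> b \<in> S \<Longrightarrow>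
       \<bar>G a - G b\<bar> \<le> L * \<bar>a - b\<bar> \<and> (\<forall>n. \<bar>(G ^^ n) a - (G ^^ n) b\<bar> \<le> C0 * exp (R * real n) * \<bar>a -
           b\<bar>)"
    using perturbation_bounds[OF f r F R] by metis
  have Flip: "\<bar>F a - F b\<bar> \<le> L * \<bar>a - b\<bar>" if "a \<in> S" "b \<in> S" for a b using pb[OF f F _ _ that] \<rho>0
      by simp
  define CA where "CA = split_const (nat \<lfloor>r\<rfloor> - 1) (r - 1) (2 * K)"
  have CA: "CA \<ge> 1" unfolding CA_def by (rule split_const_ge)
  \<comment> \<open>The surplus per level when a visit pays \<kappa> per unit of gain: \<kappa>
    r/(r-1) - 1/(r-1) - gam. Any constant price is covered at sufficiently high levels.\<close>
  define c where "c = (\<kappa> * r - 1) / (r - 1) - gam"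
  have c: "c > 0" using gam unfolding c_def by simp
  define D where "D = ln (CA * C0)"
  have deep: "gam * real m + ln CA + real m / (r - 1) + x
      \<le> \<kappa> * (real m * (r / (r - 1)) - ln (CA * C0))"
    if "(\<kappa> * D + ln CA + x) / c \<le> real m" for x m
  proof -
    have "\<kappa> * D + ln CA + x \<le> real m * c" using that c by (simp add: pos_divide_le_eq)
    moreover have "\<kappa> * (real m * (r / (r - 1)) - D) - (gam * real m + real m / (r - 1))
        = real m * c - \<kappa> * D"
    proof -
      have "(\<kappa> * r - 1) / (r - 1) = \<kappa> * (r / (r - 1)) - 1 / (r - 1)"
          by (simp add: diff_divide_distrib)
      then show ?thesis unfolding c_def by (simp only:) (simp add: algebra_simps)
    qed
    ultimately show ?thesis unfolding D_def by linarith
  qed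
  \<comment> \<open>From this value on, the geometric series of the levels fits into the mass 1 -
    exp (- gam) left by the letter for shallow points.\<close>
  define z where "z = (1 - exp (- gam))\<^sup>2"
  have z: "z > 0" using gam unfolding z_def by simp
  obtain Mmin :: nat where Mmin: "max (max 1 R)
      (max ((1 + D) * (r - 1)) (max ((\<kappa> * D + ln CA + 0) / c) (- ln z / gam))) \<le> real Mmin"
    using real_arch_simple by blast
  have M1: "1 \<le> Mmin" "R \<le> real Mmin" "(1 + D) * (r - 1) \<le> real Mmin"
      "(\<kappa> * D + ln CA + 0) / c \<le> real Mmin" "- ln z / gam \<le> real Mmin"
    using Mmin by auto
  have gain: "real m + 1 \<le> real m * (r / (r - 1)) - ln (CA * C0)" if "m \<ge> Mmin" for m
  proof -
    have "(1 + D) * (r - 1) \<le> real m" using M1(3) that by linarith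
    then have "1 + D \<le> real m / (r - 1)" using r by (simp add: pos_le_divide_eq)
    moreover have "real m * (r / (r - 1)) = real m + real m / (r - 1)" using r
        by (simp add: field_simps)
    ultimately show ?thesis unfolding D_def by linarith
  qed
  have kraft: "exp (- gam) + exp (- gam * real M) / (1 - exp (- gam)) \<le> 1" if "M \<ge> Mmin" for M
  proof -
    have "- ln z / gam \<le> real M" using M1(5) that by linarith
    then have "- ln z / gam * gam \<le> real M * gam" using gam by (intro mult_right_mono) auto
    then have "- gam * real M \<le> ln z" using gam by (simp add: mult.commute)
    then have "exp (- gam * real M) \<le> exp (ln z)" by (simp only: exp_le_cancel_iff)
    then have "exp (- gam * real M) \<le> z" using z by simp
    then have "exp (- gam * real M) / (1 - exp (- gam)) \<le> z / (1 - exp (- gam))" using gam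
        by (intro divide_right_mono) auto
    also have "\<dots> = 1 - exp (- gam)" unfolding z_def using gam by (simp add: power2_eq_square)
    finally show ?thesis by simp
  qed
  have fam: "\<exists>M'\<ge>M. \<exists>\<rho>>0. \<forall>g. cr_map I r g \<and> c1_dist I f g < \<rho> \<and> cr_norm I r g \<le> K \<longrightarrow>
       (\<exists>G L \<epsilon> N NY ycol. is_lift I g G \<and>
          branching S G (nth_deriv S 1 G) r L R C0 CA \<epsilon> H gam \<kappa> M M N NY ycol \<and>
          branching S G (nth_deriv S 1 G) r L R C0 CA \<epsilon> H gam \<kappa> M M' N NY ycol \<and>
          (\<forall>m\<ge>M'. gam * real m + ln CA + real m / (r - 1) + real N * H \<le> \<kappa> * (real m * (r / (r -
              1)) - ln (CA * C0))))"
    if M: "M \<ge> Mmin" for M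
  proof -
    \<comment> \<open>A quarter, since going from \<open>?u a\<close> to \<open>?u x\<close> takes
      three changes of at most \<open>e\<close>: to the derivative of \<open>F\<close>, from
      \<open>a\<close> to \<open>x\<close>, and back. At least \<open>e\<close> is left, so
      \<open>?u x\<close> is not 0.\<close>
    define e where "e = exp (- real M) / 4"
    have e: "e > 0" "exp (- real M) = 4 * e" unfolding e_def by auto
    obtain d where d: "d > 0" "\<And>s t. s \<in> S \<Longrightarrow> t \<in> S \<Longrightarrow> \<bar>s - t\<bar> < d \<Longrightarrow>
        \<bar>nth_deriv S 1 F s - nth_deriv S 1 F t\<bar> < e"
      using invariant_uniformly_continuous[OF lift_deriv_continuous[OF f r F]
        lift_deriv_invariant[OF F] e(1)] by blast
    define \<epsilon> where "\<epsilon> = min (1 / L) (min (exp (- R)) (d / 2))"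
    have \<epsilon>: "\<epsilon> > 0" "\<epsilon> \<le> 1 / L" "\<epsilon> \<le> exp (- R)" "\<epsilon> < d" using L d(1) unfolding \<epsilon>_def by auto
    have "1 / L \<le> 1" using L by simp
    then have \<epsilon>1: "\<epsilon> \<le> 1" using \<epsilon>(2) by linarith
    have L\<epsilon>: "L * \<epsilon> \<le> 1" using \<epsilon>(2) L by (simp add: pos_le_divide_eq mult.commute)
    have "\<epsilon> * exp R \<le> exp (- R) * exp R" using \<epsilon>(3) by (intro mult_right_mono) auto
    then have \<epsilon>R: "\<epsilon> * exp R \<le> 1" by (simp add: exp_minus)
    define e2 where "e2 = \<epsilon> / 8"
    have e2: "e2 > 0" using \<epsilon> unfolding e2_def by simp
    obtain N E where N: "N \<ge> 1" and E: "finite E" "real (card E) \<le> exp (real N * H)"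
      and sp: "\<And>x. x \<in> points I \<Longrightarrow> \<exists>y\<in>E. y \<in> points I \<and> (\<forall>i<N. dist ((f ^^ i) x) ((f ^^ i) y) \<le> e2)"
      using spanning_set[OF H(1) e2] by blast
    obtain M0 :: nat where M0: "(\<kappa> * D + ln CA + real N * H) / c \<le> real M0" using real_arch_simple
        by blast
    define M' where "M' = max M M0"
    have M': "M \<le> M'" "M0 \<le> M'" unfolding M'_def by auto
    define P where "P = real N * L ^ N"
    have P: "0 \<le> P" unfolding P_def using L by simp
    define \<rho>' where "\<rho>' = min \<rho>0 (min e (e2 / (P + 1)))"
    have "e2 / (P + 1) > 0" using e2 P by simp
    then have \<rho>': "\<rho>' > 0" "\<rho>' \<le> \<rho>0" "\<rho>' \<le> e" "\<rho>' \<le> e2 / (P + 1)" using \<rho>0 e unfolding \<rho>'_def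
        by auto
    have \<rho>P: "\<rho>' * P \<le> e2"
    proof -
      have "\<rho>' * (P + 1) \<le> e2" using \<rho>'(4) P by (simp add: pos_le_divide_eq)
      then show ?thesis using \<rho>'(1) by (simp add: distrib_left)
    qed
    define \<rho> where "\<rho> = min (\<rho>' / 2) (1 / 4)"
    have \<rho>: "\<rho> > 0" "2 * \<rho> \<le> \<rho>'" "2 * \<rho> < 1" using \<rho>' unfolding \<rho>_def by auto
    show ?thesis
    proof (intro exI[of _ M'] conjI M'(1) exI[of _ \<rho>] \<rho>(1) allI impI)
      fix g assume "cr_map I r g \<and> c1_dist I f g < \<rho> \<and> cr_norm I r g \<le> K"
      then have g: "cr_map I r g" and cd: "c1_dist I f g < \<rho>" and gK: "cr_norm I r g \<le> K" by auto
      note fm = cr_maps[OF f] and gm = cr_maps[OF g]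
      obtain G0 where G0: "is_lift I g G0" using cr_lift[OF g] by blast
      obtain G where G: "is_lift I g G" and FG: "\<And>t. t \<in> S \<Longrightarrow> \<bar>F t - G t\<bar> \<le> 2 * \<rho>"
        using near_lift[OF F G0 fm gm less_imp_le[OF c1_dist_close(1)[OF f g r cd]] \<rho>(3)] by blast
      let ?u = "nth_deriv S 1 G"
      have FG': "\<bar>F t - G t\<bar> \<le> \<rho>'" if "t \<in> S" for t using FG[OF that] \<rho> by linarith
      have uu: "\<bar>nth_deriv S 1 F t - ?u t\<bar> \<le> \<rho>'" if "t \<in> S" for t
      proof -
        have "\<pi> t \<in> points I" using that unfolding points_def by auto
        from c1_dist_close(2)[OF f g r cd this] show ?thesis
          using gderiv_lift[OF F that] gderiv_lift[OF G that] \<rho> by simp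
      qed
      have pbg: "\<bar>G a - G b\<bar> \<le> L * \<bar>a - b\<bar> \<and> (\<forall>n. \<bar>(G ^^ n) a - (G ^^ n) b\<bar>
          \<le> C0 * exp (R * real n) * \<bar>a - b\<bar>)"
        if "a \<in> S" "b \<in> S" for a b
        by (rule pb[OF g G _ _ that]) (use FG' uu \<rho>'(2) in force)+
      have cl: "dist ((f ^^ i) x) ((g ^^ i) x) \<le> e2" if i: "i < N" and x: "x \<in> points I" for i x
      proof -
        obtain t where t: "t \<in> S" "x = \<pi> t" using x unfolding points_def by auto
        have "dist ((f ^^ i) x) ((g ^^ i) x) = dist (\<pi> ((F ^^ i) t)) (\<pi> ((G ^^ i) t))"
          using lift_funpow(2)[OF F fm t(1)] lift_funpow(2)[OF G gm t(1)] t(2) by simp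
        also have "\<dots> \<le> \<bar>(F ^^ i) t - (G ^^ i) t\<bar>"
          using lift_funpow(1)[OF F fm t(1)] lift_funpow(1)[OF G gm t(1)] by (rule dist_le)
        also have "\<dots> \<le> \<rho>' * (real i * L ^ i)"
          by (rule funpow_close[OF F fm G gm L Flip FG' _ t(1)]) (use \<rho>' in auto)
        also have "\<dots> \<le> \<rho>' * P" unfolding P_def using \<rho>' i L
            by (intro mult_left_mono mult_mono power_increasing) auto
        finally show ?thesis using \<rho>P by linarith
      qed
      obtain ycol :: "real \<Rightarrow> nat" where y1: "\<And>t. t \<in> S \<Longrightarrow> ycol t < card E"
        and y2: "\<And>a b i. a \<in> S \<Longrightarrow> b \<in> S \<Longrightarrow> ycol a = ycol b \<Longrightarrow> i < N \<Longrightarrow> \<bar>(G ^^ i) a - (G ^^ i) b\<bar> \<le> 1 \<Longrightarrow>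
            \<bar>(G ^^ i) a - (G ^^ i) b\<bar> \<le> 8 * e2"
        using spanning_colour[OF E(1) sp G gm cl] by blast
      have br: "branching S G ?u r L R C0 CA \<epsilon> H gam \<kappa> M M'' N (card E) ycol" if M'': "M \<le> M''"
          for M''
      proof
        show "\<bar>(G ^^ i) a - (G ^^ i) b\<bar> \<le> \<epsilon>"
            if "a \<in> S" "b \<in> S" "ycol a = ycol b" "i < N" "\<bar>(G ^^ i) a - (G ^^ i) b\<bar> \<le> 1" for a b i
          using y2[OF that] unfolding e2_def by simp
        show "?u x \<noteq> 0" if "a \<in> S" "b \<in> S" "x \<in> S" "\<bar>a - b\<bar> \<le> \<epsilon>" "\<bar>?u a\<bar> > exp (- real M)"
            "min a b \<le> x" "x \<le> max a b" for a b x
        proof -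
          have "\<bar>a - x\<bar> < d" using that(4,6,7) \<epsilon>(4) by linarith
          then have "\<bar>nth_deriv S 1 F a - nth_deriv S 1 F x\<bar> < e" using d(2) that by blast
          then show ?thesis using uu[OF that(1)] uu[OF that(3)] \<rho>'(3) that(5) e by linarith
        qed
        show "R < real m * (r / (r - 1)) - ln (CA * C0)" if "M'' \<le> m" for m
        proof -
          have "Mmin \<le> m" using that M'' M by simp
          moreover from this have "real Mmin \<le> real m" by simp
          ultimately show ?thesis using gain[of m] M1(2) by linarith
        qed
      next
        fix m :: nat and x0 w :: real assume w: "0 < w" "w \<le> 1"
        show "\<exists>col :: real \<Rightarrow> nat.
          (\<forall>t\<in>{x0..x0+w}. real (col t) + 1 \<le> CA * exp (real m / (r - 1))) \<and>
          (\<forall>s\<in>S \<inter> {x0..x0+w}. \<forall>t\<in>S \<inter> {x0..x0+w}. s < t \<longrightarrow> col s = col t \<longrightarrow>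
             t - s \<le> w * exp (- real m / (r - 1)) \<and>
             (\<bar>?u s\<bar> \<le> exp (- real m) \<longrightarrow> \<bar>?u t\<bar> \<le> exp (- real m) \<longrightarrow> (\<forall>c\<in>{s..t}. \<bar>?u c\<bar> \<le> CA * exp (-
                 real m))) \<and>
             (\<bar>?u s\<bar> > exp (- real m - 1) \<longrightarrow> \<bar>?u t\<bar> > exp (- real m - 1) \<longrightarrow> (\<forall>c\<in>{s..t}. ?u c \<noteq> 0)))"
          unfolding CA_def by (rule cr_split[OF g r G gK K w])
      next
        show "convex S" by (rule convS)
        show "G t \<in> S" if "t \<in> S" for t by (rule lift_into[OF G gm that])
        show "(G has_real_derivative ?u t) (at t within S)" if "t \<in> S" for t
            by (rule lift_derivative[OF g r G that])
        show "continuous_on S ?u" by (rule lift_deriv_continuous[OF g r G])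
        show "\<bar>(G ^^ n) a - (G ^^ n) b\<bar> \<le> C0 * exp (R * real n) * \<bar>a - b\<bar>" if "a \<in> S" "b \<in> S"
            for a b n using pbg[OF that] by blast
        show "\<bar>G a - G b\<bar> \<le> L * \<bar>a - b\<bar>" if "a \<in> S" "b \<in> S" for a b using pbg[OF that] by blast
        show "ycol t < card E" if "t \<in> S" for t by (rule y1[OF that])
        show "exp (- gam) + exp (- gam * real M) / (1 - exp (- gam)) \<le> 1" by (rule kraft[OF M])
        show "1 \<le> M" using M M1 by simp
      qed (fact r R(2) C0 CA \<kappa> \<epsilon>(1) \<epsilon>1 L\<epsilon> \<epsilon>R N H(2) E(2) gam(1) M'')+
      have dp: "\<forall>m\<ge>M'. gam * real m + ln CA + real m / (r - 1) + real N * H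
          \<le> \<kappa> * (real m * (r / (r - 1)) - ln (CA * C0))"
      proof (intro allI impI deep)
        fix m assume "M' \<le> m"
        then show "(\<kappa> * D + ln CA + real N * H) / c \<le> real m" using M0 M'(2) by linarith
      qed
      show "\<exists>G L \<epsilon> N NY ycol. is_lift I g G \<and>
          branching S G (nth_deriv S 1 G) r L R C0 CA \<epsilon> H gam \<kappa> M M N NY ycol \<and>
          branching S G (nth_deriv S 1 G) r L R C0 CA \<epsilon> H gam \<kappa> M M' N NY ycol \<and>
          (\<forall>m\<ge>M'. gam * real m + ln CA + real m / (r - 1) + real N * H \<le> \<kappa> * (real m * (r / (r -
              1)) - ln (CA * C0)))"
        using G br[OF order_refl] br[OF M'(1)] dp by blast
    qed
  qed
  have low: "gam * real m + ln CA + real m / (r - 1)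
      \<le> \<kappa> * (real m * (r / (r - 1)) - ln (CA * C0))" if "m \<ge> Mmin" for m
    using deep[of 0 m] M1(4) that by simp
  show ?thesis
    by (rule exI[of _ C0], rule exI[of _ CA], rule exI[of _ Mmin], intro conjI allI impI)
      (rule C0 CA M1(1) | (rule low gain fam, assumption))+
qed

end

section \<open>Entropy of measures seeing small derivatives\<close>

text \<open>The value \<open>-log 0\<close> is infinite, whence the truncation at \<open>W\<close>.\<close>

definition log_depth :: "real \<Rightarrow> real \<Rightarrow> real \<Rightarrow> real" where
  "log_depth W \<eta> y = (if \<bar>y\<bar> \<le> \<eta> then (if y = 0 then W else min W (- ln \<bar>y\<bar>)) else 0)"

definition log_band :: "real \<Rightarrow> real \<Rightarrow> real \<Rightarrow> real" where
  "log_band a b y = (if a < \<bar>y\<bar> \<and> \<bar>y\<bar> \<le> b then - ln \<bar>y\<bar> else 0)"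

lemma log_depth_measurable [measurable]: "log_depth W \<eta> \<in> borel_measurable borel"
  unfolding log_depth_def by measurable

lemma log_band_measurable [measurable]: "log_band a b \<in> borel_measurable borel"
  unfolding log_band_def by measurable

lemma log_depth_bounds: "0 \<le> W \<Longrightarrow> \<eta> \<le> 1 \<Longrightarrow> 0 \<le> log_depth W \<eta> y \<and> log_depth W \<eta> y \<le> W"
  unfolding log_depth_def by simp

lemma log_band_bounds:
  assumes "0 < a" "b \<le> 1"
  shows "0 \<le> log_band a b y" "log_band a b y \<le> max 0 (- ln a)"
proof -
  have "- ln \<bar>y\<bar> \<le> - ln a" if "a < \<bar>y\<bar>" using that assms by simp
  then show "log_band a b y \<le> max 0 (- ln a)" unfolding log_band_def
      by (auto intro: max.coboundedI2)
  have "ln \<bar>y\<bar> \<le> 0" if "a < \<bar>y\<bar>" "\<bar>y\<bar> \<le> b" using that assms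
      by (intro ln_le_zero_iff[THEN iffD2]) linarith+
  then show "0 \<le> log_band a b y" unfolding log_band_def by simp
qed

lemma lap_count_subexponential:
  assumes "\<sigma> > 0" "e > 0"
  shows "\<exists>n0. \<forall>n\<ge>n0. ln (real (lap_count n \<sigma>)) + C \<le> real n * e"
proof -
  have "(\<lambda>n. (ln ((real n + 1) / \<sigma> + 2) + C) / real n) \<longlonglongrightarrow> 0" using assms(1) by real_asymp
  then have "\<forall>\<^sub>F n in sequentially. (ln ((real n + 1) / \<sigma> + 2) + C) / real n < e" using assms(2)
      by (rule order_tendstoD)
  then obtain n1 where n1: "\<And>n. n \<ge> n1 \<Longrightarrow> (ln ((real n + 1) / \<sigma> + 2) + C) / real n < e"
      unfolding eventually_sequentially by blast
  show ?thesis
  proof (intro exI[of _ "max n1 1"] allI impI)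
    fix n assume n: "max n1 1 \<le> n"
    have p: "0 < (real n + 1) / \<sigma>" using assms by simp
    have "real (lap_count n \<sigma>) \<le> (real n + 1) / \<sigma> + 2" unfolding lap_count_def using p by linarith
    moreover have "0 < real (lap_count n \<sigma>)" unfolding lap_count_def by simp
    ultimately have "ln (real (lap_count n \<sigma>)) \<le> ln ((real n + 1) / \<sigma> + 2)" by simp
    moreover have "ln ((real n + 1) / \<sigma> + 2) + C < real n * e" using n1[of n] n
        by (simp add: pos_divide_less_eq mult.commute)
    ultimately show "ln (real (lap_count n \<sigma>)) + C \<le> real n * e" by linarith
  qed
qed

text \<open>For events at time \<open>l\<close> that are read off \<open>k\<close> steps earlier;
  the first \<open>k\<close> times are counted in full.\<close>

lemma delayed_sum_le:
  fixes h :: "nat \<Rightarrow> real"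
  assumes "\<And>l. 0 \<le> h l"
  shows "(\<Sum>l<n. if l < k then 1 else h (l - k)) \<le> real k + (\<Sum>l<n. h l)"
proof -
  have "(\<Sum>l<n. if l < k then 1 else h (l - k)) = real (min n k) + (\<Sum>l<n - k. h l)"
    by (induction n) (auto simp: Suc_diff_le min_def)
  moreover have "(\<Sum>l<n - k. h l) \<le> (\<Sum>l<n. h l)" using assms by (intro sum_mono2) auto
  ultimately show ?thesis by linarith
qed

context branching
begin

text \<open>\<open>state\<close> requires lifted diameter at most 1, so the fundamental interval is
  first divided into unit pieces.\<close>

lemma initial_cover:
  assumes \<sigma>: "0 < \<sigma>" "\<sigma> < \<epsilon>" and c: "0 \<le> c" "{0..c} \<subseteq> S"
  shows "kraft_cover (dyn_small G n \<sigma>) {0..c} (\<lambda>t. ln (c + 1)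
      + cost \<sigma> (ln (real (lap_count n \<sigma>))) n 0 0 t)"
proof (rule kraft_cover_colour[where f="\<lambda>t. nat \<lfloor>t\<rfloor>" and K="nat \<lfloor>c\<rfloor> + 1" and \<kappa>="ln (c + 1)"])
  show "nat \<lfloor>t\<rfloor> < nat \<lfloor>c\<rfloor> + 1" if "t \<in> {0..c}" for t
  proof -
    have "\<lfloor>t\<rfloor> \<le> \<lfloor>c\<rfloor>" using that by (intro floor_mono) auto
    then show ?thesis by linarith
  qed
  have "real (nat \<lfloor>c\<rfloor>) \<le> c" using c by simp
  then show "real (nat \<lfloor>c\<rfloor> + 1) \<le> exp (ln (c + 1))" using c by simp
  fix j :: nat
  let ?A = "{t \<in> {0..c}. nat \<lfloor>t\<rfloor> = j}"
  have d: "\<bar>a - b\<bar> \<le> 1" if "a \<in> ?A" "b \<in> ?A" for a b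
  proof -
    have "\<lfloor>a\<rfloor> = \<lfloor>b\<rfloor>" using that by (auto simp: eq_nat_nat_iff)
    then show ?thesis by linarith
  qed
  have "state 0 0 0 ?A" unfolding state_def using c d by (auto simp: mono_between_def)
  moreover have "0 < lim_pot \<sigma> n"
  proof -
    have "0 < ln (\<epsilon> / \<sigma>)" using \<sigma> by simp
    then show ?thesis unfolding lim_pot_def using R by (intro add_nonneg_pos) auto
  qed
  ultimately show "kraft_cover (dyn_small G n \<sigma>) ?A (\<lambda>t. cost \<sigma> (ln (real (lap_count n \<sigma>))) n 0 0
      t)"
    using main_cover[OF \<sigma> refl, of 0 0 0 ?A n n] by simp
qed simp

end

locale coded_arc = arc I lam + br: branching "pdom I" G "nth_deriv (pdom I) 1 G"
    r L R C0 CA \<epsilon> H gam \<kappa> M M' N NY ycol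
  for I :: "'a::euclidean_space one_dim" and lam G r L R C0 CA \<epsilon> H gam \<kappa> M M' N NY ycol +
  fixes g :: "'a \<Rightarrow> 'a" and \<nu> :: "'a measure"
  assumes lift: "is_lift I g G" and maps: "g \<in> points I \<rightarrow> points I"
      and ergodic: "ergodic_measure (points I) g \<nu>"
    and gain_ge: "\<And>m. M' \<le> m \<Longrightarrow> real m + 1 \<le> br.gain m"

sublocale coded_arc \<subseteq> es: ergodic_system \<nu> g
  by (rule ergodic_measure_system[OF ergodic])

context arc
begin

lemma gderiv_continuous:
  assumes G: "is_lift I g G" and c: "continuous_on S (nth_deriv S 1 G)"
  shows "continuous_on (points I) (gderiv I g)"
  unfolding continuous_on_iff
proof (intro ballI allI impI)
  fix x and e :: real assume x: "x \<in> points I" and e: "0 < e"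
  obtain s where s: "s \<in> S" "x = \<pi> s" using x unfolding points_def by auto
  obtain d where d: "d > 0" "\<And>s t. s \<in> S \<Longrightarrow> t \<in> S \<Longrightarrow> \<bar>s - t\<bar> < d \<Longrightarrow>
      \<bar>nth_deriv S 1 G s - nth_deriv S 1 G t\<bar> < e"
    using invariant_uniformly_continuous[OF c lift_deriv_invariant[OF G] e] by blast
  have "dist (gderiv I g y) (gderiv I g x) < e" if y: "y \<in> points I" "dist y x < d / 2" for y
  proof -
    obtain t where t: "t \<in> S" "y = \<pi> t" using y(1) unfolding points_def by auto
    obtain t' where t': "t' \<in> S" "\<pi> t' = \<pi> t" "\<bar>s - t'\<bar> \<le> 2 * dist (\<pi> s) (\<pi> t)"
        using local_lift[OF s(1) t(1)] by blast
    have "\<bar>s - t'\<bar> < d" using t'(3) y(2) s t by (simp add: dist_commute)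
    then have "\<bar>nth_deriv S 1 G s - nth_deriv S 1 G t'\<bar> < e" using d(2) s t' by blast
    then show ?thesis using gderiv_lift[OF G s(1)] gderiv_lift[OF G t'(1)] s t t'
      by (simp add: dist_real_def abs_minus_commute)
  qed
  then show "\<exists>d>0. \<forall>y\<in>points I. dist y x < d \<longrightarrow> dist (gderiv I g y) (gderiv I g x) < e"
    using d(1) by (intro exI[of _ "d / 2"]) auto
qed

lemma gderiv_measurable:
  assumes "is_lift I g G" "continuous_on S (nth_deriv S 1 G)" "ergodic_measure (points I) g \<nu>"
  shows "gderiv I g \<in> borel_measurable \<nu>" "space \<nu> = points I"
proof -
  have s: "sets \<nu> = sets (restrict_space borel (points I))" using assms(3)
      unfolding ergodic_measure_def by blast
  have "gderiv I g \<in> borel_measurable (restrict_space borel (points I))"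
    by (rule borel_measurable_continuous_on_restrict[OF gderiv_continuous[OF assms(1,2)]])
  then show "gderiv I g \<in> borel_measurable \<nu>" using measurable_cong_sets[OF s refl] by blast
  show "space \<nu> = points I" using sets_eq_imp_space_eq[OF s] by (simp add: space_restrict_space)
qed

end

context coded_arc
begin

lemma gderiv_measurable_nu [measurable]: "gderiv I g \<in> borel_measurable \<nu>"
    and space_nu: "space \<nu> = points I"
  using gderiv_measurable[OF lift br.contu ergodic] by auto

lemma orbit_sum:
  assumes "t \<in> S"
  shows "(\<Sum>l<n. f (nth_deriv S 1 G ((G ^^ l) t))) = es.bsum (\<lambda>x. f (gderiv I g x)) n (\<pi> t)"
  unfolding es.bsum_def
proof (rule sum.cong[OF refl])
  fix l
  have "(G ^^ l) t \<in> S" by (rule br.GnS[OF assms])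
  then show "f (nth_deriv S 1 G ((G ^^ l) t)) = f (gderiv I g ((g ^^ l) (\<pi> t)))"
    using gderiv_lift[OF lift, of "(G ^^ l) t"] lift_funpow(2)[OF lift maps assms] by simp
qed

text \<open>Combines the code of \<open>main_cover\<close> with
  \<open>metric_entropy_le_kraft\<close>; the price of the initial unit piece is a constant and
  vanishes in the limit.\<close>

lemma entropy_le_cost:
  assumes main: "\<And>\<sigma> e. 0 < \<sigma> \<Longrightarrow> \<sigma> < \<epsilon> \<Longrightarrow> e > 0 \<Longrightarrow> \<exists>n0. \<forall>n\<ge>n0. \<exists>L. integrable \<nu> L \<and>
       (\<forall>t\<in>S. br.cost \<sigma> (ln (real (lap_count n \<sigma>))) n 0 0 t \<le> L (\<pi> t)) \<and> (\<integral>x. L x \<partial>\<nu>) \<le> real n *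
           (B + e)"
  shows "metric_entropy \<nu> g \<le> ereal B"
proof (rule metric_entropy_le_kraft[where A="{0..lam}" and \<pi>="param I" and G=G and ?\<sigma>0.0=\<epsilon>])
  show "ergodic_measure (points I) g \<nu>" by (rule ergodic)
  show "points I \<in> sets borel" using points_compact by (simp add: borel_compact)
  show "\<exists>t\<in>{0..lam}. \<pi> t = x" if "x \<in> points I" for x using that unfolding points_eq by auto
  have sub: "t \<in> S" if "t \<in> {0..lam}" for t using that lam(2) by auto
  show "\<pi> t \<in> points I" if "t \<in> {0..lam}" for t using that unfolding points_eq by auto
  show "dist ((g ^^ i) (\<pi> s)) ((g ^^ i) (\<pi> t)) \<le> \<bar>(G ^^ i) s - (G ^^ i) t\<bar>"
      if "s \<in> {0..lam}" "t \<in> {0..lam}" for s t i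
    using dist_le[OF br.GnS[OF sub[OF that(1)]] br.GnS[OF sub[OF that(2)]], of i i]
      lift_funpow(2)[OF lift maps sub[OF that(1)]] lift_funpow(2)[OF lift maps sub[OF that(2)]]
          by simp
  show "\<epsilon> > 0" by (rule br.\<epsilon>(1))
  fix \<sigma> e :: real assume \<sigma>: "0 < \<sigma>" "\<sigma> < \<epsilon>" and e: "e > 0"
  from main[OF \<sigma>, of "e / 2"] e obtain n0 where n0: "\<And>n. n \<ge> n0 \<Longrightarrow> \<exists>L. integrable \<nu> L \<and>
       (\<forall>t\<in>S. br.cost \<sigma> (ln (real (lap_count n \<sigma>))) n 0 0 t \<le> L (\<pi> t)) \<and> (\<integral>x. L x \<partial>\<nu>) \<le> real n *
           (B + e / 2)" by auto
  obtain n1 :: nat where n1: "ln (lam + 1) / (e / 2) \<le> real n1" using real_arch_simple by blast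
  show "\<exists>n0. \<forall>n\<ge>n0. \<exists>L. integrable \<nu> L \<and> kraft_cover (dyn_small G n \<sigma>) {0..lam} (\<lambda>t. L (\<pi> t)) \<and>
      (\<integral>x. L x \<partial>\<nu>) \<le> real n * (B + e)"
  proof (intro exI[of _ "max n0 n1"] allI impI)
    fix n assume n: "max n0 n1 \<le> n"
    then obtain L where L: "integrable \<nu> L" "\<forall>t\<in>S. br.cost \<sigma> (ln (real (lap_count n \<sigma>))) n 0 0 t
        \<le> L (\<pi> t)"
      "(\<integral>x. L x \<partial>\<nu>) \<le> real n * (B + e / 2)" using n0[of n] by auto
    show "\<exists>L. integrable \<nu> L \<and> kraft_cover (dyn_small G n \<sigma>) {0..lam} (\<lambda>t. L (\<pi> t)) \<and>
        (\<integral>x. L x \<partial>\<nu>) \<le> real n * (B + e)"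
    proof (intro exI[of _ "\<lambda>x. ln (lam + 1) + L x"] conjI)
      show "integrable \<nu> (\<lambda>x. ln (lam + 1) + L x)" using L(1) by simp
      show "kraft_cover (dyn_small G n \<sigma>) {0..lam} (\<lambda>t. ln (lam + 1) + L (\<pi> t))"
      proof (rule kraft_cover_mono[OF br.initial_cover[OF \<sigma> _ lam(2)]])
        show "0 \<le> lam" using lam by simp
      qed (use L(2) sub in auto)
      have "ln (lam + 1) / (e / 2) \<le> real n" using n1 n by linarith
      then have "ln (lam + 1) \<le> real n * (e / 2)" using e
          by (simp only: pos_divide_le_eq half_gt_zero)
      moreover have "(\<integral>x. ln (lam + 1) + L x \<partial>\<nu>) = ln (lam + 1) + (\<integral>x. L x \<partial>\<nu>)" using L(1)
          by (simp add: es.prob_space)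
      ultimately show "(\<integral>x. ln (lam + 1) + L x \<partial>\<nu>) \<le> real n * (B + e)" using L(3)
          by (simp add: distrib_left)
    qed
  qed
qed

text \<open>-ln \<bar>u\<bar> is at most the level plus 1, and \<open>gain_ge\<close> says that deep
  gains reach this. Zeros of \<open>u\<close> are left out: they are terminal visits for every value
  of the truncation.\<close>

lemma depth_gain:
  fixes W t :: real
  defines "\<phi> \<equiv> \<lambda>t. log_depth W (exp (- real M')) (nth_deriv S 1 G t)"
  shows "exp (- real M') < \<bar>nth_deriv S 1 G t\<bar> \<Longrightarrow> \<phi> t \<le> 0"
    and "0 < \<bar>nth_deriv S 1 G t\<bar> \<Longrightarrow> \<bar>nth_deriv S 1 G t\<bar> \<le> exp (- real M') \<Longrightarrow> \<phi> t \<le> br.gain (br.lev t)"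
proof -
  show "\<phi> t \<le> 0" if "exp (- real M') < \<bar>nth_deriv S 1 G t\<bar>" using that
      unfolding \<phi>_def log_depth_def by simp
  assume u: "0 < \<bar>nth_deriv S 1 G t\<bar>" "\<bar>nth_deriv S 1 G t\<bar> \<le> exp (- real M')"
  have u1: "\<bar>nth_deriv S 1 G t\<bar> \<le> 1" using u(2) by (rule order_trans) simp
  have "M' \<le> br.lev t" using br.lev_iff[OF u(1) u1] u(2) by blast
  then have "real (br.lev t) + 1 \<le> br.gain (br.lev t)" by (rule gain_ge)
  moreover have "- ln \<bar>nth_deriv S 1 G t\<bar> \<le> real (br.lev t) + 1" unfolding br.lev_def by linarith
  moreover have "\<phi> t \<le> - ln \<bar>nth_deriv S 1 G t\<bar>" using u unfolding \<phi>_def log_depth_def by auto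
  ultimately show "\<phi> t \<le> br.gain (br.lev t)" by linarith
qed

text \<open>If the deep depth has mean at least 2 R, then outside a set of small measure the next
  \<open>k0\<close> steps generate more than \<open>R * real k0\<close>. A block can only begin
  where no past stretch has an excess, so only if the orbit was in that small set \<open>k0\<close>
  steps ago. Blocks are therefore rare, and \<kappa> R remains.\<close>

theorem entropy_le_contraction:
  assumes MM: "M' = M" and deep: "\<And>m. M' \<le> m \<Longrightarrow> br.vcost m \<le> \<kappa> * br.gain m"
    and W: "W \<ge> 0" and b: "2 * R \<le> (\<integral>x. log_depth W (exp (- real M')) (gderiv I g x) \<partial>\<nu>)"
  shows "metric_entropy \<nu> g \<le> ereal (\<kappa> * R + gam)"
proof (rule entropy_le_cost)
  fix \<sigma> e :: real assume \<sigma>: "0 < \<sigma>" "\<sigma> < \<epsilon>" and e: "e > 0"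
  define NH where "NH = real N * H"
  have NH: "NH \<ge> 0" unfolding NH_def using br.N by simp
  \<comment> \<open>R/2 leaves a mean of 3R/2 > R after the error in \<open>birkhoff_lower\<close>;
    the other bound limits the mean price of the blocks to e/2 per step.\<close>
  define \<gamma> where "\<gamma> = min (R / 2) (e / (2 * (NH + 1)))"
  have "e / (2 * (NH + 1)) > 0" using e NH by simp
  then have \<gamma>: "\<gamma> > 0" using br.R unfolding \<gamma>_def by simp
  have \<gamma>R: "\<gamma> \<le> R / 2" "\<gamma> \<le> e / (2 * (NH + 1))" unfolding \<gamma>_def
      by (rule min.cobounded1, rule min.cobounded2)
  have NHg: "NH * \<gamma> \<le> e / 2"
  proof -
    have "\<gamma> * (2 * (NH + 1)) \<le> e" using \<gamma>R(2) NH by (simp add: pos_le_divide_eq)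
    then show ?thesis using \<gamma> by (simp add: algebra_simps)
  qed
  let ?f = "\<lambda>x. log_depth W (exp (- real M')) (gderiv I g x)"
  have fm: "?f \<in> borel_measurable \<nu>" by measurable
  have fb: "0 \<le> ?f x \<and> ?f x \<le> W" for x by (rule log_depth_bounds[OF W]) simp
  from es.birkhoff_lower[OF fm fb b \<gamma>] obtain n0 where n0: "\<And>n. n \<ge> n0 \<Longrightarrow>
    \<exists>\<Omega>\<in>sets \<nu>. measure \<nu> \<Omega> \<ge> 1 - \<gamma> \<and> (\<forall>x\<in>\<Omega>. \<forall>j\<le>n. 2 * R * real j - \<gamma> * real n \<le> es.bsum ?f j x)"
        by blast
  define k0 where "k0 = max n0 1"
  obtain \<Omega> where \<Omega>: "\<Omega> \<in> sets \<nu>" "measure \<nu> \<Omega> \<ge> 1 - \<gamma>" "\<forall>x\<in>\<Omega>. \<forall>j\<le>k0. 2 * R * real j - \<gamma> * real k0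
      \<le> es.bsum ?f j x"
    using n0[of k0] unfolding k0_def by auto
  have \<Omega>R: "R * real k0 < es.bsum ?f k0 x" if "x \<in> \<Omega>" for x
  proof -
    have "2 * R * real k0 - \<gamma> * real k0 \<le> es.bsum ?f k0 x" using \<Omega>(3) that by blast
    moreover have "\<gamma> * real k0 \<le> R / 2 * real k0" using \<gamma>R(1) by (intro mult_right_mono) auto
    moreover have "0 < R * real k0" using br.R unfolding k0_def by simp
    ultimately show ?thesis by simp
  qed
  define Bad where "Bad = space \<nu> - \<Omega>"
  have Bad[measurable]: "Bad \<in> sets \<nu>" using \<Omega>(1) unfolding Bad_def by auto
  have mBad: "measure \<nu> Bad \<le> \<gamma>" unfolding Bad_def using es.prob_compl[OF \<Omega>(1)] \<Omega>(2) by simp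
  define h where "h x l = indicat_real Bad ((g ^^ l) x)" for x l
  define c2 where "c2 n = ln (real (lap_count n \<sigma>)) + \<kappa> * (ln (\<epsilon> / \<sigma>) + r / (r - 1) + br.gain M')"
      for n
  obtain n1 where n1: "\<And>n. n \<ge> n1 \<Longrightarrow> ln (real (lap_count n \<sigma>))
      + (\<kappa> * (ln (\<epsilon> / \<sigma>) + r / (r - 1) + br.gain M') + NH * real k0) \<le> real n * (e / 2)"
    using lap_count_subexponential[OF \<sigma>(1), of "e / 2"] e by (metis half_gt_zero)
  show "\<exists>n0. \<forall>n\<ge>n0. \<exists>L. integrable \<nu> L \<and>
       (\<forall>t\<in>S. br.cost \<sigma> (ln (real (lap_count n \<sigma>))) n 0 0 t \<le> L (\<pi> t)) \<and> (\<integral>x. L x \<partial>\<nu>) \<le> real n *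
           (\<kappa> * R + gam + e)"
  proof (intro exI[of _ n1] allI impI)
    fix n assume n: "n1 \<le> n"
    define L where "L x = NH * (real k0 + (\<Sum>l<n. h x l)) + \<kappa> * (R * real n) + gam * real n + c2 n"
        for x
    have hi: "integrable \<nu> (\<lambda>x. h x l)" for l
      unfolding h_def using es.integrable_gpow[of "indicat_real Bad" l] Bad
          by (simp add: es.emeasure_eq_measure)
    have hI: "(\<integral>x. h x l \<partial>\<nu>) = measure \<nu> Bad" for l
      unfolding h_def using es.integral_gpow[of "indicat_real Bad" l] Bad by simp
    have Li: "integrable \<nu> L" unfolding L_def using hi by simp
    have "(\<integral>x. L x \<partial>\<nu>) = NH * (real k0 + real n * measure \<nu> Bad) + \<kappa> * (R * real n) + gam * real n
        + c2 n"
      unfolding L_def using hi hI by (simp add: es.prob_space)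
    also have "\<dots> \<le> NH * (real k0 + real n * \<gamma>) + \<kappa> * (R * real n) + gam * real n + c2 n"
    proof -
      have "NH * (real k0 + real n * measure \<nu> Bad) \<le> NH * (real k0 + real n * \<gamma>)"
        using mBad NH by (intro mult_left_mono add_left_mono) auto
      then show ?thesis by linarith
    qed
    also have "\<dots> = NH * real k0 + real n * (NH * \<gamma>) + \<kappa> * (R * real n) + gam * real n + c2 n"
        by (simp add: algebra_simps)
    also have "\<dots> \<le> NH * real k0 + real n * (e / 2) + \<kappa> * (R * real n) + gam * real n + c2 n"
      using mult_left_mono[OF NHg, of "real n"] by simp
    also have "\<dots> \<le> real n * (e / 2) + real n * (e / 2) + \<kappa> * (R * real n) + gam * real n"
      using n1[OF n] unfolding c2_def by linarith
    also have "\<dots> = real n * (\<kappa> * R + gam + e)" by (simp add: algebra_simps)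
    finally have LI: "(\<integral>x. L x \<partial>\<nu>) \<le> real n * (\<kappa> * R + gam + e)" .
    have "br.cost \<sigma> (ln (real (lap_count n \<sigma>))) n 0 0 t \<le> L (\<pi> t)" if t: "t \<in> S" for t
    proof -
      define \<phi> where "\<phi> = (\<lambda>t. log_depth W (exp (- real M')) (nth_deriv S 1 G t))"
      \<comment> \<open>The first \<open>k0\<close> times have too short a past to exclude a block
        and are charged in full.\<close>
      define \<psi> where "\<psi> l = (if l < k0 then 1 else h (\<pi> t) (l - k0))" for l
      have h0: "0 \<le> h x l" for x l unfolding h_def by simp
      have free: "1 \<le> \<psi> l" if fr: "\<And>i. i \<le> l \<Longrightarrow> (\<Sum>m\<in>{i..<l}. \<phi> ((G ^^ m) t)) \<le> R * real (l - i)"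
          for l
      proof (cases "l < k0")
        case False
        define s where "s = (G ^^ (l - k0)) t"
        have s: "s \<in> S" "\<pi> s = (g ^^ (l - k0)) (\<pi> t)" unfolding s_def
            using br.GnS[OF t] lift_funpow(2)[OF lift maps t] by auto
        have "(\<Sum>m\<in>{l - k0..<l}. \<phi> ((G ^^ m) t)) = (\<Sum>m<k0. \<phi> ((G ^^ m) s))"
          by (rule sum.reindex_bij_witness[of _ "\<lambda>m. m + (l - k0)" "\<lambda>m. m - (l - k0)"])
            (use False in \<open>auto simp: s_def funpow_add[symmetric, THEN fun_cong, unfolded o_def]\<close>)
        also have "\<dots> = es.bsum ?f k0 (\<pi> s)" unfolding \<phi>_def by (rule orbit_sum[OF s(1)])
        finally have "es.bsum ?f k0 (\<pi> s) \<le> R * real k0" using fr[of "l - k0"] False by simp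
        then have "\<pi> s \<notin> \<Omega>" using \<Omega>R[of "\<pi> s"] by auto
        moreover have "\<pi> s \<in> space \<nu>" using s(1) unfolding space_nu points_def by auto
        ultimately show ?thesis using False s(2) unfolding \<psi>_def h_def Bad_def by auto
      qed (simp add: \<psi>_def)
      have "br.cost \<sigma> (ln (real (lap_count n \<sigma>))) n 0 0 ((G ^^ 0) t) \<le>
         real N * H * (\<Sum>l\<in>{0..<0 + n}. \<psi> l) + \<kappa> * (R * real n - 0) + gam * real n + c2 n"
        unfolding c2_def
      proof (rule br.cost_bound_free[OF \<sigma> _ MM deep, where \<phi>=\<phi>])
        show "0 \<le> ln (real (lap_count n \<sigma>))" unfolding lap_count_def by simp
        show "exp (- real M') < \<bar>nth_deriv S 1 G t\<bar> \<Longrightarrow> \<phi> t \<le> 0" for t unfolding \<phi>_def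
            by (rule depth_gain(1))
        show "0 < \<bar>nth_deriv S 1 G t\<bar> \<Longrightarrow> \<bar>nth_deriv S 1 G t\<bar> \<le> exp (- real M') \<Longrightarrow>
            \<phi> t \<le> br.gain (br.lev t)" for t
          unfolding \<phi>_def by (rule depth_gain(2))
        show "0 \<le> \<psi> l" for l unfolding \<psi>_def using h0 by simp
        show "1 \<le> \<psi> l" if "\<And>i. i \<le> l \<Longrightarrow> (\<Sum>m\<in>{i..<l}. \<phi> ((G ^^ m) t)) \<le> R * real (l - i)" for l
            by (rule free[OF that])
        have "0 < ln (\<epsilon> / \<sigma>)" using \<sigma> by simp
        then show "0 < br.lim_pot \<sigma> n" unfolding br.lim_pot_def using br.R
            by (intro add_nonneg_pos) auto
      qed auto
      also have "(\<Sum>l\<in>{0..<0 + n}. \<psi> l) = (\<Sum>l<n. if l < k0 then 1 else h (\<pi> t) (l - k0))"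
          by (simp add: \<psi>_def atLeast0LessThan)
      also have "real N * H * \<dots> \<le> real N * H * (real k0 + (\<Sum>l<n. h (\<pi> t) l))"
        using NH unfolding NH_def by (intro mult_left_mono delayed_sum_le h0)
      finally show ?thesis unfolding L_def NH_def by simp
    qed
    then show "\<exists>L. integrable \<nu> L \<and> (\<forall>t\<in>S. br.cost \<sigma> (ln (real (lap_count n \<sigma>))) n 0 0 t
        \<le> L (\<pi> t)) \<and>
        (\<integral>x. L x \<partial>\<nu>) \<le> real n * (\<kappa> * R + gam + e)" using Li LI by blast
  qed
qed

text \<open>By \<open>cost_bound_recovery\<close> the entropy falls below \<open>H\<close> by
  \<open>H - \<kappa> * R\<close> times the share of recovery time. If the terminal visit comes in
  the first half, the second half is recovery; otherwise the depth collected in the first half, at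
  mean rate \<beta>, needs at least \<beta> / (2 R) of the time to be burnt. This is the minimum in
  the bound. The price of medium visits is linear in \<open>log_band\<close> and is integrated
  separately.\<close>

theorem entropy_le_recovery:
  assumes deep: "\<And>m. M' \<le> m \<Longrightarrow> br.vcost m + real N * H \<le> \<kappa> * br.gain m"
    and W: "W \<ge> 0" and b: "\<beta> \<le> (\<integral>x. log_depth W (exp (- real M')) (gderiv I g x) \<partial>\<nu>)" and \<beta>: "\<beta> > 0"
    and \<kappa>R: "\<kappa> * R \<le> H"
  shows "metric_entropy \<nu> g \<le> ereal (H + gam
      + (gam + ln CA + 1 / (r - 1)) * (\<integral>x. log_band (exp (- real M')) (exp (- real M)) (gderiv I g
          x) \<partial>\<nu>)
      - (H - \<kappa> * R) * min (1 / 2) (\<beta> / (2 * R)))"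
proof (rule entropy_le_cost)
  fix \<sigma> e :: real assume \<sigma>: "0 < \<sigma>" "\<sigma> < \<epsilon>" and e: "e > 0"
  define D where "D = H - \<kappa> * R"
  have D: "D \<ge> 0" using \<kappa>R unfolding D_def by simp
  define \<theta> where "\<theta> = min (1 / 2) (\<beta> / (2 * R))"
  have \<theta>: "\<theta> \<le> 1 / 2" "\<theta> \<le> \<beta> / (2 * R)" "0 < \<theta>" using \<beta> br.R unfolding \<theta>_def by auto
  have \<theta>R: "R * \<theta> \<le> \<beta> / 2" using \<theta>(2) br.R by (simp add: pos_le_divide_eq algebra_simps)
  \<comment> \<open>The factor of \<gamma> in the mean of \<open>L\<close>: the error of the ergodic
    estimate then costs at most e/2 per step, and the terms that are sublinear in \<open>n\<close>
    get the other half.\<close>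
  define Q where "Q = D * \<theta> + D / R + 1"
  have Q: "Q > 0" using D \<theta> br.R unfolding Q_def by (intro add_nonneg_pos add_nonneg_nonneg) auto
  define \<gamma> where "\<gamma> = e / (2 * Q)"
  have \<gamma>: "\<gamma> > 0" "Q * \<gamma> = e / 2" using e Q unfolding \<gamma>_def by auto
  have \<gamma>Q: "D * \<theta> * \<gamma> + D / R * \<gamma> \<le> e / 2" using \<gamma> unfolding Q_def by (simp add: distrib_right)
  define c1 where "c1 = ln (\<epsilon> / \<sigma>)"
  have c1: "c1 > 0" unfolding c1_def using \<sigma> by simp
  let ?f = "\<lambda>x. log_depth W (exp (- real M')) (gderiv I g x)"
  have fm: "?f \<in> borel_measurable \<nu>" by measurable
  have fb: "0 \<le> ?f x \<and> ?f x \<le> W" for x by (rule log_depth_bounds[OF W]) simp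
  from es.birkhoff_lower[OF fm fb b \<gamma>(1)] obtain n0 where n0: "\<And>n. n \<ge> n0 \<Longrightarrow>
    \<exists>\<Omega>\<in>sets \<nu>. measure \<nu> \<Omega> \<ge> 1 - \<gamma> \<and> (\<forall>x\<in>\<Omega>. \<forall>j\<le>n. \<beta> * real j - \<gamma> * real n \<le> es.bsum ?f j x)" by
        blast
  \<comment> \<open>Medium points satisfy -ln \<bar>u\<bar> \<ge> 1, since \<open>M \<ge> 1\<close>;
    so the constant part \<open>ln CA\<close> of the price is also bounded by a multiple of -ln
    \<bar>u\<bar>.\<close>
  define Cm where "Cm = gam + ln CA + 1 / (r - 1)"
  have lnCA: "0 \<le> ln CA" using br.CA by simp
  have Cm: "0 \<le> Cm" unfolding Cm_def using lnCA br.gam br.r by simp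
  let ?lb = "log_band (exp (- real M')) (exp (- real M))"
  define \<mu> where "\<mu> x = Cm * ?lb (gderiv I g x)" for x
  have lb0: "0 \<le> ?lb y" for y by (rule log_band_bounds) auto
  have \<mu>i: "integrable \<nu> \<mu>"
    unfolding \<mu>_def
  proof (intro integrable_mult_right es.integrable_const_bound[where
      B="max 0 (- ln (exp (- real M')))"] AE_I2)
    fix x show "norm (?lb (gderiv I g x)) \<le> max 0 (- ln (exp (- real M')))"
      using lb0[of "gderiv I g x"] log_band_bounds(2)[of "exp (- real M')" "exp (- real M)"
        "gderiv I g x"] by simp
  qed measurable
  have \<mu>I: "(\<integral>x. \<mu> x \<partial>\<nu>) = Cm * (\<integral>x. ?lb (gderiv I g x) \<partial>\<nu>)" unfolding \<mu>_def by simp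
  define c2 where "c2 n = ln (real (lap_count n \<sigma>)) + \<kappa> * (c1 + r / (r - 1) + br.gain M')" for n
  obtain n1 where n1: "\<And>n. n \<ge> n1 \<Longrightarrow> ln (real (lap_count n \<sigma>))
      + (\<kappa> * (c1 + r / (r - 1) + br.gain M') + (real N * H + D / R * c1)) \<le> real n * (e / 2)"
    using lap_count_subexponential[OF \<sigma>(1), of "e / 2"] e by (metis half_gt_zero)
  show "\<exists>n0. \<forall>n\<ge>n0. \<exists>L. integrable \<nu> L \<and>
       (\<forall>t\<in>S. br.cost \<sigma> (ln (real (lap_count n \<sigma>))) n 0 0 t \<le> L (\<pi> t)) \<and> (\<integral>x. L x \<partial>\<nu>) \<le> real n *
           (H + gam
      + (gam + ln CA + 1 / (r - 1)) * (\<integral>x. ?lb (gderiv I g x) \<partial>\<nu>) - (H - \<kappa> * R) * min (1 / 2) (\<beta> /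
          (2 * R)) + e)"
  proof (intro exI[of _ "max n0 n1"] allI impI)
    fix n assume n: "max n0 n1 \<le> n"
    obtain \<Omega> where \<Omega>[measurable]: "\<Omega> \<in> sets \<nu>" and \<Omega>P: "measure \<nu> \<Omega> \<ge> 1 - \<gamma>"
        and \<Omega>b: "\<forall>x\<in>\<Omega>. \<forall>j\<le>n. \<beta> * real j - \<gamma> * real n \<le> es.bsum ?f j x"
      using n0[of n] n by auto
    define L where "L x = H * real n - D * (real n * \<theta>) * indicat_real \<Omega> x
        + D / R * (\<gamma> * real n + c1) + gam * real n
       + es.bsum \<mu> n x + real N * H + c2 n" for x
    have i\<Omega>: "integrable \<nu> (indicat_real \<Omega>)"
        by (rule integrable_real_indicator[OF \<Omega>]) (simp add: es.emeasure_eq_measure)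
    have Li: "integrable \<nu> L" unfolding L_def using i\<Omega> es.integral_bsum(2)[OF \<mu>i] by simp
    have "(\<integral>x. L x \<partial>\<nu>) = H * real n - D * (real n * \<theta>) * measure \<nu> \<Omega> + D / R * (\<gamma> * real n + c1)
        + gam * real n
       + real n * (\<integral>x. \<mu> x \<partial>\<nu>) + real N * H + c2 n"
      unfolding L_def using i\<Omega> es.integral_bsum[OF \<mu>i] by (simp add: es.prob_space)
    also have "\<dots> \<le> H * real n - D * (real n * \<theta>) * (1 - \<gamma>) + D / R * (\<gamma> * real n + c1)
        + gam * real n
       + real n * (\<integral>x. \<mu> x \<partial>\<nu>) + real N * H + c2 n"
    proof -
      have "D * (real n * \<theta>) * (1 - \<gamma>) \<le> D * (real n * \<theta>) * measure \<nu> \<Omega>" using \<Omega>P D \<theta>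
          by (intro mult_left_mono) auto
      then show ?thesis by linarith
    qed
    also have "\<dots> = real n * (H + gam + (\<integral>x. \<mu> x \<partial>\<nu>) - D * \<theta>) + real n * (D * \<theta> * \<gamma> + D / R * \<gamma>)
        + (c2 n + real N * H + D / R * c1)"
      by (simp add: algebra_simps)
    also have "\<dots> \<le> real n * (H + gam + (\<integral>x. \<mu> x \<partial>\<nu>) - D * \<theta>) + real n * (e / 2) + real n * (e / 2)"
    proof -
      have "real n * (D * \<theta> * \<gamma> + D / R * \<gamma>) \<le> real n * (e / 2)" using \<gamma>Q
          by (intro mult_left_mono) auto
      moreover have "c2 n + real N * H + D / R * c1 \<le> real n * (e / 2)" using n1[of n] n
          unfolding c2_def by simp
      ultimately show ?thesis by linarith
    qed
    also have "\<dots> = real n * (H + gam + Cm * (\<integral>x. ?lb (gderiv I g x) \<partial>\<nu>) - D * \<theta> + e)"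
      unfolding \<mu>I by (simp add: algebra_simps)
    finally have LI: "(\<integral>x. L x \<partial>\<nu>) \<le> real n * (H + gam + Cm * (\<integral>x. ?lb (gderiv I g x) \<partial>\<nu>) - D * \<theta>
        + e)" .
    have "br.cost \<sigma> (ln (real (lap_count n \<sigma>))) n 0 0 t \<le> L (\<pi> t)" if t: "t \<in> S" for t
    proof -
      define \<phi> where "\<phi> = (\<lambda>t. log_depth W (exp (- real M')) (nth_deriv S 1 G t))"
      define med where "med = (\<lambda>t. Cm * ?lb (nth_deriv S 1 G t))"
      have "\<exists>i T. i \<le> n \<and> real (n - i) \<le> T \<and> T \<le> real n \<and>
         0 + (\<Sum>l<i. \<phi> ((G ^^ l) t)) - c1 \<le> R * T \<and>
         br.cost \<sigma> (ln (real (lap_count n \<sigma>))) n 0 0 t \<le> H * (real n - T) + \<kappa> * (R * T) - \<kappa> * 0 +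
             gam * real n
           + (\<Sum>l<n. med ((G ^^ l) t)) + real N * H - (if (0::real) = 0 then real 0 * H else 0) +
               c2 n"
        unfolding c1_def c2_def
      proof (rule br.cost_bound_recovery[OF \<sigma> _ deep])
        show "0 \<le> ln (real (lap_count n \<sigma>))" unfolding lap_count_def by simp
        show "0 \<le> med t" for t unfolding med_def using Cm lb0 by simp
        show "br.vcost (br.lev t) \<le> med t"
            if u: "exp (- real M') < \<bar>nth_deriv S 1 G t\<bar>" "\<bar>nth_deriv S 1 G t\<bar> \<le> exp (- real M)"
            for t
        proof -
          define y where "y = - ln \<bar>nth_deriv S 1 G t\<bar>"
          have p: "0 < \<bar>nth_deriv S 1 G t\<bar>" using u(1) by (rule less_trans[OF exp_gt_zero])
          have "ln \<bar>nth_deriv S 1 G t\<bar> \<le> ln (exp (- real M))" using u(2) p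
              by (subst ln_le_cancel_iff) auto
          then have y: "1 \<le> y" using br.M unfolding y_def by simp
          have lv: "real (br.lev t) \<le> y" unfolding br.lev_def y_def[symmetric] using y by simp
          have "br.vcost (br.lev t) = gam * real (br.lev t) + ln CA + real (br.lev t) / (r - 1)"
              unfolding br.vcost_def by simp
          also have "\<dots> \<le> gam * y + ln CA * y + y / (r - 1)"
            using lv br.gam br.r y lnCA
              by (intro add_mono mult_left_mono divide_right_mono) (auto simp: mult_le_cancel_left1)
          also have "\<dots> = Cm * y" unfolding Cm_def by (simp add: algebra_simps)
          also have "y = ?lb (nth_deriv S 1 G t)" unfolding y_def log_band_def using u by simp
          finally show ?thesis unfolding med_def .
        qed
        show "exp (- real M') < \<bar>nth_deriv S 1 G t\<bar> \<Longrightarrow> \<phi> t \<le> 0" for t unfolding \<phi>_def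
            by (rule depth_gain(1))
        show "0 < \<bar>nth_deriv S 1 G t\<bar> \<Longrightarrow> \<bar>nth_deriv S 1 G t\<bar> \<le> exp (- real M') \<Longrightarrow>
            \<phi> t \<le> br.gain (br.lev t)" for t
          unfolding \<phi>_def by (rule depth_gain(2))
        show "0 < br.lim_pot \<sigma> n" unfolding br.lim_pot_def c1_def[symmetric] using br.R c1
            by (intro add_nonneg_pos) auto
      qed auto
      then obtain i T where iT: "i \<le> n" "real (n - i) \<le> T" "T \<le> real n"
          "(\<Sum>l<i. \<phi> ((G ^^ l) t)) - c1 \<le> R * T"
        and cost: "br.cost \<sigma> (ln (real (lap_count n \<sigma>))) n 0 0 t \<le> H * (real n - T) + \<kappa> * (R * T)
            + gam * real n
           + (\<Sum>l<n. med ((G ^^ l) t)) + real N * H + c2 n" by auto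
      have T0: "0 \<le> T" using iT(2) by linarith
      have phs: "(\<Sum>l<i. \<phi> ((G ^^ l) t)) = es.bsum ?f i (\<pi> t)" unfolding \<phi>_def
          by (rule orbit_sum[OF t])
      have meds: "(\<Sum>l<n. med ((G ^^ l) t)) = es.bsum \<mu> n (\<pi> t)" unfolding med_def \<mu>_def
          by (rule orbit_sum[OF t])
      have ex: "0 \<le> (\<gamma> * real n + c1) / R" using \<gamma>(1) c1 br.R by simp
      have "real n * \<theta> * indicat_real \<Omega> (\<pi> t) \<le> T + (\<gamma> * real n + c1) / R"
      proof (cases "\<pi> t \<in> \<Omega>")
        case False
        then show ?thesis using T0 ex by simp
      next
        case True
        show ?thesis
        \<comment> \<open>In the first case \<open>real (n - i) \<le> T\<close> suffices. In the
          second, the lower bound for the sum of depths up to time \<open>i\<close> is used; this is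
          why \<open>birkhoff_lower\<close> is uniform in \<open>j \<le> n\<close>.\<close>
        proof (cases "real i \<le> real n / 2")
          case half: True
          have "real n * \<theta> \<le> real n * (1 / 2)" using \<theta> by (intro mult_left_mono) auto
          then have "real n * \<theta> \<le> T" using half iT(1,2) by (simp add: of_nat_diff)
          then show ?thesis using True ex by simp
        next
          case half: False
          have "\<beta> * real i - \<gamma> * real n \<le> es.bsum ?f i (\<pi> t)" using \<Omega>b True iT(1) by blast
          moreover have "\<beta> * (real n / 2) \<le> \<beta> * real i" using half \<beta> by (intro mult_left_mono) auto
          ultimately have 1: "\<beta> * (real n / 2) - \<gamma> * real n - c1 \<le> R * T" using iT(4) phs
              by linarith
          have "real n * (R * \<theta>) \<le> real n * (\<beta> / 2)" using \<theta>R by (intro mult_left_mono) auto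
          then have "R * (real n * \<theta>) \<le> R * T + (\<gamma> * real n + c1)" using 1
              by (simp add: algebra_simps)
          also have "\<dots> = R * (T + (\<gamma> * real n + c1) / R)" using br.R by (simp add: field_simps)
          finally show ?thesis using True br.R by simp
        qed
      qed
      then have "D * (real n * \<theta> * indicat_real \<Omega> (\<pi> t)) \<le> D * (T + (\<gamma> * real n + c1) / R)"
          using D by (intro mult_left_mono)
      then have "H * (real n - T) + \<kappa> * (R * T) \<le> H * real n
          - D * (real n * \<theta>) * indicat_real \<Omega> (\<pi> t) + D / R * (\<gamma> * real n + c1)"
        unfolding D_def by (simp add: algebra_simps)
      then show ?thesis using cost unfolding L_def meds by linarith
    qed
    then show "\<exists>L. integrable \<nu> L \<and> (\<forall>t\<in>S. br.cost \<sigma> (ln (real (lap_count n \<sigma>))) n 0 0 t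
        \<le> L (\<pi> t)) \<and>
        (\<integral>x. L x \<partial>\<nu>) \<le> real n * (H + gam
      + (gam + ln CA + 1 / (r - 1)) * (\<integral>x. ?lb (gderiv I g x) \<partial>\<nu>) - (H - \<kappa> * R) * min (1 / 2) (\<beta> /
          (2 * R)) + e)"
      using Li LI unfolding Cm_def D_def \<theta>_def by blast
  qed
qed

end

section \<open>Uniform integrability\<close>

lemma log_depth_mono: "0 \<le> W \<Longrightarrow> W \<le> W' \<Longrightarrow> \<eta> \<le> \<eta>' \<Longrightarrow> \<eta>' \<le> 1 \<Longrightarrow> log_depth W \<eta> y \<le> log_depth W' \<eta>' y"
  unfolding log_depth_def by (auto simp: min_def)

lemma log_band_le_depth:
  assumes "0 < a" "b \<le> 1" "- ln a \<le> W" "0 \<le> W"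
  shows "log_band a b y \<le> log_depth W b y"
proof (cases "a < \<bar>y\<bar> \<and> \<bar>y\<bar> \<le> b")
  case True
  then have "a < \<bar>y\<bar>" by blast
  then have "- ln \<bar>y\<bar> \<le> - ln a" using assms(1) by simp
  then show ?thesis using True assms unfolding log_band_def log_depth_def by auto
next
  case False
  then show ?thesis using log_depth_bounds[OF assms(4,2), of y] unfolding log_band_def by auto
qed

lemma log_band_sum:
  assumes "\<And>i. a (Suc i) \<le> a i"
  shows "(\<Sum>i<q. log_band (a (Suc i)) (a i) y) = log_band (a q) (a 0) y"
proof (induction q)
  case (Suc q)
  have "a q \<le> a 0" using lift_Suc_antimono_le[of a 0 q] assms by simp
  then show ?case using Suc assms[of q] unfolding log_band_def by auto
qed (simp add: log_band_def)

text \<open>Monotone convergence in the truncation \<open>W\<close>; the bound e/2 for all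
  truncations leaves room for the strict inequality in the limit.\<close>

lemma small_deriv_integral_less:
  assumes "prob_space \<nu>" and [measurable]: "gderiv I g \<in> borel_measurable \<nu>" and \<eta>: "\<eta> \<le> 1"
      and e: "0 < e"
    and small: "\<And>W. 0 \<le> W \<Longrightarrow> (\<integral>x. log_depth W \<eta> (gderiv I g x) \<partial>\<nu>) < e / 2"
  shows "small_deriv_integral I g \<nu> \<eta> < ereal e"
proof -
  interpret prob_space \<nu> by fact
  let ?f = "\<lambda>i x. ennreal (log_depth (real i) \<eta> (gderiv I g x))"
  let ?\<Omega> = "{x. \<bar>gderiv I g x\<bar> < \<eta>}"
  let ?P = "\<integral>\<^sup>+x. e2ennreal (neg_log \<bar>gderiv I g x\<bar>) \<partial>restrict_space \<nu> ?\<Omega>"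
  have b: "0 \<le> log_depth (real i) \<eta> y \<and> log_depth (real i) \<eta> y \<le> real i" for i y
      by (rule log_depth_bounds[OF _ \<eta>]) simp
  have inc: "incseq ?f"
    by (intro incseq_SucI le_funI ennreal_leI log_depth_mono) (use \<eta> in auto)
  have int: "integral\<^sup>N \<nu> (?f i) \<le> ennreal (e / 2)" for i
  proof -
    have "integrable \<nu> (\<lambda>x. log_depth (real i) \<eta> (gderiv I g x))"
      using b by (intro integrable_const_bound[where B="real i"]) auto
    then have "integral\<^sup>N \<nu> (?f i) = ennreal (\<integral>x. log_depth (real i) \<eta> (gderiv I g x) \<partial>\<nu>)"
      using b by (intro nn_integral_eq_integral) auto
    then show ?thesis using small[of "real i"] by (simp add: ennreal_leI)
  qed
  have pt: "e2ennreal (neg_log \<bar>gderiv I g x\<bar>) * indicator ?\<Omega> x \<le> (SUP i. ?f i x)" for x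
  proof (cases "x \<in> ?\<Omega>")
    case True
    define y where "y = gderiv I g x"
    have y: "\<bar>y\<bar> < \<eta>" using True unfolding y_def by simp
    show ?thesis
    proof (cases "y = 0")
      case True
      \<comment> \<open>At a critical point the truncated depth is the truncation itself, whose
        supremum is the infinite value of \<open>neg_log\<close>.\<close>
      have "(SUP i. ?f i x) = (SUP i. of_nat i)"
        using True y unfolding y_def log_depth_def by (simp add: ennreal_of_nat_eq_real_of_nat)
      also have "\<dots> = top" by (rule ennreal_SUP_of_nat_eq_top)
      finally show ?thesis by (simp only: top_greatest)
    next
      case False
      obtain i :: nat where i: "- ln \<bar>y\<bar> \<le> real i" using real_arch_simple by blast
      have "e2ennreal (neg_log \<bar>gderiv I g x\<bar>) * indicator ?\<Omega> x = ?f i x"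
        using False y i True unfolding y_def neg_log_def log_depth_def by (simp add: min_def)
      also have "\<dots> \<le> (SUP i. ?f i x)" by (rule SUP_upper) simp
      finally show ?thesis .
    qed
  qed simp
  have "?\<Omega> \<inter> space \<nu> = {x \<in> space \<nu>. \<bar>gderiv I g x\<bar> < \<eta>}" by auto
  moreover have "\<dots> \<in> sets \<nu>" by measurable
  ultimately have "?\<Omega> \<inter> space \<nu> \<in> sets \<nu>" by simp
  then have "?P = (\<integral>\<^sup>+x. e2ennreal (neg_log \<bar>gderiv I g x\<bar>) * indicator ?\<Omega> x \<partial>\<nu>)"
      by (rule nn_integral_restrict_space)
  also have "\<dots> \<le> (\<integral>\<^sup>+x. (SUP i. ?f i x) \<partial>\<nu>)" by (intro nn_integral_mono pt)
  also have "\<dots> = (SUP i. integral\<^sup>N \<nu> (?f i))"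
      by (rule nn_integral_monotone_convergence_SUP[OF inc]) measurable
  also have "\<dots> \<le> ennreal (e / 2)" by (rule SUP_least) (rule int)
  finally have "enn2ereal ?P \<le> enn2ereal (ennreal (e / 2))" by (simp add: less_eq_ennreal.rep_eq)
  also have "\<dots> = ereal (e / 2)" using e by simp
  finally have P: "enn2ereal ?P \<le> ereal (e / 2)" .
  \<comment> \<open>Subtracting the integral of the negative part can only decrease the
    value.\<close>
  have "enn2ereal ?P - enn2ereal N \<le> enn2ereal ?P - 0" for N by (rule ereal_minus_mono) auto
  then have "small_deriv_integral I g \<nu> \<eta> \<le> enn2ereal ?P"
    unfolding small_deriv_integral_def ext_integral_def by simp
  also note P
  also have "ereal (e / 2) < ereal e" using e by simp
  finally show ?thesis .
qed

context arc
begin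

text \<open>All constants are fixed before \<open>g\<close>. If the integral is not small, the
  entropy of \<nu> falls below h0 - 2 s. This contradicts h_top(g) \<ge> h0 - s from semicontinuity
  together with the assumption on \<nu>, used with \<delta> = \<open>s\<close>.\<close>

theorem small_deriv_uniform:
  assumes r: "r > 1" and f: "cr_map I r f"
      and h: "top_entropy (points I) f > ereal (growth_rate I f / r)"
    and \<epsilon>: "\<epsilon> > 0" and K: "K > 0"
  shows "\<exists>\<delta>>0. \<exists>\<eta>>0. \<exists>\<rho>>0. \<forall>g \<nu>. cr_map I r g \<and> c1_dist I f g < \<rho> \<and> cr_norm I r g \<le> K \<and>
           ergodic_measure (points I) g \<nu> \<and> metric_entropy \<nu> g \<ge> top_entropy (points I) g - ereal
               \<delta> \<longrightarrow>
           small_deriv_integral I g \<nu> \<eta> < ereal \<epsilon>"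
proof -
  obtain F where F: "is_lift I f F" using cr_lift[OF f] by blast
  obtain Lf where Lf: "Lf \<ge> 1" "\<And>t. t \<in> S \<Longrightarrow> \<bar>nth_deriv S 1 F t\<bar> \<le> Lf"
      using lift_deriv_bounded[OF f r F] by blast
  have Lip: "\<bar>F s - F t\<bar> \<le> Lf * \<bar>s - t\<bar>" if "s \<in> S" "t \<in> S" for s t
    by (rule deriv_bound_lipschitz[OF lift_derivative[OF f r F] Lf(2) that])
  have "top_entropy (points I) f \<le> ereal (ln Lf)"
      by (rule top_entropy_le_lipschitz[OF F cr_maps[OF f] Lf(1) Lip])
  then obtain h0 where h0: "top_entropy (points I) f = ereal h0" using h
      by (cases "top_entropy (points I) f") auto
  define Rf where "Rf = growth_rate I f"
  have Rf: "0 \<le> Rf" unfolding Rf_def by (rule growth_rate_bound(1)[OF f r F])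
  have hR: "Rf / r < h0" using h h0 unfolding Rf_def by simp
  have h0p: "0 < h0" using Rf r hR
      by (meson divide_nonneg_pos less_trans zero_less_one order_le_less_trans)
  have mid: "x < (x + z) / 2 \<and> (x + z) / 2 < z" if "x < z" for x z :: real using that by simp
  \<comment> \<open>Both \<open>R\<close> and \<kappa> are midpoints. R < r h0 leaves room for 1/r <
    \<kappa> < h0/R: the left inequality makes deep visits profitable and admits a positive
    \<open>gam\<close>, the right one gives the deficit d = h0 - \<kappa> R > 0.\<close>
  define R where "R = (Rf + r * h0) / 2"
  have "Rf < r * h0" using hR r by (simp add: pos_divide_less_eq mult.commute)
  then have "Rf < R \<and> R < r * h0" unfolding R_def by (rule mid)
  then have R: "Rf < R" "R < r * h0" "0 < R" using Rf by auto
  define \<kappa> where "\<kappa> = (1 / r + h0 / R) / 2"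
  have "1 / r < h0 / R" using R r by (simp add: divide_less_eq less_divide_eq mult.commute)
  then have "1 / r < \<kappa> \<and> \<kappa> < h0 / R" unfolding \<kappa>_def by (rule mid)
  then have \<kappa>: "1 / r < \<kappa>" "\<kappa> < h0 / R" by auto
  have "0 < 1 / r" using r by simp
  then have \<kappa>0: "0 < \<kappa>" using \<kappa>(1) by linarith
  have \<kappa>r: "0 < \<kappa> * r - 1" using \<kappa>(1) r by (simp add: pos_divide_less_eq)
  define d where "d = h0 - \<kappa> * R"
  have d: "0 < d" using \<kappa>(2) R unfolding d_def by (simp add: pos_less_divide_eq)
  have dh: "d \<le> h0" using \<kappa>0 R unfolding d_def by simp
  define \<theta> where "\<theta> = min (1 / 2) (\<epsilon> / 2 / (2 * R))"
  have \<theta>: "0 < \<theta>" "\<theta> \<le> 1 / 2" using \<epsilon> R unfolding \<theta>_def by auto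
  \<comment> \<open>The unit in which errors are measured: recovery lowers the entropy by at least 8
    s, against s each from \<open>H\<close>, from \<open>gam\<close> and from the medium band, and 2
    s from the lower bound for the entropy of \<nu>.\<close>
  define s where "s = d * \<theta> / 8"
  have s: "0 < s" using d \<theta> unfolding s_def by simp
  have s8: "d * \<theta> = 8 * s" unfolding s_def by simp
  have "d * \<theta> \<le> d * (1 / 2)" using d \<theta> by (intro mult_left_mono) auto
  then have sd: "16 * s \<le> d" using s8 by simp
  have kk: "0 < (\<kappa> * r - 1) / (r - 1)" using \<kappa>r r by simp
  obtain gam where gam: "0 < gam" "gam < (\<kappa> * r - 1) / (r - 1)" "gam \<le> s"
  proof
    have "0 < z / 2 \<and> z / 2 < z" if "0 < z" for z :: real using that by simp
    from this[OF kk] show "0 < min s ((\<kappa> * r - 1) / (r - 1) / 2)"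
        "min s ((\<kappa> * r - 1) / (r - 1) / 2) < (\<kappa> * r - 1) / (r - 1)"
      using s by (simp_all only: min_less_iff_disj min_less_iff_conj simp_thms)
  qed simp
  define H where "H = h0 + s"
  have Hh: "top_entropy (points I) f < ereal H" using s h0 unfolding H_def by simp
  have H0: "0 \<le> H" using s h0p unfolding H_def by simp
  from branching_family[OF f r K R(1)[unfolded Rf_def] R(3) Hh H0 \<kappa>0 gam(1,2)]
  obtain C0 CA Mmin where C0: "1 \<le> C0" and CA: "1 \<le> CA" and Mmin: "1 \<le> Mmin"
    and low: "\<forall>m\<ge>Mmin. gam * real m + ln CA + real m / (r - 1) \<le> \<kappa> * (real m * (r / (r - 1))
        - ln (CA * C0)) \<and>
       real m + 1 \<le> real m * (r / (r - 1)) - ln (CA * C0)"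
    and fam: "\<forall>M\<ge>Mmin. \<exists>M'\<ge>M. \<exists>\<rho>>0. \<forall>g. cr_map I r g \<and> c1_dist I f g < \<rho> \<and> cr_norm I r g \<le> K \<longrightarrow>
       (\<exists>G L \<epsilon> N NY ycol. is_lift I g G \<and>
          branching S G (nth_deriv S 1 G) r L R C0 CA \<epsilon> H gam \<kappa> M M N NY ycol \<and>
          branching S G (nth_deriv S 1 G) r L R C0 CA \<epsilon> H gam \<kappa> M M' N NY ycol \<and>
          (\<forall>m\<ge>M'. gam * real m + ln CA + real m / (r - 1) + real N * H \<le> \<kappa> * (real m * (r / (r -
              1)) - ln (CA * C0))))"
    by (elim exE conjE) (rule that)
  define fp where "fp M M' \<rho> \<longleftrightarrow> M \<le> M' \<and> 0 < \<rho> \<and> (\<forall>g. cr_map I r g \<and> c1_dist I f g < \<rho> \<and>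
      cr_norm I r g \<le> K \<longrightarrow>
       (\<exists>G L \<epsilon> N NY ycol. is_lift I g G \<and>
          branching S G (nth_deriv S 1 G) r L R C0 CA \<epsilon> H gam \<kappa> M M N NY ycol \<and>
          branching S G (nth_deriv S 1 G) r L R C0 CA \<epsilon> H gam \<kappa> M M' N NY ycol \<and>
          (\<forall>m\<ge>M'. gam * real m + ln CA + real m / (r - 1) + real N * H \<le> \<kappa> * (real m * (r / (r -
              1)) - ln (CA * C0)))))"
    for M M' \<rho>
  have "\<forall>M\<in>{Mmin..}. \<exists>p. fp M (fst p) (snd p)"
    using fam unfolding fp_def by simp
  from bchoice[OF this] obtain p where p: "\<forall>M\<in>{Mmin..}. fp M (fst (p M)) (snd (p M))" by (rule exE)
  \<comment> \<open>Each \<open>M'\<close> is the next \<open>M\<close>, so the bands of medium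
    derivatives between successive levels are disjoint.\<close>
  define lv where "lv i = ((\<lambda>M. fst (p M)) ^^ i) Mmin" for i
  have lvS: "lv (Suc i) = fst (p (lv i))" for i unfolding lv_def by simp
  have lvM: "Mmin \<le> lv i" for i
  proof (induction i)
    case (Suc i)
    then have "fp (lv i) (lv (Suc i)) (snd (p (lv i)))" using p lvS by auto
    then show ?case using Suc unfolding fp_def by linarith
  qed (simp add: lv_def)
  define \<rho>l where "\<rho>l i = snd (p (lv i))" for i
  have lv: "fp (lv i) (lv (Suc i)) (\<rho>l i)" for i using p lvM[of i] lvS[of i] unfolding \<rho>l_def
      by auto
  have lvm: "lv i \<le> lv (Suc i)" for i using lv[of i] unfolding fp_def by blast
  define Cm where "Cm = gam + ln CA + 1 / (r - 1)"
  have "0 \<le> ln CA" using CA by simp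
  moreover have "0 < 1 / (r - 1)" using r by simp
  ultimately have Cm: "0 < Cm" using gam unfolding Cm_def by linarith
  \<comment> \<open>With this many bands and a total depth below 2 R, some band has integral at most
    2 R / q, which costs at most \<open>s\<close>.\<close>
  obtain q0 :: nat where q0: "2 * R * Cm / s \<le> real q0" using real_arch_simple by blast
  define q where "q = q0 + 1"
  have q: "1 \<le> q" "2 * R * Cm / s \<le> real q" using q0 unfolding q_def by auto
  have qs: "Cm * (2 * R / real q) \<le> s"
  proof -
    have "2 * R * Cm \<le> real q * s" using q(2) s by (simp add: pos_divide_le_eq)
    then show ?thesis using q(1) by (simp add: pos_divide_le_eq mult_ac)
  qed
  define a where "a = h0 - s"
  have a: "0 \<le> a" "ereal a < top_entropy (points I) f" using s sd dh d h0 unfolding a_def by auto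
  obtain \<rho>h where \<rho>h: "\<rho>h > 0" and lsc: "\<And>g G0. is_lift I g G0 \<Longrightarrow> g \<in> points I \<rightarrow> points I \<Longrightarrow>
      (\<And>x. x \<in> points I \<Longrightarrow> dist (f x) (g x) \<le> \<rho>h) \<Longrightarrow> ereal a \<le> top_entropy (points I) g"
    using entropy_lower_semicontinuous[OF F cr_maps[OF f] Lf(1) Lip a] by blast
  define \<rho> where "\<rho> = Min (insert \<rho>h (\<rho>l ` {..<q}))"
  have \<rho>l: "0 < \<rho>l i" for i using lv[of i] unfolding fp_def by blast
  have \<rho>: "0 < \<rho>" unfolding \<rho>_def using \<rho>h \<rho>l by (subst Min_gr_iff) auto
  have \<rho>le: "\<rho> \<le> \<rho>h" "i < q \<Longrightarrow> \<rho> \<le> \<rho>l i" for i unfolding \<rho>_def by (auto intro: Min_le)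
  \<comment> \<open>The lower end of the last band: whichever band is selected, derivatives up to
    \<eta> are deep for it.\<close>
  define \<eta> where "\<eta> = exp (- real (lv q))"
  have \<eta>: "0 < \<eta>" "\<eta> \<le> 1" unfolding \<eta>_def by auto
  have exp1: "exp (- real i) \<le> 1" for i :: nat by simp
  have key: "small_deriv_integral I g \<nu> \<eta> < ereal \<epsilon>"
    if g: "cr_map I r g" and cd: "c1_dist I f g < \<rho>" and gK: "cr_norm I r g \<le> K"
        and erg: "ergodic_measure (points I) g \<nu>"
      and big: "metric_entropy \<nu> g \<ge> top_entropy (points I) g - ereal s" for g \<nu>
  proof (rule ccontr)
    assume bad: "\<not> small_deriv_integral I g \<nu> \<eta> < ereal \<epsilon>"
    note gm = cr_maps[OF g]
    obtain G0 where G0: "is_lift I g G0" using cr_lift[OF g] by blast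
    have dl: "dist (f x) (g x) \<le> \<rho>h" if "x \<in> points I" for x
      using c1_dist_close(1)[OF f g r cd that] \<rho>le(1) by linarith
    have "ereal a \<le> top_entropy (points I) g" by (rule lsc[OF G0 gm dl])
    then have "ereal a - ereal s \<le> top_entropy (points I) g - ereal s"
        by (intro ereal_minus_mono) auto
    then have hl: "ereal (h0 - 2 * s) \<le> metric_entropy \<nu> g" using big unfolding a_def
        by (simp add: order_trans)
    note meas = gderiv_measurable[OF G0 lift_deriv_continuous[OF g r G0] erg]
    have [measurable]: "gderiv I g \<in> borel_measurable \<nu>" by (rule meas(1))
    have ps: "prob_space \<nu>" using erg unfolding ergodic_measure_def by blast
    interpret ps: prob_space \<nu> by (rule ps)
    have di: "integrable \<nu> (\<lambda>x. log_depth W z (gderiv I g x))" if "0 \<le> W" "z \<le> 1" for W z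
      using log_depth_bounds[OF that] by (intro ps.integrable_const_bound[where B=W]) auto
    have bi: "integrable \<nu> (\<lambda>x. log_band z w (gderiv I g x))" if "0 < z" "w \<le> 1" for z w
    proof -
      have "norm (log_band z w (gderiv I g x)) \<le> max 0 (- ln z)" for x
        using log_band_bounds[OF that, of "gderiv I g x"] by simp
      then show ?thesis by (intro ps.integrable_const_bound[where B="max 0 (- ln z)"]) auto
    qed
    have dist_l: "cr_map I r g \<and> c1_dist I f g < \<rho>l i \<and> cr_norm I r g \<le> K" if "i < q" for i
      using g cd gK \<rho>le(2)[OF that] by linarith
    have coded: "coded_arc I lam G r L R C0 CA \<epsilon>' H gam \<kappa> M M' N NY ycol g \<nu>"
      if br: "branching S G (nth_deriv S 1 G) r L R C0 CA \<epsilon>' H gam \<kappa> M M' N NY ycol"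
          and G: "is_lift I g G" and MM: "Mmin \<le> M'"
      for G L \<epsilon>' M M' N NY ycol
    proof (intro coded_arc.intro coded_arc_axioms.intro arc_axioms br G gm erg)
      fix m assume m: "M' \<le> m"
      then have "Mmin \<le> m" using MM by simp
      then show "real m + 1 \<le> branching.gain r C0 CA m"
        using low unfolding branching.gain_def[OF br] branching.dcon_def[OF br] by blast
    qed
    \<comment> \<open>Otherwise \<open>entropy_le_contraction\<close> bounds the entropy by \<kappa>
      R + gam \<le> h0 - d + s, and 16 s \<le> d puts this below h0 - 2 s.\<close>
    have A: "(\<integral>x. log_depth W (exp (- real (lv 0))) (gderiv I g x) \<partial>\<nu>) < 2 * R" if W: "0 \<le> W" for W
    proof (rule ccontr)
      assume n: "\<not> ?thesis"
      have q0: "0 < q" using q by simp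
      from lv[of 0] dist_l[OF q0] obtain G L \<epsilon>' N NY ycol where G: "is_lift I g G"
        and br: "branching S G (nth_deriv S 1 G) r L R C0 CA \<epsilon>' H gam \<kappa> (lv 0) (lv 0) N NY ycol"
            unfolding fp_def by blast
      interpret c: coded_arc I lam G r L R C0 CA \<epsilon>' H gam \<kappa> "lv 0" "lv 0" N NY ycol g \<nu>
          by (rule coded[OF br G lvM])
      have "metric_entropy \<nu> g \<le> ereal (\<kappa> * R + gam)"
      proof (rule c.entropy_le_contraction[OF refl _ W])
        fix m assume "lv 0 \<le> m"
        then have "Mmin \<le> m" using lvM[of 0] by simp
        then show "c.br.vcost m \<le> \<kappa> * c.br.gain m" using low
            unfolding c.br.vcost_def c.br.gain_def c.br.dcon_def by blast
      qed (use n in simp)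
      then have "ereal (h0 - 2 * s) \<le> ereal (\<kappa> * R + gam)" using hl by (rule order_trans[rotated])
      then show False using gam(3) sd s unfolding d_def by simp
    qed
    let ?a = "\<lambda>i. exp (- real (lv i))"
    have am: "?a (Suc i) \<le> ?a i" for i using lvm[of i] by simp
    define b where "b i = (\<integral>x. log_band (?a (Suc i)) (?a i) (gderiv I g x) \<partial>\<nu>)" for i
    have sumb: "(\<Sum>i<q. b i) < 2 * R"
    proof -
      have "(\<Sum>i<q. b i) = (\<integral>x. (\<Sum>i<q. log_band (?a (Suc i)) (?a i) (gderiv I g x)) \<partial>\<nu>)"
        unfolding b_def using bi by (intro Bochner_Integration.integral_sum[symmetric]) auto
      also have "\<dots> = (\<integral>x. log_band (?a q) (?a 0) (gderiv I g x) \<partial>\<nu>)"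
          using log_band_sum[of ?a, OF am] by simp
      also have "\<dots> \<le> (\<integral>x. log_depth (real (lv q)) (?a 0) (gderiv I g x) \<partial>\<nu>)"
        by (intro integral_mono bi di log_band_le_depth) auto
      also have "\<dots> < 2 * R" by (rule A) simp
      finally show ?thesis .
    qed
    have "\<exists>i<q. b i \<le> 2 * R / real q"
    proof (rule ccontr)
      assume "\<not> ?thesis"
      then have "(\<Sum>i<q. 2 * R / real q) \<le> (\<Sum>i<q. b i)"
          by (intro sum_mono) (meson less_imp_le lessThan_iff not_le)
      then show False using sumb q by simp
    qed
    then obtain i where i: "i < q" "b i \<le> 2 * R / real q" by blast
    from lv[of i] dist_l[OF i(1)] obtain G L \<epsilon>' N NY ycol where G: "is_lift I g G"
      and br: "branching S G (nth_deriv S 1 G) r L R C0 CA \<epsilon>' H gam \<kappa> (lv i) (lv (Suc i)) N NY ycol"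
      and dp: "\<forall>m\<ge>lv (Suc i). gam * real m + ln CA + real m / (r - 1) + real N * H
          \<le> \<kappa> * (real m * (r / (r - 1)) - ln (CA * C0))"
      unfolding fp_def by blast
    interpret c: coded_arc I lam G r L R C0 CA \<epsilon>' H gam \<kappa> "lv i" "lv (Suc i)" N NY ycol g \<nu>
        by (rule coded[OF br G lvM])
    \<comment> \<open>The assumed failure of the inequality is passed on to a finite truncation, to
      which the ergodic estimates apply.\<close>
    have "\<exists>W\<ge>0. \<epsilon> / 2 \<le> (\<integral>x. log_depth W \<eta> (gderiv I g x) \<partial>\<nu>)"
    proof (rule ccontr)
      assume "\<not> ?thesis"
      then have "(\<integral>x. log_depth W \<eta> (gderiv I g x) \<partial>\<nu>) < \<epsilon> / 2" if "0 \<le> W" for W using that by force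
      from small_deriv_integral_less[OF ps meas(1) \<eta>(2) \<epsilon> this] bad show False by blast
    qed
    then obtain W where W: "0 \<le> W" "\<epsilon> / 2 \<le> (\<integral>x. log_depth W \<eta> (gderiv I g x) \<partial>\<nu>)" by blast
    have "lv (Suc i) \<le> lv q" using lift_Suc_mono_le[of lv "Suc i" q] lvm i(1) by simp
    then have "\<eta> \<le> ?a (Suc i)" unfolding \<eta>_def by simp
    then have "(\<integral>x. log_depth W \<eta> (gderiv I g x) \<partial>\<nu>)
        \<le> (\<integral>x. log_depth W (?a (Suc i)) (gderiv I g x) \<partial>\<nu>)"
      using W(1) \<eta> by (intro integral_mono di log_depth_mono) auto
    then have W': "\<epsilon> / 2 \<le> (\<integral>x. log_depth W (?a (Suc i)) (gderiv I g x) \<partial>\<nu>)" using W(2) by linarith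
    have Hd: "H - \<kappa> * R = d + s" unfolding H_def d_def by simp
    have "metric_entropy \<nu> g \<le> ereal (H + gam
        + (gam + ln CA + 1 / (r - 1)) * (\<integral>x. log_band (?a (Suc i)) (?a i) (gderiv I g x) \<partial>\<nu>)
        - (H - \<kappa> * R) * min (1 / 2) (\<epsilon> / 2 / (2 * R)))"
    proof (rule c.entropy_le_recovery[OF _ W(1) W'])
      show "c.br.vcost m + real N * H \<le> \<kappa> * c.br.gain m" if "lv (Suc i) \<le> m" for m
        using dp that unfolding c.br.vcost_def c.br.gain_def c.br.dcon_def by blast
      show "\<kappa> * R \<le> H" using Hd d s by linarith
    qed (use \<epsilon> in simp)
    then have "metric_entropy \<nu> g \<le> ereal (H + gam + Cm * b i - (d + s) * \<theta>)"
        unfolding Cm_def b_def \<theta>_def Hd .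
    then have "ereal (h0 - 2 * s) \<le> ereal (H + gam + Cm * b i - (d + s) * \<theta>)" using hl
        by (rule order_trans[rotated])
    then have "h0 - 2 * s \<le> H + gam + Cm * b i - (d + s) * \<theta>" by simp
    moreover have "Cm * b i \<le> s"
    proof -
      have "Cm * b i \<le> Cm * (2 * R / real q)" using i(2) Cm by (intro mult_left_mono) auto
      then show ?thesis using qs by linarith
    qed
    moreover have "8 * s \<le> (d + s) * \<theta>" using s8 s \<theta> by (simp add: distrib_right)
    ultimately show False using gam(3) s unfolding H_def by linarith
  qed
  show ?thesis using s \<eta>(1) \<rho> key by blast
qed

end

section \<open>The interval and the circle\<close>

text \<open>Up to pi/3 the cosine is at least 1/2, so sin x - x/2 increases; beyond it sin x is at
  least sqrt 3 / 2 > 0.85 > pi/4.\<close>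

lemma sin_ge_half: "x / 2 \<le> sin x" if "0 \<le> x" "x \<le> pi / 2" for x :: real
proof (cases "x \<le> pi / 3")
  case True
  have "sin 0 - 0 / 2 \<le> sin x - x / 2"
  proof (rule DERIV_nonneg_imp_nondecreasing[OF that(1)])
    fix y assume y: "0 \<le> y" "y \<le> x"
    have "cos (pi / 3) \<le> cos y" using y True pi_gt_zero by (intro cos_monotone_0_pi_le) auto
    then have "0 \<le> cos y - 1 / 2" by (simp add: cos_60)
    moreover have "((\<lambda>x. sin x - x / 2) has_real_derivative cos y - 1 / 2) (at y)"
        by (auto intro!: derivative_eq_intros)
    ultimately show "\<exists>d. ((\<lambda>x. sin x - x / 2) has_real_derivative d) (at y) \<and> 0 \<le> d" by blast
  qed
  then show ?thesis by simp
next
  case False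
  have "sin (pi / 3) \<le> sin x" using False that pi_gt_zero by (intro sin_monotone_2pi_le) auto
  moreover have "17 / 10 \<le> sqrt 3" by (rule real_le_rsqrt) (simp add: power2_eq_square)
  moreover have "pi < 34 / 10" using pi_approx by simp
  ultimately show ?thesis using that by (simp add: sin_60)
qed

lemma dist_cis: "dist (cis s) (cis t) = 2 * \<bar>sin ((s - t) / 2)\<bar>"
proof -
  have "(dist (cis s) (cis t))\<^sup>2 = (cos s - cos t)\<^sup>2 + (sin s - sin t)\<^sup>2"
    by (simp add: dist_norm cmod_power2)
  also have "\<dots> = 2 - 2 * (cos s * cos t + sin s * sin t)"
    using sin_cos_squared_add[of s] sin_cos_squared_add[of t]
      by (simp add: power2_eq_square algebra_simps)
  also have "\<dots> = 2 - 2 * cos (s - t)" by (simp add: cos_diff)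
  also have "\<dots> = (2 * \<bar>sin ((s - t) / 2)\<bar>)\<^sup>2"
  proof -
    have "2 * ((s - t) / 2) = s - t" by simp
    from cos_double_sin[of "(s - t) / 2", unfolded this] show ?thesis
        by (simp add: power_mult_distrib)
  qed
  finally show ?thesis by (rule power2_eq_imp_eq) auto
qed

text \<open>An arc of at most half a turn is at most twice its chord; this is the source of the
  factors 2 in \<open>arc\<close>.\<close>

lemma dist_cis_ge: "\<bar>s - t\<bar> \<le> 2 * dist (cis s) (cis t)" if "\<bar>s - t\<bar> \<le> pi"
proof -
  have "(\<bar>s - t\<bar> / 2) / 2 \<le> sin (\<bar>s - t\<bar> / 2)" using that by (intro sin_ge_half) auto
  also have "\<dots> \<le> \<bar>sin ((s - t) / 2)\<bar>"
  proof (cases "s \<le> t")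
    case True
    then have "\<bar>s - t\<bar> = - (s - t)" by simp
    then have "\<bar>s - t\<bar> / 2 = - ((s - t) / 2)" by (simp only: minus_divide_left)
    then have "sin (\<bar>s - t\<bar> / 2) = - sin ((s - t) / 2)" by (simp only: sin_minus)
    then show ?thesis by linarith
  qed auto
  finally have 1: "\<bar>s - t\<bar> / 2 / 2 \<le> \<bar>sin ((s - t) / 2)\<bar>" .
  have "a \<le> 2 * (2 * y)" if "a / 2 / 2 \<le> y" for a y :: real using that by simp
  from this[OF 1] show ?thesis unfolding dist_cis .
qed

lemma cis_period: "cis (t + 2 * pi * of_int n) = cis t"
  by (simp add: cis_mult[symmetric] cis_multiple_2pi)

text \<open>Rounding the difference to the nearest number of full turns leaves at most half a
  turn.\<close>

lemma cis_near_rep: "\<exists>t'. cis t' = cis t \<and> \<bar>s - t'\<bar> \<le> pi"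
proof -
  define n where "n = round ((s - t) / (2 * pi))"
  have "\<bar>(s - t) / (2 * pi) - of_int n\<bar> \<le> 1/2" unfolding n_def using of_int_round_abs_le
      by (metis abs_minus_commute)
  then have "2 * pi * \<bar>(s - t) / (2 * pi) - of_int n\<bar> \<le> 2 * pi * (1/2)"
      by (intro mult_left_mono) auto
  also have "2 * pi * \<bar>(s - t) / (2 * pi) - of_int n\<bar> = \<bar>2 * pi * ((s - t) / (2 * pi)
      - of_int n)\<bar>" by (simp add: abs_mult)
  also have "2 * pi * ((s - t) / (2 * pi) - of_int n) = s - (t + 2 * pi * of_int n)"
      by (simp add: field_simps)
  finally show ?thesis using cis_period by (intro exI[of _ "t + 2 * pi * of_int n"]) auto
qed

interpretation interval: arc unit_interval 1
proof
  have S: "pdom unit_interval = {0..1}" and p: "param unit_interval = (\<lambda>t. t)"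
      by (auto simp: unit_interval_def)
  show "\<exists>c. \<forall>t\<in>pdom unit_interval. G t = H t + c"
      if "is_lift unit_interval g G" "is_lift unit_interval g H" for g G H
    using that by (intro exI[of _ 0]) (auto simp: is_lift_def S p)
  show "G t \<in> pdom unit_interval"
      if "is_lift unit_interval g G" "g \<in> points unit_interval \<rightarrow> points unit_interval"
      "t \<in> pdom unit_interval" for g G t
    using that by (auto simp: is_lift_def S p points_unit_interval Pi_iff)
  show "min \<bar>s - t\<bar> (1 - \<bar>s - t\<bar>) \<le> 2 * dist (param unit_interval s) (param unit_interval t)"
      for s t
    unfolding p dist_real_def by (rule min.coboundedI1) simp
qed (auto simp: unit_interval_def dist_real_def intro!: bexI)

interpretation circle: arc unit_circle "2 * pi"
proof
  have S: "pdom unit_circle = UNIV" and p: "param unit_circle = cis" by (auto simp: unit_circle_def)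
  show "convex (pdom unit_circle)" "{0..2 * pi} \<subseteq> pdom unit_circle" by (auto simp: S)
  show "1 \<le> 2 * pi" using pi_gt3 by simp
  show "\<exists>s\<in>{0..2 * pi}. param unit_circle s = param unit_circle t" if "t \<in> pdom unit_circle" for t
  proof -
    define n where "n = \<lfloor>t / (2 * pi)\<rfloor>"
    have "of_int n \<le> t / (2 * pi)" "t / (2 * pi) \<le> of_int n + 1" unfolding n_def by linarith+
    then have "0 \<le> t + 2 * pi * of_int (- n)" "t + 2 * pi * of_int (- n) \<le> 2 * pi"
        by (auto simp: field_simps)
    then show ?thesis using cis_period[of t "- n"] unfolding p
        by (intro bexI[of _ "t + 2 * pi * of_int (- n)"]) auto
  qed
  show "dist (param unit_circle s) (param unit_circle t) \<le> \<bar>s - t\<bar>" for s t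
    unfolding p dist_cis using abs_sin_x_le_abs_x[of "(s - t) / 2"] by simp
  show "\<bar>s - t\<bar> \<le> 2 * dist (param unit_circle s) (param unit_circle t)" if "\<bar>s - t\<bar> \<le> 1" for s t
    unfolding p using that pi_gt3 by (intro dist_cis_ge) auto
  show "\<exists>t'\<in>pdom unit_circle. param unit_circle t' = param unit_circle t \<and>
      \<bar>s - t'\<bar> \<le> 2 * dist (param unit_circle s) (param unit_circle t)" for s t
  proof -
    obtain t' where "cis t' = cis t" "\<bar>s - t'\<bar> \<le> pi" using cis_near_rep by blast
    then show ?thesis using dist_cis_ge[of s t'] unfolding p S by auto
  qed
  show "s + a \<in> pdom unit_circle \<and> param unit_circle (s + a) = param unit_circle (t + a)"
      if "param unit_circle s = param unit_circle t" for s t a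
    using that unfolding S p by (simp add: cis_mult[symmetric])
  show "min \<bar>s - t\<bar> (2 * pi - \<bar>s - t\<bar>) \<le> 2 * dist (param unit_circle s) (param unit_circle t)"
      if "s \<in> {0..2*pi}" "t \<in> {0..2*pi}" for s t
  proof (cases "\<bar>s - t\<bar> \<le> pi")
    case True
    then show ?thesis using dist_cis_ge[OF True] unfolding p by linarith
  next
    case False
    \<comment> \<open>For points more than half a turn apart the shorter arc runs the other way
      round; \<open>t'\<close> represents the same point one turn closer to
      \<open>s\<close>.\<close>
    define t' where "t' = (if s \<le> t then t - 2 * pi else t + 2 * pi)"
    have "cis t' = cis t" using cis_period[of t 1] cis_period[of t "-1"] unfolding t'_def by auto
    moreover have "\<bar>s - t'\<bar> = 2 * pi - \<bar>s - t\<bar>" using that False unfolding t'_def by auto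
    ultimately show ?thesis using dist_cis_ge[of s t'] False unfolding p by auto
  qed
  show "\<exists>c. \<forall>t\<in>pdom unit_circle. G t = H t + c"
      if "is_lift unit_circle g G" "is_lift unit_circle g H" for g G H
    using lift_unique[OF that] by metis
  show "nth_deriv (pdom unit_circle) k G s = nth_deriv (pdom unit_circle) k G t"
    if G: "is_lift unit_circle g G" and st: "param unit_circle s = param unit_circle t"
        and k: "1 \<le> k" for g G s t k
  proof -
    have "is_lift unit_circle g (\<lambda>u. G (u + (s - t)))"
      using G st continuous_on_compose2[of UNIV G UNIV "\<lambda>u. u + (s - t)"]
      by (auto simp: is_lift_def unit_circle_def cis_mult[symmetric] cis_divide[symmetric]
        continuous_intros)
    from lift_unique[OF G this] obtain c where c: "\<And>u. G u = G (u + (s - t)) + c" by blast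
    have "nth_deriv UNIV k G t = nth_deriv UNIV k G (t + (s - t))"
        by (rule nth_deriv_shift[OF k]) (rule c)
    then show ?thesis unfolding S by simp
  qed
qed (auto simp: unit_circle_def)

theorem theorem1p8:
  fixes r :: real
  assumes "r > 1"
  shows
    "(\<forall>f :: real \<Rightarrow> real.
        cr_map unit_interval r f \<and>
        top_entropy (points unit_interval) f > ereal (growth_rate unit_interval f / r) \<longrightarrow>
        (\<forall>\<epsilon>>0. \<forall>K>0. \<exists>\<delta>>0. \<exists>\<eta>>0. \<exists>\<rho>>0. \<forall>g \<nu>.
           cr_map unit_interval r g \<and> c1_dist unit_interval f g < \<rho> \<and>
           cr_norm unit_interval r g \<le> K \<and>
           ergodic_measure (points unit_interval) g \<nu> \<and>
           metric_entropy \<nu> g \<ge> top_entropy (points unit_interval) g - ereal \<delta> \<longrightarrow>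
           small_deriv_integral unit_interval g \<nu> \<eta> < ereal \<epsilon>)) \<and>
     (\<forall>f :: complex \<Rightarrow> complex.
        cr_map unit_circle r f \<and>
        top_entropy (points unit_circle) f > ereal (growth_rate unit_circle f / r) \<longrightarrow>
        (\<forall>\<epsilon>>0. \<forall>K>0. \<exists>\<delta>>0. \<exists>\<eta>>0. \<exists>\<rho>>0. \<forall>g \<nu>.
           cr_map unit_circle r g \<and> c1_dist unit_circle f g < \<rho> \<and>
           cr_norm unit_circle r g \<le> K \<and>
           ergodic_measure (points unit_circle) g \<nu> \<and>
           metric_entropy \<nu> g \<ge> top_entropy (points unit_circle) g - ereal \<delta> \<longrightarrow>
           small_deriv_integral unit_circle g \<nu> \<eta> < ereal \<epsilon>))"
  by (intro conjI allI impI; elim conjE;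
      rule interval.small_deriv_uniform[OF assms] circle.small_deriv_uniform[OF assms]; assumption)

end
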